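(* Let $X$ be a Banach space with finite cotype. Suppose that $T=(T_1,\ldots,T_d)$ is a $d$-tuple of commuting Ritt operators on $X$ which has an $H^\infty(B_{\gamma_1}\times\cdots\times B_{\gamma_d})$ joint functional calculus for some $\gamma_1,\ldots,\gamma_d$ in $(0,\frac{\pi}{2})$. Let $\alpha=(\alpha_1,\ldots,\alpha_d)$ in $(\mathbb{R}_+^* )^d$. Then $T$ satisfies the following square function estimate: there exists a constant $K>0$ such that for any $x$ in $X$ we have $$\|x\|_{T,\alpha}\le K\|x\|.$$
   Context: Banach spaces are complex, $d\ge 1$ is an integer, $B(X)$ is the algebra of bounded operators on $X$, $R(\lambda,T)=(\lambda I_X-T)^{-1}$, $\mathbb{N}^*=\{1,2,\ldots\}$, $\mathbb{R}_+^*=(0,\infty)$. Ritt operators. $T\in B(X)$ is a Ritt operator if there is $C>0$ with $\|T^n\|\le C$ and $\|n(T^n-T^{n-1})\|\le C$ for all $n\ge 1$. For $a\in(0,\frac{\pi}{2})$, the Stolz domain $B_a$ is the interior of the convex hull of $1$ and the disc $D(0,\sin a)$. A Ritt operator $T$ is of type $a\in(0,\frac\pi2)$ if $\sigma(T)\subset\overline{B_a}$ and for every $b\in(a,\frac{\pi}{2})$ there is $K_b>0$ with $\|(\lambda-1)R(\lambda,T)\|\le K_b$ for all $\lambda\in\mathbb{C}\setminus\overline{B_b}$. Every Ritt operator is of type $a$ for some $a\in(0,\frac\pi2)$. Joint functional calculus. Let $\gamma_1,\ldots,\gamma_d\in(0,\frac{\pi}{2})$. For $\Lambda\subset\{1,\ldots,d\}$,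 $H_0^\infty(\prod_{i\in\Lambda}B_{\gamma_i})$ is the algebra of bounded holomorphic functions $f$ on $B_{\gamma_1}\times\cdots\times B_{\gamma_d}$ depending only on the variables $(\lambda_i)_{i\in\Lambda}$ and for which there are positive constants $c,(s_i)_{i\in\Lambda}$ with $|f(\lambda_1,\ldots,\lambda_d)|\le c\prod_{i\in\Lambda}|1-\lambda_i|^{s_i}$ (constant functions if $\Lambda=\emptyset$). Let $(T_1,\ldots,T_d)$ be commuting Ritt operators, $T_k$ of type $a_k\in(0,\gamma_k)$, and let $b_k\in(a_k,\gamma_k)$. For $\Lambda\neq\emptyset$ and $f\in H_0^\infty(\prod_{i\in\Lambda}B_{\gamma_i})$, set $$f(T_1,\ldots,T_d)=\Big(\frac{1}{2\pi i}\Big)^{|\Lambda|}\int_{\prod_{i\in\Lambda}\partial B_{b_i}}f(\lambda_1,\ldots,\lambda_d)\prod_{i\in\Lambda}R(\lambda_i,T_i)\prod_{i\in\Lambda}d\lambda_i$$ (counterclockwise orientation; absolutely convergent and independent of the $b_i$), and $f(T_1,\ldots,T_d)=cI_X$ if $f\equiv c$. Extend linearly to the direct sum $H_{0,1}^\infty(B_{\gamma_1}\times\cdots\times B_{\gamma_d})=\bigoplus_{\Lambda\subset\{1,\ldots,d\}}H_0^\infty(\prod_{i\in\Lambda}B_{\gamma_i})$. The tuple $(T_1,\ldots,T_d)$ (with $T_k$ of some type $a_k<\gamma_k$) has an $H^\infty(B_{\gamma_1}\times\cdots\times B_{\gamma_d})$ joint functional calculus if there is $K>0$ with $\|f(T_1,\ldots,T_d)\|\le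 K\sup_{B_{\gamma_1}\times\cdots\times B_{\gamma_d}}|f|$ for all $f\in H_{0,1}^\infty(B_{\gamma_1}\times\cdots\times B_{\gamma_d})$. Square functions. For a Ritt operator $T$ of type $a\in(0,\frac\pi2)$ and $\alpha>0$, $(I_X-T)^\alpha=p_\alpha(T)=\frac{1}{2\pi i}\int_{\partial B_b}p_\alpha(\lambda)R(\lambda,T)\,d\lambda$, where $p_\alpha(z)=(1-z)^\alpha$, $b\in(a,\frac\pi2)$ and $\partial B_b$ is oriented counterclockwise (the integral is absolutely convergent and independent of $b$). For a nonempty countable set $\mathcal{I}$ and a family $(r_\iota)_{\iota\in\mathcal{I}}$ of independent Rademacher variables on a probability space $\Omega_0$, $\mathrm{Rad}(\mathcal{I};X)$ is the closure in $L_2(\Omega_0;X)$ of the set of finite sums $\sum_\iota r_\iota\otimes x_\iota$, $x_\iota\in X$. For commuting Ritt operators $T=(T_1,\ldots,T_d)$, $\alpha\in(\mathbb{R}_+^* )^d$ and $x\in X$, set $x_{k_1,\ldots,k_d}=\prod_{i=1}^d k_i^{\alpha_i-\frac12}T_i^{k_i-1}(I_X-T_i)^{\alpha_i}x$ and $$\|x\|_{T,\alpha}=\Big\|\sum_{k_1,\ldots,k_d\ge1}r_{k_1,\ldots,k_d}\otimes x_{k_1,\ldots,k_d}\Big\|_{\mathrm{Rad}((\mathbb{N}^* )^d;X)}$$ if the family $(r_{k_1,\ldots,k_d}\otimes x_{k_1,\ldots,k_d})$ is summable in $\mathrm{Rad}((\mathbb{N}^* )^d;X)$, and $\|x\|_{T,\alpha}=\infty$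 otherwise. *)

theory Defs
  imports "HOL-Complex_Analysis.Complex_Analysis" "HOL-Probability.Probability"
begin

section \<open>Complex Banach spaces and bounded operators\<close>

text \<open>A complex Banach space is a type of sort \<open>{complex_normed_vector, banach}\<close>.\<close>

class complex_normed_vector = real_normed_vector +
  fixes scaleC :: "complex \<Rightarrow> 'a \<Rightarrow> 'a" (infixr \<open>*\<^sub>C\<close> 75)
  assumes scaleC_add_right: "c *\<^sub>C (x + y) = c *\<^sub>C x + c *\<^sub>C y"
    and scaleC_add_left: "(c + d) *\<^sub>C x = c *\<^sub>C x + d *\<^sub>C x"
    and scaleC_scaleC: "c *\<^sub>C d *\<^sub>C x = (c * d) *\<^sub>C x"
    and scaleC_of_real: "complex_of_real s *\<^sub>C x = s *\<^sub>R x"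
    and norm_scaleC: "norm (c *\<^sub>C x) = cmod c * norm x"

lemma bounded_linear_scaleC_right:
  "bounded_linear (\<lambda>x::'a::complex_normed_vector. c *\<^sub>C x)"
proof (rule bounded_linear_intro[where K = "cmod c"])
  fix s :: real and x :: 'a
  show "c *\<^sub>C s *\<^sub>R x = s *\<^sub>R c *\<^sub>C x"
    by (simp add: scaleC_of_real[symmetric] scaleC_scaleC mult.commute)
qed (simp_all add: scaleC_add_right norm_scaleC mult.commute)

text \<open>The library type \<open>'a \<Rightarrow>\<^sub>L 'b\<close> consists of the bounded \<^emph>\<open>real\<close>-linear maps with the operator
  norm.  With pointwise scalar multiplication it is a complex normed space, of which \<open>B(X)\<close>
  is the closed subspace cut out by \<open>clinear_op\<close> below.\<close>

instantiation blinfun :: (real_normed_vector, complex_normed_vector) complex_normed_vector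
begin

lift_definition scaleC_blinfun :: "complex \<Rightarrow> 'a \<Rightarrow>\<^sub>L 'b \<Rightarrow> 'a \<Rightarrow>\<^sub>L 'b"
  is "\<lambda>c f x. c *\<^sub>C f x"
  by (rule bounded_linear_compose[OF bounded_linear_scaleC_right])

instance
proof
  fix c d :: complex and s :: real and f g :: "'a \<Rightarrow>\<^sub>L 'b"
  show "c *\<^sub>C (f + g) = c *\<^sub>C f + c *\<^sub>C g"
    by (rule blinfun_eqI) (simp add: scaleC_blinfun.rep_eq blinfun.add_left scaleC_add_right)
  show "(c + d) *\<^sub>C f = c *\<^sub>C f + d *\<^sub>C f"
    by (rule blinfun_eqI) (simp add: scaleC_blinfun.rep_eq blinfun.add_left scaleC_add_left)
  show assoc: "c *\<^sub>C d *\<^sub>C f = (c * d) *\<^sub>C f" for c d and f :: "'a \<Rightarrow>\<^sub>L 'b"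
    by (rule blinfun_eqI) (simp add: scaleC_blinfun.rep_eq scaleC_scaleC)
  show real: "complex_of_real s *\<^sub>C f = s *\<^sub>R f" for s and f :: "'a \<Rightarrow>\<^sub>L 'b"
    by (rule blinfun_eqI) (simp add: scaleC_blinfun.rep_eq scaleC_of_real blinfun.scaleR_left)
  have le: "norm (c *\<^sub>C f) \<le> cmod c * norm f" for c and f :: "'a \<Rightarrow>\<^sub>L 'b"
  proof (rule norm_blinfun_bound)
    fix x
    have "cmod c * norm (f x) \<le> cmod c * (norm f * norm x)"
      by (intro mult_left_mono norm_blinfun) simp
    then show "norm ((c *\<^sub>C f) x) \<le> cmod c * norm f * norm x"
      by (simp add: scaleC_blinfun.rep_eq norm_scaleC mult.assoc)
  qed simp
  show "norm (c *\<^sub>C f) = cmod c * norm f"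
  proof (cases "c = 0")
    case True
    then show ?thesis using le[of 0 f] by simp
  next
    case False
    have "f = inverse c *\<^sub>C c *\<^sub>C f"
      using False real[of 1 f] by (simp add: assoc)
    then have "norm f \<le> cmod (inverse c) * norm (c *\<^sub>C f)"
      using le[of "inverse c" "c *\<^sub>C f"] by simp
    then have "cmod c * norm f \<le> norm (c *\<^sub>C f)"
      using False by (simp add: norm_inverse norm_divide field_simps)
    with le[of c f] show ?thesis by simp
  qed
qed

end

definition clinear_op :: "('a::complex_normed_vector \<Rightarrow>\<^sub>L 'a) \<Rightarrow> bool" where
  "clinear_op T \<longleftrightarrow> (\<forall>c x. T (c *\<^sub>C x) = c *\<^sub>C T x)"

definition op_power :: "('a::real_normed_vector \<Rightarrow>\<^sub>L 'a) \<Rightarrow> nat \<Rightarrow> 'a \<Rightarrow>\<^sub>L 'a" where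
  "op_power T n = ((\<lambda>S. T o\<^sub>L S) ^^ n) id_blinfun"

text \<open>Product of a finite family of pairwise commuting operators.\<close>

definition op_prod :: "('i \<Rightarrow> ('a::real_normed_vector \<Rightarrow>\<^sub>L 'a)) \<Rightarrow> 'i set \<Rightarrow> 'a \<Rightarrow>\<^sub>L 'a" where
  "op_prod A J = Finite_Set.fold (\<lambda>i S. A i o\<^sub>L S) id_blinfun J"

text \<open>A two-sided inverse of a complex-linear operator is again complex-linear, so for
  complex-linear \<open>T\<close> the inverses below are inverses in \<open>B(X)\<close>.\<close>

definition is_resolvent ::
  "complex \<Rightarrow> ('a::complex_normed_vector \<Rightarrow>\<^sub>L 'a) \<Rightarrow> ('a \<Rightarrow>\<^sub>L 'a) \<Rightarrow> bool" where
  "is_resolvent l T S \<longleftrightarrow>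
     S o\<^sub>L (l *\<^sub>C id_blinfun - T) = id_blinfun \<and> (l *\<^sub>C id_blinfun - T) o\<^sub>L S = id_blinfun"

definition spectrum :: "('a::complex_normed_vector \<Rightarrow>\<^sub>L 'a) \<Rightarrow> complex set" where
  "spectrum T = {l. \<not> (\<exists>S. is_resolvent l T S)}"

definition resolvent :: "complex \<Rightarrow> ('a::complex_normed_vector \<Rightarrow>\<^sub>L 'a) \<Rightarrow> 'a \<Rightarrow>\<^sub>L 'a" where
  "resolvent l T = (THE S. is_resolvent l T S)"


section \<open>Ritt operators\<close>

definition ritt :: "('a::complex_normed_vector \<Rightarrow>\<^sub>L 'a) \<Rightarrow> bool" where
  "ritt T \<longleftrightarrow> clinear_op T \<and>
     (\<exists>C>0. \<forall>n\<ge>1. norm (op_power T n) \<le> C \<and>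
        norm (real n *\<^sub>R (op_power T n - op_power T (n - 1))) \<le> C)"

definition stolz :: "real \<Rightarrow> complex set" where
  "stolz a = interior (convex hull (insert 1 (ball 0 (sin a))))"

definition ritt_of_type :: "('a::complex_normed_vector \<Rightarrow>\<^sub>L 'a) \<Rightarrow> real \<Rightarrow> bool" where
  "ritt_of_type T a \<longleftrightarrow> ritt T \<and> 0 < a \<and> a < pi / 2 \<and> spectrum T \<subseteq> closure (stolz a) \<and>
     (\<forall>b. a < b \<and> b < pi / 2 \<longrightarrow>
        (\<exists>K>0. \<forall>l. l \<notin> closure (stolz b) \<longrightarrow> norm ((l - 1) *\<^sub>C resolvent l T) \<le> K))"

text \<open>Counterclockwise parametrisation of the boundary of \<open>stolz b\<close> starting at \<open>1\<close>.  The two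
  tangents from \<open>1\<close> touch the circle of radius \<open>sin b\<close> at the arguments \<open>\<plusminus> (pi/2 - b)\<close>.\<close>

definition stolz_path :: "real \<Rightarrow> real \<Rightarrow> complex" where
  "stolz_path b =
     linepath 1 (of_real (sin b) * cis (pi/2 - b))
     +++ (part_circlepath 0 (sin b) (pi/2 - b) (3*pi/2 + b)
     +++ linepath (of_real (sin b) * cis (- (pi/2 - b))) 1)"

text \<open>Contour integrals of operator-valued functions are gauge integrals for the operator norm.
  The Bochner integral of the library needs a separable target space, which \<open>B(X)\<close> is not.
  Values of the integrand at corner points and at \<open>1\<close> are irrelevant.\<close>

definition frac_power :: "('a::{complex_normed_vector, banach} \<Rightarrow>\<^sub>L 'a) \<Rightarrow> real \<Rightarrow> 'a \<Rightarrow>\<^sub>L 'a" where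
  \<comment> \<open>\<open>(I - T)\<^sup>\<alpha>\<close>; independent of the admissible angle \<open>b\<close>\<close>
  "frac_power T \<alpha> =
     (let b = (SOME b. \<exists>a. ritt_of_type T a \<and> a < b \<and> b < pi / 2) in
      (1 / (2 * of_real pi * \<i>)) *\<^sub>C
        integral {0..1} (\<lambda>t. (((1 - stolz_path b t) powr of_real \<alpha>) *
           vector_derivative (stolz_path b) (at t)) *\<^sub>C resolvent (stolz_path b t) T))"

definition commuting_ritt :: "('d::finite \<Rightarrow> ('a::complex_normed_vector \<Rightarrow>\<^sub>L 'a)) \<Rightarrow> bool" where
  "commuting_ritt T \<longleftrightarrow> (\<forall>i. ritt (T i)) \<and> (\<forall>i j. T i o\<^sub>L T j = T j o\<^sub>L T i)"


section \<open>Joint functional calculus\<close>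

definition stolz_prod :: "('d::finite \<Rightarrow> real) \<Rightarrow> (complex^'d) set" where
  "stolz_prod \<gamma> = {z. \<forall>i. z $ i \<in> stolz (\<gamma> i)}"

text \<open>Holomorphy on an open subset of \<open>\<complex>\<^sup>d\<close>: complex Frechet differentiability.\<close>

definition holomorphic_several :: "(complex^'d::finite \<Rightarrow> complex) \<Rightarrow> (complex^'d) set \<Rightarrow> bool" where
  "holomorphic_several f U \<longleftrightarrow>
     (\<forall>z\<in>U. \<exists>D. (f has_derivative D) (at z) \<and> (\<forall>c v. D (c *s v) = c * D v))"

text \<open>Functions are total on \<open>complex^'d\<close>; only their values on \<open>stolz_prod \<gamma>\<close> matter.\<close>

definition H0_inf :: "('d::finite \<Rightarrow> real) \<Rightarrow> 'd set \<Rightarrow> (complex^'d \<Rightarrow> complex) set" where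
  "H0_inf \<gamma> \<Lambda> = {f.
     holomorphic_several f (stolz_prod \<gamma>) \<and> bounded (f ` stolz_prod \<gamma>) \<and>
     (\<forall>z\<in>stolz_prod \<gamma>. \<forall>w\<in>stolz_prod \<gamma>. (\<forall>i\<in>\<Lambda>. z $ i = w $ i) \<longrightarrow> f z = f w) \<and>
     (\<exists>c>0. \<exists>s. (\<forall>i\<in>\<Lambda>. 0 < s i) \<and>
        (\<forall>z\<in>stolz_prod \<gamma>. cmod (f z) \<le> c * (\<Prod>i\<in>\<Lambda>. cmod (1 - z $ i) powr s i)))}"

text \<open>The calculus on \<open>H0_inf \<gamma> \<Lambda>\<close>.  The integral over the product of the contours with index in
  \<open>\<Lambda>\<close> is written over the whole unit cube of \<open>real^'d\<close>: the integrand does not depend on the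
  coordinates outside \<open>\<Lambda>\<close>, and each of them contributes a factor \<open>1\<close>.  The arguments of \<open>f\<close>
  outside \<open>\<Lambda>\<close>, on which \<open>f\<close> does not depend, are set to \<open>0\<close>.\<close>

definition H0_calc ::
  "('d::finite \<Rightarrow> real) \<Rightarrow> ('d \<Rightarrow> ('a::{complex_normed_vector, banach} \<Rightarrow>\<^sub>L 'a)) \<Rightarrow> 'd set \<Rightarrow>
   (complex^'d \<Rightarrow> complex) \<Rightarrow> 'a \<Rightarrow>\<^sub>L 'a" where
  "H0_calc b T \<Lambda> f =
     (if \<Lambda> = {} then f 0 *\<^sub>C id_blinfun
      else ((1 / (2 * of_real pi * \<i>)) ^ card \<Lambda>) *\<^sub>C
        integral (cbox 0 1) (\<lambda>t::real^'d.
          (f (\<chi> i. if i \<in> \<Lambda> then stolz_path (b i) (t $ i) else 0) *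
           (\<Prod>i\<in>\<Lambda>. vector_derivative (stolz_path (b i)) (at (t $ i)))) *\<^sub>C
          op_prod (\<lambda>i. resolvent (stolz_path (b i) (t $ i)) (T i)) \<Lambda>))"

text \<open>An element of the direct sum of the \<open>H0_inf \<gamma> \<Lambda>\<close> is the family \<open>F\<close> of its components; as a
  function it is their sum.\<close>

definition H01_inf :: "('d::finite \<Rightarrow> real) \<Rightarrow> ('d set \<Rightarrow> complex^'d \<Rightarrow> complex) set" where
  "H01_inf \<gamma> = {F. \<forall>\<Lambda>. F \<Lambda> \<in> H0_inf \<gamma> \<Lambda>}"

definition H01_fun :: "('d::finite set \<Rightarrow> complex^'d \<Rightarrow> complex) \<Rightarrow> complex^'d \<Rightarrow> complex" where
  "H01_fun F z = (\<Sum>\<Lambda>\<in>UNIV. F \<Lambda> z)"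

definition H01_calc ::
  "('d::finite \<Rightarrow> real) \<Rightarrow> ('d \<Rightarrow> ('a::{complex_normed_vector, banach} \<Rightarrow>\<^sub>L 'a)) \<Rightarrow>
   ('d set \<Rightarrow> complex^'d \<Rightarrow> complex) \<Rightarrow> 'a \<Rightarrow>\<^sub>L 'a" where
  "H01_calc b T F = (\<Sum>\<Lambda>\<in>UNIV. H0_calc b T \<Lambda> (F \<Lambda>))"

text \<open>The operators \<open>H01_calc b T F\<close> do not depend on the choice of the angles \<open>b i\<close>.\<close>

definition has_joint_Hinf_calculus ::
  "('d::finite \<Rightarrow> real) \<Rightarrow> ('d \<Rightarrow> ('a::{complex_normed_vector, banach} \<Rightarrow>\<^sub>L 'a)) \<Rightarrow> bool" where
  "has_joint_Hinf_calculus \<gamma> T \<longleftrightarrow>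
     (\<exists>a b. (\<forall>i. ritt_of_type (T i) (a i) \<and> a i < b i \<and> b i < \<gamma> i) \<and>
        (\<exists>K>0. \<forall>F\<in>H01_inf \<gamma>.
           norm (H01_calc b T F) \<le> K * (SUP z\<in>stolz_prod \<gamma>. cmod (H01_fun F z))))"


section \<open>Rademacher averages and cotype\<close>

definition rademacher_family :: "'w measure \<Rightarrow> 'i set \<Rightarrow> ('i \<Rightarrow> 'w \<Rightarrow> real) \<Rightarrow> bool" where
  "rademacher_family M J r \<longleftrightarrow>
     prob_space M \<and> prob_space.indep_vars M (\<lambda>_. borel) r J \<and>
     (\<forall>i\<in>J. measure M {w \<in> space M. r i w = 1} = 1/2 \<and>
            measure M {w \<in> space M. r i w = -1} = 1/2)"

text \<open>\<open>L\<^sub>2(\<Omega>; X)\<close> for not necessarily separable \<open>X\<close>; elements are representatives, i.e.\ functions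
  rather than classes modulo null sets, and \<open>L2_norm\<close> is the corresponding seminorm.\<close>

definition strongly_measurable :: "'w measure \<Rightarrow> ('w \<Rightarrow> 'a::real_normed_vector) \<Rightarrow> bool" where
  "strongly_measurable M f \<longleftrightarrow>
     (\<exists>s. (\<forall>n::nat. simple_function M (s n)) \<and> (\<forall>w\<in>space M. (\<lambda>n. s n w) \<longlonglongrightarrow> f w))"

definition L2_space :: "'w measure \<Rightarrow> ('w \<Rightarrow> 'a::real_normed_vector) set" where
  "L2_space M = {f. strongly_measurable M f \<and> integrable M (\<lambda>w. (norm (f w))\<^sup>2)}"

definition L2_norm :: "'w measure \<Rightarrow> ('w \<Rightarrow> 'a::real_normed_vector) \<Rightarrow> real" where
  "L2_norm M f = sqrt (integral\<^sup>L M (\<lambda>w. (norm (f w))\<^sup>2))"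

definition Rad ::
  "'w measure \<Rightarrow> ('i \<Rightarrow> 'w \<Rightarrow> real) \<Rightarrow> 'i set \<Rightarrow> ('w \<Rightarrow> 'a::real_normed_vector) set" where
  "Rad M r J = {f \<in> L2_space M. \<forall>e>0. \<exists>A x. finite A \<and> A \<subseteq> J \<and>
     L2_norm M (\<lambda>w. f w - (\<Sum>i\<in>A. r i w *\<^sub>R x i)) < e}"

definition Rad_has_sum ::
  "'w measure \<Rightarrow> ('i \<Rightarrow> 'w \<Rightarrow> real) \<Rightarrow> 'i set \<Rightarrow> ('i \<Rightarrow> 'a::real_normed_vector) \<Rightarrow> ('w \<Rightarrow> 'a) \<Rightarrow> bool"
  where
  \<comment> \<open>the family \<open>(r i \<otimes> x i)\<close>, \<open>i \<in> J\<close>, is summable in \<open>Rad(J; X)\<close> with sum \<open>f\<close>\<close>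
  "Rad_has_sum M r J x f \<longleftrightarrow> f \<in> Rad M r J \<and>
     ((\<lambda>A. L2_norm M (\<lambda>w. (\<Sum>i\<in>A. r i w *\<^sub>R x i) - f w)) \<longlongrightarrow> 0) (finite_subsets_at_top J)"

definition Rad_sum_norm ::
  "'w measure \<Rightarrow> ('i \<Rightarrow> 'w \<Rightarrow> real) \<Rightarrow> 'i set \<Rightarrow> ('i \<Rightarrow> 'a::real_normed_vector) \<Rightarrow> ennreal" where
  "Rad_sum_norm M r J x =
     (if \<exists>f. Rad_has_sum M r J x f then ennreal (L2_norm M (SOME f. Rad_has_sum M r J x f))
      else \<infinity>)"

text \<open>Cotype \<open>q\<close>: the right-hand side is the \<open>L\<^sub>2\<close>-norm of the Rademacher sum, the expectation being
  written out as the average over all choices of signs.\<close>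

definition has_cotype :: "'a::real_normed_vector itself \<Rightarrow> real \<Rightarrow> bool" where
  "has_cotype X q \<longleftrightarrow>
     (\<exists>C>0. \<forall>n. \<forall>x::nat \<Rightarrow> 'a.
        (\<Sum>i<n. norm (x i) powr q) powr (1 / q) \<le>
        C * sqrt ((\<Sum>\<epsilon>\<in>{..<n} \<rightarrow>\<^sub>E {-1, 1::real}. (norm (\<Sum>i<n. \<epsilon> i *\<^sub>R x i))\<^sup>2) / 2 ^ n))"

definition finite_cotype :: "'a::real_normed_vector itself \<Rightarrow> bool" where
  "finite_cotype X \<longleftrightarrow> (\<exists>q\<ge>2. has_cotype X q)"


section \<open>Square functions\<close>

definition pos_indices :: "('d \<Rightarrow> nat) set" where
  "pos_indices = {k. \<forall>i. 1 \<le> k i}"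

definition square_term ::
  "('d::finite \<Rightarrow> ('a::{complex_normed_vector, banach} \<Rightarrow>\<^sub>L 'a)) \<Rightarrow> ('d \<Rightarrow> real) \<Rightarrow> 'a \<Rightarrow> ('d \<Rightarrow> nat) \<Rightarrow> 'a"
  where
  "square_term T \<alpha> x k =
     op_prod (\<lambda>i. (real (k i) powr (\<alpha> i - 1/2)) *\<^sub>R
                   (op_power (T i) (k i - 1) o\<^sub>L frac_power (T i) (\<alpha> i))) UNIV x"

definition square_fun_norm ::
  "'w measure \<Rightarrow> (('d::finite \<Rightarrow> nat) \<Rightarrow> 'w \<Rightarrow> real) \<Rightarrow>
   ('d \<Rightarrow> ('a::{complex_normed_vector, banach} \<Rightarrow>\<^sub>L 'a)) \<Rightarrow> ('d \<Rightarrow> real) \<Rightarrow> 'a \<Rightarrow> ennreal" where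
  "square_fun_norm M r T \<alpha> x = Rad_sum_norm M r pos_indices (square_term T \<alpha> x)"

end

theory Submission
  imports Defs "HOL-Real_Asymp.Real_Asymp" "HOL-Library.Discrete_Functions"
begin

text \<open>The terms of the square function are \<open>T\<^sup>k\<^sup>-\<^sup>1 (I - T)\<^sup>\<alpha> x\<close> with the weights \<open>k\<^sup>\<alpha>\<^sup>-\<^sup>1\<^sup>/\<^sup>2\<close>; take \<open>d = 1\<close> for
the idea.  Group the \<open>k\<close> into dyadic blocks \<open>2\<^sup>j \<le> k < 2\<^sup>j\<^sup>+\<^sup>1\<close>.  Inside a block, Abel summation
writes \<open>z\<^sup>k\<^sup>-\<^sup>1\<close> as a weighted sum, over a parameter \<open>\<sigma>\<close> that is common to all blocks, of indicators
(depending on \<open>k\<close> and \<open>\<sigma>\<close>) times a function that depends only on \<open>j\<close> and \<open>\<sigma>\<close>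
(\<open>abel_identity\<close>).  After multiplication with \<open>2\<^sup>j\<^sup>\<alpha> (1 - z)\<^sup>\<alpha>\<close> these functions \<open>h\<^sub>j\<close> satisfy
\<open>\<Sum>\<^sub>j \<bar>h\<^sub>j(z)\<bar> \<le> C\<close> on a Stolz domain, uniformly in \<open>\<sigma>\<close>, because \<open>\<bar>1 - z\<bar>\<close> is comparable with
\<open>1 - \<bar>z\<bar>\<close> there (\<open>stolz_dyadic_sum\<close>).  The functional calculus turns this into the bound
\<open>\<parallel>\<Sum>\<^sub>j \<theta>\<^sub>j h\<^sub>j(T)\<parallel> \<le> K C\<close> for all coefficients \<open>\<bar>\<theta>\<^sub>j\<bar> \<le> 1\<close> (\<open>block_op_multiplier_bound\<close>).  In \<open>d\<close>
variables everything is a product over the coordinates.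

For fixed \<open>\<sigma>\<close> the randomised sum over \<open>k\<close> becomes \<open>\<Sum>\<^sub>j g\<^sub>j y\<^sub>j\<close> with \<open>y\<^sub>j = h\<^sub>j(T) x\<close>, where the
\<open>g\<^sub>j\<close> are independent scalar Rademacher sums over the blocks, of variance at most a constant.
They are not bounded, but their tails decay exponentially, and finite cotype makes up for the
difference (\<open>blocked_sign_average_bound\<close>): split according to \<open>n \<le> \<bar>g\<^sub>j\<bar> < n + 1\<close>.  Since this
event has probability at most of order \<open>e\<^sup>-\<^sup>n\<close>, about \<open>e\<^sup>n\<close> measure preserving rearrangements of
the signs make it happen for at most one of them at a time, for every \<open>j\<close>; so signed sums of
the rearranged vectors still have coefficients of size at most \<open>n + 1\<close>.  Cotype \<open>q\<close> applied to the
rearranged copies gains the factor \<open>e\<^sup>-\<^sup>n\<^sup>/\<^sup>q\<close>, and the bands can be summed.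

This bounds all finite square sums, with arbitrary coefficients in \<open>[-1, 1]\<close> in front of the
terms.  Cotype once more, applied to disjoint finite parts of the family, shows that the parts
cannot stay large, so the series is summable in \<open>Rad\<close> (\<open>Rad_series_summable\<close>).

Some groundwork concerns the calculus itself.  The integrals over the cube have values in a
nonseparable space of operators, so the product formula for them is proved by approximation
with step-like functions (\<open>has_integral_op_list_cube\<close>); it identifies the calculus on the functions
\<open>\<Prod>\<^sub>i z\<^sub>i\<^sup>m\<^sup>i (1 - z\<^sub>i)\<^sup>\<alpha>\<^sup>i\<close>.  The operators \<open>(I - T)\<^sup>\<alpha>\<close> of the square function are defined with
a contour of their own, so independence of the contour is needed (\<open>cint_independent\<close>).\<close>

section \<open>Bounded operators and resolvents\<close>

lemma blinfun_compose_assoc: "(A o\<^sub>L B) o\<^sub>L C = A o\<^sub>L (B o\<^sub>L C)"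
  by (rule blinfun_eqI) simp

lemma blinfun_compose_id [simp]: "A o\<^sub>L id_blinfun = A" "id_blinfun o\<^sub>L A = A"
  by (rule blinfun_eqI; simp)+

lemmas bcomp = bounded_bilinear_blinfun_compose
lemmas bcomp_simps = bounded_bilinear.add_left[OF bcomp] bounded_bilinear.add_right[OF bcomp]
  bounded_bilinear.diff_left[OF bcomp] bounded_bilinear.diff_right[OF bcomp]
  bounded_bilinear.minus_left[OF bcomp] bounded_bilinear.minus_right[OF bcomp]
  bounded_bilinear.scaleR_left[OF bcomp] bounded_bilinear.scaleR_right[OF bcomp]
  bounded_bilinear.zero_left[OF bcomp] bounded_bilinear.zero_right[OF bcomp]

lemma scaleC_zero_left [simp]: "(0::complex) *\<^sub>C (x::'a::complex_normed_vector) = 0"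
  using scaleC_of_real[of 0 x] by simp

lemma scaleC_one [simp]: "(1::complex) *\<^sub>C (x::'a::complex_normed_vector) = x"
  using scaleC_of_real[of 1 x] by simp

lemma bounded_bilinear_scaleC:
  "bounded_bilinear (\<lambda>c (x::'a::complex_normed_vector). c *\<^sub>C x)"
proof
  show "(r *\<^sub>R a) *\<^sub>C b = r *\<^sub>R a *\<^sub>C b" for r a and b :: 'a
    by (simp add: scaleC_of_real[symmetric] scaleC_scaleC scaleR_conv_of_real)
  show "a *\<^sub>C r *\<^sub>R b = r *\<^sub>R a *\<^sub>C b" for r a and b :: 'a
    by (simp add: scaleC_of_real[symmetric] scaleC_scaleC mult.commute)
  show "\<exists>K. \<forall>a (b::'a). norm (a *\<^sub>C b) \<le> norm a * norm b * K"
    by (rule exI[of _ 1]) (simp add: norm_scaleC)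
qed (simp_all add: scaleC_add_left scaleC_add_right)

lemmas scaleC_simps = bounded_bilinear.diff_left[OF bounded_bilinear_scaleC]
  bounded_bilinear.diff_right[OF bounded_bilinear_scaleC]
  bounded_bilinear.minus_left[OF bounded_bilinear_scaleC]
  bounded_bilinear.minus_right[OF bounded_bilinear_scaleC]
  bounded_bilinear.zero_right[OF bounded_bilinear_scaleC]
  bounded_bilinear.scaleR_left[OF bounded_bilinear_scaleC]
  bounded_bilinear.scaleR_right[OF bounded_bilinear_scaleC]

lemma scaleC_compose_left: "(c *\<^sub>C A) o\<^sub>L B = c *\<^sub>C (A o\<^sub>L B)"
  by (rule blinfun_eqI) (simp add: scaleC_blinfun.rep_eq)

lemma scaleC_compose_right: "clinear_op A \<Longrightarrow> A o\<^sub>L (c *\<^sub>C B) = c *\<^sub>C (A o\<^sub>L B)"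
  by (rule blinfun_eqI) (simp add: scaleC_blinfun.rep_eq clinear_op_def)

lemma clinear_op_id [simp]: "clinear_op id_blinfun"
  by (simp add: clinear_op_def)

lemma clinear_op_compose: "clinear_op A \<Longrightarrow> clinear_op B \<Longrightarrow> clinear_op (A o\<^sub>L B)"
  by (simp add: clinear_op_def)

lemma clinear_op_diff: "clinear_op A \<Longrightarrow> clinear_op B \<Longrightarrow> clinear_op (A - B)"
  by (simp add: clinear_op_def blinfun.diff_left scaleC_simps)

lemma clinear_op_scaleC: "clinear_op A \<Longrightarrow> clinear_op (c *\<^sub>C A)"
  by (simp add: clinear_op_def scaleC_blinfun.rep_eq scaleC_scaleC mult.commute)

lemma norm_id_blinfun_le: "norm (id_blinfun :: 'a::real_normed_vector \<Rightarrow>\<^sub>L 'a) \<le> 1"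
  by (rule norm_blinfun_bound) auto

lemma op_power_0 [simp]: "op_power T 0 = id_blinfun"
  by (simp add: op_power_def)

lemma op_power_Suc: "op_power T (Suc n) = T o\<^sub>L op_power T n"
  by (simp add: op_power_def)

lemma op_power_commute: "T o\<^sub>L S = S o\<^sub>L T \<Longrightarrow> op_power T n o\<^sub>L S = S o\<^sub>L op_power T n"
  by (induction n) (simp_all add: op_power_Suc blinfun_compose_assoc, metis blinfun_compose_assoc)

lemma clinear_op_power: "clinear_op T \<Longrightarrow> clinear_op (op_power T n)"
  by (induction n) (simp_all add: op_power_Suc clinear_op_compose)

lemma is_resolvent_unique: "is_resolvent l T S \<Longrightarrow> is_resolvent l T S' \<Longrightarrow> S = S'"
  unfolding is_resolvent_def by (metis blinfun_compose_assoc blinfun_compose_id)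

lemma resolvent_eqI: "is_resolvent l T S \<Longrightarrow> resolvent l T = S"
  unfolding resolvent_def using is_resolvent_unique by blast

lemma is_resolvent_resolvent: "l \<notin> spectrum T \<Longrightarrow> is_resolvent l T (resolvent l T)"
  unfolding spectrum_def using resolvent_eqI by force

lemma is_resolvent_left: "is_resolvent l T S \<Longrightarrow> l *\<^sub>C S = id_blinfun + (T o\<^sub>L S)"
  unfolding is_resolvent_def by (simp add: bcomp_simps scaleC_compose_left algebra_simps)

lemma is_resolvent_commute:
  assumes "is_resolvent l T S" "T o\<^sub>L A = A o\<^sub>L T" "clinear_op A"
  shows "S o\<^sub>L A = A o\<^sub>L S"
proof -
  let ?L = "l *\<^sub>C id_blinfun - T"
  have *: "?L o\<^sub>L A = A o\<^sub>L ?L"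
    using assms by (simp add: bcomp_simps scaleC_compose_left scaleC_compose_right)
  have "S o\<^sub>L A = S o\<^sub>L (A o\<^sub>L (?L o\<^sub>L S))" using assms(1) by (simp add: is_resolvent_def)
  also have "\<dots> = S o\<^sub>L ((?L o\<^sub>L A) o\<^sub>L S)" by (simp only: * blinfun_compose_assoc)
  also have "\<dots> = (S o\<^sub>L ?L) o\<^sub>L (A o\<^sub>L S)" by (simp only: blinfun_compose_assoc)
  also have "\<dots> = A o\<^sub>L S" using assms(1) by (simp add: is_resolvent_def)
  finally show ?thesis .
qed

lemma is_resolvent_clinear:
  assumes "is_resolvent l T S" "clinear_op T"
  shows "clinear_op S"
  unfolding clinear_op_def
proof (intro allI)
  fix c x
  let ?L = "l *\<^sub>C id_blinfun - T"
  have L: "clinear_op ?L" by (intro clinear_op_diff clinear_op_scaleC clinear_op_id assms)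
  have inv: "S (?L y) = y" "?L (S y) = y" for y
    using assms(1) unfolding is_resolvent_def by (metis blinfun_apply_blinfun_compose blinfun_apply_id_blinfun id_apply)+
  have "S (c *\<^sub>C x) = S (c *\<^sub>C ?L (S x))" by (simp add: inv)
  also have "\<dots> = S (?L (c *\<^sub>C S x))" using L by (simp add: clinear_op_def)
  finally show "S (c *\<^sub>C x) = c *\<^sub>C S x" by (simp add: inv)
qed

text \<open>Both resolvent identities in one: with \<open>T = U\<close> this is the difference in the spectral parameter,
with \<open>l = m\<close> the difference in the operator, which is what the homotopy \<open>r \<mapsto> r T\<close> needs.\<close>

lemma is_resolvent_diff:
  assumes "is_resolvent l T S" "is_resolvent m U V"
  shows "S - V = S o\<^sub>L (((m - l) *\<^sub>C id_blinfun + (T - U)) o\<^sub>L V)"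
proof -
  have "S - V = (S o\<^sub>L ((m *\<^sub>C id_blinfun - U) o\<^sub>L V)) - ((S o\<^sub>L (l *\<^sub>C id_blinfun - T)) o\<^sub>L V)"
    using assms by (simp add: is_resolvent_def)
  also have "\<dots> = S o\<^sub>L (((m *\<^sub>C id_blinfun - U) - (l *\<^sub>C id_blinfun - T)) o\<^sub>L V)"
    by (simp add: blinfun_compose_assoc bcomp_simps)
  also have "(m *\<^sub>C id_blinfun - U) - (l *\<^sub>C id_blinfun - T) = (m - l) *\<^sub>C id_blinfun + (T - U)"
    by (simp add: scaleC_simps algebra_simps)
  finally show ?thesis .
qed

section \<open>Gauge integrals of operator-valued functions on the cube\<close>

text \<open>The Riemann sums of \<open>f\<close> and of its approximant \<open>s\<close> differ by at most the Riemann sums of \<open>h\<close>.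
Only gauges are involved, so the values may lie in a nonseparable space.\<close>

lemma has_integral_approx:
  fixes f :: "'n::euclidean_space \<Rightarrow> 'b::real_normed_vector"
  assumes "\<And>e. e > 0 \<Longrightarrow> \<exists>s v h H. (s has_integral v) (cbox a b) \<and> (h has_integral H) (cbox a b) \<and>
     (\<forall>t\<in>cbox a b. norm (f t - s t) \<le> h t) \<and> H < e \<and> norm (v - V) < e"
  shows "(f has_integral V) (cbox a b)"
  unfolding has_integral
proof (intro allI impI)
  fix e :: real assume "e > 0"
  then obtain s v h H where s: "(s has_integral v) (cbox a b)" and h: "(h has_integral H) (cbox a b)"
    and le: "\<And>t. t \<in> cbox a b \<Longrightarrow> norm (f t - s t) \<le> h t" and H: "H < e/4" and v: "norm (v - V) < e/4"
    using assms[of "e/4"] by auto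
  have e4: "e/4 > 0" using \<open>e > 0\<close> by simp
  obtain g1 where g1: "gauge g1" "\<And>D. D tagged_division_of cbox a b \<Longrightarrow> g1 fine D \<Longrightarrow>
      norm ((\<Sum>(x,k)\<in>D. measure lborel k *\<^sub>R s x) - v) < e/4"
    using has_integralD[OF s e4] by metis
  obtain g2 where g2: "gauge g2" "\<And>D. D tagged_division_of cbox a b \<Longrightarrow> g2 fine D \<Longrightarrow>
      norm ((\<Sum>(x,k)\<in>D. measure lborel k *\<^sub>R h x) - H) < e/4"
    using has_integralD[OF h e4] by metis
  show "\<exists>\<gamma>. gauge \<gamma> \<and> (\<forall>D. D tagged_division_of cbox a b \<and> \<gamma> fine D \<longrightarrow>
      norm ((\<Sum>(x,k)\<in>D. measure lborel k *\<^sub>R f x) - V) < e)"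
  proof (intro exI conjI allI impI)
    show "gauge (\<lambda>x. g1 x \<inter> g2 x)" using g1(1) g2(1) by (rule gauge_Int)
    fix D assume D: "D tagged_division_of cbox a b \<and> (\<lambda>x. g1 x \<inter> g2 x) fine D"
    then have f1: "g1 fine D" and f2: "g2 fine D" and tD: "D tagged_division_of cbox a b"
      by (auto simp: fine_Int)
    have "norm ((\<Sum>(x,k)\<in>D. measure lborel k *\<^sub>R f x) - (\<Sum>(x,k)\<in>D. measure lborel k *\<^sub>R s x))
        = norm (\<Sum>(x,k)\<in>D. measure lborel k *\<^sub>R (f x - s x))"
      by (simp add: sum_subtractf[symmetric] case_prod_unfold scaleR_diff_right)
    also have "\<dots> \<le> (\<Sum>(x,k)\<in>D. measure lborel k *\<^sub>R h x)"
    proof (rule sum_norm_le)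
      fix p assume "p \<in> D"
      moreover obtain x k where "p = (x, k)" by (cases p)
      ultimately show "norm (case p of (x, k) \<Rightarrow> measure lborel k *\<^sub>R (f x - s x)) \<le>
          (case p of (x, k) \<Rightarrow> measure lborel k *\<^sub>R h x)"
        using le[of x] tag_in_interval[OF tD] by (auto intro!: mult_left_mono)
    qed
    also have "\<dots> < e/4 + e/4"
      using g2(2)[OF tD f2] H unfolding real_norm_def real_scaleR_def by linarith
    finally have 1: "norm ((\<Sum>(x,k)\<in>D. measure lborel k *\<^sub>R f x) - (\<Sum>(x,k)\<in>D. measure lborel k *\<^sub>R s x)) < e/2" by simp
    have tri: "norm (x - V) \<le> norm (x - y) + (norm (y - v) + norm (v - V))" for x y :: 'b
      using norm_triangle_ineq[of "x - y" "y - V"] norm_triangle_ineq[of "y - v" "v - V"] by simp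
    have "norm ((\<Sum>(x,k)\<in>D. measure lborel k *\<^sub>R f x) - V) \<le>
       norm ((\<Sum>(x,k)\<in>D. measure lborel k *\<^sub>R f x) - (\<Sum>(x,k)\<in>D. measure lborel k *\<^sub>R s x)) +
       (norm ((\<Sum>(x,k)\<in>D. measure lborel k *\<^sub>R s x) - v) + norm (v - V))"
      by (rule tri)
    also have "\<dots> < e" using 1 g1(2)[OF tD f1] v by linarith
    finally show "norm ((\<Sum>(x,k)\<in>D. measure lborel k *\<^sub>R f x) - V) < e" .
  qed
qed

text \<open>The integrals of the approximants form a Cauchy sequence, whose limit is the integral.\<close>

lemma integrable_approx:
  fixes f :: "'n::euclidean_space \<Rightarrow> 'b::banach"
  assumes "\<And>e. e > 0 \<Longrightarrow> \<exists>s h. s integrable_on cbox a b \<and> h integrable_on cbox a b \<and>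
     (\<forall>t\<in>cbox a b. norm (f t - s t) \<le> h t) \<and> integral (cbox a b) h < e"
  shows "f integrable_on cbox a b"
proof -
  let ?I = "cbox a b"
  have "\<forall>n::nat. \<exists>s h. s integrable_on ?I \<and> h integrable_on ?I \<and>
     (\<forall>t\<in>?I. norm (f t - s t) \<le> h t) \<and> integral ?I h < inverse (Suc n)"
    using assms by simp
  then obtain s h where s: "\<And>n. s n integrable_on ?I" and h: "\<And>n. h n integrable_on ?I"
    and le: "\<And>n t. t \<in> ?I \<Longrightarrow> norm (f t - s n t) \<le> h n t"
    and small: "\<And>n. integral ?I (h n) < inverse (Suc n)"
    by metis
  have diff: "norm (integral ?I (s n) - integral ?I (s m)) \<le> integral ?I (h n) + integral ?I (h m)" for n m
  proof -
    have "norm (integral ?I (\<lambda>t. s n t - s m t)) \<le> integral ?I (\<lambda>t. h n t + h m t)"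
    proof (rule integral_norm_bound_integral)
      fix t assume "t \<in> ?I"
      have "norm (s n t - s m t) \<le> norm (f t - s n t) + norm (f t - s m t)"
        by (metis norm_minus_commute norm_diff_triangle_le order_refl)
      then show "norm (s n t - s m t) \<le> h n t + h m t"
        using le[OF \<open>t \<in> ?I\<close>, of n] le[OF \<open>t \<in> ?I\<close>, of m] by linarith
    qed (intro integrable_diff integrable_add s h)+
    then show ?thesis by (simp add: integral_diff integral_add s h)
  qed
  have "Cauchy (\<lambda>n. integral ?I (s n))"
  proof (rule metric_CauchyI)
    fix e :: real assume "e > 0"
    then obtain M where M: "inverse (Suc M) < e/2" using reals_Archimedean[of "e/2"] by auto
    show "\<exists>M. \<forall>m\<ge>M. \<forall>n\<ge>M. dist (integral ?I (s m)) (integral ?I (s n)) < e"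
    proof (intro exI allI impI)
      fix m n assume "m \<ge> M" "n \<ge> M"
      then have "inverse (real (Suc m)) \<le> inverse (Suc M)" "inverse (real (Suc n)) \<le> inverse (Suc M)"
        by (simp_all add: field_simps)
      then have "norm (integral ?I (s m) - integral ?I (s n)) < e"
        using diff[of m n] small[of m] small[of n] M by linarith
      then show "dist (integral ?I (s m)) (integral ?I (s n)) < e" by (simp add: dist_norm)
    qed
  qed
  then obtain V where V: "(\<lambda>n. integral ?I (s n)) \<longlonglongrightarrow> V"
    using Cauchy_convergent convergent_def by blast
  have "(f has_integral V) ?I"
  proof (rule has_integral_approx)
    fix e :: real assume "e > 0"
    from tendstoD[OF V this] have "\<forall>\<^sub>F n in sequentially. norm (integral ?I (s n) - V) < e" by (simp add: dist_norm)
    moreover have "\<forall>\<^sub>F n in sequentially. inverse (real (Suc n)) < e"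
      using LIMSEQ_inverse_real_of_nat \<open>e > 0\<close> by (rule order_tendstoD)
    ultimately obtain n where "norm (integral ?I (s n) - V) < e" "inverse (real (Suc n)) < e"
      using eventually_happens'[OF sequentially_bot eventually_conj] by blast
    then show "\<exists>s v h H. (s has_integral v) ?I \<and> (h has_integral H) ?I \<and>
     (\<forall>t\<in>?I. norm (f t - s t) \<le> h t) \<and> H < e \<and> norm (v - V) < e"
      using s[of n] h[of n] le[of _ n] small[of n]
      by (meson integrable_integral less_trans)
  qed
  then show ?thesis by blast
qed

text \<open>The approximants are finite sums of integrable scalar functions times fixed vectors.  Scalar
factors, rather than indicators of intervals, make such sums stable under the Fubini argument below.\<close>

definition approx01 :: "(real \<Rightarrow> 'b::banach) \<Rightarrow> real \<Rightarrow> nat \<Rightarrow> (nat \<Rightarrow> real \<Rightarrow> real) \<Rightarrow> (nat \<Rightarrow> 'b) \<Rightarrow> (real \<Rightarrow> real) \<Rightarrow> bool" where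
  "approx01 G e n g A h \<longleftrightarrow> (\<forall>m<n. set_integrable lborel {0..1} (g m)) \<and>
     set_integrable lborel {0..1} h \<and>
     (\<forall>t\<in>{0..1}. norm (G t - (\<Sum>m<n. g m t *\<^sub>R A m)) \<le> h t) \<and> integral {0..1} h < e"

definition bochner01 :: "(real \<Rightarrow> 'b::banach) \<Rightarrow> bool" where
  "bochner01 G \<longleftrightarrow> (\<forall>e>0. \<exists>n g A h. approx01 G e n g A h)"

lemma approx01D:
  assumes "approx01 G e n g A h"
  shows "m < n \<Longrightarrow> set_integrable lborel {0..1} (g m)"
    "set_integrable lborel {0..1} h"
    "t \<in> {0..1} \<Longrightarrow> norm (G t - (\<Sum>m<n. g m t *\<^sub>R A m)) \<le> h t" "integral {0..1} h < e"
  using assms by (simp_all add: approx01_def)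

lemma bochner01I:
  assumes "\<And>e. e > 0 \<Longrightarrow> \<exists>n g A h. approx01 G e n g A h" shows "bochner01 G"
  using assms by (simp add: bochner01_def)

lemma bochner01E:
  assumes "bochner01 G" "e > 0"
  obtains n g A h where "approx01 G e n g A h"
  using assms unfolding bochner01_def by blast

lemma set_integrable_on: "set_integrable lborel {0..1} (g::real \<Rightarrow> real) \<Longrightarrow> g integrable_on {0..1}"
  by (rule set_borel_integral_eq_integral)

lemma step_integrable:
  fixes A :: "nat \<Rightarrow> 'b::banach"
  assumes "\<And>m. m < n \<Longrightarrow> set_integrable lborel {0..1} (g m :: real \<Rightarrow> real)"
  shows "((\<lambda>t. \<Sum>m<n. g m t *\<^sub>R A m) has_integral (\<Sum>m<n. integral {0..1} (g m) *\<^sub>R A m)) {0..1}"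
  by (intro has_integral_sum has_integral_scaleR_left integrable_integral set_integrable_on assms) auto

lemma bochner01_integrable:
  assumes "bochner01 G" shows "G integrable_on {0..1}"
proof -
  have "G integrable_on cbox 0 1"
  proof (rule integrable_approx)
    fix e :: real assume "e > 0"
    obtain n g A h where ap: "approx01 G e n g A h"
      using bochner01E[OF assms \<open>e > 0\<close>] by blast
    note * = approx01D[OF ap]
    show "\<exists>s h. s integrable_on cbox 0 1 \<and> h integrable_on cbox 0 1 \<and>
     (\<forall>t\<in>cbox 0 1. norm (G t - s t) \<le> h t) \<and> integral (cbox 0 1) h < e"
    proof (intro exI conjI ballI)
      show "(\<lambda>t. \<Sum>m<n. g m t *\<^sub>R A m) integrable_on cbox 0 1"
        unfolding box_real using has_integral_integrable[OF step_integrable[OF *(1)]] .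
      show "h integrable_on cbox 0 1" unfolding box_real by (rule set_integrable_on[OF *(2)])
      show "integral (cbox 0 1) h < e" unfolding box_real by (rule *(4))
      show "norm (G t - (\<Sum>m<n. g m t *\<^sub>R A m)) \<le> h t" if "t \<in> cbox 0 1" for t
        using *(3)[of t] that unfolding box_real .
    qed
  qed
  then show ?thesis by simp
qed

lemma bochner01_dominated:
  assumes "bochner01 G"
  obtains g where "set_integrable lborel {0..1} g" "\<And>t. t \<in> {0..1} \<Longrightarrow> norm (G t) \<le> g t" "\<And>t. t \<in> {0..1} \<Longrightarrow> 0 \<le> g t"
proof -
  obtain n g A h where ap: "approx01 G 1 n g A h"
      using bochner01E[OF assms zero_less_one] by blast
    note * = approx01D[OF ap]
  let ?g = "\<lambda>t. h t + (\<Sum>m<n. \<bar>g m t\<bar> * norm (A m))"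
  have le: "norm (G t) \<le> ?g t" if "t \<in> {0..1}" for t
  proof -
    have "norm (G t) \<le> norm (G t - (\<Sum>m<n. g m t *\<^sub>R A m)) + norm (\<Sum>m<n. g m t *\<^sub>R A m)"
      by (metis add.commute norm_triangle_sub)
    also have "norm (\<Sum>m<n. g m t *\<^sub>R A m) \<le> (\<Sum>m<n. \<bar>g m t\<bar> * norm (A m))"
      by (rule sum_norm_le) simp
    finally show ?thesis using *(3)[OF that] by linarith
  qed
  moreover have "set_integrable lborel {0..1} (\<lambda>t. \<bar>g m t\<bar> * norm (A m))" if "m < n" for m
    by (intro set_integrable_mult_left set_integrable_abs *(1) that)
  then have "set_integrable lborel {0..1} ?g"
    using *(2) unfolding set_integrable_def scaleR_right_distrib scaleR_sum_right
    by (intro Bochner_Integration.integrable_add Bochner_Integration.integrable_sum) auto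
  moreover have "0 \<le> ?g t" if "t \<in> {0..1}" for t
    using le[OF that] norm_ge_zero[of "G t"] by linarith
  ultimately show ?thesis using that[of ?g] by blast
qed

lemma sum_lessThan_add: "(\<Sum>m<a+b::nat. f m) = (\<Sum>m<a. f m) + (\<Sum>m<b. f (a + m) :: 'a::comm_monoid_add)"
  by (induction b) (simp_all add: add.assoc)

lemma bochner01_add:
  assumes "bochner01 G" "bochner01 G'" shows "bochner01 (\<lambda>t. G t + G' t)"
proof (rule bochner01I)
  fix e :: real assume "e > 0"
  then have "e/2 > 0" by simp
  obtain n g A h where ap: "approx01 G (e/2) n g A h"
      using bochner01E[OF assms(1) \<open>e/2>0\<close>] by blast
    note * = approx01D[OF ap]
  obtain n' g' A' h' where ap': "approx01 G' (e/2) n' g' A' h'"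
      using bochner01E[OF assms(2) \<open>e/2>0\<close>] by blast
    note ** = approx01D[OF ap']
  let ?g = "\<lambda>m. if m < n then g m else g' (m - n)" and ?A = "\<lambda>m. if m < n then A m else A' (m - n)"
  have s: "(\<Sum>m<n+n'. ?g m t *\<^sub>R ?A m) = (\<Sum>m<n. g m t *\<^sub>R A m) + (\<Sum>m<n'. g' m t *\<^sub>R A' m)" for t
    by (simp add: sum_lessThan_add)
  have "norm (G t + G' t - (\<Sum>m<n+n'. ?g m t *\<^sub>R ?A m)) \<le> h t + h' t" if "t \<in> {0..1}" for t
    unfolding s using norm_triangle_mono[OF *(3)[OF that] **(3)[OF that]] by (simp add: algebra_simps)
  moreover have "integral {0..1} (\<lambda>t. h t + h' t) < e"
    using *(2,4) **(2,4) by (simp add: integral_add set_integrable_on)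
  moreover have "\<forall>m<n+n'. set_integrable lborel {0..1} (?g m)" using *(1) **(1) by auto
  ultimately show "\<exists>n g A h. approx01 (\<lambda>t. G t + G' t) e n g A h"
    unfolding approx01_def
    using set_integral_add(1)[OF *(2) **(2)] by (intro exI[of _ "n+n'"] exI[of _ ?g] exI[of _ ?A] exI[of _ "\<lambda>t. h t + h' t"]) auto
qed

lemma bochner01_spike:
  assumes "bochner01 G" "finite S" "\<And>t. t \<in> {0..1} - S \<Longrightarrow> G' t = G t" shows "bochner01 G'"
proof (rule bochner01I)
  fix e :: real assume "e > 0"
  obtain n g A h where ap: "approx01 G e n g A h"
      using bochner01E[OF assms(1) \<open>e>0\<close>] by blast
    note * = approx01D[OF ap]
  let ?c = "\<lambda>p. norm (G' p - (\<Sum>m<n. g m p *\<^sub>R A m))"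
  let ?h = "\<lambda>t. h t + (\<Sum>p\<in>S. ?c p * indicator {p} t)"
  have le: "norm (G' t - (\<Sum>m<n. g m t *\<^sub>R A m)) \<le> ?h t" if t: "t \<in> {0..1}" for t
  proof (cases "t \<in> S")
    case True
    have "?c t = ?c t * indicator {t} t" by simp
    also have "\<dots> \<le> (\<Sum>p\<in>S. ?c p * indicator {p} t)"
      by (rule member_le_sum[OF True]) (auto simp: assms(2))
    finally show ?thesis using order_trans[OF norm_ge_zero *(3)[OF t]] by linarith
  next
    case False
    have "0 \<le> (\<Sum>p\<in>S. ?c p * indicator {p} t)" by (intro sum_nonneg) auto
    then show ?thesis using *(3)[OF t] assms(3)[of t] False t by auto
  qed
  have i1: "integrable lborel (\<lambda>t. ?c p * indicator {p} t :: real)" for p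
    by (intro integrable_mult_right) auto
  have i2: "set_integrable lborel {0..1} (\<lambda>t. ?c p * indicator {p} t)" for p
    unfolding set_integrable_def using integrable_mult_indicator[OF _ i1[of p], of "{0..1}"] by simp
  have i3: "set_integrable lborel {0..1} (\<lambda>t. \<Sum>p\<in>S. ?c p * indicator {p} t)"
    unfolding set_integrable_def scaleR_sum_right
    using i2 by (intro Bochner_Integration.integrable_sum) (simp add: set_integrable_def)
  have "((\<lambda>t. \<Sum>p\<in>S. ?c p * indicator {p} t) has_integral 0) {0..1}"
    by (rule has_integral_spike_finite[OF assms(2) _ has_integral_0])
       (auto intro!: sum.neutral simp: indicator_def)
  then have "integral {0..1} ?h = integral {0..1} h"
    using integral_add[OF set_integrable_on[OF *(2)] set_integrable_on[OF i3]] by (simp add: integral_unique)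
  then show "\<exists>n g A h. approx01 G' e n g A h"
    unfolding approx01_def
    using *(1,4) le set_integral_add(1)[OF *(2) i3]
    by (intro exI[of _ n] exI[of _ g] exI[of _ A] exI[of _ ?h]) auto
qed

lemma set_integrable_indicator_sub:
  assumes "set_integrable lborel {0..1} (g::real\<Rightarrow>real)" "S \<in> sets borel"
  shows "set_integrable lborel {0..1} (\<lambda>t. g t * indicator S t)"
proof -
  have "integrable lborel (\<lambda>t. indicator S t *\<^sub>R (indicator {0..1} t *\<^sub>R g t))"
    using assms unfolding set_integrable_def by (intro integrable_mult_indicator[OF _ assms(1)[unfolded set_integrable_def]]) auto
  then show ?thesis unfolding set_integrable_def real_scaleR_def by (simp only: mult_ac)
qed

text \<open>Integrands of contour integrals are continuous off finitely many points, with an integrable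
singularity at \<open>1\<close>.  Cut away short pieces at both ends, where the majorant has small integral,
and use uniform continuity on the compact rest.\<close>

lemma bochner01_continuous:
  fixes G :: "real \<Rightarrow> 'b::banach"
  assumes cont: "continuous_on {a<..<b} G" and ab: "0 \<le> a" "a < b" "b \<le> 1"
    and g: "set_integrable lborel {0..1} g" and le: "\<And>t. t \<in> {a<..<b} \<Longrightarrow> norm (G t) \<le> g t"
  shows "bochner01 (\<lambda>t. if t \<in> {a<..<b} then G t else 0)"
proof (rule bochner01I)
  fix e :: real assume "e > 0"
  let ?E = "\<lambda>n::nat. {a<..<b} - {a + inverse (Suc n)..b - inverse (Suc n)}"
  let ?h = "\<lambda>n t. g t * indicator (?E n) t"
  have lim: "(\<lambda>n. integral\<^sup>L lborel (\<lambda>t. indicator {0..1} t *\<^sub>R ?h n t)) \<longlonglongrightarrow> integral\<^sup>L lborel (\<lambda>t::real. 0::real)"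
  proof (rule integral_dominated_convergence[where w = "\<lambda>t. \<bar>indicator {0..1} t *\<^sub>R g t\<bar>"])
    show "integrable lborel (\<lambda>t. \<bar>indicator {0..1} t *\<^sub>R g t\<bar>)"
      using g unfolding set_integrable_def by (rule integrable_abs)
    show "AE t in lborel. (\<lambda>n. indicator {0..1} t *\<^sub>R ?h n t) \<longlonglongrightarrow> 0"
    proof (rule AE_I2)
      fix t :: real
      show "(\<lambda>n. indicator {0..1} t *\<^sub>R ?h n t) \<longlonglongrightarrow> 0"
      proof (cases "t \<in> {a<..<b}")
        case False
        then have "(\<lambda>n. indicator {0..1} t *\<^sub>R ?h n t) = (\<lambda>n. 0)" by (intro ext) (auto simp: indicator_def)
        then show ?thesis by (simp only: tendsto_const)
      next
        case True
        have "\<forall>\<^sub>F n in sequentially. inverse (real (Suc n)) < min (t - a) (b - t)"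
          using True by (intro order_tendstoD[OF LIMSEQ_inverse_real_of_nat]) auto
        then have "\<forall>\<^sub>F n in sequentially. indicator {0..1} t *\<^sub>R ?h n t = 0"
          by eventually_elim (auto simp: indicator_def)
        then show ?thesis by (rule tendsto_eventually)
      qed
    qed
    show "(\<lambda>t. indicator {0..1} t *\<^sub>R ?h n t) \<in> borel_measurable lborel" for n
      using set_integrable_indicator_sub[OF g, of "?E n"] unfolding set_integrable_def by auto
  qed (auto simp: indicator_def)
  have int: "set_integrable lborel {0..1} (?h n)" for n
    by (rule set_integrable_indicator_sub[OF g]) auto
  have "(\<lambda>n. integral {0..1} (?h n)) \<longlonglongrightarrow> 0"
    using lim set_borel_integral_eq_integral(2)[OF int] by (simp add: set_lebesgue_integral_def)
  from order_tendstoD(2)[OF this, of "e/2"] \<open>e > 0\<close>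
  obtain n where n: "integral {0..1} (?h n) < e/2"
    using eventually_happens'[OF sequentially_bot] by force
  define c d where "c = a + inverse (Suc n)" and "d = b - inverse (Suc n)"
  have ip: "0 < inverse (real (Suc n))" by simp
  have sub: "{c..d} \<subseteq> {a<..<b}"
  proof
    fix x assume "x \<in> {c..d}"
    then have "a + inverse (real (Suc n)) \<le> x" "x \<le> b - inverse (real (Suc n))" by (auto simp: c_def d_def)
    then show "x \<in> {a<..<b}" unfolding greaterThanLessThan_iff using ip by linarith
  qed
  have "uniformly_continuous_on {c..d} G"
    by (rule compact_uniformly_continuous[OF continuous_on_subset[OF cont sub]]) simp
  then obtain \<delta> where \<delta>: "\<delta> > 0" "\<And>t t'. t \<in> {c..d} \<Longrightarrow> t' \<in> {c..d} \<Longrightarrow> dist t' t < \<delta> \<Longrightarrow> dist (G t') (G t) < e/2"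
    using \<open>e > 0\<close> unfolding uniformly_continuous_on_def by (meson half_gt_zero)
  obtain N0 :: nat where N0: "inverse (Suc N0) < \<delta>" using reals_Archimedean \<delta>(1) by blast
  define N where "N = Suc N0"
  have N: "N > 0" "1 / N < \<delta>" using N0 by (simp_all add: N_def field_simps)
  \<comment> \<open>Level sets of the function rounding down to the grid of mesh \<open>1/N\<close>; \<open>A m\<close> is an arbitrary value of \<open>G\<close> on the cell.\<close>
  define I where "I m = {t \<in> {c..d}. nat \<lfloor>t * N\<rfloor> = m}" for m :: nat
  define A where "A m = G (SOME t. t \<in> I m)" for m
  have Ib: "I m \<in> sets borel" for m unfolding I_def by measurable
  have pos: "t \<ge> 0" if "t \<in> {c..d}" for t using subsetD[OF sub that] ab by auto
  have close: "norm (G t - A (nat \<lfloor>t * N\<rfloor>)) < e/2" if t: "t \<in> {c..d}" for t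
  proof -
    have "t \<in> I (nat \<lfloor>t * N\<rfloor>)" using t by (simp add: I_def)
    then have s: "(SOME s. s \<in> I (nat \<lfloor>t * N\<rfloor>)) \<in> I (nat \<lfloor>t * N\<rfloor>)" (is "?s \<in> _") by (rule someI)
    then have s1: "?s \<in> {c..d}" "nat \<lfloor>?s * N\<rfloor> = nat \<lfloor>t * N\<rfloor>" by (auto simp: I_def)
    then have "\<lfloor>?s * N\<rfloor> = \<lfloor>t * N\<rfloor>" using pos[OF t] pos[OF s1(1)] by (simp add: eq_nat_nat_iff)
    then have "\<bar>?s * N - t * N\<bar> < 1" by linarith
    then have "\<bar>?s - t\<bar> * N < 1" using N by (simp add: abs_mult left_diff_distrib[symmetric])
    then have "\<bar>?s - t\<bar> < 1 / N" using N by (simp add: field_simps)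
    then have "dist ?s t < \<delta>" using N(2) by (simp add: dist_real_def)
    from \<delta>(2)[OF t s1(1) this] show ?thesis by (simp add: A_def dist_norm norm_minus_commute)
  qed
  let ?g = "\<lambda>m t. indicator (I m) t :: real"
  have sm: "(\<Sum>m<Suc N. ?g m t *\<^sub>R A m) = (if t \<in> {c..d} then A (nat \<lfloor>t * N\<rfloor>) else 0)" if "t \<in> {0..1}" for t
  proof (cases "t \<in> {c..d}")
    case True
    have "t * N \<le> N" using that by (simp add: mult_left_le_one_le)
    then have "nat \<lfloor>t * N\<rfloor> \<le> N" by linarith
    have "(\<Sum>m<Suc N. ?g m t *\<^sub>R A m) = (\<Sum>m<Suc N. if m = nat \<lfloor>t * N\<rfloor> then A m else 0)"
      using True by (intro sum.cong) (auto simp: I_def indicator_def)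
    also have "\<dots> = A (nat \<lfloor>t * N\<rfloor>)" using \<open>nat \<lfloor>t * N\<rfloor> \<le> N\<close> by (subst sum.delta) auto
    finally show ?thesis using True by simp
  qed (auto simp: I_def)
  have "norm ((if t \<in> {a<..<b} then G t else 0) - (\<Sum>m<Suc N. ?g m t *\<^sub>R A m)) \<le> ?h n t + e/2"
    if t: "t \<in> {0..1}" for t
  proof (cases "t \<in> {c..d}")
    case True
    then have "t \<in> {a<..<b}" "t \<notin> ?E n" using sub by (auto simp: c_def d_def)
    then show ?thesis unfolding sm[OF t] using close[OF True] True by simp
  next
    case False
    then have "t \<in> {a<..<b} \<Longrightarrow> t \<in> ?E n" by (auto simp: c_def d_def)
    then show ?thesis unfolding sm[OF t] using le[of t] False \<open>e > 0\<close> by (auto simp: indicator_def)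
  qed
  moreover have "set_integrable lborel {0..1} (?g m)" for m
    using Ib unfolding set_integrable_def by (auto intro!: integrable_real_mult_indicator)
  moreover have ce: "set_integrable lborel {0..1} (\<lambda>t::real. e/2)"
    unfolding set_integrable_def by auto
  moreover have "integral {0..1} (\<lambda>t. ?h n t + e/2) < e"
    using integral_add[OF set_integrable_on[OF int[of n]] set_integrable_on[OF ce]] n by simp
  ultimately show "\<exists>n g A h. approx01 (\<lambda>t. if t \<in> {a<..<b} then G t else 0) e n g A h"
    unfolding approx01_def
    using set_integral_add(1)[OF int[of n] ce]
    by (intro exI[of _ "Suc N"] exI[of _ ?g] exI[of _ A] exI[of _ "\<lambda>t. ?h n t + e/2"]) auto
qed

text \<open>Fubini for products, transported from the product measure on coordinate functions to
\<open>real ^ 'd\<close> along the standard basis.\<close>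

lemma has_integral_prod_cube:
  fixes u :: "'d::finite \<Rightarrow> real \<Rightarrow> real"
  assumes u: "\<And>k. set_integrable lborel {0..1} (u k)"
  shows "((\<lambda>t::real^'d. \<Prod>k\<in>UNIV. u k (t $ k)) has_integral (\<Prod>k\<in>UNIV. integral {0..1} (u k))) (cbox 0 1)"
proof -
  define v where "v k x = indicator {0..1} x *\<^sub>R u k x" for k x
  have v: "integrable lborel (v k)" for k using u by (simp add: v_def[abs_def] set_integrable_def)
  then have vm: "v k \<in> borel_measurable borel" for k using borel_measurable_integrable[OF v[of k]] by simp
  define F where "F t = (\<Prod>k\<in>UNIV. v k (t $ k))" for t :: "real^'d"
  have Fm: "F \<in> borel_measurable borel"
    unfolding F_def[abs_def]
    by (intro borel_measurable_prod measurable_compose[OF _ vm] borel_measurable_continuous_onI continuous_intros)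
  interpret product_sigma_finite "\<lambda>_::real^'d. lborel :: real measure"
    by (rule product_sigma_finite.intro) (rule sigma_finite_lborel)
  let ?ax = "\<lambda>k::'d. axis k (1::real)"
  have inj: "inj_on ?ax UNIV" by (auto simp: inj_on_def axis_eq_axis)
  have B: "(Basis :: (real^'d) set) = ?ax ` UNIV" by (auto simp: Basis_vec_def)
  define w where "w b = v (the_inv ?ax b)" for b :: "real^'d"
  have w: "w (?ax k) = v k" for k using the_inv_f_f[OF inj, of k] by (simp add: w_def)
  let ?\<phi> = "\<lambda>f. \<Sum>b\<in>(Basis :: (real^'d) set). f b *\<^sub>R b"
  have Fphi: "F (?\<phi> f) = (\<Prod>b\<in>Basis. w b (f b))" for f
  proof -
    have "?\<phi> f $ k = f (?ax k)" for k
      using inner_sum_left_Basis[of "?ax k" f] by (simp add: cart_eq_inner_axis axis_in_Basis_iff)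
    then have "F (?\<phi> f) = (\<Prod>k\<in>UNIV. w (?ax k) (f (?ax k)))" by (simp add: F_def w)
    also have "\<dots> = (\<Prod>b\<in>Basis. w b (f b))" unfolding B by (subst prod.reindex[OF inj]) simp
    finally show ?thesis .
  qed
  have L: "(lborel :: (real^'d) measure) = distr (\<Pi>\<^sub>M b\<in>Basis. lborel) borel ?\<phi>" by (rule lborel_eq)
  have \<phi>m: "?\<phi> \<in> measurable (\<Pi>\<^sub>M b\<in>Basis. lborel) borel" by measurable
  have wi: "integrable lborel (w b)" if b: "b \<in> Basis" for b
  proof -
    from b obtain k where "b = ?ax k" unfolding B by blast
    then show ?thesis using v w by simp
  qed
  have "integrable (\<Pi>\<^sub>M b\<in>(Basis :: (real^'d) set). lborel) (\<lambda>f. \<Prod>b\<in>Basis. w b (f b))"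
    using wi by (intro product_integrable_prod) auto
  then have "integrable lborel F"
    unfolding L using Fm \<phi>m by (subst integrable_distr_eq) (auto simp: Fphi)
  then have "(F has_integral integral\<^sup>L lborel F) UNIV" by (rule has_integral_integral_lborel)
  also have "integral\<^sup>L lborel F = (\<integral>f. (\<Prod>b\<in>Basis. w b (f b)) \<partial>(\<Pi>\<^sub>M b\<in>(Basis :: (real^'d) set). lborel))"
    unfolding L using Fm \<phi>m by (subst integral_distr) (auto simp: Fphi)
  also have "\<dots> = (\<Prod>b\<in>Basis. integral\<^sup>L lborel (w b))"
    using wi by (intro product_integral_prod) auto
  also have "\<dots> = (\<Prod>k\<in>UNIV. integral\<^sup>L lborel (v k))"
    unfolding B by (subst prod.reindex[OF inj]) (simp add: w)
  also have "\<dots> = (\<Prod>k\<in>UNIV. integral {0..1} (u k))"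
    using set_borel_integral_eq_integral(2)[OF u] by (simp add: v_def[abs_def] set_lebesgue_integral_def)
  also have "F = (\<lambda>t. if t \<in> cbox 0 1 then \<Prod>k\<in>UNIV. u k (t $ k) else 0)"
  proof
    fix t :: "real^'d"
    show "F t = (if t \<in> cbox 0 1 then \<Prod>k\<in>UNIV. u k (t $ k) else 0)"
    proof (cases "t \<in> cbox 0 1")
      case False
      then obtain k where "t $ k \<notin> {0..1}" by (auto simp: mem_box_cart)
      then have "v k (t $ k) = 0" by (simp add: v_def)
      then show ?thesis using False unfolding F_def by (auto intro!: prod_zero)
    qed (auto simp: F_def v_def mem_box_cart)
  qed
  finally show ?thesis by (simp only: has_integral_restrict_UNIV)
qed

definition op_list :: "('i \<Rightarrow> ('a::real_normed_vector \<Rightarrow>\<^sub>L 'a)) \<Rightarrow> 'i list \<Rightarrow> 'a \<Rightarrow>\<^sub>L 'a" where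
  "op_list A xs = foldr (\<lambda>i S. A i o\<^sub>L S) xs id_blinfun"

lemma op_list_simps [simp]: "op_list A [] = id_blinfun" "op_list A (i # xs) = A i o\<^sub>L op_list A xs"
  by (simp_all add: op_list_def)

lemma norm_op_list_le: "distinct xs \<Longrightarrow> norm (op_list A xs) \<le> (\<Prod>i\<in>set xs. norm (A i))"
proof (induction xs)
  case (Cons i xs)
  have "norm (op_list A (i # xs)) \<le> norm (A i) * norm (op_list A xs)"
    by (simp add: norm_blinfun_compose)
  also have "\<dots> \<le> norm (A i) * (\<Prod>i\<in>set xs. norm (A i))"
    using Cons by (intro mult_left_mono) auto
  finally show ?case using Cons by simp
qed (simp add: norm_id_blinfun_le)

text \<open>Fubini for products of operator-valued functions of separate variables.  Induction on the list:
replacing the factor \<open>G i\<close> by \<open>\<Sum>m<n. g m *\<^sub>R A m\<close> turns it into a scalar function, which the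
induction hypothesis absorbs into the factors \<open>u k\<close>; this is why scalar factors in the remaining
variables are part of the statement.\<close>

lemma has_integral_op_list_cube:
  fixes G :: "'d::finite \<Rightarrow> real \<Rightarrow> ('a::banach \<Rightarrow>\<^sub>L 'a)"
  assumes "distinct xs" "\<And>i. i \<in> set xs \<Longrightarrow> bochner01 (G i)"
    "\<And>k. k \<notin> set xs \<Longrightarrow> set_integrable lborel {0..1} (u k)"
  shows "((\<lambda>t::real^'d. (\<Prod>k\<in>-set xs. u k (t $ k)) *\<^sub>R op_list (\<lambda>i. G i (t $ i)) xs) has_integral
    ((\<Prod>k\<in>-set xs. integral {0..1} (u k)) *\<^sub>R op_list (\<lambda>i. integral {0..1} (G i)) xs)) (cbox 0 1)"
  using assms
proof (induction xs arbitrary: u)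
  case Nil
  have "set_integrable lborel {0..1} (u k)" for k using Nil by auto
  from has_integral_scaleR_left[OF has_integral_prod_cube[of u, OF this], where c = id_blinfun]
  show ?case by simp
next
  case (Cons i xs)
  define W where "W t = (\<Prod>k\<in>-set (i#xs). u k (t $ k))" for t :: "real^'d"
  define Wi where "Wi = (\<Prod>k\<in>-set (i#xs). integral {0..1} (u k))"
  define F where "F t = op_list (\<lambda>i. G i (t $ i)) xs" for t :: "real^'d"
  define Fi where "Fi = op_list (\<lambda>i. integral {0..1} (G i)) xs"
  have dist: "distinct xs" "i \<notin> set xs" using Cons.prems by auto
  have c: "- set xs = insert i (- set (i#xs))" using dist by auto
  have "\<forall>k\<in>set xs. \<exists>g. set_integrable lborel {0..1} g \<and> (\<forall>t\<in>{0..1}. norm (G k t) \<le> g t) \<and> (\<forall>t\<in>{0..1}. 0 \<le> g t)"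
    using bochner01_dominated Cons.prems(2) by (metis list.set_intros(2))
  then obtain gh where gh: "\<And>k. k \<in> set xs \<Longrightarrow> set_integrable lborel {0..1} (gh k)"
    "\<And>k t. k \<in> set xs \<Longrightarrow> t \<in> {0..1} \<Longrightarrow> norm (G k t) \<le> gh k t" 
    "\<And>k t. k \<in> set xs \<Longrightarrow> t \<in> {0..1} \<Longrightarrow> 0 \<le> gh k t" by metis
  \<comment> \<open>Scalar majorants of all factors except the one with index \<open>i\<close>; multiplied by the approximation error of that factor, their product dominates the total error.\<close>
  define p where "p k t = (if k \<in> set xs then gh k t else \<bar>u k t\<bar>)" for k t
  have p: "set_integrable lborel {0..1} (p k)" "\<And>t. t \<in> {0..1} \<Longrightarrow> 0 \<le> p k t" if "k \<noteq> i" for k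
    using gh that Cons.prems(3)[of k] by (cases "k \<in> set xs"; auto simp: p_def[abs_def] intro: set_integrable_abs)+
  define Cst where "Cst = (\<Prod>k\<in>UNIV-{i}. integral {0..1} (p k))"
  have Cst: "Cst \<ge> 0" unfolding Cst_def 
    by (intro prod_nonneg ballI integral_nonneg set_integrable_on p) auto
  have WF: "norm (W t *\<^sub>R F t) \<le> (\<Prod>k\<in>UNIV-{i}. p k (t $ k))" if t: "t \<in> cbox 0 1" for t
  proof -
    have "norm (F t) \<le> (\<Prod>k\<in>set xs. norm (G k (t $ k)))" unfolding F_def by (rule norm_op_list_le[OF dist(1)])
    also have "\<dots> \<le> (\<Prod>k\<in>set xs. p k (t $ k))"
      using t gh by (intro prod_mono) (auto simp: p_def mem_box_cart)
    finally have "norm (W t *\<^sub>R F t) \<le> (\<Prod>k\<in>-set (i#xs). p k (t $ k)) * (\<Prod>k\<in>set xs. p k (t $ k))"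
      by (auto simp: W_def abs_prod p_def intro!: mult_mono prod_nonneg)
    also have "\<dots> = (\<Prod>k\<in>-set (i#xs) \<union> set xs. p k (t $ k))"
      by (subst prod.union_disjoint) auto
    also have "-set (i#xs) \<union> set xs = UNIV - {i}" using dist by auto
    finally show ?thesis .
  qed
  have "((\<lambda>t. W t *\<^sub>R (G i (t $ i) o\<^sub>L F t)) has_integral (Wi *\<^sub>R (integral {0..1} (G i) o\<^sub>L Fi))) (cbox 0 1)"
  proof (rule has_integral_approx)
    fix e :: real assume "e > 0"
    define e' where "e' = e / (Cst + norm (Wi *\<^sub>R Fi) + 1)"
    have den: "Cst + norm (Wi *\<^sub>R Fi) + 1 > 0" using Cst norm_ge_zero[of "Wi *\<^sub>R Fi"] by linarith
    have e': "e' > 0" using \<open>e > 0\<close> den by (simp add: e'_def)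
    have small: "e' * Cst < e" "e' * norm (Wi *\<^sub>R Fi) < e"
    proof -
      have "e = e' * (Cst + norm (Wi *\<^sub>R Fi) + 1)" using den by (simp add: e'_def)
      also have "\<dots> = e' * Cst + e' * norm (Wi *\<^sub>R Fi) + e'" by (simp add: algebra_simps)
      finally show "e' * Cst < e" "e' * norm (Wi *\<^sub>R Fi) < e"
        using e' mult_nonneg_nonneg[OF less_imp_le[OF e'] Cst] mult_nonneg_nonneg[OF less_imp_le[OF e'] norm_ge_zero[of "Wi *\<^sub>R Fi"]] by linarith+
    qed
    have "bochner01 (G i)" using Cons.prems by simp
    obtain n g A h where ap: "approx01 (G i) e' n g A h"
      using bochner01E[OF \<open>bochner01 (G i)\<close> e'] by blast
    note * = approx01D[OF ap]
    let ?s = "\<lambda>t. \<Sum>m<n. A m o\<^sub>L ((g m (t $ i) * W t) *\<^sub>R F t)"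
    let ?v = "\<Sum>m<n. A m o\<^sub>L ((integral {0..1} (g m) * Wi) *\<^sub>R Fi)"
    have s: "(?s has_integral ?v) (cbox 0 1)"
    proof (rule has_integral_sum)
      fix m assume "m \<in> {..<n}"
      then have "set_integrable lborel {0..1} ((u(i := g m)) k)" if "k \<notin> set xs" for k
        using that *(1)[of m] Cons.prems(3) by auto
      then have "((\<lambda>t. (\<Prod>k\<in>-set xs. (u(i := g m)) k (t $ k)) *\<^sub>R F t) has_integral
        ((\<Prod>k\<in>-set xs. integral {0..1} ((u(i := g m)) k)) *\<^sub>R Fi)) (cbox 0 1)"
        unfolding F_def Fi_def using Cons.IH[OF dist(1), of "u(i := g m)"] Cons.prems(2) by simp
      also have "(\<lambda>t. (\<Prod>k\<in>-set xs. (u(i := g m)) k (t $ k)) *\<^sub>R F t) = (\<lambda>t. (g m (t $ i) * W t) *\<^sub>R F t)"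
        unfolding c W_def by (rule ext) (auto intro!: prod.cong)
      also have "(\<Prod>k\<in>-set xs. integral {0..1} ((u(i := g m)) k)) = integral {0..1} (g m) * Wi"
        unfolding c Wi_def by (auto intro!: prod.cong)
      finally show "((\<lambda>t. A m o\<^sub>L ((g m (t $ i) * W t) *\<^sub>R F t)) has_integral
          (A m o\<^sub>L ((integral {0..1} (g m) * Wi) *\<^sub>R Fi))) (cbox 0 1)"
        using has_integral_linear[OF _ bounded_bilinear.bounded_linear_right[OF bcomp]] by (simp add: o_def)
    qed simp
    have s_eq: "?s t = (\<Sum>m<n. g m (t $ i) *\<^sub>R A m) o\<^sub>L (W t *\<^sub>R F t)" for t
      by (simp add: bounded_bilinear.sum_left[OF bcomp] bcomp_simps scaleR_sum_right mult.commute)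
    have v_eq: "?v = (\<Sum>m<n. integral {0..1} (g m) *\<^sub>R A m) o\<^sub>L (Wi *\<^sub>R Fi)"
      by (simp add: bounded_bilinear.sum_left[OF bcomp] bcomp_simps scaleR_sum_right mult.commute)
    let ?p = "p(i := h)"
    have "((\<lambda>t::real^'d. \<Prod>k\<in>UNIV. ?p k (t $ k)) has_integral (\<Prod>k\<in>UNIV. integral {0..1} (?p k))) (cbox 0 1)"
      using p *(2) by (intro has_integral_prod_cube) auto
    also have "(\<Prod>k\<in>UNIV. integral {0..1} (?p k)) = integral {0..1} h * Cst"
      unfolding Cst_def by (subst prod.remove[of UNIV i]) (auto intro!: prod.cong arg_cong2[where f="(*)"])
    also have "(\<lambda>t::real^'d. \<Prod>k\<in>UNIV. ?p k (t $ k)) = (\<lambda>t. h (t $ i) * (\<Prod>k\<in>UNIV-{i}. p k (t $ k)))"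
      by (rule ext, subst prod.remove[of UNIV i]) (auto intro!: prod.cong arg_cong2[where f="(*)"])
    finally have h: "((\<lambda>t::real^'d. h (t $ i) * (\<Prod>k\<in>UNIV-{i}. p k (t $ k))) has_integral integral {0..1} h * Cst) (cbox 0 1)" .
    have h0: "0 \<le> h t" if "t \<in> {0..1}" for t using *(3)[OF that] norm_ge_zero order_trans by blast
    have le: "norm (W t *\<^sub>R (G i (t $ i) o\<^sub>L F t) - ?s t) \<le> h (t $ i) * (\<Prod>k\<in>UNIV-{i}. p k (t $ k))"
      if t: "t \<in> cbox 0 1" for t
    proof -
      have ti: "t $ i \<in> {0..1}" using t by (auto simp: mem_box_cart)
      have "W t *\<^sub>R (G i (t $ i) o\<^sub>L F t) - ?s t = (G i (t $ i) - (\<Sum>m<n. g m (t $ i) *\<^sub>R A m)) o\<^sub>L (W t *\<^sub>R F t)"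
        unfolding s_eq by (simp add: bcomp_simps scaleR_diff_right)
      also have "norm \<dots> \<le> norm (G i (t $ i) - (\<Sum>m<n. g m (t $ i) *\<^sub>R A m)) * norm (W t *\<^sub>R F t)"
        by (rule norm_blinfun_compose)
      also have "\<dots> \<le> h (t $ i) * (\<Prod>k\<in>UNIV-{i}. p k (t $ k))"
        by (intro mult_mono WF[OF t] *(3)[OF ti] h0[OF ti]) auto
      finally show ?thesis .
    qed
    have "norm (integral {0..1} (G i) - (\<Sum>m<n. integral {0..1} (g m) *\<^sub>R A m)) \<le> integral {0..1} h"
    proof -
      have hi: "((\<lambda>t. G i t - (\<Sum>m<n. g m t *\<^sub>R A m)) has_integral
          integral {0..1} (G i) - (\<Sum>m<n. integral {0..1} (g m) *\<^sub>R A m)) {0..1}"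
        by (rule has_integral_diff[OF integrable_integral[OF bochner01_integrable[OF \<open>bochner01 (G i)\<close>]] step_integrable[OF *(1)]])
      have "norm (integral {0..1} (\<lambda>t. G i t - (\<Sum>m<n. g m t *\<^sub>R A m))) \<le> integral {0..1} h"
        by (rule integral_norm_bound_integral[OF has_integral_integrable[OF hi] set_integrable_on[OF *(2)] *(3)])
      then show ?thesis unfolding integral_unique[OF hi] .
    qed
    then have d: "norm (?v - Wi *\<^sub>R (integral {0..1} (G i) o\<^sub>L Fi)) \<le> e' * norm (Wi *\<^sub>R Fi)"
    proof -
      assume a: "norm (integral {0..1} (G i) - (\<Sum>m<n. integral {0..1} (g m) *\<^sub>R A m)) \<le> integral {0..1} h"
      have "?v - Wi *\<^sub>R (integral {0..1} (G i) o\<^sub>L Fi) =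
        ((\<Sum>m<n. integral {0..1} (g m) *\<^sub>R A m) - integral {0..1} (G i)) o\<^sub>L (Wi *\<^sub>R Fi)"
        unfolding v_eq by (simp add: bcomp_simps scaleR_diff_right)
      also have "norm \<dots> \<le> norm ((\<Sum>m<n. integral {0..1} (g m) *\<^sub>R A m) - integral {0..1} (G i)) * norm (Wi *\<^sub>R Fi)"
        by (rule norm_blinfun_compose)
      also have "\<dots> \<le> e' * norm (Wi *\<^sub>R Fi)"
        using a *(4) by (intro mult_right_mono) (auto simp: norm_minus_commute)
      finally show ?thesis .
    qed
    have "integral {0..1} h * Cst \<le> e' * Cst" using *(4) Cst by (intro mult_right_mono) auto
    then have "integral {0..1} h * Cst < e" using small(1) by linarith
    moreover have "norm (?v - Wi *\<^sub>R (integral {0..1} (G i) o\<^sub>L Fi)) < e"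
      using d small(2) by (rule le_less_trans)
    ultimately show "\<exists>s v h H. (s has_integral v) (cbox 0 1) \<and> (h has_integral H) (cbox 0 1) \<and>
     (\<forall>t\<in>cbox 0 1. norm (W t *\<^sub>R (G i (t $ i) o\<^sub>L F t) - s t) \<le> h t) \<and> H < e \<and>
      norm (v - Wi *\<^sub>R (integral {0..1} (G i) o\<^sub>L Fi)) < e"
      by (rule_tac x = ?s in exI, rule_tac x = ?v in exI,
          rule_tac x = "\<lambda>t. h (t $ i) * (\<Prod>k\<in>UNIV-{i}. p k (t $ k))" in exI,
          rule_tac x = "integral {0..1} h * Cst" in exI)
        (intro conjI ballI s h le)
  qed
  then show ?case by (simp add: W_def Wi_def F_def Fi_def)
qed

section \<open>Stolz domains and their boundary contour\<close>

lemma inner_cis: "cis \<psi> \<bullet> z = cos \<psi> * Re z + sin \<psi> * Im z"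
  by (simp add: inner_complex_def)

text \<open>The support function of the hull of \<open>1\<close> and a disc is the maximum of the two support functions.
A point is shown to lie outside by violating this bound for one direction.\<close>

lemma closure_stolz_support:
  assumes "z \<in> closure (stolz a)" shows "cis \<psi> \<bullet> z \<le> max (cos \<psi>) (sin a)"
proof -
  let ?H = "{z. cis \<psi> \<bullet> z \<le> max (cos \<psi>) (sin a)}"
  have "insert 1 (ball 0 (sin a)) \<subseteq> ?H"
  proof
    fix w assume w: "w \<in> insert 1 (ball (0::complex) (sin a))"
    show "w \<in> ?H"
    proof (cases "w = 1")
      case True then show ?thesis by (simp add: inner_cis)
    next
      case False
      then have "norm w < sin a" using w by simp
      then show ?thesis using norm_cauchy_schwarz[of "cis \<psi>" w] by simp
    qed
  qed
  then have "convex hull (insert 1 (ball 0 (sin a))) \<subseteq> ?H"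
    by (intro hull_minimal convex_halfspace_le)
  then have "stolz a \<subseteq> ?H" unfolding stolz_def using interior_subset by blast
  then have "closure (stolz a) \<subseteq> ?H" by (intro closure_minimal closed_halfspace_le)
  then show ?thesis using assms by blast
qed

lemma stolz_corner: "complex_of_real (sin b) * cis (pi/2 - b) = 1 - of_real (cos b) * cis (-b)"
  "complex_of_real (sin b) * cis (- (pi/2 - b)) = 1 - of_real (cos b) * cis b"
proof -
  have *: "1 - cos b * cos b = sin b * sin b" using sin_cos_squared_add[of b] by (simp add: power2_eq_square algebra_simps)
  show "complex_of_real (sin b) * cis (pi/2 - b) = 1 - of_real (cos b) * cis (-b)"
    "complex_of_real (sin b) * cis (- (pi/2 - b)) = 1 - of_real (cos b) * cis b"
    using * by (simp_all add: complex_eq_iff cos_diff sin_diff mult.commute)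
qed

text \<open>The angle on the circular arc, which the contour traverses for \<open>t\<close> between \<open>1/2\<close> and \<open>3/4\<close>.\<close>

definition stolz_arg :: "real \<Rightarrow> real \<Rightarrow> real" where
  "stolz_arg b t = (pi/2 - b) + (4 * t - 2) * (pi + 2 * b)"

lemma stolz_path_1: "t \<le> 1/2 \<Longrightarrow> stolz_path b t = 1 - of_real (2 * t * cos b) * cis (-b)"
  unfolding stolz_path_def joinpaths_def stolz_corner
  by (simp add: linepath_def scaleR_conv_of_real algebra_simps)

lemma stolz_path_2: assumes "1/2 \<le> t" "t \<le> 3/4" shows "stolz_path b t = of_real (sin b) * cis (stolz_arg b t)"
proof (cases "t = 1/2")
  case True
  have "stolz_arg b (1/2) = pi/2 - b" by (simp add: stolz_arg_def)
  then show ?thesis unfolding True using stolz_path_1[of "1/2" b] stolz_corner(1)[of b] by simp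
next
  case False
  have "linepath (pi/2 - b) (3*pi/2 + b) (2 * (2 * t - 1)) = stolz_arg b t"
    by (simp add: linepath_def stolz_arg_def field_simps)
  then show ?thesis using assms False
    unfolding stolz_path_def joinpaths_def by (simp add: part_circlepath_def cis_conv_exp mult.commute)
qed

lemma stolz_path_3: assumes "3/4 \<le> t" shows "stolz_path b t = 1 - of_real (4 * (1 - t) * cos b) * cis b"
proof (cases "t = 3/4")
  case True
  have "stolz_arg b t = - (pi/2 - b) + 2 * pi" by (simp add: True stolz_arg_def algebra_simps)
  then have "cis (stolz_arg b t) = cis (- (pi/2 - b))" by (simp only: complex_eq_iff cis.sel cos_periodic sin_periodic simp_thms)
  then show ?thesis unfolding True using stolz_path_2[of "3/4" b] stolz_corner(2)[of b] by simp
next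
  case False
  then show ?thesis using assms
    unfolding stolz_path_def joinpaths_def stolz_corner
    by (simp add: linepath_def scaleR_conv_of_real algebra_simps)
qed

lemma valid_path_stolz: "valid_path (stolz_path b)"
proof -
  have 1: "pathfinish (part_circlepath 0 (sin b) (pi/2 - b) (3*pi/2 + b)) = of_real (sin b) * cis (- (pi/2 - b))"
  proof -
    have "3*pi/2 + b = - (pi/2 - b) + 2 * pi" by simp
    then have "cis (3*pi/2 + b) = cis (- (pi/2 - b))" by (simp only: cis.ctr sin_periodic cos_periodic)
    then show ?thesis by (simp add: cis_conv_exp)
  qed
  show ?thesis unfolding stolz_path_def
    by (intro valid_path_join) (auto simp: 1 cis_conv_exp simp del: pathfinish_part_circlepath)
qed

lemma path_stolz: "continuous_on {0..1} (stolz_path b)"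
  using valid_path_imp_path[OF valid_path_stolz] by (simp add: path_def)

lemma stolz_path_ends [simp]: "stolz_path b 0 = 1" "stolz_path b 1 = 1"
  by (simp_all add: stolz_path_1 stolz_path_3)

definition stolz_deriv :: "real \<Rightarrow> real \<Rightarrow> complex" where
  "stolz_deriv b t = vector_derivative (stolz_path b) (at t)"

lemma hvd_stolz_1: assumes "0 < t" "t < 1/2"
  shows "(stolz_path b has_vector_derivative (- of_real (2 * cos b) * cis (-b))) (at t)"
proof -
  have "((\<lambda>t. 1 - of_real (2 * t * cos b) * cis (-b)) has_vector_derivative (- of_real (2 * cos b) * cis (-b))) (at t)"
    by (auto intro!: derivative_eq_intros simp: scaleR_conv_of_real)
  then show ?thesis
    by (rule has_vector_derivative_transform_within_open[where S = "{..<1/2}"]) (use assms stolz_path_1 in auto)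
qed

lemma hvd_stolz_2: assumes "1/2 < t" "t < 3/4"
  shows "(stolz_path b has_vector_derivative (of_real (4 * (pi + 2 * b)) * \<i> * of_real (sin b) * cis (stolz_arg b t))) (at t)"
proof -
  let ?c = "part_circlepath 0 (sin b) (pi/2 - b) (3*pi/2 + b)"
  have lin: "linepath (pi/2 - b) (3*pi/2 + b) (4 * t - 2) = stolz_arg b t" for t
    by (simp add: linepath_def stolz_arg_def field_simps)
  have "((?c \<circ> (\<lambda>t. 4 * t - 2)) has_vector_derivative (4 *\<^sub>R (\<i> * of_real (sin b) * (of_real (3*pi/2 + b) - of_real (pi/2 - b)) *
      exp (\<i> * of_real (linepath (pi/2 - b) (3*pi/2 + b) (4 * t - 2)))))) (at t)"
    by (rule vector_diff_chain_at) (auto intro!: derivative_eq_intros has_vector_derivative_part_circlepath)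
  moreover have "?c \<circ> (\<lambda>t. 4 * t - 2) = (\<lambda>t. of_real (sin b) * cis (stolz_arg b t))"
    by (rule ext) (simp add: part_circlepath_def lin cis_conv_exp)
  moreover have "4 *\<^sub>R (\<i> * of_real (sin b) * (of_real (3*pi/2 + b) - of_real (pi/2 - b)) *
      exp (\<i> * of_real (linepath (pi/2 - b) (3*pi/2 + b) (4 * t - 2)))) = of_real (4 * (pi + 2 * b)) * \<i> * of_real (sin b) * cis (stolz_arg b t)"
    unfolding lin cis_conv_exp by (simp add: scaleR_conv_of_real algebra_simps)
  ultimately have "((\<lambda>t. of_real (sin b) * cis (stolz_arg b t)) has_vector_derivative (of_real (4 * (pi + 2 * b)) * \<i> * of_real (sin b) * cis (stolz_arg b t))) (at t)"
    by simp
  then show ?thesis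
    by (rule has_vector_derivative_transform_within_open[where S = "{1/2<..<3/4}"]) (use assms stolz_path_2 in auto)
qed

lemma hvd_stolz_3: assumes "3/4 < t"
  shows "(stolz_path b has_vector_derivative (of_real (4 * cos b) * cis b)) (at t)"
proof -
  have "((\<lambda>t. 1 - of_real (4 * (1 - t) * cos b) * cis b) has_vector_derivative (of_real (4 * cos b) * cis b)) (at t)"
    by (auto intro!: derivative_eq_intros simp: scaleR_conv_of_real)
  then show ?thesis
    by (rule has_vector_derivative_transform_within_open[where S = "{3/4<..}"]) (use assms stolz_path_3 in auto)
qed

lemma stolz_deriv_eq:
  "0 < t \<Longrightarrow> t < 1/2 \<Longrightarrow> stolz_deriv b t = - of_real (2 * cos b) * cis (-b)"
  "1/2 < t \<Longrightarrow> t < 3/4 \<Longrightarrow> stolz_deriv b t = of_real (4 * (pi + 2 * b)) * \<i> * of_real (sin b) * cis (stolz_arg b t)"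
  "3/4 < t \<Longrightarrow> stolz_deriv b t = of_real (4 * cos b) * cis b"
  unfolding stolz_deriv_def
  by (intro vector_derivative_at hvd_stolz_1 hvd_stolz_2 hvd_stolz_3; assumption)+

lemma hvd_stolz:
  assumes "t \<in> {0..1} - {0, 1/2, 3/4, 1}"
  shows "(stolz_path b has_vector_derivative stolz_deriv b t) (at t)"
proof -
  have "(0 < t \<and> t < 1/2) \<or> (1/2 < t \<and> t < 3/4) \<or> 3/4 < t" using assms by auto
  then show ?thesis
    using hvd_stolz_1[of t b] hvd_stolz_2[of t b] hvd_stolz_3[of t b] stolz_deriv_eq[of t b] by metis
qed

lemma norm_stolz_deriv:
  assumes "t \<in> {0..1} - {0, 1/2, 3/4, 1}" "0 \<le> b" "b \<le> pi/2"
  shows "norm (stolz_deriv b t) \<le> 8 * pi"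
proof -
  have "(0 < t \<and> t < 1/2) \<or> (1/2 < t \<and> t < 3/4) \<or> 3/4 < t" using assms by auto
  moreover have "\<bar>2 * cos b\<bar> \<le> 8 * pi" "\<bar>4 * cos b\<bar> \<le> 8 * pi"
    using abs_cos_le_one[of b] pi_gt3 unfolding abs_mult abs_numeral by linarith+
  moreover have "\<bar>4 * (pi + 2 * b)\<bar> * \<bar>sin b\<bar> \<le> 8 * pi * 1"
    using assms abs_sin_le_one[of b] by (intro mult_mono) auto
  ultimately show ?thesis
    by (elim disjE) (auto simp: stolz_deriv_eq norm_mult simp del: of_real_mult of_real_add of_real_numeral)
qed

locale stolz_angle =
  fixes b :: real
  assumes b0: "0 < b" and b2: "b < pi/2"
begin

lemma sin01: "0 < sin b" "sin b < 1" and cos01: "0 < cos b" "cos b < 1"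
proof -
  show s: "0 < sin b" using b0 b2 by (intro sin_gt_zero) auto
  show c: "0 < cos b" using b0 b2 by (intro cos_gt_zero) auto
  have "(sin b)\<^sup>2 + (cos b)\<^sup>2 = 1" by simp
  moreover have "(sin b)\<^sup>2 > 0" "(cos b)\<^sup>2 > 0" using s c by simp_all
  ultimately have "(sin b)\<^sup>2 < 1" "(cos b)\<^sup>2 < 1" by linarith+
  then show "sin b < 1" "cos b < 1" by (auto simp: abs_square_less_1)
qed

lemma arc_cos:
  assumes "1/2 < t" "t < 3/4" shows "cos (stolz_arg b t) < sin b"
proof -
  define u where "u = stolz_arg b t - pi"
  have "pi/2 - b < stolz_arg b t" using assms b0 by (simp add: stolz_arg_def add_pos_pos)
  moreover have "stolz_arg b t < 3*pi/2 + b"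
  proof -
    have "(4 * t - 2) * (pi + 2 * b) < 1 * (pi + 2 * b)" using assms b0 by (intro mult_strict_right_mono) (auto intro: add_pos_pos)
    then show ?thesis by (simp add: stolz_arg_def)
  qed
  ultimately have u: "\<bar>u\<bar> < pi/2 + b" by (auto simp: u_def)
  have "cos (pi/2 + b) < cos \<bar>u\<bar>" using u b2 by (intro cos_monotone_0_pi) auto
  moreover have "cos (pi/2 + b) = - sin b" by (simp add: cos_add)
  moreover have "cos (stolz_arg b t) = - cos \<bar>u\<bar>" by (simp add: u_def cos_diff)
  ultimately show ?thesis by simp
qed

lemma three_cases: "0 < t \<Longrightarrow> t < 1 \<Longrightarrow> (t \<le> 1/2) \<or> (1/2 < t \<and> t < 3/4) \<or> (3/4 \<le> (t::real))"
  by linarith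

lemma norm_1_minus:
  "0 \<le> t \<Longrightarrow> t \<le> 1/2 \<Longrightarrow> norm (1 - stolz_path b t) = 2 * t * cos b"
  "3/4 \<le> t \<Longrightarrow> t \<le> 1 \<Longrightarrow> norm (1 - stolz_path b t) = 4 * (1 - t) * cos b"
  using cos01 by (simp_all add: stolz_path_1 stolz_path_3 norm_mult abs_mult del: of_real_mult of_real_diff)

lemma path_norm_le: assumes "0 \<le> t" "t \<le> 1" shows "norm (stolz_path b t) \<le> 1"
proof -
  have l: "norm (1 - of_real (x * cos b) * cis y) \<le> 1" if "0 \<le> x" "x \<le> 1" "y = b \<or> y = -b" for x y
  proof -
    have "1 - of_real (x * cos b) * cis y = of_real (1 - x) * 1 + of_real x * (1 - of_real (cos b) * cis y)"
      by (simp add: algebra_simps)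
    also have "norm \<dots> \<le> (1 - x) * 1 + x * norm (1 - of_real (cos b) * cis y)"
      by (rule order_trans[OF norm_triangle_ineq]) (use that in \<open>simp add: norm_mult del: of_real_diff\<close>)
    also have "norm (1 - of_real (cos b) * cis y) \<le> 1"
      using that(3) stolz_corner[of b, symmetric] sin01 by (auto simp: norm_mult)
    finally show ?thesis using that by (simp add: mult_left_mono)
  qed
  consider "t \<le> 1/2" | "1/2 \<le> t \<and> t \<le> 3/4" | "3/4 \<le> t" by linarith
  then show ?thesis
  proof cases
    case 1 then show ?thesis using l[of "2 * t" "-b"] assms by (simp add: stolz_path_1)
  next
    case 2 then show ?thesis using sin01 by (simp add: stolz_path_2 norm_mult)
  next
    case 3 then show ?thesis using l[of "4 * (1 - t)" b] assms by (simp add: stolz_path_3)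
  qed
qed

lemma arc_Re: assumes "1/2 \<le> t" "t \<le> 3/4" shows "Re (stolz_path b t) \<le> (sin b)\<^sup>2"
proof -
  have "cos (stolz_arg b t) \<le> sin b"
  proof (cases "1/2 < t \<and> t < 3/4")
    case True then show ?thesis using arc_cos by (simp add: less_imp_le)
  next
    case False
    then consider "t = 1/2" | "t = 3/4" using assms by linarith
    then show ?thesis
    proof cases
      case 1
      have "stolz_arg b t = pi/2 - b" unfolding 1 by (simp add: stolz_arg_def)
      then show ?thesis by (simp add: cos_diff)
    next
      case 2
      have "stolz_arg b t = - (pi/2 - b) + 2 * pi" by (simp add: 2 stolz_arg_def algebra_simps)
      then have "cos (stolz_arg b t) = cos (- (pi/2 - b))" by (simp only: cos_periodic)
      then show ?thesis by (simp add: cos_diff)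
    qed
  qed
  then show ?thesis using assms sin01 by (simp add: stolz_path_2 power2_eq_square)
qed

lemma arc_dist:
  assumes "1/2 \<le> t" "t \<le> 3/4" shows "norm (stolz_path b t) = sin b" "1 - (sin b)\<^sup>2 \<le> norm (1 - stolz_path b t)"
proof -
  show "norm (stolz_path b t) = sin b" using assms sin01 by (simp add: stolz_path_2 norm_mult)
  have "1 - (sin b)\<^sup>2 \<le> Re (1 - stolz_path b t)" using arc_Re[OF assms] by simp
  also have "\<dots> \<le> norm (1 - stolz_path b t)" by (rule complex_Re_le_cmod)
  finally show "1 - (sin b)\<^sup>2 \<le> norm (1 - stolz_path b t)" .
qed

lemma sin2: "(sin b)\<^sup>2 < 1"
  using sin01 by (simp add: abs_square_less_1)

lemma path_ne_1: assumes "0 < t" "t < 1" shows "stolz_path b t \<noteq> 1"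
proof -
  have "norm (1 - stolz_path b t) > 0"
    using three_cases[OF assms]
  proof (elim disjE)
    assume "t \<le> 1/2" then show ?thesis using norm_1_minus(1)[of t] assms cos01 by simp
  next
    assume "1/2 < t \<and> t < 3/4" then have "1 - (sin b)\<^sup>2 \<le> norm (1 - stolz_path b t)" using arc_dist(2)[of t] by simp
    then show ?thesis using sin2 by linarith
  next
    assume "3/4 \<le> t" then show ?thesis using norm_1_minus(2)[of t] assms cos01 by simp
  qed
  then show ?thesis by auto
qed

text \<open>On the segments the separating direction is the normal of the corresponding side of the smaller
domain, on the arc it is the radial direction.  Dilating by \<open>1 / r\<close> pushes the contour further out;
it is used for the resolvents of \<open>r T\<close>.\<close>

lemma path_outside:
  assumes a: "0 < a" "a < b" and r: "0 < r" "r \<le> 1" and t: "0 \<le> t" "t \<le> 1" and rt: "r < 1 \<or> (0 < t \<and> t < 1)"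
  shows "stolz_path b t / of_real r \<notin> closure (stolz a)"
proof
  assume inn: "stolz_path b t / of_real r \<in> closure (stolz a)"
  have sa: "0 < sin a" "sin a < sin b" using a b2 by (auto intro: sin_gt_zero sin_monotone_2pi)
  have ir: "cis \<psi> \<bullet> (stolz_path b t / of_real r) = (cis \<psi> \<bullet> stolz_path b t) / r" for \<psi>
    by (simp add: inner_cis add_divide_distrib)
  have le: "cis \<psi> \<bullet> stolz_path b t \<le> r * max (cos \<psi>) (sin a)" for \<psi>
    using closure_stolz_support[OF inn, of \<psi>] r unfolding ir by (simp add: field_simps)
  have key: "sin a < sin b * cos (b - a)"
  proof -
    have "sin a = sin (b - (b - a))" by simp
    also have "\<dots> = sin b * cos (b - a) - cos b * sin (b - a)" by (rule sin_diff)
    also have "\<dots> < sin b * cos (b - a)" using cos01 a b2 by (simp add: sin_gt_zero)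
    finally show ?thesis .
  qed
  have seg: False if p: "cis \<psi> \<bullet> stolz_path b t = (1 - x) * sin a + x * (sin b * cos (b - a))"
     and c: "cos \<psi> = sin a" and x: "0 \<le> x" "x \<le> 1" and rx: "r < 1 \<or> 0 < x" for \<psi> x
  proof -
    have eq: "cis \<psi> \<bullet> stolz_path b t = sin a + x * (sin b * cos (b - a) - sin a)" using p by (simp add: algebra_simps)
    have "sin a + x * (sin b * cos (b - a) - sin a) \<le> r * sin a" using le[of \<psi>] unfolding eq c by simp
    moreover have "x * (sin b * cos (b - a) - sin a) \<ge> 0" using x key by simp
    moreover have "r * sin a \<le> sin a" using r sa by (simp add: mult_left_le_one_le)
    moreover have "r < 1 \<Longrightarrow> r * sin a < sin a" using sa by simp
    moreover have "0 < x \<Longrightarrow> x * (sin b * cos (b - a) - sin a) > 0" using key by simp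
    ultimately show False using rx by linarith
  qed
  consider "t \<le> 1/2" | "1/2 < t \<and> t < 3/4" | "3/4 \<le> t" by linarith
  then show False
  proof cases
    case 1
    have e: "cis (pi/2 - a) \<bullet> stolz_path b t = (1 - 2 * t) * sin a + 2 * t * (sin b * cos (b - a))"
    proof -
      have eq: "stolz_path b t = of_real (1 - 2 * t) + of_real (2 * t) * (of_real (sin b) * cis (pi/2 - b))"
        unfolding stolz_path_1[OF 1] stolz_corner by (simp add: algebra_simps)
      show ?thesis unfolding eq by (simp add: inner_cis cos_diff sin_diff algebra_simps)
    qed
    show False by (rule seg[OF e]) (use 1 t rt in \<open>auto simp: cos_diff\<close>)
  next
    case 2
    have "cis (stolz_arg b t) \<bullet> stolz_path b t = sin b"
      using 2 by (simp add: stolz_path_2 scaleR_conv_of_real[symmetric] dot_square_norm)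
    then have "sin b \<le> r * max (cos (stolz_arg b t)) (sin a)" using le[of "stolz_arg b t"] by simp
    moreover have "r * max (cos (stolz_arg b t)) (sin a) < sin b"
    proof (cases "max (cos (stolz_arg b t)) (sin a) \<le> 0")
      case True
      then have "r * max (cos (stolz_arg b t)) (sin a) \<le> 0" using r by (simp add: mult_le_0_iff)
      then show ?thesis using sin01 by linarith
    next
      case False
      then have "r * max (cos (stolz_arg b t)) (sin a) \<le> 1 * max (cos (stolz_arg b t)) (sin a)"
        using r by (intro mult_right_mono) auto
      also have "\<dots> < sin b" using arc_cos 2 sa by simp
      finally show ?thesis .
    qed
    ultimately show False by simp
  next
    case 3
    have e: "cis (- (pi/2 - a)) \<bullet> stolz_path b t = (1 - 4 * (1 - t)) * sin a + 4 * (1 - t) * (sin b * cos (b - a))"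
    proof -
      have eq: "stolz_path b t = of_real (1 - 4 * (1 - t)) + of_real (4 * (1 - t)) * (of_real (sin b) * cis (- (pi/2 - b)))"
        unfolding stolz_path_3[OF 3] stolz_corner by (simp add: algebra_simps)
      show ?thesis unfolding eq by (simp add: inner_cis cos_diff sin_diff algebra_simps)
    qed
    show False by (rule seg[OF e]) (use 3 t rt in \<open>auto simp: cos_diff\<close>)
  qed
qed

lemma real_not_on_path:
  assumes "0 \<le> r" "r < 1" "0 \<le> t" "t \<le> 1" shows "stolz_path b t \<noteq> of_real r"
proof
  assume eq: "stolz_path b t = of_real r"
  then have Im: "Im (stolz_path b t) = 0" by simp
  consider "t \<le> 1/2" | "1/2 \<le> t \<and> t \<le> 3/4" | "3/4 \<le> t" by linarith
  then show False
  proof cases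
    case 1
    then have "t = 0" using Im cos01 sin01 by (simp add: stolz_path_1)
    then show False using eq assms by simp
  next
    case 2
    then have "r = sin b" "r \<le> (sin b)\<^sup>2" using arc_dist(1)[of t] arc_Re[of t] eq assms by simp_all
    then show False using sin01 by (simp add: power2_eq_square)
  next
    case 3
    then have "t = 1" using Im cos01 sin01 by (simp add: stolz_path_3)
    then show False using eq assms by simp
  qed
qed

definition "dist_const = min (sin b) ((1 - (sin b)\<^sup>2) / 4)"

lemma dist_const_pos: "dist_const > 0"
  using sin01 sin2 by (simp add: dist_const_def)

text \<open>The contour leaves \<open>1\<close> at a fixed angle from the real axis, so points \<open>r\<close> of the axis near
\<open>1\<close> are not closer than a multiple of \<open>\<bar>1 - z\<bar>\<close> to a point \<open>z\<close> of the contour.\<close>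

lemma path_dist:
  assumes r: "(1 + (sin b)\<^sup>2) / 2 \<le> r" "r \<le> 1" and t: "0 \<le> t" "t \<le> 1"
  shows "dist_const * norm (1 - stolz_path b t) \<le> norm (stolz_path b t - of_real r)"
proof -
  have seg: "dist_const * norm (1 - stolz_path b t) \<le> norm (stolz_path b t - of_real r)"
    if "stolz_path b t = 1 - of_real x * cis y" "0 \<le> x" "y = b \<or> y = -b" for x y
  proof -
    have n: "norm (1 - stolz_path b t) = x" using that by (simp add: norm_mult)
    have "\<bar>Im (stolz_path b t - of_real r)\<bar> = x * sin b" using that sin01 by (auto simp: abs_mult)
    then have "x * sin b \<le> norm (stolz_path b t - of_real r)" using abs_Im_le_cmod by metis
    moreover have "dist_const * x \<le> sin b * x" using that by (intro mult_right_mono) (auto simp: dist_const_def)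
    ultimately show ?thesis unfolding n by (simp add: mult.commute)
  qed
  consider "t \<le> 1/2" | "1/2 \<le> t \<and> t \<le> 3/4" | "3/4 \<le> t" by linarith
  then show ?thesis
  proof cases
    case 1 then show ?thesis using seg[of "2 * t * cos b" "-b"] cos01 t by (simp add: stolz_path_1)
  next
    case 2
    have "(1 - (sin b)\<^sup>2) / 2 \<le> Re (of_real r - stolz_path b t)" using arc_Re[of t] 2 r by simp
    also have "\<dots> \<le> norm (of_real r - stolz_path b t)" by (rule complex_Re_le_cmod)
    finally have 1: "(1 - (sin b)\<^sup>2) / 2 \<le> norm (stolz_path b t - of_real r)" by (simp add: norm_minus_commute)
    have "norm (1 - stolz_path b t) \<le> 2" using norm_triangle_ineq4[of 1 "stolz_path b t"] path_norm_le[OF t] by simp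
    then have "dist_const * norm (1 - stolz_path b t) \<le> ((1 - (sin b)\<^sup>2) / 4) * 2"
      using dist_const_pos by (intro mult_mono min.cobounded2[of "sin b" "(1 - (sin b)\<^sup>2) / 4", folded dist_const_def]) (use sin2 in simp_all)
    then show ?thesis using 1 by simp
  next
    case 3 then show ?thesis using seg[of "4 * (1 - t) * cos b" b] cos01 t by (simp add: stolz_path_3)
  qed
qed

text \<open>The contour touches the unit circle at \<open>1\<close>, hence only continuity up to the boundary of the disc
is available there.\<close>

lemma cauchy_stolz:
  assumes "continuous_on (cball 0 1) f" "\<And>z. norm z < 1 \<Longrightarrow> f field_differentiable at z"
  shows "((\<lambda>t. f (stolz_path b t) * stolz_deriv b t) has_integral 0) {0..1}"
proof -
  have "(f has_contour_integral 0) (stolz_path b)"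
  proof (rule Cauchy_theorem_disc[where K = "{}" and a = 0 and e = 1])
    show "path_image (stolz_path b) \<subseteq> cball 0 1" using path_norm_le by (auto simp: path_image_def)
    show "pathfinish (stolz_path b) = pathstart (stolz_path b)" by (simp add: pathfinish_def pathstart_def)
  qed (use assms valid_path_stolz in auto)
  then show ?thesis by (simp add: has_contour_integral stolz_deriv_def)
qed

text \<open>The normalisation of the calculus: the winding number of the contour around \<open>0\<close> is one.  The two
segments lie in the right half plane, where \<open>Ln\<close> is a primitive, and the arc is computed directly.\<close>

lemma integral_inverse_stolz:
  "((\<lambda>t. inverse (stolz_path b t) * stolz_deriv b t) has_integral (2 * of_real pi * \<i>)) {0..1}"
proof -
  let ?P = "of_real (sin b) * cis (pi/2 - b)" and ?Q = "of_real (sin b) * cis (- (pi/2 - b))"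
  let ?S = "{z. Re z > 0}"
  have Re: "Re ?P > 0" "Re ?Q > 0" using sin01 by (simp_all add: cos_diff)
  have LnP: "Ln (of_real (sin b) * cis y) = of_real (ln (sin b)) + \<i> * of_real y" if "\<bar>y\<bar> < pi" for y
  proof -
    have "of_real (sin b) * cis y = exp (of_real (ln (sin b)) + \<i> * of_real y)"
      using sin01 by (simp add: exp_add cis_conv_exp exp_of_real)
    then show ?thesis using that by (simp add: Ln_exp del: exp_add)
  qed
  have prim: "(inverse has_contour_integral (Ln (pathfinish g) - Ln (pathstart g))) g"
    if "valid_path g" "path_image g \<subseteq> ?S" for g
  proof (rule contour_integral_primitive[where S = ?S])
    fix z assume "z \<in> ?S"
    then show "(Ln has_field_derivative inverse z) (at z within ?S)"
      by (auto intro!: derivative_eq_intros simp: complex_nonpos_Reals_iff)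
  qed (use that in auto)
  have i1: "(inverse has_contour_integral (Ln ?P - Ln 1)) (linepath 1 ?P)"
    using prim[of "linepath 1 ?P"] closed_segment_subset[OF _ _ convex_halfspace_Re_gt[of 0], of 1 ?P] Re(1) by simp
  have i3: "(inverse has_contour_integral (Ln 1 - Ln ?Q)) (linepath ?Q 1)"
    using prim[of "linepath ?Q 1"] closed_segment_subset[OF _ _ convex_halfspace_Re_gt[of 0], of ?Q 1] Re(2) by simp
  have i2: "(inverse has_contour_integral (\<i> * of_real (pi + 2 * b))) (part_circlepath 0 (sin b) (pi/2 - b) (3*pi/2 + b))"
  proof -
    have "((\<lambda>t. inverse (0 + of_real (sin b) * cis t) * of_real (sin b) * \<i> * cis t) has_integral (\<i> * of_real (pi + 2 * b))) {pi/2 - b..3*pi/2 + b}"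
    proof -
      have "(\<lambda>t. inverse (0 + of_real (sin b) * cis t) * of_real (sin b) * \<i> * cis t) = (\<lambda>t. \<i>)"
        using sin01 by (simp add: fun_eq_iff field_simps)
      then show ?thesis using has_integral_const_real[of "\<i>" "pi/2 - b" "3*pi/2 + b"] b0
        by (simp add: scaleR_conv_of_real algebra_simps content_real_if)
    qed
    moreover have "pi/2 - b < 3*pi/2 + b" using b0 pi_gt_zero by linarith
    ultimately show ?thesis by (subst has_contour_integral_part_circlepath_iff) auto
  qed
  have "(inverse has_contour_integral ((Ln ?P - Ln 1) + (\<i> * of_real (pi + 2 * b) + (Ln 1 - Ln ?Q)))) (stolz_path b)"
    unfolding stolz_path_def
    by (intro has_contour_integral_join i1 i2 i3 valid_path_join)
      (simp_all add: cis_conv_exp exp_eq, (intro exI[of _ 1])?, simp_all add: algebra_simps)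
  also have "(Ln ?P - Ln 1) + (\<i> * of_real (pi + 2 * b) + (Ln 1 - Ln ?Q)) = 2 * of_real pi * \<i>"
    using b0 b2 by (simp add: LnP algebra_simps)
  finally show ?thesis by (simp add: has_contour_integral stolz_deriv_def)
qed

lemma set_integrable_powr: assumes "p > -1"
  shows "set_integrable lborel {0..1} (\<lambda>t::real. t powr p)" "set_integrable lborel {0..1} (\<lambda>t::real. (1 - t) powr p)"
proof -
  have "(\<lambda>t::real. t powr p) absolutely_integrable_on {0..1}"
    by (rule nonnegative_absolutely_integrable_1) (use has_integral_powr_from_0[OF assms, of 1] in \<open>auto simp: integrable_on_def\<close>)
  then have "integrable (completion lborel) (\<lambda>t::real. indicator {0..1} t *\<^sub>R t powr p)" by (simp add: set_integrable_def)
  then have i: "integrable lborel (\<lambda>t::real. indicator {0..1} t *\<^sub>R t powr p)"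
    by (subst (asm) integrable_completion) auto
  then show "set_integrable lborel {0..1} (\<lambda>t::real. t powr p)" by (simp add: set_integrable_def)
  have "integrable lborel (\<lambda>t::real. indicator {0..1} (1 + (-1) * t) *\<^sub>R (1 + (-1) * t) powr p)"
    by (rule lborel_integrable_real_affine[OF i]) simp
  also have "(\<lambda>t::real. indicator {0..1} (1 + (-1) * t) *\<^sub>R (1 + (-1) * t) powr p) = (\<lambda>t. indicator {0..1} t *\<^sub>R (1 - t) powr p)"
    by (auto simp: indicator_def)
  finally show "set_integrable lborel {0..1} (\<lambda>t::real. (1 - t) powr p)" by (simp add: set_integrable_def)
qed

text \<open>An explicit integrable majorant of \<open>\<bar>1 - z\<bar>\<^sup>p\<close> along the contour for \<open>p > -1\<close>: the first two terms
serve the segments, the constants serve the arc for \<open>p\<close> negative or not.\<close>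

definition "dist_majorant p t = (2 * cos b) powr p * t powr p + (4 * cos b) powr p * (1 - t) powr p + ((1 - (sin b)\<^sup>2) powr p + 2 powr p)"

lemma dist_majorant_integrable: "p > -1 \<Longrightarrow> set_integrable lborel {0..1} (dist_majorant p)"
  unfolding dist_majorant_def[abs_def]
  by (intro set_integral_add set_integrable_mult_right set_integrable_powr impI) (auto simp: set_integrable_def)

lemma dist_majorant: assumes "0 < t" "t < 1" shows "norm (1 - stolz_path b t) powr p \<le> dist_majorant p t"
  using three_cases[OF assms]
proof (elim disjE)
  assume "t \<le> 1/2"
  then have "norm (1 - stolz_path b t) powr p = (2 * cos b) powr p * t powr p"
    using norm_1_minus(1)[of t] assms cos01 by (simp add: powr_mult[symmetric] mult_ac)
  then show ?thesis by (simp add: dist_majorant_def)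
next
  assume "3/4 \<le> t"
  then have "norm (1 - stolz_path b t) powr p = (4 * cos b) powr p * (1 - t) powr p"
    using norm_1_minus(2)[of t] assms cos01 by (simp add: powr_mult[symmetric] mult_ac)
  then show ?thesis by (simp add: dist_majorant_def)
next
  assume t: "1/2 < t \<and> t < 3/4"
  have n: "1 - (sin b)\<^sup>2 \<le> norm (1 - stolz_path b t)" "norm (1 - stolz_path b t) \<le> 2"
    using arc_dist(2)[of t] t norm_triangle_ineq4[of 1 "stolz_path b t"] path_norm_le[of t] by auto
  have "norm (1 - stolz_path b t) powr p \<le> (1 - (sin b)\<^sup>2) powr p + 2 powr p"
  proof (cases "p \<ge> 0")
    case True
    then have "norm (1 - stolz_path b t) powr p \<le> 2 powr p" using n by (intro powr_mono2) auto
    then show ?thesis by (simp add: add_increasing)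
  next
    case False
    then have "norm (1 - stolz_path b t) powr p \<le> (1 - (sin b)\<^sup>2) powr p" using n sin2 by (intro powr_mono2') auto
    then show ?thesis by (simp add: add_increasing2)
  qed
  then show ?thesis by (simp add: dist_majorant_def add_increasing)
qed

end

section \<open>The contour calculus of a single Ritt operator\<close>

lemma has_derivative_quadratic:
  assumes "bounded_linear f'" "e > 0"
    "\<And>y. y \<in> S \<Longrightarrow> dist y x < e \<Longrightarrow> norm (f y - f x - f' (y - x)) \<le> C * (norm (y - x))\<^sup>2"
  shows "(f has_derivative f') (at x within S)"
proof (rule has_derivativeI_sandwich[OF assms(2,1), where H = "\<lambda>y. C * norm (y - x)"])
  show "norm (f y - f x - f' (y - x)) / norm (y - x) \<le> C * norm (y - x)" if "y \<in> S" "y \<noteq> x" "dist y x < e" for y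
    using assms(3)[OF that(1,3)] that(2) by (simp add: divide_le_eq power2_eq_square mult.assoc)
  have "((\<lambda>y. C * norm (y - x)) \<longlongrightarrow> C * norm (x - x)) (at x within S)" by (intro tendsto_intros)
  then show "((\<lambda>y. C * norm (y - x)) \<longlongrightarrow> 0) (at x within S)" by simp
qed

lemma stolz_closure_mono: assumes "0 \<le> a" "a \<le> c" "c \<le> pi/2" shows "closure (stolz a) \<subseteq> closure (stolz c)"
proof -
  have "sin a \<le> sin c" using assms by (intro sin_monotone_2pi_le) auto
  then have "insert 1 (ball 0 (sin a)) \<subseteq> insert (1::complex) (ball 0 (sin c))" by (auto intro: subset_ball[THEN subsetD])
  then show ?thesis unfolding stolz_def by (intro closure_mono interior_mono hull_mono)
qed

lemma continuous_powr_disc: "0 < \<beta> \<Longrightarrow> continuous_on (cball 0 1) (\<lambda>z. (1 - z) powr complex_of_real \<beta>)"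
proof (rule continuous_on_powr_complex)
  show "cball 0 1 \<subseteq> {z. 0 \<le> Re (1 - z) \<or> Im (1 - z) \<noteq> 0}"
    using complex_Re_le_cmod order_trans by fastforce
qed (auto intro!: continuous_intros)

lemma powr_disc_differentiable: 
  assumes "norm z < 1" shows "(\<lambda>z. (1 - z) powr complex_of_real \<beta>) field_differentiable at z"
proof -
  have "Re z < 1" using assms complex_Re_le_cmod[of z] by linarith
  then have "1 - z \<notin> \<real>\<^sub>\<le>\<^sub>0" by (auto simp: complex_nonpos_Reals_iff)
  then show ?thesis unfolding field_differentiable_def
    by (intro exI derivative_eq_intros) (auto intro!: derivative_eq_intros)
qed

text \<open>The binomial coefficients are of order \<open>k\<^sup>-\<^sup>\<beta>\<^sup>-\<^sup>1\<close>.\<close>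

lemma summable_gbinomial: assumes "\<beta> > 0" shows "summable (\<lambda>k. norm (complex_of_real \<beta> gchoose k))"
proof -
  let ?z = "complex_of_real \<beta>"
  let ?r = "\<lambda>n. (?z gchoose n) / ((-1)^n / exp ((?z+1) * of_real (ln (real n))))"
  have "Bseq ?r" using gbinomial_asymptotic[of ?z] by (intro convergent_imp_Bseq) (auto simp: convergent_def)
  then obtain M where M: "M > 0" "\<And>n. norm (?r n) \<le> M" unfolding Bseq_def by auto
  show ?thesis
  proof (rule summable_comparison_test)
    show "summable (\<lambda>n. M * real n powr (- (\<beta> + 1)))"
      using assms by (intro summable_mult) (simp add: summable_real_powr_iff)
    show "\<exists>N. \<forall>n\<ge>N. norm (norm (?z gchoose n)) \<le> M * real n powr (- (\<beta> + 1))"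
    proof (intro exI[of _ 1] allI impI)
      fix n :: nat assume n: "1 \<le> n"
      have e: "norm (exp ((?z+1) * of_real (ln (real n)))) = real n powr (\<beta> + 1)"
        using n by (simp add: norm_exp_eq_Re powr_def)
      have "norm (?r n) = norm (?z gchoose n) * real n powr (\<beta> + 1)"
        by (simp only: norm_divide norm_power e norm_minus_cancel norm_one power_one) simp
      then have "norm (?z gchoose n) * real n powr (\<beta> + 1) \<le> M" using M(2)[of n] by simp
      then have "norm (?z gchoose n) \<le> M / real n powr (\<beta> + 1)" using n by (simp add: pos_le_divide_eq)
      moreover have "M * real n powr (- (\<beta> + 1)) = M / real n powr (\<beta> + 1)"
        unfolding powr_minus by (simp only: divide_inverse)
      ultimately show "norm (norm (?z gchoose n)) \<le> M * real n powr (- (\<beta> + 1))"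
        by (simp only: real_norm_def abs_norm_cancel)
    qed
  qed
qed

text \<open>The binomial series converges absolutely up to the boundary of the disc; the polynomials
therefore approximate \<open>(1 - z)\<^sup>\<beta>\<close> uniformly, also at \<open>1\<close> where the contour touches the circle.\<close>

lemma binomial_uniform:
  assumes "\<beta> > 0"
  shows "\<exists>(c :: nat \<Rightarrow> complex) (e :: nat \<Rightarrow> real). e \<longlonglongrightarrow> 0 \<and>
    (\<forall>n z. norm z \<le> 1 \<longrightarrow> norm ((\<Sum>k<n. c k * z ^ k) - (1 - z) powr of_real \<beta>) \<le> e n)"
proof -
  define c where "c k = (complex_of_real \<beta> gchoose k) * (-1) ^ k" for k
  define e where "e n = (\<Sum>k. norm (c (k + n)))" for n
  have s: "summable (\<lambda>k. norm (c k))" using summable_gbinomial[OF assms] by (simp add: c_def norm_mult norm_power)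
  have e: "e \<longlonglongrightarrow> 0" unfolding e_def using suminf_exist_split2[OF s] .
  have ball: "norm ((\<Sum>k<n. c k * z ^ k) - (1 - z) powr of_real \<beta>) \<le> e n" if "z \<in> ball 0 1" for n z
  proof -
    have z: "norm z < 1" using that by simp
    have "(\<lambda>k. c k * z ^ k) = (\<lambda>k. (complex_of_real \<beta> gchoose k) * (- z) ^ k)"
      by (rule ext) (simp add: c_def power_minus[of z] mult_ac)
    then have su: "(\<lambda>k. c k * z ^ k) sums (1 - z) powr of_real \<beta>"
      using gen_binomial_complex[of "- z" "of_real \<beta>"] z by simp
    have "(1 - z) powr of_real \<beta> = (\<Sum>k. c (k + n) * z ^ (k + n)) + (\<Sum>k<n. c k * z ^ k)"
      using suminf_split_initial_segment[OF sums_summable[OF su], of n] sums_unique[OF su] by simp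
    then have "norm ((\<Sum>k<n. c k * z ^ k) - (1 - z) powr of_real \<beta>) = norm (\<Sum>k. c (k + n) * z ^ (k + n))"
      by (simp add: norm_minus_commute)
    also have "\<dots> \<le> (\<Sum>k. norm (c (k + n)))"
    proof (rule norm_suminf_le)
      show "summable (\<lambda>k. norm (c (k + n)))" using s by (subst summable_iff_shift)
      show "norm (c (k + n) * z ^ (k + n)) \<le> norm (c (k + n))" for k
        using z power_le_one[of "norm z" "k + n"] by (simp add: norm_mult norm_power mult_left_le)
    qed
    finally show ?thesis by (simp add: e_def)
  qed
  have "norm ((\<Sum>k<n. c k * z ^ k) - (1 - z) powr of_real \<beta>) \<le> e n" if "norm z \<le> 1" for n z
  proof (rule continuous_on_closure_norm_le[where f = "\<lambda>z. (\<Sum>k<n. c k * z ^ k) - (1 - z) powr of_real \<beta>"])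
    show "continuous_on (closure (ball 0 1)) (\<lambda>z. (\<Sum>k<n. c k * z ^ k) - (1 - z) powr of_real \<beta>)"
      using continuous_on_diff[OF _ continuous_powr_disc[OF assms], of "\<lambda>z. \<Sum>k<n. c k * z ^ k"]
      by (simp add: closure_ball continuous_intros)
    show "z \<in> closure (ball 0 1)" using that by (simp add: closure_ball)
    show "\<forall>y\<in>ball 0 1. norm ((\<Sum>k<n. c k * y ^ k) - (1 - y) powr of_real \<beta>) \<le> e n" using ball by blast
  qed
  with e have "e \<longlonglongrightarrow> 0 \<and>
    (\<forall>n z. norm z \<le> 1 \<longrightarrow> norm ((\<Sum>k<n. c k * z ^ k) - (1 - z) powr of_real \<beta>) \<le> e n)" by simp
  then show ?thesis by (intro exI)
qed

text \<open>The functions to which the contour calculus is applied; the order \<open>p > 0\<close> of vanishing at \<open>1\<close>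
compensates the growth \<open>\<bar>1 - z\<bar>\<^sup>-\<^sup>1\<close> of the resolvent.\<close>

definition adm :: "real \<Rightarrow> (complex \<Rightarrow> complex) \<Rightarrow> bool" where
  "adm p f \<longleftrightarrow> continuous_on (cball 0 1) f \<and> (\<forall>z. norm z < 1 \<longrightarrow> f field_differentiable at z) \<and>
     (\<exists>C. \<forall>z. norm z \<le> 1 \<longrightarrow> norm (f z) \<le> C * norm (1 - z) powr p)"

lemma adm_mult:
  assumes "adm p f" "continuous_on (cball 0 1) g" "\<And>z. norm z < 1 \<Longrightarrow> g field_differentiable at z"
  shows "adm p (\<lambda>z. g z * f z)"
proof -
  obtain C where C: "\<And>z. norm z \<le> 1 \<Longrightarrow> norm (f z) \<le> C * norm (1 - z) powr p" using assms(1) by (auto simp: adm_def)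
  have "bounded (g ` cball 0 1)" using assms(2) by (intro compact_imp_bounded compact_continuous_image) auto
  then obtain B where B0: "B > 0" "\<forall>z\<in>cball 0 1. norm (g z) \<le> B" unfolding bounded_pos by auto
  then have B: "\<And>z. norm z \<le> 1 \<Longrightarrow> norm (g z) \<le> B" "B > 0" by auto
  have "norm (g z * f z) \<le> (B * C) * norm (1 - z) powr p" if "norm z \<le> 1" for z
  proof -
    have "norm (g z * f z) \<le> B * (C * norm (1 - z) powr p)"
      unfolding norm_mult using that B C by (intro mult_mono) auto
    then show ?thesis by (simp add: mult.assoc)
  qed
  then show ?thesis using assms unfolding adm_def
    by (intro conjI continuous_on_mult allI impI field_differentiable_mult) auto
qed

lemma adm_powr: "0 < \<beta> \<Longrightarrow> adm \<beta> (\<lambda>z. (1 - z) powr of_real \<beta>)"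
  unfolding adm_def by (auto simp: continuous_powr_disc powr_disc_differentiable norm_powr_real_powr' intro!: exI[of _ 1])

definition cint :: "real \<Rightarrow> ('a::{complex_normed_vector, banach} \<Rightarrow>\<^sub>L 'a) \<Rightarrow> (complex \<Rightarrow> complex) \<Rightarrow> 'a \<Rightarrow>\<^sub>L 'a" where
  "cint b T f = integral {0..1} (\<lambda>t. (f (stolz_path b t) * stolz_deriv b t) *\<^sub>C resolvent (stolz_path b t) T)"

locale ritt_angle = stolz_angle b for b +
  fixes T :: "'a::{complex_normed_vector, banach} \<Rightarrow>\<^sub>L 'a" and a :: real
  assumes type: "ritt_of_type T a" and ab: "a < b"
begin

text \<open>An intermediate angle: the resolvent estimate outside the domain of angle \<open>c\<close> holds on a
neighbourhood of the contour of angle \<open>b\<close> without \<open>1\<close>.\<close>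

definition "c = (a + b) / 2"

lemma c: "0 < a" "a < c" "c < b"
  using type ab by (auto simp: c_def ritt_of_type_def)

lemma T_clinear: "clinear_op T" using type by (simp add: ritt_of_type_def ritt_def)

definition "K = (SOME K. K > 0 \<and> (\<forall>l. l \<notin> closure (stolz c) \<longrightarrow> norm ((l - 1) *\<^sub>C resolvent l T) \<le> K))"

lemma K: "K > 0" "\<And>l. l \<notin> closure (stolz c) \<Longrightarrow> norm ((l - 1) *\<^sub>C resolvent l T) \<le> K"
proof -
  have "\<exists>K. K > 0 \<and> (\<forall>l. l \<notin> closure (stolz c) \<longrightarrow> norm ((l - 1) *\<^sub>C resolvent l T) \<le> K)"
    using type c b2 unfolding ritt_of_type_def by (metis less_trans)
  from someI_ex[OF this] show "K > 0" "\<And>l. l \<notin> closure (stolz c) \<Longrightarrow> norm ((l - 1) *\<^sub>C resolvent l T) \<le> K"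
    unfolding K_def by blast+
qed

lemma res: assumes "l \<notin> closure (stolz c)" shows "is_resolvent l T (resolvent l T)"
proof (rule is_resolvent_resolvent)
  have "spectrum T \<subseteq> closure (stolz a)" using type by (simp add: ritt_of_type_def)
  then show "l \<notin> spectrum T" using stolz_closure_mono[of a c] c b2 assms by auto
qed

lemma norm_res: assumes "l \<notin> closure (stolz c)" "l \<noteq> 1" shows "norm (resolvent l T) \<le> K / norm (1 - l)"
  using K(2)[OF assms(1)] assms(2) by (simp add: norm_scaleC field_simps norm_minus_commute)

abbreviation "\<Gamma> \<equiv> stolz_path b"
abbreviation "\<Gamma>' \<equiv> stolz_deriv b"
abbreviation "U \<equiv> - closure (stolz c) - {1}"

lemma path_U: "t \<in> {0<..<1} \<Longrightarrow> \<Gamma> t \<in> U"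
  using path_outside[of c 1 t] path_ne_1[of t] c by auto

lemma res_diff:
  assumes "l \<in> U" "m \<in> U"
  shows "resolvent l T - resolvent m T = (m - l) *\<^sub>C (resolvent l T o\<^sub>L resolvent m T)"
  using is_resolvent_diff[OF res res, of l m] assms is_resolvent_clinear[OF res T_clinear, of l]
  by (simp add: scaleC_compose_left scaleC_compose_right)

lemma open_U: "open U"
  by (intro open_Diff) auto

lemma res_local_bound:
  assumes "l \<in> U" obtains e B where "e > 0" "B > 0" "ball l e \<subseteq> U" "\<And>m. m \<in> ball l e \<Longrightarrow> norm (resolvent m T) \<le> B"
proof -
  obtain e0 where e0: "e0 > 0" "ball l e0 \<subseteq> U" using open_U assms open_contains_ball by blast
  define e where "e = min e0 (norm (1 - l) / 2)"
  have l1: "norm (1 - l) > 0" using assms by auto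
  have e: "e > 0" "ball l e \<subseteq> U" using e0 l1 by (auto simp: e_def)
  have "norm (resolvent m T) \<le> K / (norm (1 - l) / 2)" if m: "m \<in> ball l e" for m
  proof -
    have "norm (1 - l) \<le> norm (1 - m) + norm (m - l)" by (metis norm_triangle_sub diff_add_cancel add_diff_eq norm_triangle_ineq)
    moreover have "norm (m - l) < norm (1 - l) / 2" using m by (simp add: e_def dist_norm norm_minus_commute)
    ultimately have "norm (1 - l) / 2 \<le> norm (1 - m)" by linarith
    moreover have "norm (1 - m) > 0" using \<open>norm (1 - l) / 2 \<le> norm (1 - m)\<close> l1 by linarith
    ultimately have "K / norm (1 - m) \<le> K / (norm (1 - l) / 2)" using K(1) l1 by (intro divide_left_mono) (auto intro!: mult_pos_pos simp del: zero_less_norm_iff)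
    moreover have "norm (resolvent m T) \<le> K / norm (1 - m)" using m e(2) by (intro norm_res) auto
    ultimately show ?thesis by linarith
  qed
  moreover have "K / (norm (1 - l) / 2) > 0" using K(1) l1 by simp
  ultimately show ?thesis using that e by blast
qed

text \<open>Iterating the resolvent identity leaves a remainder quadratic in the increment.\<close>

lemma res_deriv:
  assumes l: "l \<in> U"
  shows "((\<lambda>l. resolvent l T) has_derivative (\<lambda>h. (- h) *\<^sub>C (resolvent l T o\<^sub>L resolvent l T))) (at l)"
proof -
  let ?R = "\<lambda>l. resolvent l T"
  obtain e B where e: "e > 0" "B > 0" "ball l e \<subseteq> U" "\<And>m. m \<in> ball l e \<Longrightarrow> norm (?R m) \<le> B" using res_local_bound[OF l] by metis
  show ?thesis
  proof (rule has_derivative_quadratic[OF _ e(1), where C = "B ^ 3"])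
    show "bounded_linear (\<lambda>h. (- h) *\<^sub>C (?R l o\<^sub>L ?R l))"
      by (intro bounded_linear_compose[OF bounded_bilinear.bounded_linear_left[OF bounded_bilinear_scaleC] bounded_linear_minus[OF bounded_linear_ident]])
    fix m assume m: "dist m l < e"
    then have mb: "m \<in> ball l e" "l \<in> ball l e" using e(1) by (auto simp: dist_commute)
    then have mU: "m \<in> U" using e(3) by blast
    have "?R m - ?R l - (- (m - l)) *\<^sub>C (?R l o\<^sub>L ?R l) = (l - m) *\<^sub>C (?R m o\<^sub>L ?R l) - (l - m) *\<^sub>C (?R l o\<^sub>L ?R l)"
      using res_diff[OF mU l] by simp
    also have "\<dots> = (l - m) *\<^sub>C ((?R m - ?R l) o\<^sub>L ?R l)"
      by (simp only: bounded_bilinear.diff_right[OF bounded_bilinear_scaleC] bounded_bilinear.diff_left[OF bcomp])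
    also have "\<dots> = (l - m) *\<^sub>C (l - m) *\<^sub>C ((?R m o\<^sub>L ?R l) o\<^sub>L ?R l)"
      by (simp only: res_diff[OF mU l] scaleC_compose_left)
    finally have "norm (?R m - ?R l - (- (m - l)) *\<^sub>C (?R l o\<^sub>L ?R l)) = (norm (m - l))\<^sup>2 * norm ((?R m o\<^sub>L ?R l) o\<^sub>L ?R l)"
      by (simp only: norm_scaleC power2_eq_square norm_minus_commute[of l m] mult.assoc)
    moreover have "norm ((?R m o\<^sub>L ?R l) o\<^sub>L ?R l) \<le> B ^ 3"
    proof -
      have "norm ((?R m o\<^sub>L ?R l) o\<^sub>L ?R l) \<le> norm (?R m o\<^sub>L ?R l) * norm (?R l)" by (rule norm_blinfun_compose)
      also have "\<dots> \<le> (norm (?R m) * norm (?R l)) * norm (?R l)" by (intro mult_right_mono norm_blinfun_compose) auto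
      also have "\<dots> \<le> (B * B) * B" using e(2) e(4)[OF mb(1)] e(4)[OF mb(2)] by (intro mult_mono) auto
      finally show ?thesis by (simp only: power3_eq_cube)
    qed
    ultimately show "norm (?R m - ?R l - (- (m - l)) *\<^sub>C (?R l o\<^sub>L ?R l)) \<le> B ^ 3 * (norm (m - l))\<^sup>2"
      by (simp only: mult.commute[of "B ^ 3"] mult_left_mono zero_le_power2)
  qed
qed

lemma res_continuous: "continuous_on U (\<lambda>l. resolvent l T)"
  using res_deriv has_derivative_continuous by (metis continuous_at_imp_continuous_on)

text \<open>The velocity \<open>\<Gamma>'\<close> is continuous on the three smooth pieces of the contour.\<close>

lemma bochner01_path_integrand:
  assumes "continuous_on {0<..<1} (H :: real \<Rightarrow> 'a \<Rightarrow>\<^sub>L 'a)" "set_integrable lborel {0..1} g"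
    "\<And>t. t \<in> {0<..<1} \<Longrightarrow> norm (H t) \<le> g t"
  shows "bochner01 (\<lambda>t. \<Gamma>' t *\<^sub>C H t)"
proof -
  let ?G = "\<lambda>t. \<Gamma>' t *\<^sub>C H t"
  let ?c = "\<lambda>a b t. if t \<in> {a<..<b} then ?G t else 0"
  have piece: "bochner01 (?c x y)" if xy: "0 \<le> x" "x < y" "y \<le> 1" "{x<..<y} \<inter> {0, 1/2, 3/4, 1} = {}" and cont: "continuous_on {x<..<y} \<Gamma>'" for x y
  proof (rule bochner01_continuous[where g = "\<lambda>t. 8 * pi * g t"])
    have "{x<..<y} \<subseteq> {0<..<1}" using xy by auto
    then show "continuous_on {x<..<y} ?G"
      by (intro bounded_bilinear.continuous_on[OF bounded_bilinear_scaleC] cont continuous_on_subset[OF assms(1)])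
    show "set_integrable lborel {0..1} (\<lambda>t. 8 * pi * g t)" using assms(2) by simp
    fix t assume t: "t \<in> {x<..<y}"
    then have "t \<in> {0..1} - {0, 1/2, 3/4, 1}" "t \<in> {0<..<1}" using xy by auto
    then show "norm (?G t) \<le> 8 * pi * g t"
      unfolding norm_scaleC using norm_stolz_deriv[of t b] b0 b2 assms(3)[of t] by (intro mult_mono) auto
  qed (use xy in auto)
  have c1: "continuous_on {0<..<1/2} \<Gamma>'"
    by (rule continuous_on_cong[THEN iffD1, OF refl _ continuous_on_const]) (simp add: stolz_deriv_eq)
  have c2: "continuous_on {1/2<..<3/4} \<Gamma>'"
  proof (rule continuous_on_cong[THEN iffD1, OF refl])
    show "continuous_on {1/2<..<3/4} (\<lambda>t. of_real (4 * (pi + 2 * b)) * \<i> * of_real (sin b) * cis (stolz_arg b t))"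
      unfolding stolz_arg_def by (intro continuous_intros)
  qed (simp add: stolz_deriv_eq)
  have c3: "continuous_on {3/4<..<1} \<Gamma>'"
    by (rule continuous_on_cong[THEN iffD1, OF refl _ continuous_on_const]) (simp add: stolz_deriv_eq)
  have "bochner01 (\<lambda>t. (?c 0 (1/2) t + ?c (1/2) (3/4) t) + ?c (3/4) 1 t)"
    by (intro bochner01_add piece c1 c2 c3) auto
  then show ?thesis
    by (rule bochner01_spike[where S = "{0, 1/2, 3/4, 1}"]) auto
qed

lemma path_integral_bound:
  assumes "((\<lambda>t. \<Gamma>' t *\<^sub>C (H t :: 'a \<Rightarrow>\<^sub>L 'a)) has_integral i) {0..1}" "\<And>t. t \<in> {0<..<1} \<Longrightarrow> norm (H t) \<le> B" "0 \<le> B"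
  shows "norm i \<le> 8 * pi * B"
proof -
  have "norm i \<le> (8 * pi * B) * measure lborel (cbox 0 (1::real))"
  proof (rule has_integral_bound_spike_finite[where S = "{0, 1/2, 3/4, 1}"])
    fix t :: real assume "t \<in> cbox 0 1 - {0, 1/2, 3/4, 1}"
    then have "t \<in> {0..1} - {0, 1/2, 3/4, 1}" "t \<in> {0<..<1}" by auto
    then show "norm (\<Gamma>' t *\<^sub>C H t) \<le> 8 * pi * B"
      unfolding norm_scaleC using norm_stolz_deriv[of t b] b0 b2 assms(2)[of t] by (intro mult_mono) auto
  qed (use assms in auto)
  then show ?thesis by simp
qed

lemma path_cont01: "continuous_on {0<..<1} \<Gamma>"
  by (rule continuous_on_subset[OF path_stolz]) auto

lemma cont_res_path: "continuous_on {0<..<1} (\<lambda>t. resolvent (\<Gamma> t) T)"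
  by (rule continuous_on_compose2[OF res_continuous path_cont01]) (use path_U in auto)

lemma norm_res_path: "t \<in> {0<..<1} \<Longrightarrow> norm (resolvent (\<Gamma> t) T) \<le> K / norm (1 - \<Gamma> t)"
  using path_U[of t] by (intro norm_res) auto

lemma integrand_bound:
  assumes "norm (f (\<Gamma> t)) \<le> C * norm (1 - \<Gamma> t) powr p" "t \<in> {0<..<1}" 
  shows "norm (f (\<Gamma> t) *\<^sub>C resolvent (\<Gamma> t) T) \<le> C * K * dist_majorant (p - 1) t"
proof -
  have n: "norm (1 - \<Gamma> t) > 0" using path_ne_1[of t] assms(2) by auto
  have "norm (f (\<Gamma> t) *\<^sub>C resolvent (\<Gamma> t) T) \<le> (C * norm (1 - \<Gamma> t) powr p) * (K / norm (1 - \<Gamma> t))"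
    unfolding norm_scaleC using assms norm_res_path[OF assms(2)] by (intro mult_mono) (auto intro: order_trans[OF norm_ge_zero])
  also have "\<dots> = C * K * norm (1 - \<Gamma> t) powr (p - 1)" using n by (simp add: powr_diff)
  also have "\<dots> \<le> C * K * dist_majorant (p - 1) t"
  proof (rule mult_left_mono)
    show "norm (1 - \<Gamma> t) powr (p - 1) \<le> dist_majorant (p - 1) t" using dist_majorant[of t "p - 1"] assms(2) by auto
    have "0 \<le> C * norm (1 - \<Gamma> t) powr p" using assms(1) norm_ge_zero order_trans by blast
    then have "0 \<le> C" using n by (simp add: zero_le_mult_iff)
    then show "0 \<le> C * K" using K(1) by simp
  qed
  finally show ?thesis .
qed

lemma bochner01_adm:
  assumes "adm p f" "p > 0"
  shows "bochner01 (\<lambda>t. (f (\<Gamma> t) * \<Gamma>' t) *\<^sub>C resolvent (\<Gamma> t) T)"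
proof -
  obtain C where C: "\<And>z. norm z \<le> 1 \<Longrightarrow> norm (f z) \<le> C * norm (1 - z) powr p" using assms(1) by (auto simp: adm_def)
  have cf: "continuous_on (cball 0 1) f" using assms by (simp add: adm_def)
  have "bochner01 (\<lambda>t. \<Gamma>' t *\<^sub>C (f (\<Gamma> t) *\<^sub>C resolvent (\<Gamma> t) T))"
  proof (rule bochner01_path_integrand)
    show "continuous_on {0<..<1} (\<lambda>t. f (\<Gamma> t) *\<^sub>C resolvent (\<Gamma> t) T)"
      using path_norm_le by (intro bounded_bilinear.continuous_on[OF bounded_bilinear_scaleC] cont_res_path continuous_on_compose2[OF cf path_cont01]) auto
    show "set_integrable lborel {0..1} (\<lambda>t. C * K * dist_majorant (p - 1) t)" using dist_majorant_integrable[of "p - 1"] assms(2) by simp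
    show "norm (f (\<Gamma> t) *\<^sub>C resolvent (\<Gamma> t) T) \<le> C * K * dist_majorant (p - 1) t" if "t \<in> {0<..<1}" for t
      using that path_norm_le[of t] by (intro integrand_bound C) auto
  qed
  then show ?thesis by (simp add: scaleC_scaleC mult.commute)
qed

lemma cint_has_integral:
  assumes "adm p f" "p > 0"
  shows "((\<lambda>t. (f (\<Gamma> t) * \<Gamma>' t) *\<^sub>C resolvent (\<Gamma> t) T) has_integral cint b T f) {0..1}"
  unfolding cint_def using bochner01_integrable[OF bochner01_adm[OF assms]] by (rule integrable_integral)

lemma cint_bound:
  assumes f: "adm p f" and p: "p > 0" and C: "\<And>z. norm z \<le> 1 \<Longrightarrow> norm (f z) \<le> C * norm (1 - z) powr p"
  shows "norm (cint b T f) \<le> C * (8 * pi * K * integral {0..1} (dist_majorant (p - 1)))"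
proof -
  have mi: "dist_majorant (p - 1) integrable_on {0..1}" using dist_majorant_integrable[of "p - 1"] p by (intro set_integrable_on) simp
  let ?F = "\<lambda>t. (f (\<Gamma> t) * \<Gamma>' t) *\<^sub>C resolvent (\<Gamma> t) T"
  let ?F' = "\<lambda>t. if t \<in> {0, 1/2, 3/4, 1} then 0 else ?F t"
  have h: "(?F' has_integral cint b T f) {0..1}"
    by (rule has_integral_spike_finite[OF _ _ cint_has_integral[OF f p], where S = "{0, 1/2, 3/4, 1}"]) auto
  have "norm (integral {0..1} ?F') \<le> integral {0..1} (\<lambda>t. 8 * pi * (C * K * dist_majorant (p - 1) t))"
  proof (rule integral_norm_bound_integral)
    show "?F' integrable_on {0..1}" using h by blast
    show "(\<lambda>t. 8 * pi * (C * K * dist_majorant (p - 1) t)) integrable_on {0..1}" by (intro integrable_on_mult_right mi)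
    fix t :: real assume t: "t \<in> {0..1}"
    have C0: "0 \<le> C" using order_trans[OF norm_ge_zero C[of 0]] by simp
    show "norm (?F' t) \<le> 8 * pi * (C * K * dist_majorant (p - 1) t)"
    proof (cases "t \<in> {0, 1/2, 3/4, 1}")
      case True
      have "0 \<le> dist_majorant (p - 1) t" by (simp add: dist_majorant_def)
      then show ?thesis using True C0 K(1) by auto
    next
      case False
      then have t': "t \<in> {0..1} - {0, 1/2, 3/4, 1}" "t \<in> {0<..<1}" using t by auto
      have "norm (?F t) = norm (\<Gamma>' t) * norm (f (\<Gamma> t) *\<^sub>C resolvent (\<Gamma> t) T)" by (simp add: norm_scaleC norm_mult mult_ac)
      also have "\<dots> \<le> 8 * pi * (C * K * dist_majorant (p - 1) t)"
      proof (intro mult_mono)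
        show "norm (f (\<Gamma> t) *\<^sub>C resolvent (\<Gamma> t) T) \<le> C * K * dist_majorant (p - 1) t"
          by (intro integrand_bound C path_norm_le) (use t t' in auto)
      qed (use norm_stolz_deriv[OF t'(1)] b0 b2 in auto)
      finally show ?thesis using False by simp
    qed
  qed
  then show ?thesis using integral_unique[OF h] by (simp add: mult_ac)
qed

lemma cint_diff:
  assumes "adm p f" "adm p g" "p > 0"
  shows "cint b T (\<lambda>z. f z - g z) = cint b T f - cint b T g"
proof -
  have "((\<lambda>t. ((f (\<Gamma> t) - g (\<Gamma> t)) * \<Gamma>' t) *\<^sub>C resolvent (\<Gamma> t) T) has_integral (cint b T f - cint b T g)) {0..1}"
    using has_integral_diff[OF cint_has_integral[OF assms(1,3)] cint_has_integral[OF assms(2,3)]]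
    by (simp add: left_diff_distrib scaleC_simps)
  then show ?thesis unfolding cint_def by (rule integral_unique)
qed

lemma cint_scale:
  assumes "adm p f" "p > 0"
  shows "cint b T (\<lambda>z. k * f z) = k *\<^sub>C cint b T f"
proof -
  have "((\<lambda>t. (k * f (\<Gamma> t) * \<Gamma>' t) *\<^sub>C resolvent (\<Gamma> t) T) has_integral (k *\<^sub>C cint b T f)) {0..1}"
    using has_integral_linear[OF cint_has_integral[OF assms] bounded_linear_scaleC_right[of k]]
    by (simp add: o_def scaleC_scaleC mult.assoc)
  then show ?thesis unfolding cint_def by (rule integral_unique)
qed

lemma cint_sum:
  assumes "\<And>k. k \<in> A \<Longrightarrow> adm p (f k)" "p > 0"
  shows "cint b T (\<lambda>z. \<Sum>k\<in>A. f k z) = (\<Sum>k\<in>A. cint b T (f k))"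
proof (cases "finite A")
  case True
  have "((\<lambda>t. ((\<Sum>k\<in>A. f k (\<Gamma> t)) * \<Gamma>' t) *\<^sub>C resolvent (\<Gamma> t) T) has_integral (\<Sum>k\<in>A. cint b T (f k))) {0..1}"
    using has_integral_sum[OF True cint_has_integral[OF assms]]
    by (simp add: sum_distrib_right bounded_bilinear.sum_left[OF bounded_bilinear_scaleC])
  then show ?thesis unfolding cint_def by (rule integral_unique)
qed (simp add: cint_def)

text \<open>\<open>z R(z) = I + T R(z)\<close>, and the scalar integral of \<open>f\<close> over the contour vanishes by Cauchy's theorem.\<close>

lemma cint_times:
  assumes "adm p f" "p > 0"
  shows "cint b T (\<lambda>z. z * f z) = T o\<^sub>L cint b T f"
proof -
  have "((\<lambda>t. (f (\<Gamma> t) * \<Gamma>' t) *\<^sub>C (id_blinfun :: 'a \<Rightarrow>\<^sub>L 'a)) has_integral 0 *\<^sub>C id_blinfun) {0..1}"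
    using has_integral_linear[OF cauchy_stolz[of f] bounded_bilinear.bounded_linear_left[OF bounded_bilinear_scaleC, of "id_blinfun :: 'a \<Rightarrow>\<^sub>L 'a"]] assms(1)
    by (simp add: o_def adm_def)
  moreover have "((\<lambda>t. T o\<^sub>L ((f (\<Gamma> t) * \<Gamma>' t) *\<^sub>C resolvent (\<Gamma> t) T)) has_integral T o\<^sub>L cint b T f) {0..1}"
    using has_integral_linear[OF cint_has_integral[OF assms] bounded_bilinear.bounded_linear_right[OF bcomp, of T]] by (simp add: o_def)
  ultimately have h: "((\<lambda>t. (f (\<Gamma> t) * \<Gamma>' t) *\<^sub>C id_blinfun + (T o\<^sub>L ((f (\<Gamma> t) * \<Gamma>' t) *\<^sub>C resolvent (\<Gamma> t) T))) has_integral (0 *\<^sub>C id_blinfun + (T o\<^sub>L cint b T f))) {0..1}"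
    by (rule has_integral_add)
  have "((\<lambda>t. (\<Gamma> t * f (\<Gamma> t) * \<Gamma>' t) *\<^sub>C resolvent (\<Gamma> t) T) has_integral (0 *\<^sub>C id_blinfun + (T o\<^sub>L cint b T f))) {0..1}"
  proof (rule has_integral_spike_finite[OF _ _ h, where S = "{0, 1}"])
    fix t :: real assume "t \<in> {0..1} - {0, 1}"
    then have "\<Gamma> t \<in> U" using path_U by auto
    then have "\<Gamma> t *\<^sub>C resolvent (\<Gamma> t) T = id_blinfun + (T o\<^sub>L resolvent (\<Gamma> t) T)" by (intro is_resolvent_left res) auto
    then have "(f (\<Gamma> t) * \<Gamma>' t) *\<^sub>C (\<Gamma> t *\<^sub>C resolvent (\<Gamma> t) T) = (f (\<Gamma> t) * \<Gamma>' t) *\<^sub>C id_blinfun + (T o\<^sub>L ((f (\<Gamma> t) * \<Gamma>' t) *\<^sub>C resolvent (\<Gamma> t) T))"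
      by (simp add: scaleC_add_right scaleC_compose_right[OF T_clinear])
    then show "(\<Gamma> t * f (\<Gamma> t) * \<Gamma>' t) *\<^sub>C resolvent (\<Gamma> t) T = (f (\<Gamma> t) * \<Gamma>' t) *\<^sub>C id_blinfun + (T o\<^sub>L ((f (\<Gamma> t) * \<Gamma>' t) *\<^sub>C resolvent (\<Gamma> t) T))"
      by (simp add: scaleC_scaleC mult_ac)
  qed auto
  then show ?thesis unfolding cint_def by (simp add: integral_unique)
qed

lemma adm_pow: "adm p f \<Longrightarrow> adm p (\<lambda>z. z ^ n * f z)"
  by (rule adm_mult) (auto intro!: continuous_intros derivative_intros field_differentiable_power field_differentiable_ident)

lemma cint_power:
  assumes "adm p f" "p > 0"
  shows "cint b T (\<lambda>z. z ^ n * f z) = op_power T n o\<^sub>L cint b T f"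
proof (induction n)
  case (Suc n)
  have "cint b T (\<lambda>z. z ^ Suc n * f z) = cint b T (\<lambda>z. z * (z ^ n * f z))" by (simp add: mult.assoc)
  also have "\<dots> = T o\<^sub>L cint b T (\<lambda>z. z ^ n * f z)" by (rule cint_times[OF adm_pow assms(2)]) (rule assms(1))
  finally show ?case by (simp add: Suc op_power_Suc blinfun_compose_assoc)
qed simp

end

section \<open>Independence of the angle\<close>

lemma is_resolvent_scale:
  assumes "is_resolvent (l / k) T S" "k \<noteq> 0" "clinear_op T"
  shows "is_resolvent l (k *\<^sub>C T) (inverse k *\<^sub>C S)"
proof -
  have L: "l *\<^sub>C id_blinfun - k *\<^sub>C T = k *\<^sub>C ((l / k) *\<^sub>C id_blinfun - T)"
    using assms(2) by (simp add: scaleC_simps scaleC_scaleC)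
  have c: "clinear_op S" "clinear_op ((l / k) *\<^sub>C id_blinfun - T)"
    using is_resolvent_clinear[OF assms(1,3)] clinear_op_diff[OF clinear_op_scaleC[OF clinear_op_id] assms(3)] by auto
  show ?thesis
    using assms unfolding is_resolvent_def L
    by (simp add: scaleC_compose_left scaleC_compose_right c scaleC_scaleC)
qed

context ritt_angle
begin

text \<open>The resolvent of \<open>r T\<close> at the point of the contour with parameter \<open>t\<close>, written by means of the
resolvent of \<open>T\<close>.  For \<open>r < 1\<close> it has no singularity at \<open>1\<close>, so the unweighted contour integral exists.\<close>

definition "scaled_res r t = inverse (complex_of_real r) *\<^sub>C resolvent (\<Gamma> t / of_real r) T"

lemma outside_r: "0 < r \<Longrightarrow> r < 1 \<Longrightarrow> t \<in> {0..1} \<Longrightarrow> \<Gamma> t / of_real r \<in> U"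
  using path_outside[of c r t] real_not_on_path[of r t] c by auto

lemma scaled_res_res: "0 < r \<Longrightarrow> r < 1 \<Longrightarrow> t \<in> {0..1} \<Longrightarrow> is_resolvent (\<Gamma> t) (complex_of_real r *\<^sub>C T) (scaled_res r t)"
  unfolding scaled_res_def using outside_r by (intro is_resolvent_scale res T_clinear) auto

lemma scaled_res_clinear: "0 < r \<Longrightarrow> r < 1 \<Longrightarrow> t \<in> {0..1} \<Longrightarrow> clinear_op (scaled_res r t)"
  using is_resolvent_clinear[OF scaled_res_res clinear_op_scaleC[OF T_clinear]] .

lemma scaled_res_commute: "0 < r \<Longrightarrow> r < 1 \<Longrightarrow> t \<in> {0..1} \<Longrightarrow> scaled_res r t o\<^sub>L T = T o\<^sub>L scaled_res r t"
  by (rule is_resolvent_commute[OF scaled_res_res _ T_clinear]) (simp_all add: scaleC_compose_left scaleC_compose_right T_clinear)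

text \<open>The contour is compact and does not meet the segment \<open>[0, r1]\<close>; the bound for the resolvent of \<open>T\<close>
depends on the distance between the two.\<close>

lemma scaled_res_bound:
  assumes "r1 < 1"
  obtains B where "B > 0" "\<And>r t. 0 < r \<Longrightarrow> r \<le> r1 \<Longrightarrow> t \<in> {0..1} \<Longrightarrow> norm (scaled_res r t) \<le> B"
    "\<And>t. t \<in> {0..1} \<Longrightarrow> norm (inverse (\<Gamma> t)) \<le> B"
proof -
  define r2 where "r2 = max r1 0"
  have "compact (\<Gamma> ` {0..1})" by (intro compact_continuous_image path_stolz) auto
  moreover have "closed (complex_of_real ` {0..r2})" by (intro compact_imp_closed compact_continuous_image continuous_intros) auto
  moreover have "\<Gamma> ` {0..1} \<inter> complex_of_real ` {0..r2} = {}"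
    using real_not_on_path assms by (auto simp: r2_def image_iff)
  ultimately obtain d where d: "d > 0" "\<forall>x\<in>\<Gamma> ` {0..1}. \<forall>y\<in>complex_of_real ` {0..r2}. d \<le> dist x y"
    using separate_compact_closed by metis
  have dd: "d \<le> norm (\<Gamma> t - of_real r)" if "t \<in> {0..1}" "0 \<le> r" "r \<le> r2" for t r
    using d(2) that by (auto simp: dist_norm)
  define B where "B = (K + 1) / d"
  have "norm (scaled_res r t) \<le> B" if r: "0 < r" "r \<le> r1" and t: "t \<in> {0..1}" for r t
  proof -
    have r1: "r < 1" "r \<le> r2" using r assms by (auto simp: r2_def)
    have "norm (scaled_res r t) = inverse r * norm (resolvent (\<Gamma> t / of_real r) T)" using r by (simp add: scaled_res_def norm_scaleC norm_inverse)
    also have "\<dots> \<le> inverse r * (K / norm (1 - \<Gamma> t / of_real r))"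
      using outside_r[OF r(1) r1(1) t] r by (intro mult_left_mono norm_res) auto
    also have "1 - \<Gamma> t / of_real r = - (\<Gamma> t - of_real r) / of_real r" using r by (simp add: field_simps)
    also have "inverse r * (K / norm (- (\<Gamma> t - of_real r) / of_real r)) = K / norm (\<Gamma> t - of_real r)"
      using r by (simp only: norm_divide norm_minus_cancel) (simp add: field_simps)
    also have "\<dots> \<le> (K + 1) / d" using dd[OF t _ r1(2)] r K(1) d(1) by (intro frac_le) auto
    finally show ?thesis by (simp add: B_def)
  qed
  moreover have "norm (inverse (\<Gamma> t)) \<le> B" if t: "t \<in> {0..1}" for t
  proof -
    have "norm (inverse (\<Gamma> t)) = 1 / norm (\<Gamma> t - of_real 0)" by (simp add: norm_inverse divide_inverse)
    also have "\<dots> \<le> (K + 1) / d" using dd[OF t, of 0] K(1) d(1) by (intro frac_le) (auto simp: r2_def)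
    finally show ?thesis by (simp add: B_def)
  qed
  moreover have "B > 0" using K(1) d(1) by (simp add: B_def)
  ultimately show ?thesis using that by blast
qed

lemma scaled_res_cont: assumes "0 < r" "r < 1" shows "continuous_on {0..1} (scaled_res r)"
  unfolding scaled_res_def[abs_def]
  by (intro bounded_bilinear.continuous_on[OF bounded_bilinear_scaleC] continuous_on_const
     continuous_on_compose2[OF res_continuous] continuous_on_divide path_stolz)
    (use outside_r assms in auto)

lemma bochner01_path_continuous:
  assumes "continuous_on {0..1} (H :: real \<Rightarrow> 'a \<Rightarrow>\<^sub>L 'a)"
  shows "bochner01 (\<lambda>t. \<Gamma>' t *\<^sub>C H t)"
proof -
  have "bounded (H ` {0..1})" using assms by (intro compact_imp_bounded compact_continuous_image) auto
  then obtain B where B: "\<forall>t\<in>{0..1}. norm (H t) \<le> B" unfolding bounded_iff by auto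
  show ?thesis
    by (rule bochner01_path_integrand[where g = "\<lambda>_. B"])
      (use B in \<open>auto simp: set_integrable_def intro: continuous_on_subset[OF assms]\<close>)
qed

lemma scaled_res_has_vector_derivative:
  assumes r: "0 < r" "r < 1" and t: "t \<in> {0..1} - {0, 1/2, 3/4, 1}"
  shows "(scaled_res r has_vector_derivative - (\<Gamma>' t *\<^sub>C (scaled_res r t o\<^sub>L scaled_res r t))) (at t)"
proof -
  let ?l = "\<Gamma> t / of_real r"
  let ?R = "resolvent ?l T"
  let ?k = "inverse (complex_of_real r)"
  have t01: "t \<in> {0..1}" using t by auto
  have l: "?l \<in> U" by (rule outside_r[OF r t01])
  have "(\<Gamma> has_derivative (\<lambda>h. h *\<^sub>R \<Gamma>' t)) (at t)" using hvd_stolz[OF t, of b] by (simp add: has_vector_derivative_def)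
  then have g: "((\<lambda>t. \<Gamma> t / of_real r) has_derivative (\<lambda>h. h *\<^sub>R \<Gamma>' t / of_real r)) (at t)"
    by (rule bounded_linear.has_derivative[OF bounded_linear_divide])
  have "((\<lambda>l. resolvent l T) \<circ> (\<lambda>t. \<Gamma> t / of_real r) has_derivative
      (\<lambda>h. (- h) *\<^sub>C (?R o\<^sub>L ?R)) \<circ> (\<lambda>h. h *\<^sub>R \<Gamma>' t / of_real r)) (at t)"
    by (rule diff_chain_at[OF g res_deriv[OF l]])
  then have "((\<lambda>t. ?k *\<^sub>C resolvent (\<Gamma> t / of_real r) T) has_derivative
      (\<lambda>h. ?k *\<^sub>C ((- (h *\<^sub>R \<Gamma>' t / of_real r)) *\<^sub>C (?R o\<^sub>L ?R)))) (at t)"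
    unfolding o_def by (rule bounded_linear.has_derivative[OF bounded_linear_scaleC_right])
  moreover have "?k *\<^sub>C ((- (h *\<^sub>R \<Gamma>' t / of_real r)) *\<^sub>C (?R o\<^sub>L ?R)) = h *\<^sub>R (- (\<Gamma>' t *\<^sub>C (scaled_res r t o\<^sub>L scaled_res r t)))" for h
  proof -
    have "scaled_res r t o\<^sub>L scaled_res r t = (?k * ?k) *\<^sub>C (?R o\<^sub>L ?R)"
      unfolding scaled_res_def using is_resolvent_clinear[OF res T_clinear, of ?l] l
      by (simp add: scaleC_compose_left scaleC_compose_right scaleC_scaleC)
    then have "h *\<^sub>R (- (\<Gamma>' t *\<^sub>C (scaled_res r t o\<^sub>L scaled_res r t))) = (- (of_real h * (\<Gamma>' t * (?k * ?k)))) *\<^sub>C (?R o\<^sub>L ?R)"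
      by (simp add: scaleC_scaleC scaleC_of_real[symmetric] scaleC_simps)
    moreover have "?k *\<^sub>C ((- (h *\<^sub>R \<Gamma>' t / of_real r)) *\<^sub>C (?R o\<^sub>L ?R)) = (?k * (- (of_real h * \<Gamma>' t * ?k))) *\<^sub>C (?R o\<^sub>L ?R)"
      by (simp add: scaleC_scaleC scaleR_conv_of_real divide_inverse)
    moreover have "?k * (- (of_real h * \<Gamma>' t * ?k)) = - (of_real h * (\<Gamma>' t * (?k * ?k)))" by (simp only: mult_ac mult_minus_right)
    ultimately show ?thesis by (simp only:)
  qed
  ultimately have f: "((\<lambda>t. ?k *\<^sub>C resolvent (\<Gamma> t / of_real r) T) has_derivative (\<lambda>h. h *\<^sub>R (- (\<Gamma>' t *\<^sub>C (scaled_res r t o\<^sub>L scaled_res r t))))) (at t)"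
    by (simp only:)
  have qe: "scaled_res r = (\<lambda>t. ?k *\<^sub>C resolvent (\<Gamma> t / of_real r) T)" by (rule ext) (rule scaled_res_def)
  show ?thesis unfolding has_vector_derivative_def by (subst (1) qe) (rule f)
qed

text \<open>The integrand is, up to sign, the derivative of the resolvent along a closed contour.\<close>

lemma scaled_res_sq_integral:
  assumes r: "0 < r" "r < 1"
  shows "((\<lambda>t. \<Gamma>' t *\<^sub>C (scaled_res r t o\<^sub>L scaled_res r t)) has_integral 0) {0..1}"
proof -
  have "((\<lambda>t. - (\<Gamma>' t *\<^sub>C (scaled_res r t o\<^sub>L scaled_res r t))) has_integral (scaled_res r 1 - scaled_res r 0)) {0..1}"
    by (rule fundamental_theorem_of_calculus_strong[where S = "{0, 1/2, 3/4, 1}"])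
      (use scaled_res_has_vector_derivative[OF r] scaled_res_cont[OF r] in auto)
  moreover have "scaled_res r 1 = scaled_res r 0" by (simp add: scaled_res_def)
  ultimately show ?thesis using has_integral_neg[of "\<lambda>t. - (\<Gamma>' t *\<^sub>C (scaled_res r t o\<^sub>L scaled_res r t))" 0] by simp
qed

text \<open>Up to the factor \<open>2 pi i\<close> this is \<open>(r T)\<^sup>n\<close>, which is proved in three steps: constancy in \<open>r\<close>
of the case \<open>n = 0\<close>, its limit at \<open>r = 0\<close>, and a recursion in \<open>n\<close>.\<close>

definition "scaled_moment n r = integral {0..1} (\<lambda>t. \<Gamma>' t *\<^sub>C (\<Gamma> t ^ n *\<^sub>C scaled_res r t))"

lemma scaled_moment_has_integral:
  assumes r: "0 < r" "r < 1"
  shows "((\<lambda>t. \<Gamma>' t *\<^sub>C (\<Gamma> t ^ n *\<^sub>C scaled_res r t)) has_integral scaled_moment n r) {0..1}"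
  unfolding scaled_moment_def
  by (intro integrable_integral bochner01_integrable bochner01_path_continuous bounded_bilinear.continuous_on[OF bounded_bilinear_scaleC]
      scaled_res_cont[OF r] continuous_on_power path_stolz)

lemma scaled_moment_0_has_integral:
  assumes r: "0 < r" "r < 1"
  shows "((\<lambda>t. \<Gamma>' t *\<^sub>C scaled_res r t) has_integral scaled_moment 0 r) {0..1}"
  using scaled_moment_has_integral[OF r, of 0] by simp

text \<open>The derivative in \<open>r\<close> is \<open>T\<close> times the integral of the squared resolvent, which vanishes.\<close>

lemma scaled_moment_0_derivative:
  assumes r: "0 < r" "r < 1"
  shows "(scaled_moment 0 has_derivative (\<lambda>h. 0)) (at r within {0<..<1})"
proof -
  define r1 where "r1 = (1 + r) / 2"
  have r1: "r < r1" "r1 < 1" using r by (auto simp: r1_def)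
  obtain B where B: "B > 0" "\<And>r t. 0 < r \<Longrightarrow> r \<le> r1 \<Longrightarrow> t \<in> {0..1} \<Longrightarrow> norm (scaled_res r t) \<le> B" using scaled_res_bound[OF r1(2)] by metis
  have e: "r1 - r > 0" using r1 by simp
  show ?thesis
  proof (rule has_derivative_quadratic[OF bounded_linear_zero e, where C = "8 * pi * (norm T * norm T * (B * B * B))"])
    fix y assume y: "y \<in> {0<..<1}" "dist y r < r1 - r"
    then have y1: "0 < y" "y < 1" "y \<le> r1" by (auto simp: dist_real_def)
    define k where "k = complex_of_real (y - r)"
    have kT: "complex_of_real y *\<^sub>C T - complex_of_real r *\<^sub>C T = k *\<^sub>C T" by (simp add: k_def scaleC_simps)
    have "((\<lambda>t. k *\<^sub>C (T o\<^sub>L (\<Gamma>' t *\<^sub>C (scaled_res r t o\<^sub>L scaled_res r t)))) has_integral k *\<^sub>C (T o\<^sub>L 0)) {0..1}"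
      using has_integral_linear[OF has_integral_linear[OF scaled_res_sq_integral[OF r] bounded_bilinear.bounded_linear_right[OF bcomp, of T]] bounded_linear_scaleC_right[of k]]
      by (simp add: o_def)
    then have "((\<lambda>t. \<Gamma>' t *\<^sub>C (k *\<^sub>C (T o\<^sub>L (scaled_res r t o\<^sub>L scaled_res r t)))) has_integral 0) {0..1}"
      by (simp add: scaleC_compose_right[OF T_clinear] scaleC_scaleC bcomp_simps scaleC_simps mult.commute)
    from has_integral_diff[OF has_integral_diff[OF scaled_moment_0_has_integral[OF y1(1,2)] scaled_moment_0_has_integral[OF r]] this]
    have h: "((\<lambda>t. \<Gamma>' t *\<^sub>C (scaled_res y t - scaled_res r t - k *\<^sub>C (T o\<^sub>L (scaled_res r t o\<^sub>L scaled_res r t)))) has_integral (scaled_moment 0 y - scaled_moment 0 r)) {0..1}"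
      by (simp add: scaleC_simps)
    have "norm (scaled_moment 0 y - scaled_moment 0 r) \<le> 8 * pi * ((norm T * norm T * (B * B * B)) * (norm (y - r))\<^sup>2)"
    proof (rule path_integral_bound[OF h])
      fix t :: real assume "t \<in> {0<..<1}"
      then have t: "t \<in> {0..1}" by auto
      let ?A = "T o\<^sub>L scaled_res r t"
      have d: "scaled_res y t - scaled_res r t = k *\<^sub>C (scaled_res y t o\<^sub>L ?A)"
        using is_resolvent_diff[OF scaled_res_res[OF y1(1,2) t] scaled_res_res[OF r t]] scaled_res_clinear[OF y1(1,2) t]
        by (simp add: kT scaleC_compose_left scaleC_compose_right)
      have "T o\<^sub>L (scaled_res r t o\<^sub>L scaled_res r t) = scaled_res r t o\<^sub>L ?A"
        using scaled_res_commute[OF r t] by (simp only: blinfun_compose_assoc[symmetric])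
      then have "scaled_res y t - scaled_res r t - k *\<^sub>C (T o\<^sub>L (scaled_res r t o\<^sub>L scaled_res r t)) = k *\<^sub>C (scaled_res y t o\<^sub>L ?A) - k *\<^sub>C (scaled_res r t o\<^sub>L ?A)"
        using d by (simp only:)
      also have "\<dots> = k *\<^sub>C ((scaled_res y t - scaled_res r t) o\<^sub>L ?A)"
        by (simp only: bounded_bilinear.diff_right[OF bounded_bilinear_scaleC] bounded_bilinear.diff_left[OF bcomp])
      also have "\<dots> = (k * k) *\<^sub>C ((scaled_res y t o\<^sub>L ?A) o\<^sub>L ?A)" by (simp only: d scaleC_compose_left scaleC_scaleC)
      finally have "norm (scaled_res y t - scaled_res r t - k *\<^sub>C (T o\<^sub>L (scaled_res r t o\<^sub>L scaled_res r t))) = norm (k * k) * norm ((scaled_res y t o\<^sub>L ?A) o\<^sub>L ?A)"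
        by (simp only: norm_scaleC)
      also have "norm (k * k) = (norm (y - r))\<^sup>2" by (simp only: k_def norm_mult norm_of_real power2_eq_square real_norm_def)
      finally have eq: "norm (scaled_res y t - scaled_res r t - k *\<^sub>C (T o\<^sub>L (scaled_res r t o\<^sub>L scaled_res r t))) = (norm (y - r))\<^sup>2 * norm ((scaled_res y t o\<^sub>L ?A) o\<^sub>L ?A)" .
      have "norm ((scaled_res y t o\<^sub>L ?A) o\<^sub>L ?A) \<le> (B * (norm T * B)) * (norm T * B)"
      proof -
        have A: "norm ?A \<le> norm T * B"
          by (rule order_trans[OF norm_blinfun_compose]) (use B(2)[of r t] r r1 t in \<open>auto intro: mult_left_mono\<close>)
        have "norm ((scaled_res y t o\<^sub>L ?A) o\<^sub>L ?A) \<le> norm (scaled_res y t o\<^sub>L ?A) * norm ?A" by (rule norm_blinfun_compose)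
        also have "\<dots> \<le> (norm (scaled_res y t) * norm ?A) * norm ?A" by (intro mult_right_mono norm_blinfun_compose) auto
        also have "\<dots> \<le> (B * (norm T * B)) * (norm T * B)"
          using A B(2)[OF y1(1,3) t] B(1) by (intro mult_mono) auto
        finally show ?thesis .
      qed
      then have "(norm (y - r))\<^sup>2 * norm ((scaled_res y t o\<^sub>L ?A) o\<^sub>L ?A) \<le> (norm (y - r))\<^sup>2 * ((B * (norm T * B)) * (norm T * B))"
        by (rule mult_left_mono) simp
      also have "\<dots> = (norm T * norm T * (B * B * B)) * (norm (y - r))\<^sup>2" by (simp only: mult_ac)
      finally show "norm (scaled_res y t - scaled_res r t - k *\<^sub>C (T o\<^sub>L (scaled_res r t o\<^sub>L scaled_res r t))) \<le> (norm T * norm T * (B * B * B)) * (norm (y - r))\<^sup>2"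
        unfolding eq .
    qed (use B(1) in auto)
    then show "norm (scaled_moment 0 y - scaled_moment 0 r - 0) \<le> 8 * pi * (norm T * norm T * (B * B * B)) * (norm (y - r))\<^sup>2"
      by (simp only: diff_zero mult.assoc)
  qed
qed

text \<open>As \<open>r\<close> tends to \<open>0\<close> the integrand tends to \<open>I / z\<close>.\<close>

lemma scaled_moment_0:
  assumes r: "0 < r" "r < 1"
  shows "scaled_moment 0 r = (2 * of_real pi * \<i>) *\<^sub>C id_blinfun"
proof -
  let ?V = "(2 * of_real pi * \<i>) *\<^sub>C (id_blinfun :: 'a \<Rightarrow>\<^sub>L 'a)"
  have "\<exists>k. \<forall>x\<in>{0<..<1}. scaled_moment 0 x = k"
    by (rule has_derivative_zero_constant) (use scaled_moment_0_derivative in auto)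
  then obtain k where k: "\<And>x. 0 < x \<Longrightarrow> x < 1 \<Longrightarrow> scaled_moment 0 x = k" by auto
  obtain B where B: "B > 0" "\<And>r t. 0 < r \<Longrightarrow> r \<le> 1/2 \<Longrightarrow> t \<in> {0..1} \<Longrightarrow> norm (scaled_res r t) \<le> B"
    "\<And>t. t \<in> {0..1} \<Longrightarrow> norm (inverse (\<Gamma> t)) \<le> B" using scaled_res_bound[of "1/2"] by auto
  have i0: "((\<lambda>t. \<Gamma>' t *\<^sub>C (inverse (\<Gamma> t) *\<^sub>C (id_blinfun :: 'a \<Rightarrow>\<^sub>L 'a))) has_integral ?V) {0..1}"
    using has_integral_linear[OF integral_inverse_stolz bounded_bilinear.bounded_linear_left[OF bounded_bilinear_scaleC, of "id_blinfun :: 'a \<Rightarrow>\<^sub>L 'a"]]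
    by (simp add: o_def scaleC_scaleC mult.commute)
  define Z where "Z = 8 * pi * (B * (norm T * B))"
  have le: "norm (k - ?V) \<le> x * Z" if x: "0 < x" "x \<le> 1/2" for x
  proof -
    have x1: "x < 1" using x by simp
    have h: "((\<lambda>t. \<Gamma>' t *\<^sub>C (scaled_res x t - inverse (\<Gamma> t) *\<^sub>C id_blinfun)) has_integral (k - ?V)) {0..1}"
      using has_integral_diff[OF scaled_moment_0_has_integral[OF x(1) x1] i0] k[OF x(1) x1] by (simp add: scaleC_simps)
    have "norm (k - ?V) \<le> 8 * pi * (x * (B * (norm T * B)))"
    proof (rule path_integral_bound[OF h])
      fix t :: real assume "t \<in> {0<..<1}"
      then have t: "t \<in> {0..1}" by auto
      have n0: "\<Gamma> t \<noteq> 0" using real_not_on_path[of 0 t] t by auto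
      have "is_resolvent (\<Gamma> t) 0 (inverse (\<Gamma> t) *\<^sub>C (id_blinfun :: 'a \<Rightarrow>\<^sub>L 'a))"
        unfolding is_resolvent_def using n0 by (simp add: scaleC_compose_left scaleC_scaleC)
      from is_resolvent_diff[OF scaled_res_res[OF x(1) x1 t] this]
      have "scaled_res x t - inverse (\<Gamma> t) *\<^sub>C id_blinfun = scaled_res x t o\<^sub>L ((of_real x *\<^sub>C T) o\<^sub>L (inverse (\<Gamma> t) *\<^sub>C id_blinfun))"
        by simp
      also have "norm \<dots> \<le> norm (scaled_res x t) * norm ((of_real x *\<^sub>C T) o\<^sub>L (inverse (\<Gamma> t) *\<^sub>C id_blinfun))"
        by (rule norm_blinfun_compose)
      also have "\<dots> \<le> B * ((x * norm T) * B)"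
      proof (intro mult_mono)
        have "norm ((of_real x *\<^sub>C T) o\<^sub>L (inverse (\<Gamma> t) *\<^sub>C id_blinfun)) \<le> norm (of_real x *\<^sub>C T) * norm (inverse (\<Gamma> t) *\<^sub>C (id_blinfun :: 'a \<Rightarrow>\<^sub>L 'a))"
          by (rule norm_blinfun_compose)
        also have "\<dots> \<le> (x * norm T) * (B * 1)"
          unfolding norm_scaleC using x B(3)[OF t] norm_id_blinfun_le B(1) by (intro mult_mono) auto
        finally show "norm ((of_real x *\<^sub>C T) o\<^sub>L (inverse (\<Gamma> t) *\<^sub>C id_blinfun)) \<le> (x * norm T) * B" by simp
      qed (use B(1) B(2)[OF x t] in auto)
      finally show "norm (scaled_res x t - inverse (\<Gamma> t) *\<^sub>C id_blinfun) \<le> x * (B * (norm T * B))" by (simp only: mult_ac)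
    qed (use x B(1) in auto)
    then show ?thesis by (simp only: Z_def mult_ac)
  qed
  have "((\<lambda>x. x * Z) \<longlongrightarrow> 0 * Z) (at_right 0)" by (intro tendsto_intros)
  moreover have "\<forall>\<^sub>F x in at_right 0. norm (k - ?V) \<le> x * Z"
    unfolding eventually_at_right_field using le by (intro exI[of _ "1/2"]) auto
  ultimately have "norm (k - ?V) \<le> 0 * Z" by (intro tendsto_lowerbound) auto
  then show ?thesis using k[OF r] by simp
qed

lemma scaled_moment_Suc:
  assumes r: "0 < r" "r < 1"
  shows "scaled_moment (Suc n) r = (complex_of_real r *\<^sub>C T) o\<^sub>L scaled_moment n r"
proof -
  let ?T = "complex_of_real r *\<^sub>C T"
  have cl: "clinear_op ?T" by (rule clinear_op_scaleC[OF T_clinear])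
  have c0: "((\<lambda>t. \<Gamma> t ^ n * \<Gamma>' t) has_integral 0) {0..1}"
    by (rule cauchy_stolz) (auto intro!: continuous_intros field_differentiable_power field_differentiable_ident)
  have "((\<lambda>t. (\<Gamma> t ^ n * \<Gamma>' t) *\<^sub>C (id_blinfun :: 'a \<Rightarrow>\<^sub>L 'a)) has_integral 0 *\<^sub>C id_blinfun) {0..1}"
    using has_integral_linear[OF c0 bounded_bilinear.bounded_linear_left[OF bounded_bilinear_scaleC, of "id_blinfun :: 'a \<Rightarrow>\<^sub>L 'a"]]
    by (simp add: o_def)
  moreover have "((\<lambda>t. ?T o\<^sub>L (\<Gamma>' t *\<^sub>C (\<Gamma> t ^ n *\<^sub>C scaled_res r t))) has_integral ?T o\<^sub>L scaled_moment n r) {0..1}"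
    using has_integral_linear[OF scaled_moment_has_integral[OF r] bounded_bilinear.bounded_linear_right[OF bcomp, of ?T]] by (simp add: o_def)
  ultimately have h: "((\<lambda>t. (\<Gamma> t ^ n * \<Gamma>' t) *\<^sub>C id_blinfun + (?T o\<^sub>L (\<Gamma>' t *\<^sub>C (\<Gamma> t ^ n *\<^sub>C scaled_res r t)))) has_integral (0 *\<^sub>C id_blinfun + (?T o\<^sub>L scaled_moment n r))) {0..1}"
    by (rule has_integral_add)
  have "((\<lambda>t. \<Gamma>' t *\<^sub>C (\<Gamma> t ^ Suc n *\<^sub>C scaled_res r t)) has_integral (0 *\<^sub>C id_blinfun + (?T o\<^sub>L scaled_moment n r))) {0..1}"
  proof (rule has_integral_eq[OF _ h])
    fix t :: real assume t: "t \<in> {0..1}"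
    have "(\<Gamma>' t * \<Gamma> t ^ n) *\<^sub>C (\<Gamma> t *\<^sub>C scaled_res r t) = (\<Gamma>' t * \<Gamma> t ^ n) *\<^sub>C (id_blinfun + (?T o\<^sub>L scaled_res r t))"
      by (simp only: is_resolvent_left[OF scaled_res_res[OF r t]])
    then have e: "(\<Gamma>' t * \<Gamma> t ^ n * \<Gamma> t) *\<^sub>C scaled_res r t = (\<Gamma>' t * \<Gamma> t ^ n) *\<^sub>C id_blinfun + (\<Gamma>' t * \<Gamma> t ^ n) *\<^sub>C (?T o\<^sub>L scaled_res r t)"
      by (simp only: scaleC_scaleC scaleC_add_right)
    have 1: "\<Gamma>' t *\<^sub>C (\<Gamma> t ^ Suc n *\<^sub>C scaled_res r t) = (\<Gamma>' t * \<Gamma> t ^ n * \<Gamma> t) *\<^sub>C scaled_res r t" by (simp add: scaleC_scaleC mult_ac)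
    have 2: "?T o\<^sub>L (\<Gamma>' t *\<^sub>C (\<Gamma> t ^ n *\<^sub>C scaled_res r t)) = (\<Gamma>' t * \<Gamma> t ^ n) *\<^sub>C (?T o\<^sub>L scaled_res r t)"
      by (simp only: scaleC_scaleC scaleC_compose_right[OF cl])
    show "(\<Gamma> t ^ n * \<Gamma>' t) *\<^sub>C id_blinfun + (?T o\<^sub>L (\<Gamma>' t *\<^sub>C (\<Gamma> t ^ n *\<^sub>C scaled_res r t))) = \<Gamma>' t *\<^sub>C (\<Gamma> t ^ Suc n *\<^sub>C scaled_res r t)"
      unfolding 1 2 e by (simp only: mult.commute)
  qed
  then have "scaled_moment (Suc n) r = 0 *\<^sub>C id_blinfun + (?T o\<^sub>L scaled_moment n r)" unfolding scaled_moment_def by (rule integral_unique)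
  then show ?thesis by simp
qed

text \<open>The limit \<open>r \<rightarrow> 1\<close> in the calculus of \<open>r T\<close>.  Both resolvents are of size \<open>\<bar>1 - z\<bar>\<^sup>-\<^sup>1\<close> on the contour,
uniformly in \<open>r\<close>, and the two factors \<open>1 - z\<close> compensate the two resolvents in their difference.
The right-hand side does not mention the contour any more.\<close>

lemma cint_sq:
  "cint b T (\<lambda>z. (1 - z) powr of_real 2) = (2 * of_real pi * \<i>) *\<^sub>C (id_blinfun - 2 *\<^sub>C T + (T o\<^sub>L T))"
proof -
  let ?c = "2 * of_real pi * \<i>"
  have p2: "(1 - z) powr of_real 2 = (1 - z)\<^sup>2" for z :: complex
    using powr_complexpow[of "1 - z" 2] by (cases "z = 1") auto
  have a2: "adm 2 (\<lambda>z. (1 - z)\<^sup>2)" using adm_powr[of 2] by (simp only: p2)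
  define V where "V r = ?c *\<^sub>C (id_blinfun - (2 * complex_of_real r) *\<^sub>C T + (complex_of_real (r * r)) *\<^sub>C (T o\<^sub>L T))" for r
  define Y where "Y = cint b T (\<lambda>z. (1 - z)\<^sup>2)"
  define Z where "Z = 8 * pi * (norm T * K * K / dist_const)"
  have le: "norm (Y - V r) \<le> Z * (1 - r)" if r: "(1 + (sin b)\<^sup>2) / 2 \<le> r" "r < 1" for r
  proof -
    have r0: "0 < r" using r(1) by (smt (verit) zero_le_power2 divide_pos_pos)
    have X1: "scaled_moment 1 r = ?c *\<^sub>C (complex_of_real r *\<^sub>C T)"
      using scaled_moment_Suc[OF r0 r(2), of 0] by (simp add: scaled_moment_0[OF r0 r(2)] scaleC_compose_left scaleC_compose_right[OF T_clinear] scaleC_scaleC mult.commute)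
    have X2: "scaled_moment 2 r = ?c *\<^sub>C (complex_of_real (r * r) *\<^sub>C (T o\<^sub>L T))"
    proof -
      have "scaled_moment 2 r = (complex_of_real r *\<^sub>C T) o\<^sub>L scaled_moment 1 r" using scaled_moment_Suc[OF r0 r(2), of 1] by (simp add: numeral_2_eq_2)
      then show ?thesis unfolding X1 by (simp add: scaleC_compose_left scaleC_compose_right[OF T_clinear] scaleC_scaleC mult_ac)
    qed
    have Vr: "V r = scaled_moment 0 r - 2 *\<^sub>C scaled_moment 1 r + scaled_moment 2 r"
      unfolding V_def scaled_moment_0[OF r0 r(2)] X1 X2
      by (simp add: scaleC_simps scaleC_add_right scaleC_scaleC mult_ac)
    have h1: "((\<lambda>t. \<Gamma>' t *\<^sub>C ((1 - \<Gamma> t)\<^sup>2 *\<^sub>C scaled_res r t)) has_integral V r) {0..1}"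
    proof -
      have "((\<lambda>t. \<Gamma>' t *\<^sub>C (\<Gamma> t ^ 0 *\<^sub>C scaled_res r t) - 2 *\<^sub>C (\<Gamma>' t *\<^sub>C (\<Gamma> t ^ 1 *\<^sub>C scaled_res r t)) + \<Gamma>' t *\<^sub>C (\<Gamma> t ^ 2 *\<^sub>C scaled_res r t)) has_integral V r) {0..1}"
        unfolding Vr
        using has_integral_linear[OF scaled_moment_has_integral[OF r0 r(2), of 1] bounded_linear_scaleC_right[of 2]]
        by (intro has_integral_add has_integral_diff scaled_moment_has_integral r0 r) (simp add: o_def)
      moreover have "\<Gamma>' t *\<^sub>C (\<Gamma> t ^ 0 *\<^sub>C scaled_res r t) - 2 *\<^sub>C (\<Gamma>' t *\<^sub>C (\<Gamma> t ^ 1 *\<^sub>C scaled_res r t)) + \<Gamma>' t *\<^sub>C (\<Gamma> t ^ 2 *\<^sub>C scaled_res r t) = \<Gamma>' t *\<^sub>C ((1 - \<Gamma> t)\<^sup>2 *\<^sub>C scaled_res r t)" for t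
      proof -
        have "\<Gamma>' t *\<^sub>C (\<Gamma> t ^ 0 *\<^sub>C scaled_res r t) - 2 *\<^sub>C (\<Gamma>' t *\<^sub>C (\<Gamma> t ^ 1 *\<^sub>C scaled_res r t)) + \<Gamma>' t *\<^sub>C (\<Gamma> t ^ 2 *\<^sub>C scaled_res r t)
          = (\<Gamma>' t * \<Gamma> t ^ 0 - 2 * (\<Gamma>' t * \<Gamma> t ^ 1) + \<Gamma>' t * \<Gamma> t ^ 2) *\<^sub>C scaled_res r t"
          by (simp only: scaleC_scaleC scaleC_add_left bounded_bilinear.diff_left[OF bounded_bilinear_scaleC])
        also have "\<Gamma>' t * \<Gamma> t ^ 0 - 2 * (\<Gamma>' t * \<Gamma> t ^ 1) + \<Gamma>' t * \<Gamma> t ^ 2 = \<Gamma>' t * (1 - \<Gamma> t)\<^sup>2"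
          by (simp add: power2_eq_square algebra_simps)
        finally show ?thesis by (simp only: scaleC_scaleC)
      qed
      ultimately show ?thesis by simp
    qed
    have h2: "((\<lambda>t. \<Gamma>' t *\<^sub>C ((1 - \<Gamma> t)\<^sup>2 *\<^sub>C resolvent (\<Gamma> t) T)) has_integral Y) {0..1}"
      unfolding Y_def using cint_has_integral[OF a2] by (simp add: scaleC_scaleC mult.commute)
    have h: "((\<lambda>t. \<Gamma>' t *\<^sub>C ((1 - \<Gamma> t)\<^sup>2 *\<^sub>C (resolvent (\<Gamma> t) T - scaled_res r t))) has_integral (Y - V r)) {0..1}"
      using has_integral_diff[OF h2 h1] by (simp only: bounded_bilinear.diff_right[OF bounded_bilinear_scaleC])
    have "norm (Y - V r) \<le> 8 * pi * ((1 - r) * (norm T * K * K / dist_const))"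
    proof (rule path_integral_bound[OF h])
      fix t :: real assume tt: "t \<in> {0<..<1}"
      then have t: "t \<in> {0..1}" by auto
      let ?n = "norm (1 - \<Gamma> t)"
      have n: "?n > 0" using path_ne_1[of t] tt by auto
      have "is_resolvent (\<Gamma> t) T (resolvent (\<Gamma> t) T)" using path_U[OF tt] by (intro res) auto
      from is_resolvent_diff[OF this scaled_res_res[OF r0 r(2) t]]
      have d: "resolvent (\<Gamma> t) T - scaled_res r t = resolvent (\<Gamma> t) T o\<^sub>L (((1 - complex_of_real r) *\<^sub>C T) o\<^sub>L scaled_res r t)"
        by (simp add: scaleC_simps)
      have Qn: "norm (scaled_res r t) \<le> K / (dist_const * ?n)"
      proof -
        have "norm (scaled_res r t) = inverse r * norm (resolvent (\<Gamma> t / of_real r) T)" using r0 by (simp add: scaled_res_def norm_scaleC norm_inverse)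
        also have "\<dots> \<le> inverse r * (K / norm (1 - \<Gamma> t / of_real r))"
          using outside_r[OF r0 r(2) t] r0 by (intro mult_left_mono norm_res) auto
        also have "1 - \<Gamma> t / of_real r = - (\<Gamma> t - of_real r) / of_real r" using r0 by (simp add: field_simps)
        also have "inverse r * (K / norm (- (\<Gamma> t - of_real r) / of_real r)) = K / norm (\<Gamma> t - of_real r)"
          using r0 by (simp only: norm_divide norm_minus_cancel) (simp add: field_simps)
        also have "\<dots> \<le> K / (dist_const * ?n)"
          using path_dist[OF r(1), of t] r(2) t n K(1) dist_const_pos by (intro divide_left_mono mult_pos_pos) (auto intro: less_le_trans[of 0 "dist_const * ?n"] simp del: zero_less_norm_iff)
        finally show ?thesis .
      qed
      have "norm (resolvent (\<Gamma> t) T - scaled_res r t) \<le> norm (resolvent (\<Gamma> t) T) * norm (((1 - complex_of_real r) *\<^sub>C T) o\<^sub>L scaled_res r t)"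
        unfolding d by (rule norm_blinfun_compose)
      also have "\<dots> \<le> norm (resolvent (\<Gamma> t) T) * (norm ((1 - complex_of_real r) *\<^sub>C T) * norm (scaled_res r t))"
        by (intro mult_left_mono norm_blinfun_compose) auto
      also have "norm ((1 - complex_of_real r) *\<^sub>C T) = (1 - r) * norm T"
      proof -
        have "1 - complex_of_real r = complex_of_real (1 - r)" by simp
        then have "norm (1 - complex_of_real r) = \<bar>1 - r\<bar>" by (simp only: norm_of_real)
        then show ?thesis using r(2) by (simp add: norm_scaleC)
      qed
      also have "norm (resolvent (\<Gamma> t) T) * ((1 - r) * norm T * norm (scaled_res r t)) \<le> (K / ?n) * ((1 - r) * norm T * (K / (dist_const * ?n)))"
        using norm_res_path[OF tt] Qn r(2) K(1) n by (intro mult_mono) auto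
      finally have "norm ((1 - \<Gamma> t)\<^sup>2 *\<^sub>C (resolvent (\<Gamma> t) T - scaled_res r t)) \<le> ?n\<^sup>2 * ((K / ?n) * ((1 - r) * norm T * (K / (dist_const * ?n))))"
        unfolding norm_scaleC norm_power by (intro mult_left_mono) auto
      also have "\<dots> = (1 - r) * (norm T * K * K / dist_const)"
        using n dist_const_pos by (simp add: power2_eq_square field_simps)
      finally show "norm ((1 - \<Gamma> t)\<^sup>2 *\<^sub>C (resolvent (\<Gamma> t) T - scaled_res r t)) \<le> (1 - r) * (norm T * K * K / dist_const)" .
    qed (use r(2) K(1) dist_const_pos in auto)
    then show ?thesis by (simp only: Z_def mult_ac)
  qed
  have "((\<lambda>r. norm (Y - V r) - Z * (1 - r)) \<longlongrightarrow> norm (Y - V 1) - Z * (1 - 1)) (at_left 1)"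
    unfolding V_def
    by (intro tendsto_intros bounded_bilinear.tendsto[OF bounded_bilinear_scaleC])
  moreover have "\<forall>\<^sub>F r in at_left 1. norm (Y - V r) - Z * (1 - r) \<le> 0"
    unfolding eventually_at_left_field using le sin2 by (intro exI[of _ "(1 + (sin b)\<^sup>2) / 2"]) auto
  ultimately have "norm (Y - V 1) - Z * (1 - 1) \<le> 0" by (intro tendsto_upperbound) auto
  then show ?thesis by (simp add: Y_def V_def p2)
qed

text \<open>Polynomials act by \<open>cint_power\<close>, and uniform convergence passes to the calculus because the
remaining factor \<open>f\<close> keeps the integrals absolutely convergent.\<close>

lemma cint_tendsto:
  assumes f: "adm p f" "p > 0" and b: "\<beta> > 0" and e: "e \<longlonglongrightarrow> 0"
    and ce: "\<And>n z. norm z \<le> 1 \<Longrightarrow> norm ((\<Sum>k<n. w k * z ^ k) - (1 - z) powr of_real \<beta>) \<le> e n"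
  shows "(\<lambda>n. \<Sum>k<n. w k *\<^sub>C (op_power T k o\<^sub>L cint b T f)) \<longlonglongrightarrow> cint b T (\<lambda>z. (1 - z) powr of_real \<beta> * f z)"
proof -
  obtain C where C: "\<And>z. norm z \<le> 1 \<Longrightarrow> norm (f z) \<le> C * norm (1 - z) powr p" using f(1) by (auto simp: adm_def)
  define M where "M = 8 * pi * K * integral {0..1} (dist_majorant (p - 1))"
  have ap: "adm p (\<lambda>z. (1 - z) powr of_real \<beta> * f z)"
    by (rule adm_mult[OF f(1) continuous_powr_disc[OF b] powr_disc_differentiable])
  have an: "adm p (\<lambda>z. w k * (z ^ k * f z))" for k
    using adm_mult[OF adm_pow[OF f(1)], of "\<lambda>_. w k"] by auto
  have as: "adm p (\<lambda>z. (\<Sum>k<n. w k * z ^ k) * f z)" for n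
    by (rule adm_mult[OF f(1)]) (auto intro!: continuous_intros holomorphic_on_imp_differentiable_at[of _ UNIV] holomorphic_intros)
  have eq: "(\<Sum>k<n. w k *\<^sub>C (op_power T k o\<^sub>L cint b T f)) = cint b T (\<lambda>z. (\<Sum>k<n. w k * z ^ k) * f z)" for n
  proof -
    have "cint b T (\<lambda>z. \<Sum>k<n. w k * (z ^ k * f z)) = (\<Sum>k<n. cint b T (\<lambda>z. w k * (z ^ k * f z)))"
      by (rule cint_sum[OF an f(2)])
    also have "\<dots> = (\<Sum>k<n. w k *\<^sub>C (op_power T k o\<^sub>L cint b T f))"
      by (intro sum.cong refl) (simp add: cint_scale[OF adm_pow[OF f(1)] f(2)] cint_power[OF f])
    finally show ?thesis by (simp add: sum_distrib_right mult.assoc)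
  qed
  have bd: "norm (cint b T (\<lambda>z. (\<Sum>k<n. w k * z ^ k) * f z) - cint b T (\<lambda>z. (1 - z) powr of_real \<beta> * f z)) \<le> e n * C * M" for n
  proof -
    have e0: "0 \<le> e n" using order_trans[OF norm_ge_zero ce[of 0 n]] by simp
    have ad: "adm p (\<lambda>z. ((\<Sum>k<n. w k * z ^ k) - (1 - z) powr of_real \<beta>) * f z)"
      by (rule adm_mult[OF f(1)]) (auto intro!: continuous_on_diff continuous_powr_disc[OF b] continuous_intros field_differentiable_diff
          powr_disc_differentiable holomorphic_on_imp_differentiable_at[of _ UNIV] holomorphic_intros)
    have "cint b T (\<lambda>z. (\<Sum>k<n. w k * z ^ k) * f z) - cint b T (\<lambda>z. (1 - z) powr of_real \<beta> * f z)
       = cint b T (\<lambda>z. ((\<Sum>k<n. w k * z ^ k) - (1 - z) powr of_real \<beta>) * f z)"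
      using cint_diff[OF as ap f(2), of n] by (simp add: left_diff_distrib)
    also have "norm \<dots> \<le> (e n * C) * M"
      unfolding M_def
    proof (rule cint_bound[OF ad f(2)])
      fix z :: complex assume z: "norm z \<le> 1"
      have "norm (((\<Sum>k<n. w k * z ^ k) - (1 - z) powr of_real \<beta>) * f z) \<le> e n * (C * norm (1 - z) powr p)"
        unfolding norm_mult using ce[OF z] C[OF z] e0 by (intro mult_mono) auto
      then show "norm (((\<Sum>k<n. w k * z ^ k) - (1 - z) powr of_real \<beta>) * f z) \<le> e n * C * norm (1 - z) powr p"
        by (simp only: mult.assoc)
    qed
    finally show ?thesis .
  qed
  have "(\<lambda>n. e n * C * M) \<longlonglongrightarrow> 0 * C * M" by (intro tendsto_mult e tendsto_const)
  then have lim: "(\<lambda>n. e n * C * M) \<longlonglongrightarrow> 0" by (simp only: mult_zero_left)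
  have "(\<lambda>n. cint b T (\<lambda>z. (\<Sum>k<n. w k * z ^ k) * f z) - cint b T (\<lambda>z. (1 - z) powr of_real \<beta> * f z)) \<longlonglongrightarrow> 0"
    by (rule Lim_null_comparison[OF always_eventually lim]) (rule allI, rule bd)
  then show ?thesis unfolding eq by (rule LIM_zero_cancel)
qed

lemma cint_commute:
  assumes S: "T o\<^sub>L S = S o\<^sub>L T" "clinear_op S" and f: "adm p f" "p > 0"
  shows "S o\<^sub>L cint b T f = cint b T f o\<^sub>L S"
proof -
  let ?F = "\<lambda>t. (f (\<Gamma> t) * \<Gamma>' t) *\<^sub>C resolvent (\<Gamma> t) T"
  have 1: "((\<lambda>t. S o\<^sub>L ?F t) has_integral S o\<^sub>L cint b T f) {0..1}"
    using has_integral_linear[OF cint_has_integral[OF f] bounded_bilinear.bounded_linear_right[OF bcomp, of S]] by (simp add: o_def)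
  have 2: "((\<lambda>t. ?F t o\<^sub>L S) has_integral cint b T f o\<^sub>L S) {0..1}"
    using has_integral_linear[OF cint_has_integral[OF f] bounded_bilinear.bounded_linear_left[OF bcomp, of S]] by (simp add: o_def)
  have "((\<lambda>t. S o\<^sub>L ?F t) has_integral cint b T f o\<^sub>L S) {0..1}"
  proof (rule has_integral_spike_finite[OF _ _ 2, where S = "{0, 1}"])
    fix t :: real assume "t \<in> {0..1} - {0, 1}"
    then have "\<Gamma> t \<in> U" using path_U by auto
    then have "resolvent (\<Gamma> t) T o\<^sub>L S = S o\<^sub>L resolvent (\<Gamma> t) T" by (intro is_resolvent_commute[OF res S]) auto
    then show "S o\<^sub>L ?F t = ?F t o\<^sub>L S" by (simp add: scaleC_compose_left scaleC_compose_right[OF S(2)])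
  qed auto
  then show ?thesis using 1 has_integral_unique by blast
qed

lemma cint_clinear: assumes f: "adm p f" "p > 0" shows "clinear_op (cint b T f)"
  unfolding clinear_op_def
proof (intro allI)
  fix k x
  have "(k *\<^sub>C id_blinfun) o\<^sub>L cint b T f = cint b T f o\<^sub>L (k *\<^sub>C id_blinfun)"
    by (rule cint_commute[OF _ _ f]) (simp_all add: scaleC_compose_left scaleC_compose_right[OF T_clinear] clinear_op_scaleC)
  from arg_cong[OF this, of "\<lambda>A. A x"]
  show "cint b T f (k *\<^sub>C x) = k *\<^sub>C cint b T f x" by (simp add: scaleC_blinfun.rep_eq)
qed

end

text \<open>Let \<open>D f\<close> be the difference of the two contour integrals.  It vanishes for \<open>(1 - z)\<^sup>2\<close> by
\<open>cint_sq\<close>.  Multiplying by a uniform limit of polynomials keeps it zero, which gives all exponents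
\<open>2 + x\<close>.  Conversely, if it vanishes for \<open>(1 - z) f\<close>, then \<open>T\<close> fixes \<open>D f\<close>, so a polynomial acts on
\<open>D f\<close> as its value at \<open>1\<close>; hence \<open>D\<close> vanishes for \<open>(1 - z)\<^sup>\<beta> f\<close> with \<open>\<beta>\<close> arbitrarily small.
Two such steps lower the exponent from \<open>2 + x\<close> to any positive number.\<close>

lemma cint_independent:
  assumes A: "ritt_angle b T a" and B: "ritt_angle b' T a'" and "\<beta> > 0"
  shows "cint b T (\<lambda>z. (1 - z) powr of_real \<beta>) = cint b' T (\<lambda>z. (1 - z) powr of_real \<beta>)"
proof -
  interpret A: ritt_angle b T a by fact
  interpret B: ritt_angle b' T a' by fact
  define D where "D f = cint b T f - cint b' T f" for f
  have Dz: "D (\<lambda>z. z * f z) = T o\<^sub>L D f" if "adm p f" "p > 0" for p f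
    using that by (simp add: D_def A.cint_times B.cint_times bcomp_simps)
  have Dlim: "(\<lambda>n. \<Sum>k<n. c k *\<^sub>C (op_power T k o\<^sub>L D f)) \<longlonglongrightarrow> D (\<lambda>z. (1 - z) powr of_real \<beta> * f z)"
    if "adm p f" "p > 0" "\<beta> > 0" "e \<longlonglongrightarrow> 0"
     "\<And>n z. norm z \<le> 1 \<Longrightarrow> norm ((\<Sum>k<n. c k * z ^ k) - (1 - z) powr of_real \<beta>) \<le> e n" for p f \<beta> c e
    using tendsto_diff[OF A.cint_tendsto[OF that] B.cint_tendsto[OF that]]
    by (simp add: D_def bcomp_simps scaleC_simps sum_subtractf)
  have stepA: "D (\<lambda>z. (1 - z) powr of_real \<beta> * f z) = 0" if f: "adm p f" "p > 0" "\<beta> > 0" and 0: "D f = 0" for p f \<beta>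
  proof -
    obtain c e where ce0: "e \<longlonglongrightarrow> 0 \<and> (\<forall>n z. norm z \<le> 1 \<longrightarrow> norm ((\<Sum>k<n. c k * z ^ k) - (1 - z) powr complex_of_real \<beta>) \<le> e n)"
      using binomial_uniform[OF f(3)] by (elim exE) (rule that)
    note ce = ce0[THEN conjunct1] ce0[THEN conjunct2, rule_format]
    have "(\<lambda>n. 0) \<longlonglongrightarrow> D (\<lambda>z. (1 - z) powr of_real \<beta> * f z)"
      using Dlim[OF f ce] by (simp add: 0 bcomp_simps scaleC_simps)
    then show ?thesis by (simp add: LIMSEQ_const_iff)
  qed
  have stepB: "D (\<lambda>z. (1 - z) powr of_real \<beta> * f z) = 0" if f: "adm p f" "p > 0" "\<beta> > 0" and 0: "D (\<lambda>z. (1 - z) * f z) = 0" for p f \<beta>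
  proof -
    have az: "adm p (\<lambda>z. z * f z)" using adm_mult[OF f(1), of "\<lambda>z. z"] by (auto intro!: continuous_intros)
    have "D (\<lambda>z. (1 - z) * f z) = D f - D (\<lambda>z. z * f z)"
      unfolding D_def left_diff_distrib mult_1 A.cint_diff[OF f(1) az f(2)] B.cint_diff[OF f(1) az f(2)] by simp
    then have T: "T o\<^sub>L D f = D f" using 0 Dz[OF f(1,2)] by simp
    have Tk: "op_power T k o\<^sub>L D f = D f" for k
      by (induction k) (simp_all add: op_power_Suc blinfun_compose_assoc T)
    obtain c e where ce0: "e \<longlonglongrightarrow> 0 \<and> (\<forall>n z. norm z \<le> 1 \<longrightarrow> norm ((\<Sum>k<n. c k * z ^ k) - (1 - z) powr complex_of_real \<beta>) \<le> e n)"
      using binomial_uniform[OF f(3)] by (elim exE) (rule that)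
    note ce = ce0[THEN conjunct1] ce0[THEN conjunct2, rule_format]
    have "(\<lambda>n. (\<Sum>k<n. c k) *\<^sub>C D f) \<longlonglongrightarrow> D (\<lambda>z. (1 - z) powr of_real \<beta> * f z)"
      using Dlim[OF f ce] by (simp add: Tk bounded_bilinear.sum_left[OF bounded_bilinear_scaleC])
    moreover have "(\<lambda>n. (\<Sum>k<n. c k) *\<^sub>C D f) \<longlonglongrightarrow> 0 *\<^sub>C D f"
    proof (intro bounded_bilinear.tendsto[OF bounded_bilinear_scaleC] tendsto_const)
      show "(\<lambda>n. \<Sum>k<n. c k) \<longlonglongrightarrow> 0"
        by (rule Lim_null_comparison[OF always_eventually ce(1)]) (use ce(2)[of 1] in simp)
    qed
    ultimately show ?thesis using LIMSEQ_unique by fastforce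
  qed
  have mul: "(1 - z) powr complex_of_real x * (1 - z) powr complex_of_real y = (1 - z) powr complex_of_real (x + y)" for x y z
    by (simp add: powr_add)
  have one: "(1 - z) * (1 - z) powr complex_of_real x = (1 - z) powr complex_of_real (1 + x)" for x and z :: complex
    by (cases "z = 1") (simp_all add: powr_add)
  have D2: "D (\<lambda>z. (1 - z) powr of_real 2) = 0" by (simp only: D_def A.cint_sq B.cint_sq diff_self)
  have D2b: "D (\<lambda>z. (1 - z) powr of_real (2 + x)) = 0" if "x > 0" for x
    using stepA[OF adm_powr[of 2] _ that D2] by (simp only: mul add.commute)
  have D1b: "D (\<lambda>z. (1 - z) powr of_real (1 + x)) = 0" if "x > 0" for x
  proof -
    have e: "1 + (1 + x / 2) = 2 + x / 2" by simp
    have "D (\<lambda>z. (1 - z) * (1 - z) powr of_real (1 + x / 2)) = 0"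
      unfolding one e using that by (intro D2b) simp
    then have "D (\<lambda>z. (1 - z) powr of_real (x / 2) * (1 - z) powr of_real (1 + x / 2)) = 0"
      using that by (intro stepB[OF adm_powr]) auto
    moreover have "x / 2 + (1 + x / 2) = 1 + x" by simp
    ultimately show ?thesis by (simp only: mul)
  qed
  have "D (\<lambda>z. (1 - z) * (1 - z) powr of_real (\<beta> / 2)) = 0"
    unfolding one using \<open>\<beta> > 0\<close> by (intro D1b) simp
  then have "D (\<lambda>z. (1 - z) powr of_real (\<beta> / 2) * (1 - z) powr of_real (\<beta> / 2)) = 0"
    using \<open>\<beta> > 0\<close> by (intro stepB[OF adm_powr]) auto
  moreover have "\<beta> / 2 + \<beta> / 2 = \<beta>" by simp
  ultimately have "D (\<lambda>z. (1 - z) powr of_real \<beta>) = 0" by (simp only: mul)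
  then show ?thesis by (simp add: D_def)
qed

context ritt_angle
begin

lemma frac_power_cint:
  assumes "\<beta> > 0"
  shows "(2 * of_real pi * \<i>) *\<^sub>C frac_power T \<beta> = cint b T (\<lambda>z. (1 - z) powr of_real \<beta>)"
proof -
  define b' where "b' = (SOME b. \<exists>a. ritt_of_type T a \<and> a < b \<and> b < pi / 2)"
  have "\<exists>b a. ritt_of_type T a \<and> a < b \<and> b < pi / 2" using type ab b2 by blast
  from someI_ex[OF this] obtain a' where a': "ritt_of_type T a'" "a' < b'" "b' < pi/2" unfolding b'_def by blast
  then have B: "ritt_angle b' T a'" by unfold_locales (auto simp: ritt_of_type_def)
  have "frac_power T \<beta> = (1 / (2 * of_real pi * \<i>)) *\<^sub>C cint b' T (\<lambda>z. (1 - z) powr of_real \<beta>)"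
    unfolding frac_power_def b'_def[symmetric] cint_def stolz_deriv_def Let_def ..
  also have "cint b' T (\<lambda>z. (1 - z) powr of_real \<beta>) = cint b T (\<lambda>z. (1 - z) powr of_real \<beta>)"
    by (rule cint_independent[OF B ritt_angle_axioms assms])
  finally show ?thesis by (simp add: scaleC_scaleC)
qed

lemma monomial_cint:
  assumes "\<beta> > 0"
  shows "cint b T (\<lambda>z. z ^ n * (1 - z) powr of_real \<beta>) = (2 * of_real pi * \<i>) *\<^sub>C (op_power T n o\<^sub>L frac_power T \<beta>)"
  unfolding cint_power[OF adm_powr[OF assms] assms] frac_power_cint[OF assms, symmetric]
  by (simp add: scaleC_compose_right[OF clinear_op_power[OF T_clinear]])

lemma frac_power_eq: 
  assumes "\<beta> > 0" shows "frac_power T \<beta> = (1 / (2 * of_real pi * \<i>)) *\<^sub>C cint b T (\<lambda>z. (1 - z) powr of_real \<beta>)"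
  unfolding frac_power_cint[OF assms, symmetric] by (simp add: scaleC_scaleC)

lemma frac_power_clinear: assumes "\<beta> > 0" shows "clinear_op (frac_power T \<beta>)"
  unfolding frac_power_eq[OF assms] by (intro clinear_op_scaleC cint_clinear[OF adm_powr] assms)

lemma frac_power_commute:
  assumes "\<beta> > 0" "T o\<^sub>L S = S o\<^sub>L T" "clinear_op S"
  shows "S o\<^sub>L frac_power T \<beta> = frac_power T \<beta> o\<^sub>L S"
  unfolding frac_power_eq[OF assms(1)]
  by (simp add: scaleC_compose_left scaleC_compose_right[OF assms(3)] cint_commute[OF assms(2,3) adm_powr[OF assms(1)] assms(1)])

end

section \<open>The joint calculus on monomials\<close>

text \<open>Folding over a set is independent of the enumeration because the factors commute.\<close>

lemma op_prod_eq_op_list: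
  fixes A :: "'i \<Rightarrow> ('a::real_normed_vector \<Rightarrow>\<^sub>L 'a)"
  assumes "\<And>i j. i \<in> J \<Longrightarrow> j \<in> J \<Longrightarrow> A i o\<^sub>L A j = A j o\<^sub>L A i" "distinct xs" "set xs \<subseteq> J"
  shows "op_prod A (set xs) = op_list A xs"
proof -
  interpret comp_fun_commute_on J "\<lambda>i S. A i o\<^sub>L S"
  proof
    fix x y assume "x \<in> J" "y \<in> J"
    then have *: "(A y o\<^sub>L A x) o\<^sub>L S = (A x o\<^sub>L A y) o\<^sub>L S" for S using assms(1) by simp
    show "(\<lambda>S. A y o\<^sub>L S) \<circ> (\<lambda>S. A x o\<^sub>L S) = (\<lambda>S. A x o\<^sub>L S) \<circ> (\<lambda>S. A y o\<^sub>L S)"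
      by (rule ext) (simp only: o_def *[unfolded blinfun_compose_assoc])
  qed
  show ?thesis using assms(2,3)
  proof (induction xs)
    case Nil
    show ?case by (simp add: op_prod_def)
  next
    case (Cons i xs)
    then show ?case using fold_insert[of i "set xs" id_blinfun] by (simp add: op_prod_def)
  qed
qed

lemma op_list_zero: "i \<in> set xs \<Longrightarrow> A i = 0 \<Longrightarrow> op_list A xs = 0"
  by (induction xs) (auto simp: bcomp_simps)

lemma op_list_scaleC:
  assumes "distinct xs" "\<And>i. i \<in> set xs \<Longrightarrow> clinear_op (A i)"
  shows "op_list (\<lambda>i. c i *\<^sub>C A i) xs = (\<Prod>i\<in>set xs. c i) *\<^sub>C op_list A xs"
  using assms by (induction xs) (simp_all add: scaleC_compose_left scaleC_compose_right scaleC_scaleC mult.commute)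

locale ritt_tuple =
  fixes T :: "'d::finite \<Rightarrow> ('a::{complex_normed_vector, banach} \<Rightarrow>\<^sub>L 'a)" and a b \<alpha> :: "'d \<Rightarrow> real"
  assumes angle: "\<And>i. ritt_angle (b i) (T i) (a i)"
    and comm: "\<And>i j. T i o\<^sub>L T j = T j o\<^sub>L T i"
    and \<alpha>: "\<And>i. \<alpha> i > 0"
begin

text \<open>The factors \<open>(1 - z)\<^sup>\<alpha>\<close> are those of the square function; they also put the functions
into the algebra on which the calculus is given by an integral.\<close>

definition "monomial m z = (\<Prod>i\<in>UNIV. z $ i ^ m i * (1 - z $ i) powr complex_of_real (\<alpha> i))"
definition "factor n i = op_power (T i) n o\<^sub>L frac_power (T i) (\<alpha> i)"
definition "mon_op m = op_prod (\<lambda>i. factor (m i) i) UNIV"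

abbreviation "pt t \<equiv> (\<chi> i. stolz_path (b i) (t $ i))"

lemma T_clinear: "clinear_op (T i)" using ritt_angle.T_clinear[OF angle] .

lemma frac_comm: "frac_power (T i) (\<alpha> i) o\<^sub>L T j = T j o\<^sub>L frac_power (T i) (\<alpha> i)"
  using ritt_angle.frac_power_commute[OF angle \<alpha> comm T_clinear] by simp

lemma frac_clinear: "clinear_op (frac_power (T i) (\<alpha> i))"
  by (rule ritt_angle.frac_power_clinear[OF angle \<alpha>])

lemma frac_frac_comm: "frac_power (T i) (\<alpha> i) o\<^sub>L frac_power (T j) (\<alpha> j) = frac_power (T j) (\<alpha> j) o\<^sub>L frac_power (T i) (\<alpha> i)"
  using ritt_angle.frac_power_commute[OF angle \<alpha> _ frac_clinear] frac_comm by metis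

lemma factor_clinear: "clinear_op (factor n i)"
  unfolding factor_def by (intro clinear_op_compose clinear_op_power T_clinear frac_clinear)

lemma compose_swap:
  assumes "A o\<^sub>L C = C o\<^sub>L A" "A o\<^sub>L D = D o\<^sub>L A" shows "A o\<^sub>L (C o\<^sub>L D) = (C o\<^sub>L D) o\<^sub>L (A :: 'a \<Rightarrow>\<^sub>L 'a)"
  by (metis assms blinfun_compose_assoc)

lemma factor_comm: "factor n i o\<^sub>L factor m j = factor m j o\<^sub>L factor n i"
proof -
  have pp: "op_power (T i) n o\<^sub>L op_power (T j) m = op_power (T j) m o\<^sub>L op_power (T i) n"
    by (intro op_power_commute op_power_commute[symmetric] comm)
  have pf: "op_power (T i) n o\<^sub>L frac_power (T j) (\<alpha> j) = frac_power (T j) (\<alpha> j) o\<^sub>L op_power (T i) n" for i j n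
    by (intro op_power_commute frac_comm[symmetric])
  have 1: "op_power (T i) n o\<^sub>L factor m j = factor m j o\<^sub>L op_power (T i) n"
    unfolding factor_def by (rule compose_swap[OF pp pf])
  have 2: "frac_power (T i) (\<alpha> i) o\<^sub>L factor m j = factor m j o\<^sub>L frac_power (T i) (\<alpha> i)"
    unfolding factor_def by (rule compose_swap[OF pf[symmetric] frac_frac_comm])
  show ?thesis
    using compose_swap[OF 1[symmetric] 2[symmetric]] by (simp add: factor_def)
qed

definition "integrand f t = (f (pt t) * (\<Prod>i\<in>UNIV. vector_derivative (stolz_path (b i)) (at (t $ i)))) *\<^sub>C
          op_prod (\<lambda>i. resolvent (stolz_path (b i) (t $ i)) (T i)) UNIV"

lemma H0_calc_eq: "H0_calc b T UNIV f = ((1 / (2 * of_real pi * \<i>)) ^ CARD('d)) *\<^sub>C integral (cbox 0 1) (integrand f)"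
  unfolding H0_calc_def integrand_def[abs_def] by simp

lemma path_end: "x \<in> {0..1} \<Longrightarrow> x \<notin> {0<..<1} \<Longrightarrow> stolz_path (b i) x = 1"
  by (cases "x = 0"; cases "x = 1"; auto)

text \<open>The integrand is a product of functions of separate variables, each of which integrates to a
factor of \<open>mon_op\<close>.  On the faces of the cube, where some point of a contour is \<open>1\<close> and the resolvent there
may be meaningless, the scalar factor vanishes.\<close>

lemma integrand_monomial:
  "(integrand (monomial m) has_integral ((2 * of_real pi * \<i>) ^ CARD('d)) *\<^sub>C mon_op m) (cbox 0 1)"
proof -
  obtain xs :: "'d list" where xs: "set xs = UNIV" "distinct xs" using finite_distinct_list[OF finite[of "UNIV :: 'd set"]] by auto
  define f where "f i z = z ^ m i * (1 - z) powr complex_of_real (\<alpha> i)" for i z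
  define G where "G i x = (f i (stolz_path (b i) x) * stolz_deriv (b i) x) *\<^sub>C resolvent (stolz_path (b i) x) (T i)" for i x
  have ad: "adm (\<alpha> i) (f i)" for i
    unfolding f_def[abs_def] by (rule ritt_angle.adm_pow[OF angle adm_powr[OF \<alpha>]])
  have bo: "bochner01 (G i)" for i
    unfolding G_def[abs_def] by (rule ritt_angle.bochner01_adm[OF angle ad \<alpha>])
  have main: "((\<lambda>t::real^'d. op_list (\<lambda>i. G i (t $ i)) xs) has_integral op_list (\<lambda>i. integral {0..1} (G i)) xs) (cbox 0 1)"
    using has_integral_op_list_cube[where G = G and u = "\<lambda>_ _. 1", OF xs(2) bo] by (simp add: xs(1))
  have "integral {0..1} (G i) = (2 * of_real pi * \<i>) *\<^sub>C factor (m i) i" for i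
    unfolding factor_def G_def[abs_def] f_def
    using ritt_angle.monomial_cint[OF angle \<alpha>, of i "m i"] by (simp only: cint_def)
  then have "op_list (\<lambda>i. integral {0..1} (G i)) xs = (\<Prod>i\<in>set xs. 2 * of_real pi * \<i>) *\<^sub>C op_list (\<lambda>i. factor (m i) i) xs"
    using op_list_scaleC[OF xs(2), of "\<lambda>i. factor (m i) i" "\<lambda>_. 2 * of_real pi * \<i>"] factor_clinear by simp
  also have "op_list (\<lambda>i. factor (m i) i) xs = mon_op m"
    unfolding mon_op_def xs(1)[symmetric] by (rule op_prod_eq_op_list[symmetric, where J = UNIV]) (auto simp: factor_comm xs(2))
  finally have val: "op_list (\<lambda>i. integral {0..1} (G i)) xs = ((2 * of_real pi * \<i>) ^ CARD('d)) *\<^sub>C mon_op m"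
    by (simp add: xs(1))
  have eq: "op_list (\<lambda>i. G i (t $ i)) xs = integrand (monomial m) t" if t: "t \<in> cbox 0 1" for t
  proof (cases "\<forall>i. t $ i \<in> {0<..<1}")
    case True
    let ?R = "\<lambda>i. resolvent (stolz_path (b i) (t $ i)) (T i)"
    have res: "is_resolvent (stolz_path (b i) (t $ i)) (T i) (?R i)" for i
      using True ritt_angle.path_U[OF angle, of "t $ i" i] by (intro ritt_angle.res[OF angle]) auto
    have cl: "clinear_op (?R i)" for i by (rule is_resolvent_clinear[OF res T_clinear])
    have "?R i o\<^sub>L T j = T j o\<^sub>L ?R i" for i j by (rule is_resolvent_commute[OF res comm T_clinear])
    then have co: "?R i o\<^sub>L ?R j = ?R j o\<^sub>L ?R i" for i j
      using is_resolvent_commute[OF res _ cl, of i j] by metis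
    have "op_list (\<lambda>i. G i (t $ i)) xs = (\<Prod>i\<in>set xs. f i (stolz_path (b i) (t $ i)) * stolz_deriv (b i) (t $ i)) *\<^sub>C op_list ?R xs"
      unfolding G_def by (rule op_list_scaleC[OF xs(2) cl])
    also have "op_list ?R xs = op_prod ?R UNIV"
      unfolding xs(1)[symmetric] by (rule op_prod_eq_op_list[symmetric, where J = UNIV]) (auto simp: co xs(2))
    finally show ?thesis
      by (simp add: integrand_def monomial_def f_def xs(1) prod.distrib stolz_deriv_def)
  next
    case False
    then obtain i where i: "t $ i \<notin> {0<..<1}" by auto
    have "t $ i \<in> {0..1}" using t by (auto simp: mem_box_cart)
    then have p: "stolz_path (b i) (t $ i) = 1" using i path_end by blast
    have "G i (t $ i) = 0" by (simp add: G_def f_def p)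
    then have "op_list (\<lambda>i. G i (t $ i)) xs = 0" using xs(1) by (intro op_list_zero[of i]) auto
    moreover have "\<exists>i\<in>UNIV. pt t $ i ^ m i * (1 - pt t $ i) powr complex_of_real (\<alpha> i) = 0"
      by (rule bexI[of _ i]) (simp_all add: p)
    then have "monomial m (pt t) = 0" unfolding monomial_def by (rule prod_zero[OF finite])
    ultimately show ?thesis by (simp add: integrand_def)
  qed
  show ?thesis using has_integral_eq[OF eq main] by (simp add: val)
qed

lemma H0_calc_span:
  assumes "finite A"
  shows "H0_calc b T UNIV (\<lambda>z. \<Sum>j\<in>A. k j * monomial (m j) z) = (\<Sum>j\<in>A. k j *\<^sub>C mon_op (m j))"
proof -
  let ?c = "(2 * of_real pi * \<i>) ^ CARD('d)"
  have "((\<lambda>t. \<Sum>j\<in>A. k j *\<^sub>C integrand (monomial (m j)) t) has_integral (\<Sum>j\<in>A. k j *\<^sub>C (?c *\<^sub>C mon_op (m j)))) (cbox 0 1)"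
  proof (rule has_integral_sum[OF assms])
    fix j
    show "((\<lambda>t. k j *\<^sub>C integrand (monomial (m j)) t) has_integral k j *\<^sub>C (?c *\<^sub>C mon_op (m j))) (cbox 0 1)"
      using has_integral_linear[OF integrand_monomial bounded_linear_scaleC_right] by (simp add: o_def)
  qed
  moreover have "(\<Sum>j\<in>A. k j *\<^sub>C integrand (monomial (m j)) t) = integrand (\<lambda>z. \<Sum>j\<in>A. k j * monomial (m j) z) t" for t
    by (simp add: integrand_def scaleC_scaleC bounded_bilinear.sum_left[OF bounded_bilinear_scaleC] sum_distrib_right mult.assoc)
  ultimately have "(integrand (\<lambda>z. \<Sum>j\<in>A. k j * monomial (m j) z) has_integral (\<Sum>j\<in>A. k j *\<^sub>C (?c *\<^sub>C mon_op (m j)))) (cbox 0 1)"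
    by simp
  then have "H0_calc b T UNIV (\<lambda>z. \<Sum>j\<in>A. k j * monomial (m j) z) = ((1 / (2 * of_real pi * \<i>)) ^ CARD('d)) *\<^sub>C (\<Sum>j\<in>A. k j *\<^sub>C (?c *\<^sub>C mon_op (m j)))"
    unfolding H0_calc_eq by (simp add: integral_unique)
  also have "\<dots> = (\<Sum>j\<in>A. k j *\<^sub>C mon_op (m j))"
    unfolding bounded_bilinear.sum_right[OF bounded_bilinear_scaleC] scaleC_scaleC
  proof (rule sum.cong[OF refl])
    fix j
    have "(1 / (2 * of_real pi * \<i>)) ^ CARD('d) * (k j * ?c) = k j * ((1 / (2 * of_real pi * \<i>)) * (2 * of_real pi * \<i>)) ^ CARD('d)"
      by (simp only: power_mult_distrib mult_ac)
    also have "(1 / (2 * of_real pi * \<i>)) * (2 * of_real pi * \<i>) = (1::complex)" by simp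
    finally have "(1 / (2 * of_real pi * \<i>)) ^ CARD('d) * (k j * ?c) = k j" by (simp only: power_one mult_1_right)
    then show "((1 / (2 * of_real pi * \<i>)) ^ CARD('d) * (k j * ?c)) *\<^sub>C mon_op (m j) = k j *\<^sub>C mon_op (m j)" by (simp only:)
  qed
  finally show ?thesis .
qed

end

definition hol_at :: "(complex^'d::finite \<Rightarrow> complex) \<Rightarrow> complex^'d \<Rightarrow> bool" where
  "hol_at f z \<longleftrightarrow> (\<exists>D. (f has_derivative D) (at z) \<and> (\<forall>c v. D (c *s v) = c * D v))"

lemma hol_at_const: "hol_at (\<lambda>_. k) z"
  unfolding hol_at_def by (rule exI[of _ "\<lambda>_. 0"]) auto

lemma hol_at_add: "hol_at f z \<Longrightarrow> hol_at g z \<Longrightarrow> hol_at (\<lambda>z. f z + g z) z"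
  unfolding hol_at_def by (elim exE conjE, rule exI, rule conjI, erule (1) has_derivative_add) (simp add: distrib_left)

lemma hol_at_mult: "hol_at f z \<Longrightarrow> hol_at g z \<Longrightarrow> hol_at (\<lambda>z. f z * g z) z"
  unfolding hol_at_def by (elim exE conjE, rule exI, rule conjI, erule (1) has_derivative_mult) (simp add: algebra_simps)

lemma hol_at_sum: "finite A \<Longrightarrow> (\<And>i. i \<in> A \<Longrightarrow> hol_at (f i) z) \<Longrightarrow> hol_at (\<lambda>z. \<Sum>i\<in>A. f i z) z"
  by (induction A rule: finite_induct) (auto intro: hol_at_const hol_at_add)

lemma hol_at_prod: "finite A \<Longrightarrow> (\<And>i. i \<in> A \<Longrightarrow> hol_at (f i) z) \<Longrightarrow> hol_at (\<lambda>z. \<Prod>i\<in>A. f i z) z"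
  by (induction A rule: finite_induct) (auto intro: hol_at_const hol_at_mult)

lemma hol_at_coord:
  fixes z :: "complex^'d::finite"
  assumes "g field_differentiable at (z $ i)" shows "hol_at (\<lambda>z. g (z $ i)) z"
proof -
  obtain g' where "(g has_field_derivative g') (at (z $ i))" using assms by (auto simp: field_differentiable_def)
  then have g: "(g has_derivative (\<lambda>h. g' * h)) (at (z $ i))" by (simp add: has_field_derivative_def)
  have "((\<lambda>z. z $ i) has_derivative (\<lambda>v. v $ i)) (at z)" by (rule bounded_linear_imp_has_derivative[OF bounded_linear_vec_nth])
  from diff_chain_at[OF this g] show ?thesis
    unfolding hol_at_def by (intro exI[of _ "\<lambda>v. g' * v $ i"]) (simp add: o_def)
qed

text \<open>A point of the hull is \<open>(1 - v) + v w\<close> with \<open>\<bar>w\<bar> < sin \<gamma>\<close>; then \<open>\<bar>1 - z\<bar> \<le> 2 v\<close> and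
\<open>1 - \<bar>z\<bar> \<ge> v (1 - sin \<gamma>)\<close>.\<close>

lemma stolz_geometry:
  assumes z: "z \<in> stolz \<gamma>" and \<gamma>: "0 < \<gamma>" "\<gamma> < pi/2"
  shows "norm z < 1" "norm (1 - z) \<le> 2 / (1 - sin \<gamma>) * (1 - norm z)"
proof -
  interpret stolz_angle \<gamma> by unfold_locales (use \<gamma> in auto)
  let ?S = "convex hull (insert 1 (ball (0::complex) (sin \<gamma>)))"
  have "?S \<subseteq> cball 0 1" by (rule hull_minimal) (use sin01 in auto)
  then have "interior ?S \<subseteq> ball 0 1" using interior_mono[of ?S "cball 0 1"] by simp
  then show "norm z < 1" using z by (auto simp: stolz_def)
  have "z \<in> ?S" using z interior_subset unfolding stolz_def by blast
  then obtain u v w where uvw: "u \<ge> 0" "v \<ge> 0" "u + v = 1" "w \<in> ball 0 (sin \<gamma>)" "z = u *\<^sub>R 1 + v *\<^sub>R w"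
    using convex_hull_insert[of "ball (0::complex) (sin \<gamma>)" 1] sin01 by (auto simp: convex_hull_eq[THEN iffD2, OF convex_ball])
  have w: "norm w < sin \<gamma>" using uvw by simp
  have "norm z \<le> u + v * norm w" unfolding uvw(5) using uvw(1,2) by (intro order_trans[OF norm_triangle_ineq]) simp
  moreover have "v * norm w \<le> v * sin \<gamma>" using uvw w by (intro mult_left_mono) auto
  ultimately have 1: "v * (1 - sin \<gamma>) \<le> 1 - norm z" using uvw(3) by (simp add: algebra_simps)
  have u: "u = 1 - v" using uvw(3) by simp
  have "1 - z = v *\<^sub>R (1 - w)" unfolding uvw(5) u by (simp add: algebra_simps scaleR_conv_of_real)
  then have "norm (1 - z) = v * norm (1 - w)" using uvw(2) by simp
  also have "\<dots> \<le> v * 2" using w sin01 norm_triangle_ineq4[of 1 w] uvw(2) by (intro mult_left_mono) auto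
  finally have "norm (1 - z) * (1 - sin \<gamma>) \<le> 2 * (v * (1 - sin \<gamma>))" using sin01 by (simp add: mult_right_mono)
  also have "\<dots> \<le> 2 * (1 - norm z)" using 1 by simp
  finally show "norm (1 - z) \<le> 2 / (1 - sin \<gamma>) * (1 - norm z)" using sin01 by (simp add: field_simps)
qed

lemma zero_in_stolz: assumes "0 < \<gamma>" "\<gamma> < pi/2" shows "0 \<in> stolz \<gamma>"
proof -
  interpret stolz_angle \<gamma> by unfold_locales (use assms in auto)
  have "ball 0 (sin \<gamma>) \<subseteq> stolz \<gamma>" unfolding stolz_def
    by (rule interior_maximal) (auto intro: hull_inc)
  then show ?thesis using sin01 by auto
qed

context ritt_tuple
begin

lemma span_in_H0:
  assumes A: "finite A" and \<gamma>: "\<And>i. 0 < \<gamma> i \<and> \<gamma> i < pi / 2"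
  shows "(\<lambda>z. \<Sum>j\<in>A. k j * monomial (m j) z) \<in> H0_inf \<gamma> UNIV"
proof -
  let ?f = "\<lambda>z. \<Sum>j\<in>A. k j * monomial (m j) z"
  have n1: "norm (z $ i) < 1" if "z \<in> stolz_prod \<gamma>" for z :: "complex^'d" and i
    using that stolz_geometry(1)[of "z $ i" "\<gamma> i"] \<gamma> by (auto simp: stolz_prod_def)
  have hol: "hol_at ?f z" if z: "z \<in> stolz_prod \<gamma>" for z
    unfolding monomial_def
  proof (intro hol_at_sum[OF A] hol_at_mult hol_at_const hol_at_prod finite)
    fix i m
    show "hol_at (\<lambda>z. z $ i ^ m) z"
      by (rule hol_at_coord[of "\<lambda>w. w ^ m"]) (auto intro!: field_differentiable_power field_differentiable_ident)
    show "hol_at (\<lambda>z. (1 - z $ i) powr complex_of_real (\<alpha> i)) z"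
      by (rule hol_at_coord[of "\<lambda>w. (1 - w) powr complex_of_real (\<alpha> i)"]) (rule powr_disc_differentiable[OF n1[OF z]])
  qed
  define M where "M = (\<Sum>j\<in>A. norm (k j)) + 1"
  have M: "M > 0" unfolding M_def by (smt (verit) norm_ge_zero sum_nonneg)
  have bd: "norm (?f z) \<le> M * (\<Prod>i\<in>UNIV. norm (1 - z $ i) powr \<alpha> i)" if z: "z \<in> stolz_prod \<gamma>" for z
  proof -
    let ?P = "\<Prod>i\<in>UNIV. norm (1 - z $ i) powr \<alpha> i"
    have P0: "?P \<ge> 0" by (intro prod_nonneg) auto
    have "norm (monomial (m j) z) \<le> ?P" for j
      unfolding monomial_def prod_norm[symmetric]
    proof (rule prod_mono, rule conjI)
      fix i
      have "norm (z $ i) ^ m j i \<le> 1" using n1[OF z, of i] by (intro power_le_one) auto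
      then have "norm (z $ i) ^ m j i * norm (1 - z $ i) powr \<alpha> i \<le> 1 * norm (1 - z $ i) powr \<alpha> i" by (rule mult_right_mono) simp
      then show "norm (z $ i ^ m j i * (1 - z $ i) powr complex_of_real (\<alpha> i)) \<le> norm (1 - z $ i) powr \<alpha> i"
        by (simp add: norm_mult norm_power norm_powr_real_powr')
    qed simp
    then have "norm (?f z) \<le> (\<Sum>j\<in>A. norm (k j) * ?P)"
      by (intro sum_norm_le) (auto simp: norm_mult intro: mult_left_mono)
    also have "\<dots> = (\<Sum>j\<in>A. norm (k j)) * ?P" by (simp add: sum_distrib_right)
    also have "\<dots> \<le> M * ?P" using P0 by (intro mult_right_mono) (auto simp: M_def)
    finally show ?thesis .
  qed
  have bdd: "norm (?f z) \<le> M * (\<Prod>i\<in>UNIV. 2 powr \<alpha> i)" if z: "z \<in> stolz_prod \<gamma>" for z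
  proof -
    have "(\<Prod>i\<in>UNIV. norm (1 - z $ i) powr \<alpha> i) \<le> (\<Prod>i\<in>UNIV. 2 powr \<alpha> i)"
    proof (rule prod_mono, rule conjI)
      fix i
      have "norm (1 - z $ i) \<le> 2" using norm_triangle_ineq4[of 1 "z $ i"] n1[OF z, of i] by simp
      then show "norm (1 - z $ i) powr \<alpha> i \<le> 2 powr \<alpha> i" using \<alpha>[of i] by (intro powr_mono2) auto
    qed simp
    then have "M * (\<Prod>i\<in>UNIV. norm (1 - z $ i) powr \<alpha> i) \<le> M * (\<Prod>i\<in>UNIV. 2 powr \<alpha> i)" using M by (intro mult_left_mono) auto
    then show ?thesis using bd[OF z] by (rule order_trans[rotated])
  qed
  have b1: "bounded (?f ` stolz_prod \<gamma>)"
    unfolding bounded_iff by (rule exI[of _ "M * (\<Prod>i\<in>UNIV. 2 powr \<alpha> i)"]) (use bdd in auto)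
  have b2: "\<exists>c>0. \<exists>s. (\<forall>i\<in>UNIV. 0 < s i) \<and> (\<forall>z\<in>stolz_prod \<gamma>. cmod (?f z) \<le> c * (\<Prod>i\<in>UNIV. cmod (1 - z $ i) powr s i))"
    by (rule exI[of _ M], intro conjI M, rule exI[of _ \<alpha>]) (use \<alpha> bd in auto)
  have b3: "\<forall>z\<in>stolz_prod \<gamma>. \<forall>w\<in>stolz_prod \<gamma>. (\<forall>i\<in>UNIV. z $ i = w $ i) \<longrightarrow> ?f z = ?f w"
  proof (intro ballI impI)
    fix z w :: "complex^'d" assume "\<forall>i\<in>UNIV. z $ i = w $ i"
    then have "z = w" by (simp add: vec_eq_iff)
    then show "?f z = ?f w" by simp
  qed
  have b4: "holomorphic_several ?f (stolz_prod \<gamma>)"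
    unfolding holomorphic_several_def using hol unfolding hol_at_def by blast
  show ?thesis unfolding H0_inf_def using b1 b2 b3 b4 by blast
qed

text \<open>The linear combination is the component with index set \<open>UNIV\<close> of a family whose other components
are zero.\<close>

lemma calculus_bound:
  assumes A: "finite A" and \<gamma>: "\<And>i. 0 < \<gamma> i \<and> \<gamma> i < pi / 2"
    and K: "K > 0" "\<And>F. F \<in> H01_inf \<gamma> \<Longrightarrow> norm (H01_calc b T F) \<le> K * (SUP z\<in>stolz_prod \<gamma>. cmod (H01_fun F z))"
    and C: "\<And>z. z \<in> stolz_prod \<gamma> \<Longrightarrow> norm (\<Sum>j\<in>A. k j * monomial (m j) z) \<le> C"
  shows "norm (\<Sum>j\<in>A. k j *\<^sub>C mon_op (m j)) \<le> K * C"
proof -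
  let ?f = "\<lambda>z. \<Sum>j\<in>A. k j * monomial (m j) z"
  define F where "F \<Lambda> = (if \<Lambda> = UNIV then ?f else (\<lambda>_. 0))" for \<Lambda> :: "'d set"
  have zero: "(\<lambda>_. 0) \<in> H0_inf \<gamma> \<Lambda>" for \<Lambda>
    unfolding H0_inf_def holomorphic_several_def
    by (auto intro!: exI[of _ "\<lambda>_. 0"] exI[of _ "1::real"] exI[of _ "\<lambda>_. 1::real"] prod_nonneg bounded_subset[OF bounded_insert[THEN iffD2, OF bounded_empty], of _ 0])
  have F: "F \<in> H01_inf \<gamma>" unfolding H01_inf_def F_def using span_in_H0[OF A \<gamma>] zero by auto
  have ff: "H01_fun F z = ?f z" for z
  proof -
    have "H01_fun F z = (\<Sum>\<Lambda>\<in>(UNIV :: 'd set set). if \<Lambda> = UNIV then ?f z else 0)" unfolding H01_fun_def F_def by (rule sum.cong) auto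
    then show ?thesis by simp
  qed
  have calc0: "H0_calc b T \<Lambda> (\<lambda>_. 0) = 0" for \<Lambda> by (simp add: H0_calc_def scaleC_simps)
  have "H01_calc b T F = (\<Sum>\<Lambda>\<in>(UNIV :: 'd set set). if \<Lambda> = UNIV then H0_calc b T UNIV ?f else 0)"
    unfolding H01_calc_def F_def by (rule sum.cong) (auto simp: calc0)
  then have calc: "H01_calc b T F = (\<Sum>j\<in>A. k j *\<^sub>C mon_op (m j))" by (simp add: H0_calc_span[OF A])
  have "(\<chi> i. 0) \<in> stolz_prod \<gamma>" using zero_in_stolz \<gamma> by (auto simp: stolz_prod_def)
  then have "(SUP z\<in>stolz_prod \<gamma>. cmod (H01_fun F z)) \<le> C"
    by (intro cSUP_least) (auto simp: ff intro: C)
  then have "K * (SUP z\<in>stolz_prod \<gamma>. cmod (H01_fun F z)) \<le> K * C" using K(1) by (intro mult_left_mono) auto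
  then show ?thesis using K(2)[OF F] unfolding calc by linarith
qed

end

section \<open>Rademacher sums in spaces of finite cotype\<close>

definition sign_cube :: "'k set \<Rightarrow> ('k \<Rightarrow> real) set" where
  "sign_cube K = (K \<rightarrow>\<^sub>E {-1, 1})"

lemma finite_sign_cube [simp]: "finite K \<Longrightarrow> finite (sign_cube K)"
  unfolding sign_cube_def by (intro finite_PiE) auto

lemma card_sign_cube: "finite K \<Longrightarrow> card (sign_cube K) = 2 ^ card K"
  unfolding sign_cube_def by (subst card_PiE) (simp_all add: card_insert_if numeral_2_eq_2[symmetric])

lemma sign_cube_abs: "\<epsilon> \<in> sign_cube K \<Longrightarrow> k \<in> K \<Longrightarrow> \<bar>\<epsilon> k\<bar> = 1"
  unfolding sign_cube_def by (auto dest: PiE_mem)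

lemma cotype_of_bounded_sign_sums:
  fixes x :: "nat \<Rightarrow> 'a::real_normed_vector"
  assumes cot: "\<And>n. \<And>x::nat \<Rightarrow> 'a. (\<Sum>i<n. norm (x i) powr q) powr (1 / q) \<le>
        C * sqrt ((\<Sum>\<epsilon>\<in>sign_cube {..<n}. (norm (\<Sum>i<n. \<epsilon> i *\<^sub>R x i))\<^sup>2) / 2 ^ n)"
    and q: "q > 0" and C: "C \<ge> 0" and B: "B \<ge> 0"
    and bd: "\<And>\<epsilon>. \<epsilon> \<in> sign_cube {..<n} \<Longrightarrow> norm (\<Sum>i<n. \<epsilon> i *\<^sub>R x i) \<le> B"
  shows "(\<Sum>i<n. norm (x i) powr q) \<le> (C * B) powr q"
proof -
  have "(\<Sum>\<epsilon>\<in>sign_cube {..<n}. (norm (\<Sum>i<n. \<epsilon> i *\<^sub>R x i))\<^sup>2) \<le> (\<Sum>\<epsilon>\<in>sign_cube {..<n}. B\<^sup>2)"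
    by (intro sum_mono power_mono bd) auto
  also have "\<dots> = 2 ^ n * B\<^sup>2" by (simp add: card_sign_cube)
  finally have "(\<Sum>\<epsilon>\<in>sign_cube {..<n}. (norm (\<Sum>i<n. \<epsilon> i *\<^sub>R x i))\<^sup>2) / 2 ^ n \<le> B\<^sup>2"
    by (simp add: field_simps)
  then have "sqrt ((\<Sum>\<epsilon>\<in>sign_cube {..<n}. (norm (\<Sum>i<n. \<epsilon> i *\<^sub>R x i))\<^sup>2) / 2 ^ n) \<le> B"
    using B by (intro real_le_lsqrt) auto
  then have "(\<Sum>i<n. norm (x i) powr q) powr (1 / q) \<le> C * B"
    using cot[where n = n and x = x] C by (meson mult_left_mono order_trans)
  then have "((\<Sum>i<n. norm (x i) powr q) powr (1 / q)) powr q \<le> (C * B) powr q"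
    using q by (intro powr_mono2) auto
  then show ?thesis using q by (simp add: powr_powr sum_nonneg)
qed

lemma disjoint_subsets_of_card:
  fixes N :: nat
  assumes "finite H" "b * N \<le> card H"
  shows "\<exists>S. (\<forall>c<N. S c \<subseteq> H \<and> card (S c) = b) \<and> (\<forall>c<N. \<forall>c'<N. c \<noteq> c' \<longrightarrow> S c \<inter> S c' = {})"
  using assms(2)
proof (induction N)
  case (Suc N)
  have "b * N \<le> card H" using Suc.prems by simp
  then obtain S where S0: "\<forall>c<N. S c \<subseteq> H \<and> card (S c) = b" "\<forall>c<N. \<forall>c'<N. c \<noteq> c' \<longrightarrow> S c \<inter> S c' = {}"
    using Suc.IH by blast
  then have S: "\<And>c. c < N \<Longrightarrow> S c \<subseteq> H" "\<And>c. c < N \<Longrightarrow> card (S c) = b"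
    "\<And>c c'. c < N \<Longrightarrow> c' < N \<Longrightarrow> c \<noteq> c' \<Longrightarrow> S c \<inter> S c' = {}" by blast+
  let ?U = "\<Union>c<N. S c"
  have fin: "finite (S c)" if "c < N" for c using S(1)[OF that] assms(1) finite_subset by blast
  have "card ?U \<le> (\<Sum>c<N. card (S c))" by (rule card_UN_le) simp
  also have "\<dots> = N * b" using S(2) by simp
  finally have "b \<le> card (H - ?U)"
    using Suc.prems S(1) assms(1) fin by (subst card_Diff_subset) (auto simp: algebra_simps)
  then obtain R where R: "R \<subseteq> H - ?U" "card R = b" using obtain_subset_with_card_n by metis
  show ?case
  proof (intro exI[of _ "S(N := R)"] conjI allI impI)
    fix c c' assume "c < Suc N" "c' < Suc N" "c \<noteq> c'"
    then consider "c < N" "c' < N" | "c = N" "c' < N" | "c < N" "c' = N" by linarith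
    then show "(S(N := R)) c \<inter> (S(N := R)) c' = {}"
    proof cases
      case 1
      then show ?thesis using S(3) \<open>c \<noteq> c'\<close> by simp
    next
      case 2
      then have "S c' \<subseteq> ?U" by blast
      then show ?thesis using R(1) 2 by auto
    next
      case 3
      then have "S c \<subseteq> ?U" by blast
      then show ?thesis using R(1) 3 by auto
    qed
  next
    fix c assume "c < Suc N"
    then show "(S(N := R)) c \<subseteq> H" "card ((S(N := R)) c) = b"
      using R S(1,2) by (cases "c = N"; auto simp: less_Suc_eq)+
  qed
qed auto

text \<open>A subset of density at most \<open>1/N\<close> can be moved by \<open>N\<close> permutations of the ambient set so that its
preimages are disjoint.\<close>

lemma disjoint_preimages:
  fixes N :: nat
  assumes "finite H" "Bd \<subseteq> H" "card Bd * N \<le> card H"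
  obtains \<pi> where "\<And>c. c < N \<Longrightarrow> bij_betw (\<pi> c) H H"
    "\<And>c c' h. c < N \<Longrightarrow> c' < N \<Longrightarrow> h \<in> H \<Longrightarrow> \<pi> c h \<in> Bd \<Longrightarrow> \<pi> c' h \<in> Bd \<Longrightarrow> c = c'"
proof -
  obtain S where S0: "\<forall>c<N. S c \<subseteq> H \<and> card (S c) = card Bd" "\<forall>c<N. \<forall>c'<N. c \<noteq> c' \<longrightarrow> S c \<inter> S c' = {}"
    using disjoint_subsets_of_card[OF assms(1,3)] by blast
  then have S: "\<And>c. c < N \<Longrightarrow> S c \<subseteq> H" "\<And>c. c < N \<Longrightarrow> card (S c) = card Bd"
    "\<And>c c'. c < N \<Longrightarrow> c' < N \<Longrightarrow> c \<noteq> c' \<Longrightarrow> S c \<inter> S c' = {}" by blast+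
  have "\<exists>p. bij_betw p H H \<and> (\<forall>h\<in>H. p h \<in> Bd \<longrightarrow> h \<in> S c)" if c: "c < N" for c
  proof -
    have fin: "finite (S c)" "finite Bd" using S(1)[OF c] assms finite_subset by blast+
    obtain f where f: "bij_betw f (S c) Bd" using finite_same_card_bij[OF fin S(2)[OF c]] by blast
    have "card (H - S c) = card (H - Bd)"
      using S(1,2)[OF c] assms fin by (simp add: card_Diff_subset)
    then obtain g where g: "bij_betw g (H - S c) (H - Bd)"
      using finite_same_card_bij[of "H - S c" "H - Bd"] assms(1) by auto
    let ?p = "\<lambda>h. if h \<in> S c then f h else g h"
    have "bij_betw ?p (S c) Bd" using f by (rule bij_betw_cong[THEN iffD1, rotated]) auto
    moreover have "bij_betw ?p (H - S c) (H - Bd)" using g by (rule bij_betw_cong[THEN iffD1, rotated]) auto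
    ultimately have "bij_betw ?p (S c \<union> (H - S c)) (Bd \<union> (H - Bd))" by (rule bij_betw_combine) auto
    moreover have "S c \<union> (H - S c) = H" "Bd \<union> (H - Bd) = H" using S(1)[OF c] assms(2) by auto
    ultimately have 1: "bij_betw ?p H H" by (simp only:)
    have 2: "\<forall>h\<in>H. ?p h \<in> Bd \<longrightarrow> h \<in> S c" using bij_betwE[OF g] by auto
    show ?thesis by (rule exI[of _ ?p], rule conjI[OF 1 2])
  qed
  then have "\<forall>c. \<exists>p. c < N \<longrightarrow> bij_betw p H H \<and> (\<forall>h\<in>H. p h \<in> Bd \<longrightarrow> h \<in> S c)" by blast
  from choice[OF this] obtain \<pi> where \<pi>: "\<forall>c. c < N \<longrightarrow> bij_betw (\<pi> c) H H \<and> (\<forall>h\<in>H. \<pi> c h \<in> Bd \<longrightarrow> h \<in> S c)" by blast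
  show ?thesis
  proof (rule that[of \<pi>])
    show "bij_betw (\<pi> c) H H" if "c < N" for c using \<pi> that by blast
    show "c = c'" if "c < N" "c' < N" "h \<in> H" "\<pi> c h \<in> Bd" "\<pi> c' h \<in> Bd" for c c' h
    proof (rule ccontr)
      assume "c \<noteq> c'"
      then have "S c \<inter> S c' = {}" using S(3) that by blast
      moreover have "h \<in> S c" "h \<in> S c'" using \<pi> that by blast+
      ultimately show False by blast
    qed
  qed
qed

lemma exp_plus_exp_minus_le:
  assumes "\<bar>a\<bar> \<le> (1::real)" shows "exp (-a) + exp a \<le> 2 * exp (a\<^sup>2)"
proof -
  have main: "exp (-a) + exp a \<le> 2 * exp (a\<^sup>2)" if "0 \<le> a" "a \<le> 1" for a :: real
  proof -
    have 1: "exp a \<le> 1 + a + a\<^sup>2" using exp_bound[OF that] .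
    have "exp (-a) = inverse (exp a)" by (rule exp_minus)
    also have "\<dots> \<le> inverse (1 + a)" using that exp_ge_add_one_self[of a] by (intro le_imp_inverse_le) auto
    also have "\<dots> \<le> 1 - a + a\<^sup>2"
    proof -
      have "(1 + a) * (1 - a + a\<^sup>2) = 1 + a ^ 3" by (simp add: algebra_simps power2_eq_square power3_eq_cube)
      then have "1 \<le> (1 + a) * (1 - a + a\<^sup>2)" using that by simp
      then show ?thesis using that by (simp add: field_simps)
    qed
    finally have "exp (-a) + exp a \<le> 2 * (1 + a\<^sup>2)" using 1 by simp
    also have "\<dots> \<le> 2 * exp (a\<^sup>2)" using exp_ge_add_one_self[of "a\<^sup>2"] by (intro mult_left_mono) auto
    finally show ?thesis .
  qed
  show ?thesis using main[of "\<bar>a\<bar>"] assms by (cases "a \<ge> 0") auto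
qed

text \<open>The exponential moment is at most \<open>exp (\<Sum>a\<^sub>k\<^sup>2)\<close>, since \<open>cosh a \<le> exp (a\<^sup>2)\<close> for \<open>\<bar>a\<bar> \<le> 1\<close>.
An exponential tail is enough for the sequel.\<close>

lemma rademacher_tail:
  assumes K: "finite K" and a: "(\<Sum>k\<in>K. (a k)\<^sup>2) \<le> 1"
  shows "real (card {\<epsilon> \<in> sign_cube K. t \<le> \<bar>\<Sum>k\<in>K. \<epsilon> k * a k\<bar>}) \<le> 2 * exp (1 - t) * 2 ^ card K"
proof -
  have a1: "\<bar>a k\<bar> \<le> 1" if "k \<in> K" for k
  proof -
    have "(a k)\<^sup>2 \<le> (\<Sum>k\<in>K. (a k)\<^sup>2)" by (rule member_le_sum[OF that]) (auto simp: K)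
    then have "(a k)\<^sup>2 \<le> 1" using a by linarith
    then show ?thesis by (simp add: abs_square_le_1)
  qed
  have gen: "(\<Sum>\<epsilon>\<in>sign_cube K. exp (\<Sum>k\<in>K. \<epsilon> k * b k)) \<le> exp 1 * 2 ^ card K"
    if b: "\<And>k. k \<in> K \<Longrightarrow> (b k)\<^sup>2 = (a k)\<^sup>2" for b
  proof -
    have b1: "\<bar>b k\<bar> \<le> 1" if "k \<in> K" for k using a1[OF that] b[OF that] abs_square_le_1[of "a k"] abs_square_le_1[of "b k"] by simp
    have "(\<Sum>\<epsilon>\<in>sign_cube K. exp (\<Sum>k\<in>K. \<epsilon> k * b k)) = (\<Sum>\<epsilon>\<in>sign_cube K. \<Prod>k\<in>K. exp (\<epsilon> k * b k))"
      by (simp add: exp_sum K)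
    also have "\<dots> = (\<Prod>k\<in>K. \<Sum>s\<in>{-1, 1}. exp (s * b k))"
      unfolding sign_cube_def by (rule prod_sum_PiE[symmetric]) (auto simp: K)
    also have "\<dots> = (\<Prod>k\<in>K. exp (- b k) + exp (b k))" by (intro prod.cong) auto
    also have "\<dots> \<le> (\<Prod>k\<in>K. 2 * exp ((b k)\<^sup>2))"
      using exp_plus_exp_minus_le[OF b1] by (intro prod_mono) (auto intro: add_nonneg_nonneg)
    also have "\<dots> = 2 ^ card K * exp (\<Sum>k\<in>K. (b k)\<^sup>2)" by (simp add: prod.distrib exp_sum K)
    also have "\<dots> \<le> 2 ^ card K * exp 1" using a b by (intro mult_left_mono) auto
    finally show ?thesis by (simp add: mult.commute)
  qed
  let ?g = "\<lambda>\<epsilon>. \<Sum>k\<in>K. \<epsilon> k * a k"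
  let ?T = "{\<epsilon> \<in> sign_cube K. t \<le> \<bar>?g \<epsilon>\<bar>}"
  have "real (card ?T) * exp t = (\<Sum>\<epsilon>\<in>?T. exp t)" by simp
  also have "\<dots> \<le> (\<Sum>\<epsilon>\<in>?T. exp (?g \<epsilon>) + exp (- ?g \<epsilon>))"
  proof (rule sum_mono)
    fix \<epsilon> assume "\<epsilon> \<in> ?T"
    then have "t \<le> \<bar>?g \<epsilon>\<bar>" by simp
    then have "exp t \<le> exp \<bar>?g \<epsilon>\<bar>" by simp
    also have "\<dots> \<le> exp (?g \<epsilon>) + exp (- ?g \<epsilon>)" by (cases "?g \<epsilon> \<ge> 0") auto
    finally show "exp t \<le> exp (?g \<epsilon>) + exp (- ?g \<epsilon>)" .
  qed
  also have "\<dots> \<le> (\<Sum>\<epsilon>\<in>sign_cube K. exp (?g \<epsilon>) + exp (- ?g \<epsilon>))"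
    by (rule sum_mono2) (auto simp: K intro: add_nonneg_nonneg)
  also have "\<dots> = (\<Sum>\<epsilon>\<in>sign_cube K. exp (?g \<epsilon>)) + (\<Sum>\<epsilon>\<in>sign_cube K. exp (\<Sum>k\<in>K. \<epsilon> k * (- a k)))"
    by (simp add: sum.distrib sum_negf)
  also have "\<dots> \<le> exp 1 * 2 ^ card K + exp 1 * 2 ^ card K"
    by (intro add_mono gen) auto
  finally show ?thesis by (simp add: exp_diff field_simps)
qed

lemma sum_at_most_one:
  fixes z :: "nat \<Rightarrow> real"
  assumes "\<And>c. c < N \<Longrightarrow> \<bar>z c\<bar> \<le> B" "\<And>c c'. c < N \<Longrightarrow> c' < N \<Longrightarrow> z c \<noteq> 0 \<Longrightarrow> z c' \<noteq> 0 \<Longrightarrow> c = c'" "B \<ge> 0"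
  shows "\<bar>\<Sum>c<N. z c\<bar> \<le> B"
proof (cases "\<exists>c<N. z c \<noteq> 0")
  case True
  then obtain c where c: "c < N" "z c \<noteq> 0" by blast
  have "(\<Sum>c<N. z c) = (\<Sum>d<N. if d = c then z c else 0)"
    using assms(2)[OF c(1) _ c(2)] by (intro sum.cong) auto
  also have "\<dots> = z c" using c by simp
  finally show ?thesis using assms(1)[OF c(1)] by simp
qed (use assms(3) in auto)

text \<open>\<open>P\<close> selects a band of values and \<open>N\<close> measures how rare it is.  In each block \<open>j\<close>, choose \<open>N\<close>
permutations of the signs of the block such that the band is hit by at most one of the permuted
choices.  Together they give \<open>N\<close> permutations \<open>\<tau> c\<close> of all signs, and for each \<open>\<epsilon>\<close> a signed sum of
the vectors \<open>X (\<tau> c \<epsilon>)\<close> has in front of every \<open>y j\<close> at most one contribution, of size at most \<open>s\<close>.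
Cotype bounds the sum of the \<open>q\<close>-th powers over \<open>c\<close>; averaging over \<open>\<epsilon>\<close>, all \<open>c\<close> contribute alike.\<close>

lemma band_estimate:
  fixes y :: "'j \<Rightarrow> 'a::real_normed_vector" and N :: nat and a :: "'k \<Rightarrow> real" and blk :: "'k \<Rightarrow> 'j"
  assumes cot: "\<And>n. \<And>x::nat \<Rightarrow> 'a. (\<Sum>i<n. norm (x i) powr q) powr (1 / q) \<le>
        C * sqrt ((\<Sum>\<epsilon>\<in>sign_cube {..<n}. (norm (\<Sum>i<n. \<epsilon> i *\<^sub>R x i))\<^sup>2) / 2 ^ n)"
    and q: "q > 0" and C: "C \<ge> 0" and B: "B \<ge> 0" and K: "finite K" and J: "finite J"
    and bd: "\<And>\<theta>. (\<And>j. j \<in> J \<Longrightarrow> \<bar>\<theta> j\<bar> \<le> 1) \<Longrightarrow> norm (\<Sum>j\<in>J. \<theta> j *\<^sub>R y j) \<le> B"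
    and s: "s > 0" and Ps: "\<And>x. P x \<Longrightarrow> \<bar>x\<bar> \<le> s"
    and N: "\<And>j. j \<in> J \<Longrightarrow> card {h \<in> sign_cube {k\<in>K. blk k = j}. P (\<Sum>k\<in>{k\<in>K. blk k = j}. h k * a k)} * N
       \<le> 2 ^ card {k\<in>K. blk k = j}"
    and blk: "blk ` K \<subseteq> J"
  defines "g \<equiv> \<lambda>\<epsilon> j. \<Sum>k\<in>{k\<in>K. blk k = j}. \<epsilon> k * a k"
  shows "real N * (\<Sum>\<epsilon>\<in>sign_cube K. norm (\<Sum>j\<in>{j\<in>J. P (g \<epsilon> j)}. g \<epsilon> j *\<^sub>R y j) powr q)
     \<le> (s * C * B) powr q * 2 ^ card K"
proof -
  define Kj where "Kj j = {k\<in>K. blk k = j}" for j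
  define bad where "bad j = {h \<in> sign_cube (Kj j). P (\<Sum>k\<in>Kj j. h k * a k)}" for j
  have fKj: "finite (Kj j)" for j using K by (simp add: Kj_def)
  have g_eq: "g \<epsilon> j = (\<Sum>k\<in>Kj j. \<epsilon> k * a k)" for \<epsilon> j by (simp add: g_def Kj_def)
  have "\<exists>\<pi>. (\<forall>c<N. bij_betw (\<pi> c) (sign_cube (Kj j)) (sign_cube (Kj j))) \<and>
     (\<forall>c<N. \<forall>c'<N. \<forall>h\<in>sign_cube (Kj j). \<pi> c h \<in> bad j \<longrightarrow> \<pi> c' h \<in> bad j \<longrightarrow> c = c')" if "j \<in> J" for j
  proof -
    have "card (bad j) * N \<le> card (sign_cube (Kj j))"
      using N[OF that] K by (simp add: card_sign_cube bad_def Kj_def)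
    moreover have "finite (sign_cube (Kj j))" "bad j \<subseteq> sign_cube (Kj j)" using fKj by (auto simp: bad_def)
    ultimately obtain p where p: "\<And>c. c < N \<Longrightarrow> bij_betw (p c) (sign_cube (Kj j)) (sign_cube (Kj j))"
      "\<And>c c' h. c < N \<Longrightarrow> c' < N \<Longrightarrow> h \<in> sign_cube (Kj j) \<Longrightarrow> p c h \<in> bad j \<Longrightarrow> p c' h \<in> bad j \<Longrightarrow> c = c'"
      using disjoint_preimages[of "sign_cube (Kj j)" "bad j" N] by metis
    show ?thesis by (rule exI[of _ p]) (use p in blast)
  qed
  then have "\<forall>j. \<exists>\<pi>. j \<in> J \<longrightarrow> (\<forall>c<N. bij_betw (\<pi> c) (sign_cube (Kj j)) (sign_cube (Kj j))) \<and>
     (\<forall>c<N. \<forall>c'<N. \<forall>h\<in>sign_cube (Kj j). \<pi> c h \<in> bad j \<longrightarrow> \<pi> c' h \<in> bad j \<longrightarrow> c = c')" by blast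
  from choice[OF this] obtain \<pi> where \<pi>0: "\<forall>j. j \<in> J \<longrightarrow> (\<forall>c<N. bij_betw (\<pi> j c) (sign_cube (Kj j)) (sign_cube (Kj j))) \<and>
     (\<forall>c<N. \<forall>c'<N. \<forall>h\<in>sign_cube (Kj j). \<pi> j c h \<in> bad j \<longrightarrow> \<pi> j c' h \<in> bad j \<longrightarrow> c = c')" by blast
  have \<pi>: "\<And>j c. j \<in> J \<Longrightarrow> c < N \<Longrightarrow> bij_betw (\<pi> j c) (sign_cube (Kj j)) (sign_cube (Kj j))"
    "\<And>j c c' h. j \<in> J \<Longrightarrow> c < N \<Longrightarrow> c' < N \<Longrightarrow> h \<in> sign_cube (Kj j) \<Longrightarrow> \<pi> j c h \<in> bad j \<Longrightarrow> \<pi> j c' h \<in> bad j \<Longrightarrow> c = c'"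
    using \<pi>0 by blast+
  define \<tau> where "\<tau> c \<epsilon> = restrict (\<lambda>k. \<pi> (blk k) c (restrict \<epsilon> (Kj (blk k))) k) K" for c \<epsilon>
  have res: "restrict \<epsilon> (Kj j) \<in> sign_cube (Kj j)" if "\<epsilon> \<in> sign_cube K" for \<epsilon> j
    using that by (auto simp: sign_cube_def Kj_def PiE_def Pi_def)
  have \<tau>res: "restrict (\<tau> c \<epsilon>) (Kj j) = \<pi> j c (restrict \<epsilon> (Kj j))" if "\<epsilon> \<in> sign_cube K" "c < N" "j \<in> J" for c \<epsilon> j
  proof -
    have "\<pi> j c (restrict \<epsilon> (Kj j)) \<in> sign_cube (Kj j)"
      using bij_betwE[OF \<pi>(1)[OF that(3,2)]] res[OF that(1)] by blast
    then have "\<pi> j c (restrict \<epsilon> (Kj j)) \<in> extensional (Kj j)" by (auto simp: sign_cube_def PiE_def)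
    then show ?thesis by (intro extensionalityI[of _ "Kj j"]) (auto simp: \<tau>_def Kj_def)
  qed
  have \<tau>in: "\<tau> c \<epsilon> \<in> sign_cube K" if "\<epsilon> \<in> sign_cube K" "c < N" for c \<epsilon>
    unfolding sign_cube_def
  proof (rule PiE_I)
    fix k assume k: "k \<in> K"
    then have j: "blk k \<in> J" using blk by auto
    have "\<pi> (blk k) c (restrict \<epsilon> (Kj (blk k))) \<in> sign_cube (Kj (blk k))"
      using bij_betwE[OF \<pi>(1)[OF j that(2)]] res[OF that(1)] by blast
    moreover have "k \<in> Kj (blk k)" using k by (simp add: Kj_def)
    ultimately show "\<tau> c \<epsilon> k \<in> {-1, 1}" using k by (auto simp: \<tau>_def sign_cube_def dest: PiE_mem)
  qed (simp add: \<tau>_def)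
  have bij: "bij_betw (\<tau> c) (sign_cube K) (sign_cube K)" if c: "c < N" for c
  proof -
    have "inj_on (\<tau> c) (sign_cube K)"
    proof (rule inj_onI)
      fix \<epsilon> \<epsilon>' assume e: "\<epsilon> \<in> sign_cube K" "\<epsilon>' \<in> sign_cube K" "\<tau> c \<epsilon> = \<tau> c \<epsilon>'"
      have "\<epsilon> k = \<epsilon>' k" if k: "k \<in> K" for k
      proof -
        have j: "blk k \<in> J" using k blk by auto
        have "\<pi> (blk k) c (restrict \<epsilon> (Kj (blk k))) = \<pi> (blk k) c (restrict \<epsilon>' (Kj (blk k)))"
          using \<tau>res[OF e(1) c j] \<tau>res[OF e(2) c j] e(3) by simp
        then have "restrict \<epsilon> (Kj (blk k)) = restrict \<epsilon>' (Kj (blk k))"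
          using inj_onD[OF bij_betw_imp_inj_on[OF \<pi>(1)[OF j c]]] res e by blast
        moreover have "k \<in> Kj (blk k)" using k by (simp add: Kj_def)
        ultimately show ?thesis by (metis restrict_apply')
      qed
      then show "\<epsilon> = \<epsilon>'" using e(1,2) unfolding sign_cube_def by (intro PiE_ext) auto
    qed
    moreover have "\<tau> c ` sign_cube K \<subseteq> sign_cube K" using \<tau>in c by auto
    ultimately show ?thesis using endo_inj_surj[of "sign_cube K" "\<tau> c"] K by (simp add: bij_betw_def)
  qed
  define X where "X \<epsilon> = (\<Sum>j\<in>{j\<in>J. P (g \<epsilon> j)}. g \<epsilon> j *\<^sub>R y j)" for \<epsilon>
  define w where "w c \<epsilon> j = (if P (g (\<tau> c \<epsilon>) j) then g (\<tau> c \<epsilon>) j else 0)" for c \<epsilon> j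
  have Xw: "X (\<tau> c \<epsilon>) = (\<Sum>j\<in>J. w c \<epsilon> j *\<^sub>R y j)" for c \<epsilon>
    unfolding X_def w_def using J by (simp add: sum.inter_filter[symmetric] if_distrib[of "\<lambda>u. u *\<^sub>R _"] cong: if_cong)
  have one: "c = c'" if e: "\<epsilon> \<in> sign_cube K" and c: "c < N" "c' < N" and j: "j \<in> J" and w: "w c \<epsilon> j \<noteq> 0" "w c' \<epsilon> j \<noteq> 0" for c c' \<epsilon> j
  proof -
    have "\<pi> j d (restrict \<epsilon> (Kj j)) \<in> bad j" if d: "d < N" "w d \<epsilon> j \<noteq> 0" for d
    proof -
      have "P (g (\<tau> d \<epsilon>) j)" using d by (auto simp: w_def split: if_splits)
      moreover have "g (\<tau> d \<epsilon>) j = (\<Sum>k\<in>Kj j. (restrict (\<tau> d \<epsilon>) (Kj j)) k * a k)" by (simp add: g_eq)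
      ultimately show ?thesis
        using bij_betwE[OF \<pi>(1)[OF j d(1)]] res[OF e] by (auto simp: bad_def \<tau>res[OF e d(1) j])
    qed
    then show ?thesis using \<pi>(2)[OF j c res[OF e]] c w by blast
  qed
  have "(\<Sum>c<N. norm (X (\<tau> c \<epsilon>)) powr q) \<le> (C * (s * B)) powr q" if e: "\<epsilon> \<in> sign_cube K" for \<epsilon>
  proof (rule cotype_of_bounded_sign_sums[OF cot q C])
    fix \<eta> :: "nat \<Rightarrow> real" assume \<eta>: "\<eta> \<in> sign_cube {..<N}"
    let ?\<theta> = "\<lambda>j. (\<Sum>c<N. \<eta> c * w c \<epsilon> j) / s"
    have "(\<Sum>c<N. \<eta> c *\<^sub>R X (\<tau> c \<epsilon>)) = (\<Sum>c<N. \<Sum>j\<in>J. (\<eta> c * w c \<epsilon> j) *\<^sub>R y j)"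
      unfolding Xw by (simp add: scaleR_sum_right)
    also have "\<dots> = (\<Sum>j\<in>J. (\<Sum>c<N. \<eta> c * w c \<epsilon> j) *\<^sub>R y j)"
      by (subst sum.swap) (simp add: scaleR_sum_left)
    also have "\<dots> = s *\<^sub>R (\<Sum>j\<in>J. ?\<theta> j *\<^sub>R y j)" using s by (simp add: scaleR_sum_right)
    finally have eq: "(\<Sum>c<N. \<eta> c *\<^sub>R X (\<tau> c \<epsilon>)) = s *\<^sub>R (\<Sum>j\<in>J. ?\<theta> j *\<^sub>R y j)" .
    have "\<bar>\<Sum>c<N. \<eta> c * w c \<epsilon> j\<bar> \<le> s" if j: "j \<in> J" for j
    proof (rule sum_at_most_one)
      show "\<bar>\<eta> c * w c \<epsilon> j\<bar> \<le> s" if "c < N" for c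
        using sign_cube_abs[OF \<eta>, of c] that Ps s by (auto simp: abs_mult w_def)
      show "c = c'" if "c < N" "c' < N" "\<eta> c * w c \<epsilon> j \<noteq> 0" "\<eta> c' * w c' \<epsilon> j \<noteq> 0" for c c'
        using one[OF e that(1,2) j] that by auto
    qed (use s in auto)
    then have "norm (\<Sum>j\<in>J. ?\<theta> j *\<^sub>R y j) \<le> B" using s by (intro bd) simp
    then show "norm (\<Sum>c<N. \<eta> c *\<^sub>R X (\<tau> c \<epsilon>)) \<le> s * B" unfolding eq using s by simp
  qed (use s B in auto)
  then have "(\<Sum>\<epsilon>\<in>sign_cube K. \<Sum>c<N. norm (X (\<tau> c \<epsilon>)) powr q) \<le> (\<Sum>\<epsilon>\<in>sign_cube K. (C * (s * B)) powr q)"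
    by (rule sum_mono)
  also have "\<dots> = (s * C * B) powr q * 2 ^ card K" using K by (simp add: card_sign_cube mult_ac)
  also have "(\<Sum>\<epsilon>\<in>sign_cube K. \<Sum>c<N. norm (X (\<tau> c \<epsilon>)) powr q) = (\<Sum>c<N. \<Sum>\<epsilon>\<in>sign_cube K. norm (X (\<tau> c \<epsilon>)) powr q)"
    by (rule sum.swap)
  also have "\<dots> = (\<Sum>c<N. \<Sum>\<epsilon>\<in>sign_cube K. norm (X \<epsilon>) powr q)"
    using bij by (intro sum.cong refl sum.reindex_bij_betw[where g = "\<lambda>\<epsilon>. norm (X \<epsilon>) powr q"]) auto
  finally show ?thesis by (simp add: X_def)
qed

text \<open>If \<open>u > s\<close>, then \<open>u\<^sup>2 = u\<^sup>2\<^sup>-\<^sup>q u\<^sup>q \<le> s\<^sup>2\<^sup>-\<^sup>q u\<^sup>q\<close>.  Used with an optimal \<open>s\<close> it replaces Hoelder's inequality.\<close>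

lemma young_powr:
  assumes "u \<ge> 0" "s > (0::real)" "q \<ge> 2" shows "u\<^sup>2 \<le> s\<^sup>2 + s powr (2 - q) * u powr q"
proof (cases "u \<le> s")
  case True
  then have "u\<^sup>2 \<le> s\<^sup>2" using assms by (intro power_mono)
  moreover have "0 \<le> s powr (2 - q) * u powr q" by simp
  ultimately show ?thesis by linarith
next
  case False
  then have "u powr (2 - q) \<le> s powr (2 - q)" using assms by (intro powr_mono2') auto
  then have "u powr (2 - q) * u powr q \<le> s powr (2 - q) * u powr q" by (rule mult_right_mono) simp
  moreover have "u powr (2 - q) * u powr q = u\<^sup>2" using False assms by (simp add: powr_add[symmetric])
  ultimately show ?thesis by (smt (verit) zero_le_power2)
qed

lemma sum_sq_weighted:
  fixes u :: "'i \<Rightarrow> real"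
  assumes "\<And>i. i \<in> I \<Longrightarrow> w i > 0"
  shows "(\<Sum>i\<in>I. u i)\<^sup>2 \<le> (\<Sum>i\<in>I. w i) * (\<Sum>i\<in>I. (u i)\<^sup>2 / w i)"
proof -
  have "(\<Sum>i\<in>I. u i)\<^sup>2 = (\<Sum>i\<in>I. sqrt (w i) * (u i / sqrt (w i)))\<^sup>2"
    using assms by (intro arg_cong[where f = "\<lambda>x. x\<^sup>2"] sum.cong refl) (use less_imp_neq in fastforce)
  also have "\<dots> \<le> (\<Sum>i\<in>I. (sqrt (w i))\<^sup>2) * (\<Sum>i\<in>I. (u i / sqrt (w i))\<^sup>2)"
    by (rule Cauchy_Schwarz_ineq_sum)
  also have "\<dots> = (\<Sum>i\<in>I. w i) * (\<Sum>i\<in>I. (u i)\<^sup>2 / w i)"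
    using assms by (intro arg_cong2[where f="(*)"] sum.cong refl) (simp_all add: power_divide less_imp_le)
  finally show ?thesis .
qed

definition sign_avg :: "'k set \<Rightarrow> (('k \<Rightarrow> real) \<Rightarrow> real) \<Rightarrow> real" where
  "sign_avg K F = (\<Sum>\<epsilon>\<in>sign_cube K. F \<epsilon>) / 2 ^ card K"

text \<open>If \<open>\<parallel>\<Sum>\<theta>\<^sub>j y\<^sub>j\<parallel> \<le> B\<close> for all coefficients in \<open>[-1, 1]\<close>, then the bound persists in mean square when
the coefficients are independent Rademacher sums of variance at most one; without finite cotype this
fails, for instance for the unit vectors in \<open>c\<^sub>0\<close>.  The coefficients are split into the bands
\<open>n \<le> \<bar>g\<bar> < n + 1\<close>, to which the preceding lemmas apply; the contribution of a band decays
like \<open>(n + 1) exp (- n / q)\<close>.\<close>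

lemma blocked_sign_average_bound:
  assumes "has_cotype TYPE('a::real_normed_vector) q" "q \<ge> 2"
  shows "\<exists>D>0. \<forall>(K::'k set) (J::'j set) (blk::'k \<Rightarrow> 'j) (a::'k \<Rightarrow> real) (y::'j \<Rightarrow> 'a) B. finite K \<longrightarrow> finite J \<longrightarrow> blk ` K \<subseteq> J \<longrightarrow> B \<ge> 0 \<longrightarrow>
    (\<forall>j\<in>J. (\<Sum>k\<in>{k\<in>K. blk k = j}. (a k)\<^sup>2) \<le> 1) \<longrightarrow>
    (\<forall>\<theta>. (\<forall>j\<in>J. \<bar>\<theta> j\<bar> \<le> 1) \<longrightarrow> norm (\<Sum>j\<in>J. \<theta> j *\<^sub>R y j) \<le> B) \<longrightarrow>
    sign_avg K (\<lambda>\<epsilon>. (norm (\<Sum>k\<in>K. (\<epsilon> k * a k) *\<^sub>R y (blk k)))\<^sup>2) \<le> D * B\<^sup>2"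
proof -
  obtain C where C: "C > 0" and cot: "\<And>n. \<And>x::nat \<Rightarrow> 'a. (\<Sum>i<n. norm (x i) powr q) powr (1 / q) \<le>
        C * sqrt ((\<Sum>\<epsilon>\<in>sign_cube {..<n}. (norm (\<Sum>i<n. \<epsilon> i *\<^sub>R x i))\<^sup>2) / 2 ^ n)"
    using assms(1) unfolding has_cotype_def sign_cube_def by blast
  \<comment> \<open>Weights for the Cauchy-Schwarz inequality over the bands.\<close>
  define \<rho> where "\<rho> n = exp (- real n / q)" for n
  \<comment> \<open>The number of permutations used for the \<open>n\<close>-th band: by the tail bound the band has probability at most \<open>2 exp (1 - n)\<close>.\<close>
  define M where "M n = max 1 (nat \<lfloor>exp (real n - 1) / 2\<rfloor>)" for n
  have M_ge: "exp (real n - 1) / 4 \<le> real (M n)" for n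
  proof (cases "exp (real n - 1) / 2 \<ge> 1")
    case True
    then have "real (nat \<lfloor>exp (real n - 1) / 2\<rfloor>) \<ge> exp (real n - 1) / 2 - 1" by linarith
    moreover have "1 \<le> nat \<lfloor>exp (real n - 1) / 2\<rfloor>" using True by linarith
    ultimately show ?thesis unfolding M_def by linarith
  next
    case False
    then show ?thesis unfolding M_def by (simp add: max_def)
  qed
  define f where "f n = (real n + 1)\<^sup>2 * exp (- real n / q)" for n
  have sf: "summable f" 
  proof (rule summable_comparison_test_bigo)
    show "summable (\<lambda>n. norm (inverse (real n ^ 2)))"
      using inverse_power_summable[of 2, where 'a = real] by simp
    show "f \<in> O(\<lambda>n. inverse (real n ^ 2))"
      unfolding f_def using assms(2) by real_asymp
  qed
  have srho: "summable \<rho>"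
  proof (rule summable_comparison_test[OF _ sf])
    show "\<exists>N. \<forall>n\<ge>N. norm (\<rho> n) \<le> f n"
      by (intro exI[of _ 0] allI impI) (simp add: \<rho>_def f_def)
  qed
  define D where "D = suminf \<rho> * (2 * C\<^sup>2 * (4 * exp 1) powr (2 / q) * suminf f)"
  have rho0: "\<rho> n > 0" "f n > 0" for n by (simp_all add: \<rho>_def f_def)
  have D: "D > 0" unfolding D_def using C suminf_pos[OF srho rho0(1)] suminf_pos[OF sf rho0(2)] by simp
  show ?thesis
  proof (intro exI[of _ D] conjI D allI impI)
    fix K :: "'k set" and J :: "'j set" and blk :: "'k \<Rightarrow> 'j" and a :: "'k \<Rightarrow> real" and y :: "'j \<Rightarrow> 'a" and B :: real
    assume K: "finite K" and J: "finite J" and blk: "blk ` K \<subseteq> J" and B: "B \<ge> 0"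
      and a: "\<forall>j\<in>J. (\<Sum>k\<in>{k\<in>K. blk k = j}. (a k)\<^sup>2) \<le> 1"
      and bd: "\<forall>\<theta>. (\<forall>j\<in>J. \<bar>\<theta> j\<bar> \<le> 1) \<longrightarrow> norm (\<Sum>j\<in>J. \<theta> j *\<^sub>R y j) \<le> B"
    define g where "g \<epsilon> j = (\<Sum>k\<in>{k\<in>K. blk k = j}. \<epsilon> k * a k)" for \<epsilon> j
    define P where "P n x \<longleftrightarrow> real n \<le> \<bar>x\<bar> \<and> \<bar>x\<bar> < real n + 1" for n :: nat and x :: real
    define X where "X n \<epsilon> = (\<Sum>j\<in>{j\<in>J. P n (g \<epsilon> j)}. g \<epsilon> j *\<^sub>R y j)" for n \<epsilon>
    have band: "real (M n) * (\<Sum>\<epsilon>\<in>sign_cube K. norm (X n \<epsilon>) powr q) \<le> ((real n + 1) * C * B) powr q * 2 ^ card K" for n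
      unfolding X_def g_def
    proof (rule band_estimate[OF cot _ _ B K J])
      fix j assume j: "j \<in> J"
      let ?Kj = "{k\<in>K. blk k = j}"
      let ?b = "{h \<in> sign_cube ?Kj. P n (\<Sum>k\<in>?Kj. h k * a k)}"
      have fin: "finite ?Kj" using K by simp
      have c1: "card ?b \<le> card (sign_cube ?Kj)" by (rule card_mono) (auto simp: fin)
      have "card ?b \<le> card {h \<in> sign_cube ?Kj. real n \<le> \<bar>\<Sum>k\<in>?Kj. h k * a k\<bar>}"
        by (rule card_mono) (auto simp: fin P_def)
      then have c2: "real (card ?b) \<le> 2 * exp (1 - real n) * 2 ^ card ?Kj"
        using rademacher_tail[OF fin, of a "real n"] a j by (meson of_nat_le_iff order_trans)
      show "card ?b * M n \<le> 2 ^ card ?Kj"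
      proof (cases "exp (real n - 1) / 2 \<ge> 1")
        case True
        then have "real (M n) \<le> exp (real n - 1) / 2" unfolding M_def by linarith
        then have "real (card ?b) * real (M n) \<le> (2 * exp (1 - real n) * 2 ^ card ?Kj) * (exp (real n - 1) / 2)"
          using c2 by (intro mult_mono) auto
        also have "\<dots> = (exp (1 - real n) * exp (real n - 1)) * 2 ^ card ?Kj" by simp
        also have "\<dots> = 2 ^ card ?Kj" by (simp add: exp_add[symmetric])
        finally have "real (card ?b * M n) \<le> real (2 ^ card ?Kj)" by simp
        then show ?thesis by (simp only: of_nat_le_iff)
      next
        case False
        then have "M n = 1" unfolding M_def by (simp add: max_def)
        then show ?thesis using c1 fin by (simp add: card_sign_cube)
      qed
    qed (use assms(2) C bd blk in \<open>auto simp: P_def\<close>)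
    have Mp: "real (M n) > 0" for n by (simp add: M_def)
    have sq: "(\<Sum>\<epsilon>\<in>sign_cube K. (norm (X n \<epsilon>))\<^sup>2) \<le> 2 * (real n + 1)\<^sup>2 * C\<^sup>2 * B\<^sup>2 * (4 * exp 1) powr (2 / q) * exp (- 2 * real n / q) * 2 ^ card K" for n
    proof (cases "B = 0")
      case True
      have "(\<Sum>\<epsilon>\<in>sign_cube K. norm (X n \<epsilon>) powr q) \<le> 0"
        using band[of n] True mult_le_0_iff[of "real (M n)"] Mp[of n] by simp
      then have "\<forall>\<epsilon>\<in>sign_cube K. norm (X n \<epsilon>) powr q = 0"
        using sum_nonneg_eq_0_iff[of "sign_cube K" "\<lambda>\<epsilon>. norm (X n \<epsilon>) powr q"] K
        by (smt (verit) finite_sign_cube powr_ge_zero sum_nonneg)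
      then show ?thesis using True by simp
    next
      case False
      define s where "s = (real n + 1) * C * B * real (M n) powr (- 1 / q)"
      note Mp = Mp[of n]
      have s: "s > 0" unfolding s_def using False B C Mp by simp
      have b: "(real n + 1) * C * B > 0" using False B C by simp
      have "(\<Sum>\<epsilon>\<in>sign_cube K. (norm (X n \<epsilon>))\<^sup>2) \<le> (\<Sum>\<epsilon>\<in>sign_cube K. s\<^sup>2 + s powr (2 - q) * norm (X n \<epsilon>) powr q)"
        using s assms(2) by (intro sum_mono young_powr) auto
      also have "\<dots> = s\<^sup>2 * 2 ^ card K + s powr (2 - q) * (\<Sum>\<epsilon>\<in>sign_cube K. norm (X n \<epsilon>) powr q)"
        using K by (simp add: sum.distrib card_sign_cube sum_distrib_left)
      also have "(\<Sum>\<epsilon>\<in>sign_cube K. norm (X n \<epsilon>) powr q) \<le> s powr q * 2 ^ card K"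
      proof -
        have "s powr q = ((real n + 1) * C * B) powr q * real (M n) powr (- 1)"
          unfolding s_def using b Mp assms(2) by (subst powr_mult) (auto simp: powr_powr)
        then have "s powr q * real (M n) = ((real n + 1) * C * B) powr q"
          using Mp by (simp add: powr_minus)
        then have "real (M n) * (s powr q * 2 ^ card K) = ((real n + 1) * C * B) powr q * 2 ^ card K"
          by (metis mult.assoc mult.commute)
        then have "real (M n) * (\<Sum>\<epsilon>\<in>sign_cube K. norm (X n \<epsilon>) powr q) \<le> real (M n) * (s powr q * 2 ^ card K)"
          using band[of n] by linarith
        then show ?thesis using Mp by simp
      qed
      also have "s powr (2 - q) * (s powr q * 2 ^ card K) = s\<^sup>2 * 2 ^ card K"
        using s by (simp add: mult.assoc[symmetric] powr_add[symmetric])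
      finally have 1: "(\<Sum>\<epsilon>\<in>sign_cube K. (norm (X n \<epsilon>))\<^sup>2) \<le> 2 * s\<^sup>2 * 2 ^ card K"
        using s by (simp add: mult_left_mono)
      have "(real (M n) powr (- 1 / q))\<^sup>2 = real (M n) powr (- 2 / q)"
        using Mp by (simp add: powr_powr powr_realpow[symmetric])
      also have "\<dots> \<le> (exp (real n - 1) / 4) powr (- 2 / q)"
        using M_ge[of n] assms(2) by (intro powr_mono2') auto
      also have "\<dots> = (exp (real n) / (4 * exp 1)) powr (- 2 / q)" by (simp add: exp_diff mult.commute)
      also have "\<dots> = (4 * exp 1) powr (2 / q) * exp (- 2 * real n / q)"
        by (subst powr_divide) (auto simp: powr_minus powr_def field_simps exp_minus)
      finally have 2: "(real (M n) powr (- 1 / q))\<^sup>2 \<le> (4 * exp 1) powr (2 / q) * exp (- 2 * real n / q)" .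
      have "s\<^sup>2 = (real n + 1)\<^sup>2 * C\<^sup>2 * B\<^sup>2 * (real (M n) powr (- 1 / q))\<^sup>2" by (simp add: s_def power_mult_distrib)
      also have "\<dots> \<le> (real n + 1)\<^sup>2 * C\<^sup>2 * B\<^sup>2 * ((4 * exp 1) powr (2 / q) * exp (- 2 * real n / q))"
        by (intro mult_left_mono 2) auto
      finally have "s\<^sup>2 \<le> (real n + 1)\<^sup>2 * C\<^sup>2 * B\<^sup>2 * ((4 * exp 1) powr (2 / q) * exp (- 2 * real n / q))" .
      then have "2 * s\<^sup>2 * 2 ^ card K \<le> 2 * ((real n + 1)\<^sup>2 * C\<^sup>2 * B\<^sup>2 * ((4 * exp 1) powr (2 / q) * exp (- 2 * real n / q))) * 2 ^ card K"
        by (intro mult_right_mono mult_left_mono) auto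
      also have "\<dots> = 2 * (real n + 1)\<^sup>2 * C\<^sup>2 * B\<^sup>2 * (4 * exp 1) powr (2 / q) * exp (- 2 * real n / q) * 2 ^ card K"
        by (simp only: mult_ac)
      finally show ?thesis using 1 by (rule order_trans[rotated])
    qed
    \<comment> \<open>Only finitely many bands are nonempty.\<close>
    obtain L :: nat where L: "(\<Sum>k\<in>K. \<bar>a k\<bar>) < real L" using reals_Archimedean2 by blast
    have glt: "\<bar>g \<epsilon> j\<bar> < L" if "\<epsilon> \<in> sign_cube K" for \<epsilon> j
    proof -
      have "\<bar>g \<epsilon> j\<bar> \<le> (\<Sum>k\<in>{k\<in>K. blk k = j}. \<bar>\<epsilon> k * a k\<bar>)" unfolding g_def by (rule sum_abs)
      also have "\<dots> \<le> (\<Sum>k\<in>K. \<bar>\<epsilon> k * a k\<bar>)" by (rule sum_mono2) (auto simp: K)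
      also have "\<dots> = (\<Sum>k\<in>K. \<bar>a k\<bar>)" using sign_cube_abs[OF that] by (intro sum.cong) (auto simp: abs_mult)
      finally show ?thesis using L by simp
    qed
    have split: "(\<Sum>k\<in>K. (\<epsilon> k * a k) *\<^sub>R y (blk k)) = (\<Sum>n<L. X n \<epsilon>)" if e: "\<epsilon> \<in> sign_cube K" for \<epsilon>
    proof -
      have "(\<Sum>k\<in>K. (\<epsilon> k * a k) *\<^sub>R y (blk k)) = (\<Sum>j\<in>J. \<Sum>k\<in>{k\<in>K. blk k = j}. (\<epsilon> k * a k) *\<^sub>R y (blk k))"
        by (rule sum.group[OF K J blk, symmetric])
      also have "\<dots> = (\<Sum>j\<in>J. g \<epsilon> j *\<^sub>R y j)"
        unfolding g_def by (intro sum.cong refl) (simp add: scaleR_sum_left)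
      also have "\<dots> = (\<Sum>j\<in>J. \<Sum>n<L. if P n (g \<epsilon> j) then g \<epsilon> j *\<^sub>R y j else 0)"
      proof (rule sum.cong[OF refl])
        fix j assume "j \<in> J"
        have P: "P n (g \<epsilon> j) \<longleftrightarrow> n = nat \<lfloor>\<bar>g \<epsilon> j\<bar>\<rfloor>" for n unfolding P_def by linarith
        have "nat \<lfloor>\<bar>g \<epsilon> j\<bar>\<rfloor> < L" using glt[OF e, of j] by linarith
        then show "g \<epsilon> j *\<^sub>R y j = (\<Sum>n<L. if P n (g \<epsilon> j) then g \<epsilon> j *\<^sub>R y j else 0)"
          unfolding P by simp
      qed
      also have "\<dots> = (\<Sum>n<L. X n \<epsilon>)"
        by (subst sum.swap) (simp add: X_def sum.inter_filter J)
      finally show ?thesis .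
    qed
    have "(\<Sum>\<epsilon>\<in>sign_cube K. (norm (\<Sum>k\<in>K. (\<epsilon> k * a k) *\<^sub>R y (blk k)))\<^sup>2)
      \<le> (\<Sum>\<epsilon>\<in>sign_cube K. (\<Sum>n<L. \<rho> n) * (\<Sum>n<L. (norm (X n \<epsilon>))\<^sup>2 / \<rho> n))"
    proof (rule sum_mono)
      fix \<epsilon> assume e: "\<epsilon> \<in> sign_cube K"
      have "(norm (\<Sum>k\<in>K. (\<epsilon> k * a k) *\<^sub>R y (blk k)))\<^sup>2 \<le> (\<Sum>n<L. norm (X n \<epsilon>))\<^sup>2"
        unfolding split[OF e] by (intro power_mono norm_sum) auto
      also have "\<dots> \<le> (\<Sum>n<L. \<rho> n) * (\<Sum>n<L. (norm (X n \<epsilon>))\<^sup>2 / \<rho> n)"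
        by (rule sum_sq_weighted) (rule rho0)
      finally show "(norm (\<Sum>k\<in>K. (\<epsilon> k * a k) *\<^sub>R y (blk k)))\<^sup>2 \<le> (\<Sum>n<L. \<rho> n) * (\<Sum>n<L. (norm (X n \<epsilon>))\<^sup>2 / \<rho> n)" .
    qed
    also have "\<dots> = (\<Sum>n<L. \<rho> n) * (\<Sum>n<L. (\<Sum>\<epsilon>\<in>sign_cube K. (norm (X n \<epsilon>))\<^sup>2) / \<rho> n)"
      unfolding sum_distrib_left[symmetric] by (subst sum.swap) (simp add: sum_divide_distrib)
    also have "\<dots> \<le> (\<Sum>n<L. \<rho> n) * (\<Sum>n<L. f n * (2 * C\<^sup>2 * (4 * exp 1) powr (2 / q) * B\<^sup>2 * 2 ^ card K))"
    proof (intro mult_left_mono sum_mono sum_nonneg)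
      fix n
      have "(\<Sum>\<epsilon>\<in>sign_cube K. (norm (X n \<epsilon>))\<^sup>2) / \<rho> n \<le> (2 * (real n + 1)\<^sup>2 * C\<^sup>2 * B\<^sup>2 * (4 * exp 1) powr (2 / q) * exp (- 2 * real n / q) * 2 ^ card K) / \<rho> n"
        using sq[of n] rho0(1)[of n] by (simp add: divide_right_mono)
      also have "\<dots> = (2 * (real n + 1)\<^sup>2 * C\<^sup>2 * B\<^sup>2 * (4 * exp 1) powr (2 / q) * 2 ^ card K) * (exp (- 2 * real n / q) / exp (- real n / q))"
        by (simp add: \<rho>_def)
      also have "exp (- 2 * real n / q) / exp (- real n / q) = exp (- real n / q)"
        by (simp add: exp_diff[symmetric] diff_divide_distrib[symmetric])
      finally show "(\<Sum>\<epsilon>\<in>sign_cube K. (norm (X n \<epsilon>))\<^sup>2) / \<rho> n \<le> f n * (2 * C\<^sup>2 * (4 * exp 1) powr (2 / q) * B\<^sup>2 * 2 ^ card K)"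
        by (simp add: f_def mult_ac)
    qed (use rho0 in \<open>auto intro: less_imp_le\<close>)
    also have "\<dots> = (\<Sum>n<L. \<rho> n) * (\<Sum>n<L. f n) * (2 * C\<^sup>2 * (4 * exp 1) powr (2 / q) * B\<^sup>2 * 2 ^ card K)"
      by (simp only: sum_distrib_right[symmetric] mult.assoc)
    also have "\<dots> \<le> suminf \<rho> * suminf f * (2 * C\<^sup>2 * (4 * exp 1) powr (2 / q) * B\<^sup>2 * 2 ^ card K)"
      using rho0 by (intro mult_right_mono mult_mono sum_le_suminf srho sf sum_nonneg suminf_nonneg) (auto intro: less_imp_le)
    also have "\<dots> = D * B\<^sup>2 * 2 ^ card K" by (simp add: D_def mult_ac)
    finally show "sign_avg K (\<lambda>\<epsilon>. (norm (\<Sum>k\<in>K. (\<epsilon> k * a k) *\<^sub>R y (blk k)))\<^sup>2) \<le> D * B\<^sup>2"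
      by (simp add: sign_avg_def field_simps)
  qed
qed

section \<open>Dyadic bounds on Stolz domains\<close>

lemma poly_exp_bounded:
  fixes \<alpha> C0 q :: real
  assumes "\<alpha> > 0" "C0 > 0" "q > 0"
  shows "\<exists>B>0. \<forall>x\<ge>0. (1 + x) * (1 + x powr \<alpha>) * (1 + q * x powr \<alpha>) * exp (- x / C0) \<le> B"
proof -
  let ?f = "\<lambda>x::real. (1 + x) * (1 + x powr \<alpha>) * (1 + q * x powr \<alpha>) * exp (- x / C0)"
  have "(?f \<longlongrightarrow> 0) at_top" using assms by real_asymp
  then have "\<forall>\<^sub>F x in at_top. ?f x < 1" by (rule order_tendstoD) simp
  then obtain x0 where x0: "\<And>x. x \<ge> x0 \<Longrightarrow> ?f x < 1" by (auto simp: eventually_at_top_linorder)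
  have "continuous_on {0..max x0 0} ?f"
    using assms by (intro continuous_intros continuous_on_powr') auto
  then have "bounded (?f ` {0..max x0 0})" by (intro compact_imp_bounded compact_continuous_image) auto
  then obtain M where M: "\<forall>x\<in>{0..max x0 0}. \<bar>?f x\<bar> \<le> M" unfolding bounded_iff by auto
  have "?f x \<le> \<bar>M\<bar> + 1" if "x \<ge> 0" for x
  proof (cases "x \<le> x0")
    case True
    then have "\<bar>?f x\<bar> \<le> M" using M that by auto
    then show ?thesis by linarith
  next
    case False
    then have "?f x < 1" using x0 by simp
    then show ?thesis by linarith
  qed
  then show ?thesis by (intro exI[of _ "\<bar>M\<bar> + 1"]) auto
qed

text \<open>The \<open>j\<close>-th term is \<open>1 / (q - 1)\<close> times \<open>1 / (1 + q\<^sup>j y\<^sub>0) - 1 / (1 + q\<^sup>j\<^sup>+\<^sup>1 y\<^sub>0)\<close>.\<close>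

lemma telescoping_sum:
  fixes q y0 :: real
  assumes "q > 1" "y0 \<ge> 0"
  shows "(\<Sum>j\<le>N::nat. q ^ j * y0 / ((1 + q ^ j * y0) * (1 + q * (q ^ j * y0)))) \<le> 1 / (q - 1)"
proof -
  have "(q - 1) * (\<Sum>j\<le>N. q ^ j * y0 / ((1 + q ^ j * y0) * (1 + q * (q ^ j * y0)))) = 1 / (1 + y0) - 1 / (1 + q ^ Suc N * y0)"
  proof (induction N)
    case 0
    have "1 + y0 > 0" "1 + q * y0 > 0" using assms by (auto intro: add_pos_nonneg)
    then show ?case by (simp add: field_simps)
  next
    case (Suc N)
    define y where "y = q ^ Suc N * y0"
    have y: "1 + y > 0" "1 + q * y > 0" using assms by (auto simp: y_def intro!: add_pos_nonneg)
    have "(q - 1) * (y / ((1 + y) * (1 + q * y))) = 1 / (1 + y) - 1 / (1 + q * y)"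
      using y by (simp add: field_simps)
    moreover have "q ^ Suc (Suc N) * y0 = q * y" by (simp add: y_def)
    ultimately show ?case using Suc by (simp only: sum.atMost_Suc distrib_left y_def[symmetric])
  qed
  also have "\<dots> \<le> 1" using assms by (simp add: field_simps add_pos_nonneg add_nonneg_nonneg)
  finally show ?thesis using assms by (simp add: field_simps)
qed

text \<open>With \<open>x = 2\<^sup>j \<bar>1 - z\<bar>\<close> the \<open>j\<close>-th term is at most a multiple of \<open>x\<^sup>\<alpha> (1 + x) exp (- x / C0)\<close>, because
\<open>\<bar>z\<bar> \<le> 1 - \<bar>1 - z\<bar> / C0\<close> on the domain.  This is dominated by \<open>x\<^sup>\<alpha> / ((1 + x\<^sup>\<alpha>) (1 + q x\<^sup>\<alpha>))\<close> with \<open>q = 2\<^sup>\<alpha>\<close>,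
and \<open>x\<^sup>\<alpha>\<close> runs through a geometric sequence of ratio \<open>q\<close>, so the sum telescopes.\<close>

lemma stolz_dyadic_sum:
  assumes \<gamma>: "0 < \<gamma>" "\<gamma> < pi/2" and \<alpha>: "\<alpha> > 0"
  shows "\<exists>C>0. \<forall>z\<in>stolz \<gamma>. \<forall>N::nat. (\<Sum>j\<le>N. (2 ^ j) powr \<alpha> * norm (1 - z) powr \<alpha> * norm z ^ (2 ^ j - 1) * (1 + 2 ^ j * norm (1 - z))) \<le> C"
proof -
  interpret stolz_angle \<gamma> by unfold_locales (use \<gamma> in auto)
  define C0 where "C0 = 2 / (1 - sin \<gamma>)"
  have C0: "C0 > 0" using sin01 by (simp add: C0_def)
  define q where "q = 2 powr \<alpha>"
  have q: "q > 1" using \<alpha> by (simp add: q_def)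
  obtain B where B: "B > 0" "\<And>x. x \<ge> 0 \<Longrightarrow> (1 + x) * (1 + x powr \<alpha>) * (1 + q * x powr \<alpha>) * exp (- x / C0) \<le> B"
    using poly_exp_bounded[OF \<alpha> C0, of q] q by auto
  define E where "E = exp (2 / C0)"
  have E: "E > 0" by (simp add: E_def)
  have "(\<Sum>j\<le>N. (2 ^ j) powr \<alpha> * norm (1 - z) powr \<alpha> * norm z ^ (2 ^ j - 1) * (1 + 2 ^ j * norm (1 - z))) \<le> E * B * (1 / (q - 1))"
    if z: "z \<in> stolz \<gamma>" for z N
  proof -
    define u where "u = norm (1 - z)"
    define \<rho> where "\<rho> = norm z"
    define y0 where "y0 = u powr \<alpha>"
    have \<rho>: "0 \<le> \<rho>" "\<rho> < 1" "u \<le> C0 * (1 - \<rho>)"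
      using stolz_geometry[OF z \<gamma>] by (auto simp: \<rho>_def u_def C0_def)
    have u: "0 \<le> u" "u \<le> 2" using norm_triangle_ineq4[of 1 z] \<rho>(2) by (auto simp: u_def \<rho>_def)
    have "u / C0 \<le> 1 - \<rho>" using \<rho>(3) C0 by (simp add: field_simps)
    then have "\<rho> \<le> 1 + (- (u / C0))" by simp
    also have "\<dots> \<le> exp (- (u / C0))" by (rule exp_ge_add_one_self)
    finally have \<rho>e: "\<rho> \<le> exp (- (u / C0))" .
    have tm: "(2 ^ j) powr \<alpha> * u powr \<alpha> * \<rho> ^ (2 ^ j - 1) * (1 + 2 ^ j * u) \<le> (E * B) * (q ^ j * y0 / ((1 + q ^ j * y0) * (1 + q * (q ^ j * y0))))" for j :: nat
    proof -
      define x where "x = 2 ^ j * u"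
      have x: "x \<ge> 0" using u by (simp add: x_def)
      have "(2 ^ j) powr \<alpha> = q ^ j" by (simp add: q_def powr_realpow[symmetric] powr_powr mult.commute)
      then have xa: "x powr \<alpha> = q ^ j * y0" using u by (simp add: x_def powr_mult y0_def)
      have y: "q ^ j * y0 \<ge> 0" using q by (simp add: y0_def)
      have "\<rho> ^ (2 ^ j - 1) \<le> exp (- (u / C0)) ^ (2 ^ j - 1)" using \<rho>e \<rho>(1) by (rule power_mono)
      also have "\<dots> = exp (- (real (2 ^ j - 1) * (u / C0)))" by (simp add: exp_of_nat_mult[symmetric])
      also have "real (2 ^ j - 1) = 2 ^ j - 1" by (simp add: of_nat_diff)
      also have "- ((2 ^ j - 1) * (u / C0)) = u / C0 + (- x / C0)" using C0 by (simp add: x_def field_simps)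
      also have "exp (u / C0 + (- x / C0)) = exp (u / C0) * exp (- x / C0)" by (rule exp_add)
      also have "\<dots> \<le> E * exp (- x / C0)" unfolding E_def using u C0 by (intro mult_right_mono) (auto simp: divide_right_mono)
      finally have r: "\<rho> ^ (2 ^ j - 1) \<le> E * exp (- x / C0)" .
      have "(1 + x) * exp (- x / C0) \<le> B / ((1 + q ^ j * y0) * (1 + q * (q ^ j * y0)))"
      proof -
        have pos: "(1 + q ^ j * y0) * (1 + q * (q ^ j * y0)) > 0" using y q by (intro mult_pos_pos add_pos_nonneg) auto
        have "((1 + x) * exp (- x / C0)) * ((1 + q ^ j * y0) * (1 + q * (q ^ j * y0))) \<le> B"
          using B(2)[OF x] unfolding xa by (simp only: mult_ac)
        then show ?thesis using pos by (simp only: pos_le_divide_eq)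
      qed
      then have "E * (q ^ j * y0) * ((1 + x) * exp (- x / C0)) \<le> E * (q ^ j * y0) * (B / ((1 + q ^ j * y0) * (1 + q * (q ^ j * y0))))"
        using E y by (intro mult_left_mono) auto
      moreover have "(2 ^ j) powr \<alpha> * u powr \<alpha> * \<rho> ^ (2 ^ j - 1) * (1 + 2 ^ j * u) \<le> (q ^ j * y0) * (E * exp (- x / C0)) * (1 + x)"
        using r x y \<open>(2 ^ j) powr \<alpha> = q ^ j\<close> unfolding x_def[symmetric] y0_def[symmetric]
        by (intro mult_right_mono mult_mono) (use \<rho>(1) q in \<open>auto simp: y0_def\<close>)
      ultimately show ?thesis by (simp add: mult_ac)
    qed
    have "(\<Sum>j\<le>N. (2 ^ j) powr \<alpha> * u powr \<alpha> * \<rho> ^ (2 ^ j - 1) * (1 + 2 ^ j * u)) \<le> (\<Sum>j\<le>N. (E * B) * (q ^ j * y0 / ((1 + q ^ j * y0) * (1 + q * (q ^ j * y0)))))"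
      by (rule sum_mono) (rule tm)
    also have "\<dots> = (E * B) * (\<Sum>j\<le>N. q ^ j * y0 / ((1 + q ^ j * y0) * (1 + q * (q ^ j * y0))))"
      by (simp only: sum_distrib_left)
    also have "\<dots> \<le> E * B * (1 / (q - 1))"
      using E B(1) telescoping_sum[OF q, of y0 N] by (intro mult_left_mono) (auto simp: y0_def)
    finally show ?thesis by (simp only: u_def \<rho>_def)
  qed
  moreover have "E * B * (1 / (q - 1)) > 0" using E B(1) q by simp
  ultimately show ?thesis by blast
qed

text \<open>The summation parameter \<open>s < 2\<^sup>j\<close> of block \<open>j\<close> is written as \<open>\<sigma> div 2\<^sup>J\<^sup>-\<^sup>j\<close> with \<open>\<sigma> < 2\<^sup>J\<close>, so that
one parameter \<open>\<sigma>\<close> serves all blocks \<open>j \<le> J\<close>.  The value \<open>\<sigma> = 2\<^sup>J\<close> stands for the boundary term of the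
summation by parts.\<close>

definition abel_weight :: "nat \<Rightarrow> nat \<Rightarrow> real" where
  "abel_weight J \<sigma> = (if \<sigma> = 2 ^ J then 1 else 1 / 2 ^ J)"

definition abel_fun :: "nat \<Rightarrow> nat \<Rightarrow> nat \<Rightarrow> complex \<Rightarrow> complex" where
  "abel_fun J j \<sigma> z = (if \<sigma> = 2 ^ J then z ^ (2 ^ j) else 2 ^ j * (z ^ (\<sigma> div 2 ^ (J - j)) * (1 - z)))"

lemma sum_div_block:
  fixes g :: "nat \<Rightarrow> 'b::comm_semiring_1"
  assumes "m > 0"
  shows "(\<Sum>\<sigma><n * m. g (\<sigma> div m)) = of_nat m * (\<Sum>s<n. g s)"
proof -
  have "(\<Sum>\<sigma><n * m. g (\<sigma> div m)) = (\<Sum>s<n. \<Sum>\<sigma>\<in>{s * m..<s * m + m}. g (\<sigma> div m))"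
    by (rule sum.nat_group[symmetric])
  also have "\<dots> = (\<Sum>s<n. \<Sum>\<sigma>\<in>{s * m..<s * m + m}. g s)"
  proof (intro sum.cong refl)
    fix s \<sigma> assume "\<sigma> \<in> {s * m..<s * m + m}"
    then have "\<sigma> div m = s" using assms by (intro div_nat_eqI) (auto simp: algebra_simps)
    then show "g (\<sigma> div m) = g s" by simp
  qed
  also have "\<dots> = of_nat m * (\<Sum>s<n. g s)" by (simp add: sum_distrib_left)
  finally show ?thesis .
qed

text \<open>Summation by parts: \<open>z\<^sup>l = z\<^sup>m + \<Sum>l\<le>s<m. z\<^sup>s (1 - z)\<close> for \<open>m = 2\<^sup>j\<close>.  Each \<open>s\<close> comes from \<open>2\<^sup>J\<^sup>-\<^sup>j\<close> values of
\<open>\<sigma>\<close> of weight \<open>2\<^sup>-\<^sup>J\<close>, and the resulting factor \<open>2\<^sup>-\<^sup>j\<close> cancels against the \<open>2\<^sup>j\<close> in \<open>abel_fun\<close>.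
The exponent \<open>l\<close> enters only through the indicator.\<close>

lemma abel_identity:
  assumes "j \<le> J" "l < 2 ^ j"
  shows "z ^ l = (\<Sum>\<sigma>\<le>2 ^ J. complex_of_real (abel_weight J \<sigma>) * (of_bool (l \<le> \<sigma> div 2 ^ (J - j)) * abel_fun J j \<sigma> z))"
proof -
  let ?m = "2 ^ (J - j) :: nat"
  have J: "(2::nat) ^ J = 2 ^ j * ?m" using assms(1) by (simp add: power_add[symmetric])
  have tel: "(\<Sum>s<n. of_bool (l \<le> s) * (z ^ s * (1 - z))) = z ^ l - z ^ n" if "l \<le> n" for n
    using that
  proof (induction n)
    case (Suc n)
    show ?case
    proof (cases "l \<le> n")
      case True
      then show ?thesis using Suc by (simp add: algebra_simps)
    next
      case False
      then have "l = Suc n" using Suc.prems by simp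
      then show ?thesis by (auto intro!: sum.neutral)
    qed
  qed simp
  have "(\<Sum>\<sigma><2 ^ J. complex_of_real (abel_weight J \<sigma>) * (of_bool (l \<le> \<sigma> div ?m) * abel_fun J j \<sigma> z))
     = (\<Sum>\<sigma><2 ^ J. (2 ^ j / 2 ^ J) * (of_bool (l \<le> \<sigma> div ?m) * (z ^ (\<sigma> div ?m) * (1 - z))))"
    by (intro sum.cong refl) (auto simp: abel_weight_def abel_fun_def)
  also have "\<dots> = (2 ^ j / 2 ^ J) * (\<Sum>\<sigma><2 ^ j * ?m. of_bool (l \<le> \<sigma> div ?m) * (z ^ (\<sigma> div ?m) * (1 - z)))"
    unfolding J[symmetric] by (simp only: sum_distrib_left)
  also have "\<dots> = (2 ^ j / 2 ^ J) * (of_nat ?m * (\<Sum>s<2 ^ j. of_bool (l \<le> s) * (z ^ s * (1 - z))))"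
    by (subst sum_div_block) simp_all
  also have "\<dots> = (2 ^ j / 2 ^ J * of_nat ?m) * (z ^ l - z ^ 2 ^ j)" using tel[of "2 ^ j"] assms(2) by simp
  also have "2 ^ j / 2 ^ J * of_nat ?m = (1::complex)"
  proof -
    have "(2::complex) ^ J = 2 ^ j * 2 ^ (J - j)" using assms(1) by (simp add: power_add[symmetric])
    then show ?thesis by simp
  qed
  finally have 1: "(\<Sum>\<sigma><2 ^ J. complex_of_real (abel_weight J \<sigma>) * (of_bool (l \<le> \<sigma> div ?m) * abel_fun J j \<sigma> z)) = z ^ l - z ^ 2 ^ j"
    by simp
  have "2 ^ J div ?m = 2 ^ j" unfolding J by simp
  then have 2: "complex_of_real (abel_weight J (2 ^ J)) * (of_bool (l \<le> 2 ^ J div ?m) * abel_fun J j (2 ^ J) z) = z ^ 2 ^ j"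
    using assms(2) by (simp add: abel_weight_def abel_fun_def)
  have "{..2 ^ J} = insert (2 ^ J) {..<2 ^ J :: nat}" by auto
  then show ?thesis using 1 2 by (simp only: sum.insert finite_lessThan lessThan_iff less_irrefl not_False_eq_True) simp
qed

lemma sum_abel_weight: "(\<Sum>\<sigma>\<le>2 ^ J. abel_weight J \<sigma>) = 2"
proof -
  have "{..2 ^ J} = insert (2 ^ J) {..<2 ^ J :: nat}" by auto
  moreover have "(\<Sum>\<sigma><2 ^ J. abel_weight J \<sigma>) = (\<Sum>\<sigma><2 ^ J :: nat. 1 / 2 ^ J)" by (intro sum.cong) (auto simp: abel_weight_def)
  ultimately show ?thesis by (simp add: abel_weight_def)
qed

lemma abel_weight_pos: "abel_weight J \<sigma> > 0" by (simp add: abel_weight_def)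

text \<open>Coefficients and exponents of \<open>abel_fun\<close> as a combination of two powers of \<open>z\<close>, which is the
form in which the operator calculus can be applied to it.\<close>

definition abel_coeff :: "nat \<Rightarrow> nat \<Rightarrow> nat \<Rightarrow> nat \<Rightarrow> real" where
  "abel_coeff J j \<sigma> e = (if \<sigma> = 2 ^ J then of_bool (e = 0) else (if e = 0 then 2 ^ j else - (2 ^ j)))"
definition abel_expo :: "nat \<Rightarrow> nat \<Rightarrow> nat \<Rightarrow> nat \<Rightarrow> nat" where
  "abel_expo J j \<sigma> e = (if \<sigma> = 2 ^ J then 2 ^ j else \<sigma> div 2 ^ (J - j) + e)"

lemma abel_fun_eq: "abel_fun J j \<sigma> z = (\<Sum>e<2. complex_of_real (abel_coeff J j \<sigma> e) * z ^ abel_expo J j \<sigma> e)"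
  by (simp add: abel_fun_def abel_coeff_def abel_expo_def numeral_2_eq_2 algebra_simps)

lemma abel_fun_bound:
  assumes "norm z \<le> 1" shows "norm (abel_fun J j \<sigma> z) \<le> 1 + 2 ^ j * norm (1 - z)"
proof (cases "\<sigma> = 2 ^ J")
  case True
  have "norm z ^ (2 ^ j) \<le> 1" using assms by (intro power_le_one) auto
  then show ?thesis using True by (simp add: abel_fun_def norm_power add_increasing2)
next
  case False
  have "norm z ^ (\<sigma> div 2 ^ (J - j)) * norm (1 - z) \<le> 1 * norm (1 - z)"
    using assms by (intro mult_right_mono power_le_one) auto
  then have "2 ^ j * (norm z ^ (\<sigma> div 2 ^ (J - j)) * norm (1 - z)) \<le> 2 ^ j * norm (1 - z)"
    by (intro mult_left_mono) auto
  moreover have "norm (abel_fun J j \<sigma> z) = 2 ^ j * (norm z ^ (\<sigma> div 2 ^ (J - j)) * norm (1 - z))"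
    using False by (simp add: abel_fun_def norm_mult norm_power)
  ultimately show ?thesis by linarith
qed

text \<open>A block has \<open>2\<^sup>j\<close> elements, so the squares of these normalised coefficients sum to at most a constant.\<close>

lemma block_coeff_bound:
  fixes \<alpha> :: real
  assumes \<alpha>: "\<alpha> > 0" and k: "2 ^ j \<le> k" "k < 2 * 2 ^ j"
  shows "(real k powr (\<alpha> - 1/2) / (2 ^ j) powr \<alpha>)\<^sup>2 \<le> 2 powr (2 * \<alpha>) / 2 ^ j"
proof -
  define n :: real where "n = 2 ^ j"
  have n: "n > 0" "n \<le> real k" "real k < 2 * n" using k by (auto simp: n_def) (metis of_nat_less_iff of_nat_mult of_nat_numeral of_nat_power of_nat_le_iff)+
  have "(real k powr (\<alpha> - 1/2) / n powr \<alpha>)\<^sup>2 = real k powr (2 * \<alpha> - 1) / n powr (2 * \<alpha>)"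
    using n by (simp add: power_divide powr_powr power2_eq_square powr_add[symmetric])
  also have "\<dots> = (real k / n) powr (2 * \<alpha> - 1) / n"
    using n by (simp add: powr_divide powr_diff field_simps)
  also have "(real k / n) powr (2 * \<alpha> - 1) \<le> 2 powr (2 * \<alpha>)"
  proof (cases "2 * \<alpha> - 1 \<ge> 0")
    case True
    then have "(real k / n) powr (2 * \<alpha> - 1) \<le> 2 powr (2 * \<alpha> - 1)" using n by (intro powr_mono2) (auto simp: field_simps)
    also have "\<dots> \<le> 2 powr (2 * \<alpha>)" by (intro powr_mono) auto
    finally show ?thesis .
  next
    case False
    then have "(real k / n) powr (2 * \<alpha> - 1) \<le> 1 powr (2 * \<alpha> - 1)" using n by (intro powr_mono2') (auto simp: field_simps)
    also have "\<dots> \<le> 2 powr (2 * \<alpha>)" using \<alpha> by (simp add: ge_one_powr_ge_zero)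
    finally show ?thesis .
  qed
  finally show ?thesis using n by (simp add: n_def divide_right_mono)
qed

section \<open>Square sums of a tuple with joint calculus\<close>

locale joint_calc = ritt_tuple T a b \<alpha>
  for T :: "'d::finite \<Rightarrow> ('a::{complex_normed_vector, banach} \<Rightarrow>\<^sub>L 'a)" and a b \<alpha> :: "'d \<Rightarrow> real" +
  fixes \<gamma> :: "'d \<Rightarrow> real" and Kc :: real
  assumes \<gamma>: "\<And>i. 0 < \<gamma> i \<and> \<gamma> i < pi / 2"
    and Kc: "Kc > 0" "\<And>F. F \<in> H01_inf \<gamma> \<Longrightarrow> norm (H01_calc b T F) \<le> Kc * (SUP z\<in>stolz_prod \<gamma>. cmod (H01_fun F z))"
begin

definition two_cube :: "('d \<Rightarrow> nat) set" where "two_cube = PiE UNIV (\<lambda>_. {..<2})"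
definition block_indices :: "nat \<Rightarrow> ('d \<Rightarrow> nat) set" where "block_indices J = PiE UNIV (\<lambda>_. {..J})"
definition abel_indices :: "nat \<Rightarrow> ('d \<Rightarrow> nat) set" where "abel_indices J = PiE UNIV (\<lambda>_. {..2 ^ J})"

lemma fin: "finite two_cube" "finite (block_indices J)" "finite (abel_indices J)"
  unfolding two_cube_def block_indices_def abel_indices_def by (intro finite_PiE; simp)+

definition block_scale :: "('d \<Rightarrow> nat) \<Rightarrow> 'd \<Rightarrow> real" where "block_scale j i = (2 ^ j i) powr \<alpha> i"

lemma block_scale_pos: "block_scale j i > 0" by (simp add: block_scale_def)

text \<open>Expanding the product over the coordinates of the two-term sums \<open>abel_fun_eq\<close> gives a combination
of monomials indexed by \<open>{0, 1}\<^sup>d\<close>.  \<open>block_fun\<close> is the resulting function of block \<open>j\<close> and \<open>block_op\<close>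
the operator that belongs to it.\<close>

definition "block_coef J j \<sigma> e = (\<Prod>i\<in>UNIV. block_scale j i * abel_coeff J (j i) (\<sigma> i) (e i))"
definition "block_expo J j \<sigma> e = (\<lambda>i. 2 ^ j i - 1 + abel_expo J (j i) (\<sigma> i) (e i))"
definition "block_fun J j \<sigma> z = (\<Prod>i\<in>UNIV. complex_of_real (block_scale j i) * (z $ i ^ (2 ^ j i - 1) * (abel_fun J (j i) (\<sigma> i) (z $ i) * (1 - z $ i) powr complex_of_real (\<alpha> i))))"
definition "block_op J j \<sigma> = (\<Sum>e\<in>two_cube. complex_of_real (block_coef J j \<sigma> e) *\<^sub>C mon_op (block_expo J j \<sigma> e))"

lemma block_fun_eq: "block_fun J j \<sigma> z = (\<Sum>e\<in>two_cube. complex_of_real (block_coef J j \<sigma> e) * monomial (block_expo J j \<sigma> e) z)"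
proof -
  have "block_fun J j \<sigma> z = (\<Prod>i\<in>UNIV. \<Sum>e<2. complex_of_real (block_scale j i * abel_coeff J (j i) (\<sigma> i) e) *
      (z $ i ^ (2 ^ j i - 1 + abel_expo J (j i) (\<sigma> i) e) * (1 - z $ i) powr complex_of_real (\<alpha> i)))"
    unfolding block_fun_def abel_fun_eq
    by (intro prod.cong refl) (simp only: sum_distrib_left sum_distrib_right power_add of_real_mult mult_ac)
  also have "\<dots> = (\<Sum>e\<in>two_cube. \<Prod>i\<in>UNIV. complex_of_real (block_scale j i * abel_coeff J (j i) (\<sigma> i) (e i)) *
      (z $ i ^ (2 ^ j i - 1 + abel_expo J (j i) (\<sigma> i) (e i)) * (1 - z $ i) powr complex_of_real (\<alpha> i)))"
    unfolding two_cube_def by (rule prod_sum_PiE) auto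
  also have "\<dots> = (\<Sum>e\<in>two_cube. complex_of_real (block_coef J j \<sigma> e) * monomial (block_expo J j \<sigma> e) z)"
    unfolding block_coef_def block_expo_def monomial_def of_real_prod by (intro sum.cong refl prod.distrib)
  finally show ?thesis .
qed

text \<open>The sum over the multi-indices of the blocks factorises into the one-dimensional dyadic sums.\<close>

lemma block_fun_bound: "\<exists>Ch>0. \<forall>z\<in>stolz_prod \<gamma>. \<forall>J \<sigma>. (\<Sum>j\<in>block_indices J. norm (block_fun J j \<sigma> z)) \<le> Ch"
proof -
  have "\<forall>i. \<exists>C>0. \<forall>z\<in>stolz (\<gamma> i). \<forall>N::nat. (\<Sum>j\<le>N. (2 ^ j) powr \<alpha> i * norm (1 - z) powr \<alpha> i * norm z ^ (2 ^ j - 1) * (1 + 2 ^ j * norm (1 - z))) \<le> C"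
    using stolz_dyadic_sum \<gamma> \<alpha> by blast
  from choice[OF this] obtain C where C: "\<forall>i. C i > 0 \<and> (\<forall>z\<in>stolz (\<gamma> i). \<forall>N::nat. (\<Sum>j\<le>N. (2 ^ j) powr \<alpha> i * norm (1 - z) powr \<alpha> i * norm z ^ (2 ^ j - 1) * (1 + 2 ^ j * norm (1 - z))) \<le> C i)" ..
  have "(\<Sum>j\<in>block_indices J. norm (block_fun J j \<sigma> z)) \<le> (\<Prod>i\<in>UNIV. C i)" if z: "z \<in> stolz_prod \<gamma>" for z J \<sigma>
  proof -
    let ?t = "\<lambda>i j. (2 ^ j) powr \<alpha> i * norm (1 - z $ i) powr \<alpha> i * norm (z $ i) ^ (2 ^ j - 1) * (1 + 2 ^ j * norm (1 - z $ i))"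
    have zi: "z $ i \<in> stolz (\<gamma> i)" for i using z by (simp add: stolz_prod_def)
    have n1: "norm (z $ i) < 1" for i using stolz_geometry(1)[OF zi] \<gamma> by blast
    have "norm (block_fun J j \<sigma> z) \<le> (\<Prod>i\<in>UNIV. ?t i (j i))" for j
      unfolding block_fun_def prod_norm[symmetric]
    proof (rule prod_mono, rule conjI)
      fix i
      have "norm (abel_fun J (j i) (\<sigma> i) (z $ i)) \<le> 1 + 2 ^ j i * norm (1 - z $ i)"
        using n1[of i] by (intro abel_fun_bound) auto
      then have "(block_scale j i * (norm (1 - z $ i) powr \<alpha> i * norm (z $ i) ^ (2 ^ j i - 1))) * norm (abel_fun J (j i) (\<sigma> i) (z $ i))
         \<le> (block_scale j i * (norm (1 - z $ i) powr \<alpha> i * norm (z $ i) ^ (2 ^ j i - 1))) * (1 + 2 ^ j i * norm (1 - z $ i))"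
        by (intro mult_left_mono) (auto simp: block_scale_def)
      moreover have "norm (complex_of_real (block_scale j i) * (z $ i ^ (2 ^ j i - 1) * (abel_fun J (j i) (\<sigma> i) (z $ i) * (1 - z $ i) powr complex_of_real (\<alpha> i))))
         = (block_scale j i * (norm (1 - z $ i) powr \<alpha> i * norm (z $ i) ^ (2 ^ j i - 1))) * norm (abel_fun J (j i) (\<sigma> i) (z $ i))"
        by (simp add: norm_mult norm_power norm_powr_real_powr' block_scale_def)
      ultimately show "norm (complex_of_real (block_scale j i) * (z $ i ^ (2 ^ j i - 1) * (abel_fun J (j i) (\<sigma> i) (z $ i) * (1 - z $ i) powr complex_of_real (\<alpha> i)))) \<le> ?t i (j i)"
        by (simp only: block_scale_def mult.assoc)
    qed simp
    then have "(\<Sum>j\<in>block_indices J. norm (block_fun J j \<sigma> z)) \<le> (\<Sum>j\<in>block_indices J. \<Prod>i\<in>UNIV. ?t i (j i))" by (rule sum_mono)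
    also have "\<dots> = (\<Prod>i\<in>UNIV. \<Sum>j\<le>J. ?t i j)" unfolding block_indices_def by (rule prod_sum_PiE[symmetric]) auto
    also have "\<dots> \<le> (\<Prod>i\<in>UNIV. C i)"
      using C zi by (intro prod_mono conjI sum_nonneg) (auto intro!: mult_nonneg_nonneg add_nonneg_nonneg)
    finally show ?thesis .
  qed
  moreover have "(\<Prod>i\<in>UNIV. C i) > 0" using C by (intro prod_pos) auto
  ultimately show ?thesis by blast
qed

definition "Ch = (SOME Ch. Ch > 0 \<and> (\<forall>z\<in>stolz_prod \<gamma>. \<forall>J \<sigma>. (\<Sum>j\<in>block_indices J. norm (block_fun J j \<sigma> z)) \<le> Ch))"

lemma Ch: "Ch > 0" "\<And>z J \<sigma>. z \<in> stolz_prod \<gamma> \<Longrightarrow> (\<Sum>j\<in>block_indices J. norm (block_fun J j \<sigma> z)) \<le> Ch"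
  using someI_ex[OF block_fun_bound] unfolding Ch_def[symmetric] by blast+

lemma block_op_multiplier_bound:
  assumes \<theta>: "\<And>j. j \<in> block_indices J \<Longrightarrow> \<bar>\<theta> j\<bar> \<le> 1"
  shows "norm (\<Sum>j\<in>block_indices J. \<theta> j *\<^sub>R block_op J j \<sigma>) \<le> Kc * Ch"
proof -
  let ?k = "\<lambda>p. complex_of_real (\<theta> (fst p) * block_coef J (fst p) \<sigma> (snd p))" and ?m = "\<lambda>p. block_expo J (fst p) \<sigma> (snd p)"
  have op: "(\<Sum>j\<in>block_indices J. \<theta> j *\<^sub>R block_op J j \<sigma>) = (\<Sum>p\<in>block_indices J \<times> two_cube. ?k p *\<^sub>C mon_op (?m p))"
    unfolding sum.cartesian_product' block_op_def
    by (simp add: scaleC_of_real[symmetric] bounded_bilinear.sum_right[OF bounded_bilinear_scaleC] scaleC_scaleC)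
  have fn: "(\<Sum>p\<in>block_indices J \<times> two_cube. ?k p * monomial (?m p) z) = (\<Sum>j\<in>block_indices J. of_real (\<theta> j) * block_fun J j \<sigma> z)" for z
    unfolding sum.cartesian_product' block_fun_eq by (simp add: sum_distrib_left mult.assoc)
  show ?thesis unfolding op
  proof (rule calculus_bound[OF _ \<gamma> Kc])
    fix z assume z: "z \<in> stolz_prod \<gamma>"
    have "norm (\<Sum>j\<in>block_indices J. of_real (\<theta> j) * block_fun J j \<sigma> z) \<le> (\<Sum>j\<in>block_indices J. norm (block_fun J j \<sigma> z))"
    proof (rule sum_norm_le)
      fix j assume "j \<in> block_indices J"
      then show "norm (of_real (\<theta> j) * block_fun J j \<sigma> z) \<le> norm (block_fun J j \<sigma> z)"
        using \<theta> mult_right_mono[of "\<bar>\<theta> j\<bar>" 1 "norm (block_fun J j \<sigma> z)"] by (simp add: norm_mult)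
    qed
    also have "\<dots> \<le> Ch" by (rule Ch(2)[OF z])
    finally show "norm (\<Sum>p\<in>block_indices J \<times> two_cube. ?k p * monomial (?m p) z) \<le> Ch" unfolding fn .
  qed (use fin in auto)
qed

text \<open>An identity between scalar combinations of monomials holds for the operators, since both
sides are values of the same integral.\<close>

lemma mon_op_sum_eqI:
  assumes "finite A" "finite B" "\<And>z. (\<Sum>j\<in>A. k j * monomial (m j) z) = (\<Sum>j\<in>B. k' j * monomial (m' j) z)"
  shows "(\<Sum>j\<in>A. k j *\<^sub>C mon_op (m j)) = (\<Sum>j\<in>B. k' j *\<^sub>C mon_op (m' j))"
  unfolding H0_calc_span[OF assms(1), symmetric] H0_calc_span[OF assms(2), symmetric] assms(3) ..

definition "dyadic_block k = (\<lambda>i::'d. floor_log (k i :: nat))"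

definition "prod_weight J \<sigma> = (\<Prod>i\<in>UNIV. abel_weight J (\<sigma> (i::'d)))"
text \<open>\<open>abel_ind\<close> is the only factor in the Abel decomposition of a monomial that depends on
\<open>k\<close> within its dyadic block.\<close>

definition "abel_ind J k \<sigma> = (\<Prod>i\<in>UNIV. of_bool (k i - 2 ^ dyadic_block k i \<le> \<sigma> i div 2 ^ (J - dyadic_block k i)) :: real)"

lemma dyadic_block_bounds: "k \<in> pos_indices \<Longrightarrow> 2 ^ dyadic_block k i \<le> k i" "k \<in> pos_indices \<Longrightarrow> k i < 2 * 2 ^ dyadic_block k i"
proof -
  assume "k \<in> pos_indices"
  then have "k i > 0" by (auto simp: pos_indices_def Suc_le_eq)
  then show "2 ^ dyadic_block k i \<le> k i" "k i < 2 * 2 ^ dyadic_block k i"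
    unfolding dyadic_block_def by (simp_all add: floor_log_exp2_le floor_log_exp2_gt)
qed

text \<open>The product over the coordinates of \<open>abel_identity\<close> with \<open>l = k - 2\<^sup>j\<close>, transferred to operators.\<close>

lemma mon_op_abel:
  assumes k: "k \<in> pos_indices" and J: "\<And>i. dyadic_block k i \<le> J"
  shows "mon_op (\<lambda>i. k i - 1) = (\<Sum>\<sigma>\<in>abel_indices J. (prod_weight J \<sigma> * (abel_ind J k \<sigma> / (\<Prod>i\<in>UNIV. block_scale (dyadic_block k) i))) *\<^sub>R block_op J (dyadic_block k) \<sigma>)"
proof -
  let ?j = "dyadic_block k"
  let ?u = "\<lambda>i s. abel_weight J s * of_bool (k i - 2 ^ ?j i \<le> s div 2 ^ (J - ?j i))"
  let ?c = "\<lambda>\<sigma>. prod_weight J \<sigma> * (abel_ind J k \<sigma> / (\<Prod>i\<in>UNIV. block_scale ?j i))"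
  have c_eq: "?c \<sigma> = (\<Prod>i\<in>UNIV. ?u i (\<sigma> i) / block_scale ?j i)" for \<sigma>
    by (simp add: prod_weight_def abel_ind_def prod.distrib prod_dividef)
  have fn: "monomial (\<lambda>i. k i - 1) z = (\<Sum>\<sigma>\<in>abel_indices J. of_real (?c \<sigma>) * block_fun J ?j \<sigma> z)" for z
  proof -
    have "(\<Sum>\<sigma>\<in>abel_indices J. of_real (?c \<sigma>) * block_fun J ?j \<sigma> z)
      = (\<Sum>\<sigma>\<in>abel_indices J. \<Prod>i\<in>UNIV. complex_of_real (abel_weight J (\<sigma> i)) * (of_bool (k i - 2 ^ ?j i \<le> \<sigma> i div 2 ^ (J - ?j i)) * abel_fun J (?j i) (\<sigma> i) (z $ i)) *
         (z $ i ^ (2 ^ ?j i - 1) * (1 - z $ i) powr complex_of_real (\<alpha> i)))"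
      unfolding c_eq block_fun_def of_real_prod prod.distrib[symmetric]
    proof (intro sum.cong prod.cong refl)
      fix \<sigma> i
      show "complex_of_real (?u i (\<sigma> i) / block_scale ?j i) * (complex_of_real (block_scale ?j i) * (z $ i ^ (2 ^ ?j i - 1) * (abel_fun J (?j i) (\<sigma> i) (z $ i) * (1 - z $ i) powr complex_of_real (\<alpha> i))))
        = complex_of_real (abel_weight J (\<sigma> i)) * (of_bool (k i - 2 ^ ?j i \<le> \<sigma> i div 2 ^ (J - ?j i)) * abel_fun J (?j i) (\<sigma> i) (z $ i)) *
         (z $ i ^ (2 ^ ?j i - 1) * (1 - z $ i) powr complex_of_real (\<alpha> i))"
        using block_scale_pos[of ?j i] by simp
    qed
    also have "\<dots> = (\<Prod>i\<in>UNIV. \<Sum>s\<le>2 ^ J. complex_of_real (abel_weight J s) * (of_bool (k i - 2 ^ ?j i \<le> s div 2 ^ (J - ?j i)) * abel_fun J (?j i) s (z $ i)) *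
         (z $ i ^ (2 ^ ?j i - 1) * (1 - z $ i) powr complex_of_real (\<alpha> i)))"
      unfolding abel_indices_def by (rule prod_sum_PiE[symmetric]) auto
    also have "\<dots> = (\<Prod>i\<in>UNIV. z $ i ^ (k i - 2 ^ ?j i) * (z $ i ^ (2 ^ ?j i - 1) * (1 - z $ i) powr complex_of_real (\<alpha> i)))"
    proof (intro prod.cong refl)
      fix i
      have "k i - 2 ^ ?j i < 2 ^ ?j i" using dyadic_block_bounds[OF k, of i] by linarith
      from abel_identity[OF J this, of "z $ i"]
      show "(\<Sum>s\<le>2 ^ J. complex_of_real (abel_weight J s) * (of_bool (k i - 2 ^ ?j i \<le> s div 2 ^ (J - ?j i)) * abel_fun J (?j i) s (z $ i)) *
         (z $ i ^ (2 ^ ?j i - 1) * (1 - z $ i) powr complex_of_real (\<alpha> i))) = z $ i ^ (k i - 2 ^ ?j i) * (z $ i ^ (2 ^ ?j i - 1) * (1 - z $ i) powr complex_of_real (\<alpha> i))"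
        by (simp only: sum_distrib_right[symmetric])
    qed
    also have "\<dots> = monomial (\<lambda>i. k i - 1) z"
      unfolding monomial_def
    proof (intro prod.cong refl)
      fix i
      have "1 \<le> (2::nat) ^ ?j i" by simp
      then have "k i - 1 = (k i - 2 ^ ?j i) + (2 ^ ?j i - 1)" using dyadic_block_bounds(1)[OF k, of i] by linarith
      then show "z $ i ^ (k i - 2 ^ ?j i) * (z $ i ^ (2 ^ ?j i - 1) * (1 - z $ i) powr complex_of_real (\<alpha> i)) = z $ i ^ (k i - 1) * (1 - z $ i) powr complex_of_real (\<alpha> i)"
        by (simp only: power_add mult.assoc)
    qed
    finally show ?thesis by simp
  qed
  let ?k' = "\<lambda>p. complex_of_real (?c (fst p) * block_coef J ?j (fst p) (snd p))" and ?m' = "\<lambda>p. block_expo J ?j (fst p) (snd p)"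
  have "(\<Sum>u\<in>{()}. 1 *\<^sub>C mon_op (\<lambda>i. k i - 1)) = (\<Sum>p\<in>abel_indices J \<times> two_cube. ?k' p *\<^sub>C mon_op (?m' p))"
  proof (rule mon_op_sum_eqI)
    fix z
    have S: "(\<Sum>p\<in>abel_indices J \<times> two_cube. ?k' p * monomial (?m' p) z) = (\<Sum>\<sigma>\<in>abel_indices J. of_real (?c \<sigma>) * block_fun J ?j \<sigma> z)"
      unfolding sum.cartesian_product' block_fun_eq sum_distrib_left by (simp only: fst_conv snd_conv of_real_mult mult.assoc)
    show "(\<Sum>u\<in>{()}. 1 * monomial (\<lambda>i. k i - 1) z) = (\<Sum>p\<in>abel_indices J \<times> two_cube. ?k' p * monomial (?m' p) z)"
      unfolding S fn[symmetric] by simp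
  qed (use fin in auto)
  also have "\<dots> = (\<Sum>\<sigma>\<in>abel_indices J. ?c \<sigma> *\<^sub>R block_op J ?j \<sigma>)"
    unfolding sum.cartesian_product' block_op_def
    by (simp add: scaleC_of_real[symmetric] bounded_bilinear.sum_right[OF bounded_bilinear_scaleC] scaleC_scaleC)
  finally show ?thesis by simp
qed

lemma square_term_eq:
  "square_term T \<alpha> x k = (\<Prod>i\<in>UNIV. real (k i) powr (\<alpha> i - 1/2)) *\<^sub>R mon_op (\<lambda>i. k i - 1) x"
proof -
  obtain xs :: "'d list" where xs: "set xs = UNIV" "distinct xs" using finite_distinct_list[OF finite[of "UNIV :: 'd set"]] by auto
  let ?c = "\<lambda>i. complex_of_real (real (k i) powr (\<alpha> i - 1/2))"
  let ?A = "\<lambda>i. ?c i *\<^sub>C factor (k i - 1) i"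
  have c: "?A i o\<^sub>L ?A j = ?A j o\<^sub>L ?A i" for i j
    by (simp add: scaleC_compose_left scaleC_compose_right factor_clinear scaleC_scaleC factor_comm[of _ i] mult.commute)
  have "op_prod (\<lambda>i. (real (k i) powr (\<alpha> i - 1/2)) *\<^sub>R (op_power (T i) (k i - 1) o\<^sub>L frac_power (T i) (\<alpha> i))) UNIV = op_prod ?A UNIV"
    unfolding factor_def scaleC_of_real ..
  also have "\<dots> = op_list ?A xs" unfolding xs(1)[symmetric]
    by (rule op_prod_eq_op_list[where J = UNIV]) (use c xs in auto)
  also have "\<dots> = (\<Prod>i\<in>set xs. ?c i) *\<^sub>C op_list (\<lambda>i. factor (k i - 1) i) xs"
    by (rule op_list_scaleC[OF xs(2) factor_clinear])
  also have "op_list (\<lambda>i. factor (k i - 1) i) xs = mon_op (\<lambda>i. k i - 1)"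
    unfolding mon_op_def xs(1)[symmetric] by (rule op_prod_eq_op_list[symmetric, where J = UNIV]) (auto simp: factor_comm xs(2))
  also have "(\<Prod>i\<in>set xs. ?c i) *\<^sub>C mon_op (\<lambda>i. k i - 1) = (\<Prod>i\<in>UNIV. real (k i) powr (\<alpha> i - 1/2)) *\<^sub>R mon_op (\<lambda>i. k i - 1)"
    unfolding xs(1) of_real_prod[symmetric] scaleC_of_real ..
  finally show ?thesis unfolding square_term_def by (simp add: blinfun.scaleR_left)
qed

text \<open>\<open>block_weight\<close> collects the scalar factors of the \<open>k\<close>-th term of the square function once its
operator has been expressed by \<open>block_op\<close>; by \<open>block_coeff_bound\<close> its squares sum to at most
\<open>block_const\<close> over a block.\<close>

definition "block_const = (\<Prod>i\<in>UNIV. 2 powr (2 * \<alpha> (i::'d)))"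
definition "block_weight J \<sigma> k = (\<Prod>i\<in>UNIV. real (k i) powr (\<alpha> i - 1/2)) * (abel_ind J k \<sigma> / (\<Prod>i\<in>UNIV. block_scale (dyadic_block k) i))"

lemma block_const_pos: "block_const > 0" unfolding block_const_def by (intro prod_pos) auto

lemma block_weight_sq_sum_le_1:
  assumes A: "finite A" "A \<subseteq> pos_indices" and \<theta>: "\<And>k. k \<in> A \<Longrightarrow> \<bar>\<theta> k\<bar> \<le> 1"
  shows "(\<Sum>k\<in>{k\<in>A. dyadic_block k = j}. (\<theta> k * block_weight J \<sigma> k / sqrt block_const)\<^sup>2) \<le> 1"
proof -
  let ?B = "PiE UNIV (\<lambda>i. {2 ^ j i..<2 * 2 ^ j i}) :: ('d \<Rightarrow> nat) set"
  have sub: "{k\<in>A. dyadic_block k = j} \<subseteq> ?B" using A(2) dyadic_block_bounds by fastforce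
  have fB: "finite ?B" by (intro finite_PiE) auto
  have "(\<Sum>k\<in>{k\<in>A. dyadic_block k = j}. (\<theta> k * block_weight J \<sigma> k)\<^sup>2) \<le> (\<Sum>k\<in>{k\<in>A. dyadic_block k = j}. \<Prod>i\<in>UNIV. 2 powr (2 * \<alpha> i) / 2 ^ j i)"
  proof (rule sum_mono)
    fix k assume k: "k \<in> {k\<in>A. dyadic_block k = j}"
    then have kp: "k \<in> pos_indices" and b: "dyadic_block k = j" using A by auto
    have i01: "0 \<le> abel_ind J k \<sigma>" "abel_ind J k \<sigma> \<le> 1" unfolding abel_ind_def by (auto intro!: prod_nonneg prod_le_1)
    let ?q = "\<Prod>i\<in>UNIV. real (k i) powr (\<alpha> i - 1/2) / block_scale j i"
    have "block_weight J \<sigma> k = ?q * abel_ind J k \<sigma>" by (simp add: block_weight_def b prod_dividef)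
    moreover have q0: "?q \<ge> 0" using block_scale_pos by (intro prod_nonneg) (auto simp: less_imp_le)
    ultimately have "\<bar>\<theta> k * block_weight J \<sigma> k\<bar> = \<bar>\<theta> k\<bar> * (abel_ind J k \<sigma> * ?q)" using i01 by (simp add: abs_mult)
    also have "\<dots> \<le> 1 * (1 * ?q)" using \<theta>[of k] k i01 q0 by (intro mult_mono mult_nonneg_nonneg) auto
    finally have "\<bar>\<theta> k * block_weight J \<sigma> k\<bar> \<le> ?q" by simp
    then have "(\<theta> k * block_weight J \<sigma> k)\<^sup>2 \<le> ?q\<^sup>2" using q0 by (simp add: abs_le_square_iff[symmetric])
    also have "\<dots> = (\<Prod>i\<in>UNIV. (real (k i) powr (\<alpha> i - 1/2) / block_scale j i)\<^sup>2)" by (rule prod_power_distrib)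
    also have "\<dots> \<le> (\<Prod>i\<in>UNIV. 2 powr (2 * \<alpha> i) / 2 ^ j i)"
    proof (rule prod_mono, rule conjI)
      fix i
      show "(real (k i) powr (\<alpha> i - 1/2) / block_scale j i)\<^sup>2 \<le> 2 powr (2 * \<alpha> i) / 2 ^ j i"
        unfolding block_scale_def using dyadic_block_bounds[OF kp, of i] b by (intro block_coeff_bound \<alpha>) auto
    qed simp
    finally show "(\<theta> k * block_weight J \<sigma> k)\<^sup>2 \<le> (\<Prod>i\<in>UNIV. 2 powr (2 * \<alpha> i) / 2 ^ j i)" .
  qed
  also have "\<dots> \<le> (\<Sum>k\<in>?B. \<Prod>i\<in>UNIV. 2 powr (2 * \<alpha> i) / 2 ^ j i)"
    by (rule sum_mono2[OF fB sub]) (auto intro!: prod_nonneg)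
  also have "\<dots> = (\<Prod>i\<in>UNIV. \<Sum>k\<in>{2 ^ j i..<2 * 2 ^ j i :: nat}. 2 powr (2 * \<alpha> i) / 2 ^ j i)"
    by (rule prod_sum_PiE[symmetric]) auto
  also have "\<dots> = block_const" unfolding block_const_def by (intro prod.cong refl) simp
  finally have "(\<Sum>k\<in>{k\<in>A. dyadic_block k = j}. (\<theta> k * block_weight J \<sigma> k)\<^sup>2) / block_const \<le> 1" using block_const_pos by (simp add: field_simps)
  then show ?thesis using block_const_pos by (simp add: power_divide sum_divide_distrib)
qed

lemma sum_prod_weight: "(\<Sum>\<sigma>\<in>abel_indices J. prod_weight J \<sigma>) = 2 ^ CARD('d)"
proof -
  have "(\<Sum>\<sigma>\<in>abel_indices J. prod_weight J \<sigma>) = (\<Prod>i\<in>(UNIV :: 'd set). \<Sum>s\<le>2 ^ J. abel_weight J s)"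
    unfolding abel_indices_def prod_weight_def by (rule prod_sum_PiE[symmetric]) auto
  then show ?thesis by (simp add: sum_abel_weight)
qed

lemma prod_weight_pos: "prod_weight J \<sigma> > 0" unfolding prod_weight_def by (intro prod_pos) (simp add: abel_weight_pos)

text \<open>For fixed \<open>\<sigma>\<close> the randomised sum has the form treated in \<open>blocked_sign_average_bound\<close>.  The weights of the
\<open>\<sigma>\<close> add up to \<open>2\<^sup>d\<close>, so the Cauchy-Schwarz inequality costs the factor \<open>4\<^sup>d\<close>.  The extra coefficients \<open>\<theta>\<close>
allow signs to be attached to whole groups of terms when summability is proved.\<close>

lemma square_sum_sign_average_bound:
  assumes cot: "has_cotype TYPE('a) q" "q \<ge> 2"
  shows "\<exists>M\<ge>0. \<forall>x A \<theta>. finite A \<longrightarrow> A \<subseteq> pos_indices \<longrightarrow> (\<forall>k\<in>A. \<bar>\<theta> k\<bar> \<le> 1) \<longrightarrow>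
    sign_avg A (\<lambda>\<epsilon>. (norm (\<Sum>k\<in>A. (\<epsilon> k * \<theta> k) *\<^sub>R square_term T \<alpha> x k))\<^sup>2) \<le> M * (norm x)\<^sup>2"
proof -
  obtain D where D: "D > 0" and gd: "\<forall>(K::('d \<Rightarrow> nat) set) (J::('d \<Rightarrow> nat) set) dyadic_block (a::('d \<Rightarrow> nat) \<Rightarrow> real) (y::('d \<Rightarrow> nat) \<Rightarrow> 'a) B.
    finite K \<longrightarrow> finite J \<longrightarrow> dyadic_block ` K \<subseteq> J \<longrightarrow> B \<ge> 0 \<longrightarrow>
    (\<forall>j\<in>J. (\<Sum>k\<in>{k\<in>K. dyadic_block k = j}. (a k)\<^sup>2) \<le> 1) \<longrightarrow>
    (\<forall>\<theta>. (\<forall>j\<in>J. \<bar>\<theta> j\<bar> \<le> 1) \<longrightarrow> norm (\<Sum>j\<in>J. \<theta> j *\<^sub>R y j) \<le> B) \<longrightarrow>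
    sign_avg K (\<lambda>\<epsilon>. (norm (\<Sum>k\<in>K. (\<epsilon> k * a k) *\<^sub>R y (dyadic_block k)))\<^sup>2) \<le> D * B\<^sup>2"
    using blocked_sign_average_bound[OF cot, where 'k = "'d \<Rightarrow> nat" and 'j = "'d \<Rightarrow> nat"] by (elim exE conjE) (rule that)
  define M0 where "M0 = D * (block_const * (Kc * Ch)\<^sup>2)"
  define M where "M = 4 ^ CARD('d) * M0"
  have M0: "M0 \<ge> 0" using D block_const_pos by (simp add: M0_def)
  have "sign_avg A (\<lambda>\<epsilon>. (norm (\<Sum>k\<in>A. (\<epsilon> k * \<theta> k) *\<^sub>R square_term T \<alpha> x k))\<^sup>2) \<le> M * (norm x)\<^sup>2"
    if A: "finite A" "A \<subseteq> pos_indices" and \<theta>: "\<And>k. k \<in> A \<Longrightarrow> \<bar>\<theta> k\<bar> \<le> 1" for x A \<theta>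
  proof -
    \<comment> \<open>Any bound for all block indices that occur; the estimates do not depend on it.\<close>
    define J where "J = (\<Sum>k\<in>A. \<Sum>i\<in>UNIV. k i)"
    have bJ: "dyadic_block k i \<le> J" if k: "k \<in> A" for k i
    proof -
      have "dyadic_block k i < 2 ^ dyadic_block k i" by (rule less_exp)
      also have "\<dots> \<le> k i" using dyadic_block_bounds(1) k A(2) by blast
      also have "k i \<le> (\<Sum>i\<in>UNIV. k i)" by (rule member_le_sum) auto
      also have "\<dots> \<le> J" unfolding J_def by (rule member_le_sum[OF k]) (auto simp: A)
      finally show ?thesis by simp
    qed
    have bsub: "dyadic_block ` A \<subseteq> block_indices J" using bJ by (auto simp: block_indices_def PiE_def)
    define Z where "Z \<sigma> \<epsilon> = (\<Sum>k\<in>A. (\<epsilon> k * (\<theta> k * block_weight J \<sigma> k)) *\<^sub>R block_op J (dyadic_block k) \<sigma> x)" for \<sigma> \<epsilon>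
    have ZB: "sign_avg A (\<lambda>\<epsilon>. (norm (Z \<sigma> \<epsilon>))\<^sup>2) \<le> M0 * (norm x)\<^sup>2" for \<sigma>
    proof -
      let ?y = "\<lambda>j. sqrt block_const *\<^sub>R block_op J j \<sigma> x" and ?a = "\<lambda>k. \<theta> k * block_weight J \<sigma> k / sqrt block_const" and ?B = "sqrt block_const * (Kc * Ch * norm x)"
      have scc: "sqrt block_const > 0" using block_const_pos by simp
      have B0: "?B \<ge> 0" using scc Kc(1) Ch(1) by simp
      have bd: "norm (\<Sum>j\<in>block_indices J. \<eta> j *\<^sub>R ?y j) \<le> ?B" if \<eta>: "\<forall>j\<in>block_indices J. \<bar>\<eta> j\<bar> \<le> 1" for \<eta>
      proof -
        have "(\<Sum>j\<in>block_indices J. \<eta> j *\<^sub>R ?y j) = sqrt block_const *\<^sub>R ((\<Sum>j\<in>block_indices J. \<eta> j *\<^sub>R block_op J j \<sigma>) x)"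
          by (simp add: blinfun.sum_left blinfun.scaleR_left scaleR_sum_right mult.commute)
        moreover have "norm ((\<Sum>j\<in>block_indices J. \<eta> j *\<^sub>R block_op J j \<sigma>) x) \<le> Kc * Ch * norm x"
          by (rule order_trans[OF norm_blinfun]) (use block_op_multiplier_bound[of J \<eta> \<sigma>] \<eta> in \<open>auto intro: mult_right_mono\<close>)
        ultimately show ?thesis using scc by (simp add: mult_left_mono)
      qed
      have "sign_avg A (\<lambda>\<epsilon>. (norm (\<Sum>k\<in>A. (\<epsilon> k * ?a k) *\<^sub>R ?y (dyadic_block k)))\<^sup>2) \<le> D * ?B\<^sup>2"
        using gd[rule_format, of A "block_indices J" dyadic_block ?B ?a ?y, OF A(1) fin(2) bsub B0 block_weight_sq_sum_le_1[OF A \<theta>] bd] by blast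
      moreover have "(\<Sum>k\<in>A. (\<epsilon> k * ?a k) *\<^sub>R ?y (dyadic_block k)) = Z \<sigma> \<epsilon>" for \<epsilon>
        unfolding Z_def using scc by (intro sum.cong refl) simp
      moreover have "D * ?B\<^sup>2 = M0 * (norm x)\<^sup>2" using block_const_pos by (simp add: M0_def power_mult_distrib)
      ultimately show ?thesis by simp
    qed
    have sum_eq: "(\<Sum>k\<in>A. (\<epsilon> k * \<theta> k) *\<^sub>R square_term T \<alpha> x k) = (\<Sum>\<sigma>\<in>abel_indices J. prod_weight J \<sigma> *\<^sub>R Z \<sigma> \<epsilon>)" for \<epsilon>
    proof -
      have "(\<epsilon> k * \<theta> k) *\<^sub>R square_term T \<alpha> x k = (\<Sum>\<sigma>\<in>abel_indices J. prod_weight J \<sigma> *\<^sub>R ((\<epsilon> k * (\<theta> k * block_weight J \<sigma> k)) *\<^sub>R block_op J (dyadic_block k) \<sigma> x))" if k: "k \<in> A" for k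
      proof -
        have kp: "k \<in> pos_indices" using k A by auto
        show ?thesis
          unfolding square_term_eq mon_op_abel[OF kp bJ[OF k]] block_weight_def
          by (simp add: blinfun.sum_left blinfun.scaleR_left scaleR_sum_right mult_ac)
      qed
      then have "(\<Sum>k\<in>A. (\<epsilon> k * \<theta> k) *\<^sub>R square_term T \<alpha> x k) = (\<Sum>k\<in>A. \<Sum>\<sigma>\<in>abel_indices J. prod_weight J \<sigma> *\<^sub>R ((\<epsilon> k * (\<theta> k * block_weight J \<sigma> k)) *\<^sub>R block_op J (dyadic_block k) \<sigma> x))"
        by (intro sum.cong refl)
      also have "\<dots> = (\<Sum>\<sigma>\<in>abel_indices J. prod_weight J \<sigma> *\<^sub>R Z \<sigma> \<epsilon>)"
        unfolding Z_def scaleR_sum_right by (rule sum.swap)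
      finally show ?thesis .
    qed
    have le: "(norm (\<Sum>\<sigma>\<in>abel_indices J. prod_weight J \<sigma> *\<^sub>R Z \<sigma> \<epsilon>))\<^sup>2 \<le> 2 ^ CARD('d) * (\<Sum>\<sigma>\<in>abel_indices J. prod_weight J \<sigma> * (norm (Z \<sigma> \<epsilon>))\<^sup>2)" for \<epsilon>
    proof -
      have "norm (\<Sum>\<sigma>\<in>abel_indices J. prod_weight J \<sigma> *\<^sub>R Z \<sigma> \<epsilon>) \<le> (\<Sum>\<sigma>\<in>abel_indices J. prod_weight J \<sigma> * norm (Z \<sigma> \<epsilon>))"
        using prod_weight_pos by (intro sum_norm_le) (simp add: less_imp_le)
      then have "(norm (\<Sum>\<sigma>\<in>abel_indices J. prod_weight J \<sigma> *\<^sub>R Z \<sigma> \<epsilon>))\<^sup>2 \<le> (\<Sum>\<sigma>\<in>abel_indices J. prod_weight J \<sigma> * norm (Z \<sigma> \<epsilon>))\<^sup>2" by (rule power_mono) simp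
      also have "\<dots> \<le> (\<Sum>\<sigma>\<in>abel_indices J. prod_weight J \<sigma>) * (\<Sum>\<sigma>\<in>abel_indices J. (prod_weight J \<sigma> * norm (Z \<sigma> \<epsilon>))\<^sup>2 / prod_weight J \<sigma>)"
        by (rule sum_sq_weighted) (rule prod_weight_pos)
      also have "(\<Sum>\<sigma>\<in>abel_indices J. (prod_weight J \<sigma> * norm (Z \<sigma> \<epsilon>))\<^sup>2 / prod_weight J \<sigma>) = (\<Sum>\<sigma>\<in>abel_indices J. prod_weight J \<sigma> * (norm (Z \<sigma> \<epsilon>))\<^sup>2)"
        using prod_weight_pos[THEN less_imp_neq] by (intro sum.cong refl) (simp add: power2_eq_square)
      finally show ?thesis by (simp only: sum_prod_weight)
    qed
    have "sign_avg A (\<lambda>\<epsilon>. (norm (\<Sum>k\<in>A. (\<epsilon> k * \<theta> k) *\<^sub>R square_term T \<alpha> x k))\<^sup>2)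
      \<le> sign_avg A (\<lambda>\<epsilon>. 2 ^ CARD('d) * (\<Sum>\<sigma>\<in>abel_indices J. prod_weight J \<sigma> * (norm (Z \<sigma> \<epsilon>))\<^sup>2))"
      unfolding sign_avg_def sum_eq by (intro divide_right_mono sum_mono le) simp
    also have "\<dots> = 2 ^ CARD('d) * (\<Sum>\<sigma>\<in>abel_indices J. prod_weight J \<sigma> * sign_avg A (\<lambda>\<epsilon>. (norm (Z \<sigma> \<epsilon>))\<^sup>2))"
    proof -
      have "(\<Sum>\<epsilon>\<in>sign_cube A. \<Sum>\<sigma>\<in>abel_indices J. prod_weight J \<sigma> * (norm (Z \<sigma> \<epsilon>))\<^sup>2) = (\<Sum>\<sigma>\<in>abel_indices J. prod_weight J \<sigma> * (\<Sum>\<epsilon>\<in>sign_cube A. (norm (Z \<sigma> \<epsilon>))\<^sup>2))"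
        by (subst sum.swap) (simp only: sum_distrib_left)
      moreover have "(\<Sum>\<sigma>\<in>abel_indices J. prod_weight J \<sigma> * sign_avg A (\<lambda>\<epsilon>. (norm (Z \<sigma> \<epsilon>))\<^sup>2)) = (\<Sum>\<sigma>\<in>abel_indices J. prod_weight J \<sigma> * (\<Sum>\<epsilon>\<in>sign_cube A. (norm (Z \<sigma> \<epsilon>))\<^sup>2)) / 2 ^ card A"
        by (simp only: sign_avg_def sum_divide_distrib[of _ "abel_indices J"] times_divide_eq_right)
      ultimately show ?thesis
        unfolding sign_avg_def[of _ "\<lambda>\<epsilon>. 2 ^ CARD('d) * _ \<epsilon>"] sum_distrib_left[symmetric] by (simp only: times_divide_eq_right)
    qed
    also have "\<dots> \<le> 2 ^ CARD('d) * (\<Sum>\<sigma>\<in>abel_indices J. prod_weight J \<sigma> * (M0 * (norm x)\<^sup>2))"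
      using ZB prod_weight_pos by (intro mult_left_mono sum_mono) (auto simp: less_imp_le)
    also have "\<dots> = 2 ^ CARD('d) * (2 ^ CARD('d) * (M0 * (norm x)\<^sup>2))"
      by (simp only: sum_distrib_right[symmetric] sum_prod_weight)
    also have "\<dots> = M * (norm x)\<^sup>2"
    proof -
      have "(2::real) ^ CARD('d) * 2 ^ CARD('d) = 4 ^ CARD('d)" by (simp add: power_mult_distrib[symmetric])
      then show ?thesis unfolding M_def by (simp only: mult.assoc[symmetric])
    qed
    finally show ?thesis .
  qed
  moreover have "M \<ge> 0" using M0 by (simp add: M_def)
  ultimately show ?thesis by (intro exI[of _ M]) blast
qed

end

section \<open>Summability of Rademacher series\<close>

lemma strongly_measurable_norm:
  assumes "strongly_measurable M f" shows "(\<lambda>w. norm (f w)) \<in> borel_measurable M"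
proof -
  obtain s where s: "\<And>n. simple_function M (s n)" "\<And>w. w \<in> space M \<Longrightarrow> (\<lambda>n. s n w) \<longlonglongrightarrow> f w"
    using assms unfolding strongly_measurable_def by blast
  show ?thesis
  proof (rule borel_measurable_LIMSEQ_real)
    show "(\<lambda>n. norm (s n w)) \<longlonglongrightarrow> norm (f w)" if "w \<in> space M" for w using s(2)[OF that] by (rule tendsto_norm)
    show "(\<lambda>w. norm (s n w)) \<in> borel_measurable M" for n
      by (rule borel_measurable_simple_function[OF simple_function_compose1[OF s(1)]])
  qed
qed

lemma strongly_measurable_combine:
  assumes "strongly_measurable M f" "strongly_measurable M g"
    and h: "\<And>x y u v. u \<longlonglongrightarrow> x \<Longrightarrow> v \<longlonglongrightarrow> y \<Longrightarrow> (\<lambda>n::nat. h (u n) (v n)) \<longlonglongrightarrow> h x y"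
  shows "strongly_measurable M (\<lambda>w. h (f w) (g w))"
proof -
  obtain s where s: "\<And>n. simple_function M (s n)" "\<And>w. w \<in> space M \<Longrightarrow> (\<lambda>n. s n w) \<longlonglongrightarrow> f w"
    using assms(1) unfolding strongly_measurable_def by blast
  obtain s' where s': "\<And>n. simple_function M (s' n)" "\<And>w. w \<in> space M \<Longrightarrow> (\<lambda>n. s' n w) \<longlonglongrightarrow> g w"
    using assms(2) unfolding strongly_measurable_def by blast
  show ?thesis
    unfolding strongly_measurable_def
    by (rule exI[of _ "\<lambda>n w. h (s n w) (s' n w)"]) (use s s' in \<open>auto intro: h simple_function_compose2\<close>)
qed

lemma strongly_measurable_const: "strongly_measurable M (\<lambda>_. c)"
  unfolding strongly_measurable_def by (rule exI[of _ "\<lambda>_ _. c"]) auto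

lemma strongly_measurable_real:
  assumes "f \<in> borel_measurable M" shows "strongly_measurable M (f :: _ \<Rightarrow> real)"
  using borel_measurable_implies_sequence_metric[OF assms, of 0] unfolding strongly_measurable_def by blast

lemma strongly_measurable_sum:
  assumes "finite A" "\<And>k. k \<in> A \<Longrightarrow> f k \<in> borel_measurable M"
  shows "strongly_measurable M (\<lambda>w. \<Sum>k\<in>A. f k w *\<^sub>R x k)"
  using assms
proof (induction A rule: finite_induct)
  case empty
  show ?case using strongly_measurable_const[of M 0] by simp
next
  case (insert k A)
  have "strongly_measurable M (\<lambda>w. f k w *\<^sub>R x k)"
    by (rule strongly_measurable_combine[where h = "\<lambda>a b. a *\<^sub>R b", OF strongly_measurable_real strongly_measurable_const])
      (use insert in \<open>auto intro: tendsto_scaleR\<close>)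
  then have "strongly_measurable M (\<lambda>w. f k w *\<^sub>R x k + (\<Sum>k\<in>A. f k w *\<^sub>R x k))"
    by (rule strongly_measurable_combine[where h = "\<lambda>a b. a + b"]) (use insert in \<open>auto intro: tendsto_add\<close>)
  then show ?case using insert by simp
qed

lemma strongly_measurable_diff:
  "strongly_measurable M f \<Longrightarrow> strongly_measurable M g \<Longrightarrow> strongly_measurable M (\<lambda>w. f w - g w)"
  by (rule strongly_measurable_combine[where h = "\<lambda>a b. a - b"]) (auto intro: tendsto_diff)

text \<open>Cotype \<open>q\<close> controls squares up to the factor \<open>N\<^sup>1\<^sup>-\<^sup>2\<^sup>/\<^sup>q\<close>, which is of smaller order than \<open>N\<close>.\<close>

lemma cotype_squares:
  fixes v :: "nat \<Rightarrow> 'a::real_normed_vector"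
  assumes cot: "\<And>n. \<And>x::nat \<Rightarrow> 'a. (\<Sum>i<n. norm (x i) powr q) powr (1 / q) \<le>
        C * sqrt ((\<Sum>\<epsilon>\<in>sign_cube {..<n}. (norm (\<Sum>i<n. \<epsilon> i *\<^sub>R x i))\<^sup>2) / 2 ^ n)"
    and q: "q \<ge> 2" and C: "C > 0" and N: "N > 0"
  shows "(\<Sum>c<N. (norm (v c))\<^sup>2) \<le> 2 * real N powr (1 - 2 / q) * C\<^sup>2 * sign_avg {..<N} (\<lambda>s. (norm (\<Sum>c<N. s c *\<^sub>R v c))\<^sup>2)"
proof -
  define S where "S = sign_avg {..<N} (\<lambda>s. (norm (\<Sum>c<N. s c *\<^sub>R v c))\<^sup>2)"
  define V where "V = (\<Sum>i<N. norm (v i) powr q)"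
  have S0: "S \<ge> 0" unfolding S_def sign_avg_def by (intro divide_nonneg_nonneg sum_nonneg) auto
  have V0: "V \<ge> 0" unfolding V_def by (intro sum_nonneg) auto
  have le: "V powr (1 / q) \<le> C * sqrt S"
    using cot[where n = N and x = v] unfolding S_def V_def sign_avg_def by simp
  show ?thesis
  proof (cases "V = 0")
    case True
    then have "\<forall>i\<in>{..<N}. norm (v i) powr q = 0" unfolding V_def by (subst (asm) sum_nonneg_eq_0_iff) auto
    then have "(\<Sum>c<N. (norm (v c))\<^sup>2) = 0" by simp
    then show ?thesis using S0 unfolding S_def[symmetric] by simp
  next
    case False
    then have Vp: "V > 0" using V0 by simp
    define s where "s = (V / N) powr (1 / q)"
    have s: "s > 0" using Vp N by (simp add: s_def)
    have sq: "s powr q = V / N" using Vp N q by (simp add: s_def powr_powr)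
    have "(\<Sum>c<N. (norm (v c))\<^sup>2) \<le> (\<Sum>c<N. s\<^sup>2 + s powr (2 - q) * norm (v c) powr q)"
      using s q by (intro sum_mono young_powr) auto
    also have "\<dots> = N * s\<^sup>2 + s powr (2 - q) * V" by (simp add: sum.distrib V_def sum_distrib_left)
    also have "V = N * s powr q" using sq N by simp
    also have "s powr (2 - q) * (N * s powr q) = N * s\<^sup>2"
    proof -
      have "s powr (2 - q) * s powr q = s\<^sup>2" using s by (simp add: powr_add[symmetric])
      then show ?thesis by (simp add: mult.left_commute)
    qed
    finally have 1: "(\<Sum>c<N. (norm (v c))\<^sup>2) \<le> 2 * (N * s\<^sup>2)" by simp
    have "N * s\<^sup>2 = real N powr (1 - 2 / q) * (V powr (1 / q))\<^sup>2"
    proof -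
      have "s\<^sup>2 = (V powr (1 / q))\<^sup>2 / (real N powr (1 / q))\<^sup>2" using Vp N by (simp add: s_def powr_divide power_divide)
      also have "(real N powr (1 / q))\<^sup>2 = real N powr (2 / q)" by (simp add: power2_eq_square powr_add[symmetric])
      finally have "s\<^sup>2 = (V powr (1 / q))\<^sup>2 / real N powr (2 / q)" .
      moreover have "real N powr (1 - 2 / q) = real N / real N powr (2 / q)" using N by (simp add: powr_diff)
      ultimately show ?thesis by simp
    qed
    also have "\<dots> \<le> real N powr (1 - 2 / q) * (C\<^sup>2 * S)"
    proof (rule mult_left_mono)
      have "(V powr (1 / q))\<^sup>2 \<le> (C * sqrt S)\<^sup>2" using le by (rule power_mono) simp
      then show "(V powr (1 / q))\<^sup>2 \<le> C\<^sup>2 * S" using S0 by (simp add: power_mult_distrib)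
    qed simp
    finally show ?thesis using 1 unfolding S_def[symmetric] by (simp add: mult.assoc)
  qed
qed

locale rad_family =
  fixes M :: "'w measure" and Jx :: "'i set" and r :: "'i \<Rightarrow> 'w \<Rightarrow> real"
  assumes rad: "rademacher_family M Jx r" and count: "countable Jx"
begin

sublocale prob_space M using rad by (simp add: rademacher_family_def)

lemma r_meas: "k \<in> Jx \<Longrightarrow> r k \<in> borel_measurable M"
  using rad indep_vars_def2[of "\<lambda>_. borel" r Jx] by (auto simp: rademacher_family_def)

lemma r_sign: "k \<in> Jx \<Longrightarrow> AE w in M. r k w \<in> {-1, 1}"
proof -
  assume k: "k \<in> Jx"
  let ?A = "{w \<in> space M. r k w = 1}" and ?B = "{w \<in> space M. r k w = -1}"
  have m: "?A \<in> events" "?B \<in> events" using r_meas[OF k] by measurable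
  have "prob (?A \<union> ?B) = prob ?A + prob ?B" by (rule finite_measure_Union[OF m]) auto
  also have "\<dots> = 1" using rad k by (auto simp: rademacher_family_def)
  finally have "AE w in M. w \<in> ?A \<union> ?B" using m by (intro AE_prob_1) auto
  then show "AE w in M. r k w \<in> {-1, 1}" by eventually_elim auto
qed

text \<open>Finitely many members of the family are distributed uniformly on the cube of signs.\<close>

lemma cylinder_prob:
  assumes A: "finite A" "A \<subseteq> Jx" and \<epsilon>: "\<epsilon> \<in> sign_cube A"
  shows "prob {w \<in> space M. \<forall>k\<in>A. r k w = \<epsilon> k} = 1 / 2 ^ card A"
proof (cases "A = {}")
  case True
  then show ?thesis by (simp add: prob_space)
next
  case False
  have iv: "indep_vars (\<lambda>_. borel) r Jx" using rad by (simp add: rademacher_family_def)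
  have "prob (\<Inter>k\<in>A. r k -` {\<epsilon> k} \<inter> space M) = (\<Prod>k\<in>A. prob (r k -` {\<epsilon> k} \<inter> space M))"
    by (rule indep_varsD[OF iv False A]) auto
  also have "(\<Inter>k\<in>A. r k -` {\<epsilon> k} \<inter> space M) = {w \<in> space M. \<forall>k\<in>A. r k w = \<epsilon> k}" using False by auto
  also have "(\<Prod>k\<in>A. prob (r k -` {\<epsilon> k} \<inter> space M)) = (\<Prod>k\<in>A. 1 / 2)"
  proof (rule prod.cong[OF refl])
    fix k assume k: "k \<in> A"
    have "\<epsilon> k = 1 \<or> \<epsilon> k = -1" using \<epsilon> k by (auto simp: sign_cube_def dest: PiE_mem)
    moreover have "r k -` {\<epsilon> k} \<inter> space M = {w \<in> space M. r k w = \<epsilon> k}" by auto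
    ultimately show "prob (r k -` {\<epsilon> k} \<inter> space M) = 1 / 2"
      using rad k A(2) by (auto simp: rademacher_family_def)
  qed
  finally show ?thesis by (simp add: power_one_over)
qed

lemma expectation_sign_avg:
  assumes A: "finite A" "A \<subseteq> Jx" and Fm: "(\<lambda>w. F (restrict (\<lambda>k. r k w) A)) \<in> borel_measurable M"
  shows "integrable M (\<lambda>w. F (restrict (\<lambda>k. r k w) A))" "expectation (\<lambda>w. F (restrict (\<lambda>k. r k w) A)) = sign_avg A F"
proof -
  let ?E = "\<lambda>\<epsilon>. {w \<in> space M. \<forall>k\<in>A. r k w = \<epsilon> k}"
  let ?s = "\<lambda>w. \<Sum>\<epsilon>\<in>sign_cube A. F \<epsilon> * indicator (?E \<epsilon>) w"
  have Em: "?E \<epsilon> \<in> events" for \<epsilon>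
  proof -
    have "{w \<in> space M. r k w = \<epsilon> k} \<in> events" if "k \<in> A" for k
    proof -
      have "{w \<in> space M. r k w = \<epsilon> k} = r k -` {\<epsilon> k} \<inter> space M" by auto
      then show ?thesis using measurable_sets[OF r_meas, of k "{\<epsilon> k}"] that A(2) by auto
    qed
    then show ?thesis using A(1) by (intro sets.sets_Collect_finite_All) auto
  qed
  have ig: "integrable M ?s" using Em by (intro Bochner_Integration.integrable_sum integrable_mult_right) (auto simp: less_top[symmetric])
  have "AE w in M. \<forall>k\<in>A. r k w \<in> {-1, 1}" using r_sign A by (subst AE_finite_all[OF A(1)]) auto
  then have ae: "AE w in M. F (restrict (\<lambda>k. r k w) A) = ?s w"
    using AE_space
  proof eventually_elim
    case (elim w)
    let ?\<epsilon> = "restrict (\<lambda>k. r k w) A"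
    have in1: "?\<epsilon> \<in> sign_cube A" using elim unfolding sign_cube_def by auto
    have "?s w = (\<Sum>\<epsilon>\<in>sign_cube A. if \<epsilon> = ?\<epsilon> then F \<epsilon> else 0)"
    proof (rule sum.cong[OF refl])
      fix \<epsilon> assume e: "\<epsilon> \<in> sign_cube A"
      have "w \<in> ?E \<epsilon> \<longleftrightarrow> \<epsilon> = ?\<epsilon>"
      proof
        assume "w \<in> ?E \<epsilon>"
        then show "\<epsilon> = ?\<epsilon>" using e in1 unfolding sign_cube_def by (intro PiE_ext) auto
      next
        assume "\<epsilon> = ?\<epsilon>"
        then show "w \<in> ?E \<epsilon>" using elim by (simp add: restrict_apply')
      qed
      then show "F \<epsilon> * indicator (?E \<epsilon>) w = (if \<epsilon> = ?\<epsilon> then F \<epsilon> else 0)" by (simp add: indicator_def)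
    qed
    also have "\<dots> = F ?\<epsilon>" using in1 A(1) by simp
    finally show ?case by simp
  qed
  have sm: "?s \<in> borel_measurable M" using ig by (rule borel_measurable_integrable)
  show "integrable M (\<lambda>w. F (restrict (\<lambda>k. r k w) A))" using ig integrable_cong_AE[OF Fm sm ae] by simp
  have "expectation (\<lambda>w. F (restrict (\<lambda>k. r k w) A)) = expectation ?s" by (rule integral_cong_AE[OF Fm sm ae])
  also have "\<dots> = (\<Sum>\<epsilon>\<in>sign_cube A. expectation (\<lambda>w. F \<epsilon> * indicator (?E \<epsilon>) w))"
    using Em by (intro Bochner_Integration.integral_sum integrable_mult_right) (auto simp: less_top[symmetric])
  also have "\<dots> = (\<Sum>\<epsilon>\<in>sign_cube A. F \<epsilon> * (1 / 2 ^ card A))"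
    using Em cylinder_prob[OF A] by (intro sum.cong refl) simp
  also have "\<dots> = sign_avg A F" by (simp add: sign_avg_def sum_divide_distrib)
  finally show "expectation (\<lambda>w. F (restrict (\<lambda>k. r k w) A)) = sign_avg A F" .
qed

definition psum :: "('i \<Rightarrow> 'a::real_normed_vector) \<Rightarrow> 'i set \<Rightarrow> 'w \<Rightarrow> 'a" where
  "psum x A w = (\<Sum>k\<in>A. r k w *\<^sub>R x k)"

lemma psum_sm: "finite A \<Longrightarrow> A \<subseteq> Jx \<Longrightarrow> strongly_measurable M (psum x A)"
  unfolding psum_def[abs_def] by (intro strongly_measurable_sum) (auto intro: r_meas)

lemma psum_expectation:
  fixes x :: "'i \<Rightarrow> 'a::real_normed_vector"
  assumes A: "finite A" "A \<subseteq> Jx"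
  shows "integrable M (\<lambda>w. (norm (psum x A w))\<^sup>2)"
    "expectation (\<lambda>w. (norm (psum x A w))\<^sup>2) = sign_avg A (\<lambda>\<epsilon>. (norm (\<Sum>k\<in>A. \<epsilon> k *\<^sub>R x k))\<^sup>2)"
proof -
  let ?F = "\<lambda>\<epsilon>. (norm (\<Sum>k\<in>A. \<epsilon> k *\<^sub>R x k))\<^sup>2"
  have eq: "?F (restrict (\<lambda>k. r k w) A) = (norm (psum x A w))\<^sup>2" for w by (simp add: psum_def)
  have m: "(\<lambda>w. ?F (restrict (\<lambda>k. r k w) A)) \<in> borel_measurable M"
    unfolding eq using strongly_measurable_norm[OF psum_sm[OF A, of x]] by measurable
  show "integrable M (\<lambda>w. (norm (psum x A w))\<^sup>2)" "expectation (\<lambda>w. (norm (psum x A w))\<^sup>2) = sign_avg A ?F"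
    using expectation_sign_avg[OF A m] unfolding eq by auto
qed

end

locale rad_bounded = rad_family M Jx r
  for M :: "'w measure" and Jx :: "'i set" and r +
  fixes x :: "'i \<Rightarrow> 'a::banach" and q C M0 :: real
  assumes cot: "\<And>n. \<And>x::nat \<Rightarrow> 'a. (\<Sum>i<n. norm (x i) powr q) powr (1 / q) \<le>
        C * sqrt ((\<Sum>\<epsilon>\<in>sign_cube {..<n}. (norm (\<Sum>i<n. \<epsilon> i *\<^sub>R x i))\<^sup>2) / 2 ^ n)"
    and q: "q \<ge> 2" and C: "C > 0" and M0: "M0 \<ge> 0"
    and bd: "\<And>A \<theta>. finite A \<Longrightarrow> A \<subseteq> Jx \<Longrightarrow> (\<And>k. k \<in> A \<Longrightarrow> \<bar>\<theta> k\<bar> \<le> 1) \<Longrightarrow>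
      sign_avg A (\<lambda>\<epsilon>. (norm (\<Sum>k\<in>A. (\<epsilon> k * \<theta> k) *\<^sub>R x k))\<^sup>2) \<le> M0"
begin

abbreviation "S A w \<equiv> psum x A w"
abbreviation "E2 A \<equiv> expectation (\<lambda>w. (norm (S A w))\<^sup>2)"

lemma E2_bound: "finite A \<Longrightarrow> A \<subseteq> Jx \<Longrightarrow> E2 A \<le> M0"
  using bd[of A "\<lambda>_. 1"] by (simp add: psum_expectation)

text \<open>Apply \<open>cotype_squares\<close> pointwise to the values of the partial sums over the disjoint sets; a
choice of signs in front of these partial sums is a choice of coefficients \<open>\<theta>\<close> in \<open>bd\<close>.\<close>

lemma disjoint_blocks:
  assumes N: "N > 0" and A: "\<And>c. c < N \<Longrightarrow> finite (A c)" "\<And>c. c < N \<Longrightarrow> A c \<subseteq> Jx"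
    and disj: "\<And>c d. c < N \<Longrightarrow> d < N \<Longrightarrow> c \<noteq> d \<Longrightarrow> A c \<inter> A d = {}"
  shows "(\<Sum>c<N. E2 (A c)) \<le> 2 * real N powr (1 - 2 / q) * C\<^sup>2 * M0"
proof -
  let ?U = "\<Union>c<N. A c"
  have U: "finite ?U" "?U \<subseteq> Jx" using A by auto
  define col where "col k = (THE c. c < N \<and> k \<in> A c)" for k
  have col: "col k = c" if "c < N" "k \<in> A c" for k c
    unfolding col_def using that disj by (intro the_equality) blast+
  have eq: "(\<Sum>c<N. s c *\<^sub>R S (A c) w) = psum (\<lambda>k. s (col k) *\<^sub>R x k) ?U w" for s w
  proof -
    have "psum (\<lambda>k. s (col k) *\<^sub>R x k) ?U w = (\<Sum>c<N. \<Sum>k\<in>A c. r k w *\<^sub>R (s (col k) *\<^sub>R x k))"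
      unfolding psum_def using A(1) disj by (subst sum.UNION_disjoint) auto
    also have "\<dots> = (\<Sum>c<N. s c *\<^sub>R S (A c) w)"
      unfolding psum_def scaleR_sum_right
      by (intro sum.cong refl) (simp add: col mult.commute)
    finally show ?thesis by simp
  qed
  have i1: "integrable M (\<lambda>w. (norm (\<Sum>c<N. s c *\<^sub>R S (A c) w))\<^sup>2)" for s
    unfolding eq by (rule psum_expectation(1)[OF U])
  have le1: "expectation (\<lambda>w. (norm (\<Sum>c<N. s c *\<^sub>R S (A c) w))\<^sup>2) \<le> M0" if s: "s \<in> sign_cube {..<N}" for s
  proof -
    have "\<bar>s (col k)\<bar> \<le> 1" if "k \<in> ?U" for k
    proof -
      from that obtain c where c: "c < N" "k \<in> A c" by blast
      then show ?thesis using sign_cube_abs[OF s, of c] col[OF c] by simp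
    qed
    then have "sign_avg ?U (\<lambda>\<epsilon>. (norm (\<Sum>k\<in>?U. (\<epsilon> k * s (col k)) *\<^sub>R x k))\<^sup>2) \<le> M0" by (rule bd[OF U])
    then show ?thesis unfolding eq psum_expectation(2)[OF U] by simp
  qed
  let ?K = "2 * real N powr (1 - 2 / q) * C\<^sup>2"
  have "(\<Sum>c<N. E2 (A c)) = expectation (\<lambda>w. \<Sum>c<N. (norm (S (A c) w))\<^sup>2)"
    using A by (intro Bochner_Integration.integral_sum[symmetric] psum_expectation(1)) auto
  also have "\<dots> \<le> expectation (\<lambda>w. ?K * sign_avg {..<N} (\<lambda>s. (norm (\<Sum>c<N. s c *\<^sub>R S (A c) w))\<^sup>2))"
    using A unfolding sign_avg_def
    by (intro integral_mono cotype_squares[OF cot q C N, unfolded sign_avg_def] Bochner_Integration.integrable_sum psum_expectation(1) integrable_mult_right integrable_divide i1) auto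
  also have "\<dots> = ?K * sign_avg {..<N} (\<lambda>s. expectation (\<lambda>w. (norm (\<Sum>c<N. s c *\<^sub>R S (A c) w))\<^sup>2))"
    unfolding sign_avg_def by (simp add: i1 Bochner_Integration.integral_sum)
  also have "\<dots> \<le> ?K * M0"
  proof (rule mult_left_mono)
    have "(\<Sum>s\<in>sign_cube {..<N}. expectation (\<lambda>w. (norm (\<Sum>c<N. s c *\<^sub>R S (A c) w))\<^sup>2)) \<le> (\<Sum>s\<in>sign_cube {..<N}. M0)"
      by (rule sum_mono) (rule le1)
    also have "\<dots> = 2 ^ N * M0" by (simp add: card_sign_cube)
    finally show "sign_avg {..<N} (\<lambda>s. expectation (\<lambda>w. (norm (\<Sum>c<N. s c *\<^sub>R S (A c) w))\<^sup>2)) \<le> M0"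
      by (simp add: sign_avg_def field_simps)
  qed simp
  finally show ?thesis .
qed

text \<open>Otherwise there are arbitrarily many disjoint finite sets whose partial sums have mean square at
least \<open>e\<close>; by \<open>disjoint_blocks\<close> the sum of these numbers grows slower than their number.\<close>

lemma small_tail:
  assumes e: "e > 0"
  shows "\<exists>F. finite F \<and> F \<subseteq> Jx \<and> (\<forall>A. finite A \<longrightarrow> A \<subseteq> Jx - F \<longrightarrow> E2 A < e)"
proof (rule ccontr)
  assume no: "\<not> ?thesis"
  have ex: "\<exists>A. finite A \<and> A \<subseteq> Jx - F \<and> e \<le> E2 A" if "finite F" "F \<subseteq> Jx" for F
  proof -
    have "\<not> (\<forall>A. finite A \<longrightarrow> A \<subseteq> Jx - F \<longrightarrow> E2 A < e)" using no that by blast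
    then show ?thesis by (meson not_le)
  qed
  have fam: "\<exists>A. (\<forall>c<N. finite (A c) \<and> A c \<subseteq> Jx \<and> e \<le> E2 (A c)) \<and> (\<forall>c<N. \<forall>d<N. c \<noteq> d \<longrightarrow> A c \<inter> A d = {})" for N :: nat
  proof (induction N)
    case 0
    show ?case by simp
  next
    case (Suc N)
    then obtain A where A: "\<forall>c<N. finite (A c) \<and> A c \<subseteq> Jx \<and> e \<le> E2 (A c)" "\<forall>c<N. \<forall>d<N. c \<noteq> d \<longrightarrow> A c \<inter> A d = {}" by blast
    let ?U = "\<Union>c<N. A c"
    have "finite ?U" "?U \<subseteq> Jx" using A(1) by auto
    from ex[OF this] obtain B where B: "finite B" "B \<subseteq> Jx - ?U" "e \<le> E2 B" by blast
    let ?A = "A(N := B)"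
    have 1: "\<forall>c<Suc N. finite (?A c) \<and> ?A c \<subseteq> Jx \<and> e \<le> E2 (?A c)" using A(1) B by (auto simp: less_Suc_eq)
    have "?A c \<inter> ?A d = {}" if "c < Suc N" "d < Suc N" "c \<noteq> d" for c d
    proof -
      consider "c < N" "d < N" | "c = N" "d < N" | "c < N" "d = N" using \<open>c < Suc N\<close> \<open>d < Suc N\<close> \<open>c \<noteq> d\<close> by linarith
      then show ?thesis
      proof cases
        case 1 then show ?thesis using A(2) \<open>c \<noteq> d\<close> by simp
      next
        case 2 then show ?thesis using B(2) by auto
      next
        case 3 then show ?thesis using B(2) by auto
      qed
    qed
    with 1 show ?case by (intro exI[of _ ?A]) simp
  qed
  \<comment> \<open>Chosen so that \<open>N > T\<close> gives \<open>N\<^sup>2\<^sup>/\<^sup>q > 2 C\<^sup>2 M0 / e\<close>.\<close>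
  define T where "T = (2 * C\<^sup>2 * M0 / e + 1) powr (q / 2)"
  obtain N :: nat where N: "T < real N" using reals_Archimedean2 by blast
  have "2 * C\<^sup>2 * M0 / e \<ge> 0" using M0 e by simp
  then have p: "2 * C\<^sup>2 * M0 / e + 1 > 0" by linarith
  have T1: "T > 0" unfolding T_def using p by simp
  then have Np: "N > 0" using N by (cases N) auto
  obtain A where A: "\<forall>c<N. finite (A c) \<and> A c \<subseteq> Jx \<and> e \<le> E2 (A c)" "\<forall>c<N. \<forall>d<N. c \<noteq> d \<longrightarrow> A c \<inter> A d = {}" using fam[of N] by (elim exE conjE) (rule that)
  have "real N * e = (\<Sum>c<N. e)" by simp
  also have "\<dots> \<le> (\<Sum>c<N. E2 (A c))" using A(1) by (intro sum_mono) auto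
  also have "\<dots> \<le> 2 * real N powr (1 - 2 / q) * C\<^sup>2 * M0" by (rule disjoint_blocks[OF Np]) (use A in auto)
  also have "real N powr (1 - 2 / q) = real N / real N powr (2 / q)" using Np by (simp add: powr_diff)
  finally have "real N powr (2 / q) \<le> 2 * C\<^sup>2 * M0 / e" using Np e by (simp add: field_simps)
  moreover have "2 * C\<^sup>2 * M0 / e + 1 = T powr (2 / q)"
  proof -
    have "q / 2 * (2 / q) = 1" using q by simp
    then show ?thesis unfolding T_def powr_powr using powr_one[OF less_imp_le[OF p]] by simp
  qed
  moreover have "T powr (2 / q) \<le> real N powr (2 / q)" using N T1 q by (intro powr_mono2) auto
  ultimately show False by linarith
qed

lemma S_Un: "finite A \<Longrightarrow> finite B \<Longrightarrow> A \<subseteq> B \<Longrightarrow> S B w - S A w = S (B - A) w"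
  unfolding psum_def by (subst sum_diff) auto

lemma sq_add: "(norm (u + v))\<^sup>2 \<le> 2 * (norm u)\<^sup>2 + 2 * (norm (v::'a))\<^sup>2"
proof -
  have "(norm (u + v))\<^sup>2 \<le> (norm u + norm v)\<^sup>2" by (intro power_mono norm_triangle_ineq) auto
  also have "\<dots> \<le> 2 * (norm u)\<^sup>2 + 2 * (norm v)\<^sup>2"
    using sum_squares_bound[of "norm u" "norm v"] by (simp add: power2_sum)
  finally show ?thesis .
qed

text \<open>The rate \<open>(1/8)\<^sup>n\<close> makes the corresponding partial sums converge almost surely.\<close>

lemma small_tail_exhaustion:
  "\<exists>F. (\<forall>n::nat. finite (F n) \<and> F n \<subseteq> Jx \<and> (\<forall>A. finite A \<longrightarrow> A \<subseteq> Jx - F n \<longrightarrow> E2 A < (1/8) ^ n)) \<and> (\<forall>n. F n \<subseteq> F (Suc n))"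
proof -
  have "\<forall>n::nat. \<exists>F. finite F \<and> F \<subseteq> Jx \<and> (\<forall>A. finite A \<longrightarrow> A \<subseteq> Jx - F \<longrightarrow> E2 A < (1/8) ^ n)"
    using small_tail by simp
  from choice[OF this] obtain G where G: "\<forall>n::nat. finite (G n) \<and> G n \<subseteq> Jx \<and> (\<forall>A. finite A \<longrightarrow> A \<subseteq> Jx - G n \<longrightarrow> E2 A < (1/8) ^ n)" ..
  let ?F = "\<lambda>n. \<Union>m\<le>n. G m"
  have "finite (?F n) \<and> ?F n \<subseteq> Jx \<and> (\<forall>A. finite A \<longrightarrow> A \<subseteq> Jx - ?F n \<longrightarrow> E2 A < (1/8) ^ n)" for n
  proof (intro conjI allI impI)
    show "finite (?F n)" "?F n \<subseteq> Jx" using G by auto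
    fix A assume "finite A" "A \<subseteq> Jx - ?F n"
    moreover then have "A \<subseteq> Jx - G n" by auto
    ultimately show "E2 A < (1/8) ^ n" using G by blast
  qed
  moreover have "?F n \<subseteq> ?F (Suc n)" for n by (rule UN_mono) auto
  ultimately show ?thesis by (intro exI[of _ ?F]) blast
qed

text \<open>The partial sums over the sets of \<open>small_tail_exhaustion\<close> converge almost surely; their limit, set to \<open>0\<close> on a
measurable null set, is the sum.  Fatou's lemma gives the rate of convergence in mean square.  A
countable index set is needed so that the signs take values in \<open>{-1, 1}\<close> simultaneously off one null
set; there the partial sums are simple functions, as strong measurability requires.\<close>

theorem Rad_series_summable: "\<exists>f. Rad_has_sum M r Jx x f"
proof -
  obtain F where F0: "\<forall>n::nat. finite (F n) \<and> F n \<subseteq> Jx \<and> (\<forall>A. finite A \<longrightarrow> A \<subseteq> Jx - F n \<longrightarrow> E2 A < (1/8) ^ n)" "\<forall>n. F n \<subseteq> F (Suc n)"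
    using small_tail_exhaustion by blast
  have F: "finite (F n)" "F n \<subseteq> Jx" for n using F0(1) by blast+
  have Ft: "E2 A < (1/8) ^ n" if "finite A" "A \<subseteq> Jx" "A \<inter> F n = {}" for A n using F0(1) that by blast
  have Fm: "F n \<subseteq> F m" if "n \<le> m" for n m using lift_Suc_mono_le[of F n m] F0(2) that by simp
  let ?d = "\<lambda>n w. S (F (Suc n)) w - S (F n) w"
  have d_eq: "?d n w = S (F (Suc n) - F n) w" for n w using S_Un[OF F(1) F(1)] F0(2) by blast
  have dm: "(\<lambda>w. (norm (?d n w))\<^sup>2) \<in> borel_measurable M" for n
    unfolding d_eq using psum_expectation(1)[of "F (Suc n) - F n" x] F by (intro borel_measurable_integrable) auto
  have dE: "(\<integral>\<^sup>+w. ennreal ((norm (?d n w))\<^sup>2) \<partial>M) \<le> ennreal ((1/8) ^ n)" for n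
  proof -
    have "(\<integral>\<^sup>+w. ennreal ((norm (?d n w))\<^sup>2) \<partial>M) = ennreal (E2 (F (Suc n) - F n))"
      unfolding d_eq using F by (intro nn_integral_eq_integral psum_expectation(1)) auto
    also have "\<dots> \<le> ennreal ((1/8) ^ n)" by (rule ennreal_leI[OF less_imp_le[OF Ft]]) (use F in auto)
    finally show ?thesis .
  qed
  let ?g = "\<lambda>w. \<Sum>n. ennreal (2 ^ n * (norm (?d n w))\<^sup>2)"
  have dm': "(\<lambda>w. ennreal (2 ^ n * (norm (?d n w))\<^sup>2)) \<in> borel_measurable M" for n
    by (intro measurable_compose[OF _ measurable_ennreal] borel_measurable_times borel_measurable_const dm)
  have gm: "?g \<in> borel_measurable M" by (intro borel_measurable_suminf_order dm')
  have "(\<integral>\<^sup>+w. ?g w \<partial>M) = (\<Sum>n. \<integral>\<^sup>+w. ennreal (2 ^ n * (norm (?d n w))\<^sup>2) \<partial>M)"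
    by (intro nn_integral_suminf dm')
  also have "\<dots> \<le> (\<Sum>n. ennreal ((1/4) ^ n))"
  proof (intro suminf_le summableI)
    fix n
    have "(\<integral>\<^sup>+w. ennreal (2 ^ n * (norm (?d n w))\<^sup>2) \<partial>M) = ennreal (2 ^ n) * (\<integral>\<^sup>+w. ennreal ((norm (?d n w))\<^sup>2) \<partial>M)"
      using dm by (subst nn_integral_cmult[symmetric]) (auto simp: ennreal_mult intro!: nn_integral_cong)
    also have "\<dots> \<le> ennreal (2 ^ n) * ennreal ((1/8) ^ n)" by (intro mult_left_mono dE) auto
    also have "\<dots> = ennreal ((1/4) ^ n)" by (simp add: ennreal_mult[symmetric] power_mult_distrib[symmetric])
    finally show "(\<integral>\<^sup>+w. ennreal (2 ^ n * (norm (?d n w))\<^sup>2) \<partial>M) \<le> ennreal ((1/4) ^ n)" .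
  qed
  also have "\<dots> < \<infinity>" by (subst suminf_ennreal2) (auto intro!: summable_geometric)
  finally have "AE w in M. ?g w \<noteq> \<infinity>" using gm by (intro nn_integral_PInf_AE) auto
  then have ae1: "AE w in M. ?g w \<noteq> \<infinity>" .
  have ae2: "AE w in M. \<forall>k\<in>Jx. r k w \<in> {-1, 1}" using r_sign count by (simp add: AE_ball_countable)
  define G where "G = {w \<in> space M. ?g w \<noteq> \<infinity> \<and> (\<forall>k\<in>Jx. r k w \<in> {-1, 1})}"
  have GAE: "AE w in M. w \<in> G" using ae1 ae2 AE_space by eventually_elim (simp add: G_def)
  have Gm: "G \<in> events"
  proof -
    have g1: "{w \<in> space M. ?g w \<noteq> \<infinity>} \<in> events" using gm by measurable
    have g2: "{w \<in> space M. \<forall>k\<in>Jx. r k w \<in> {-1, 1}} \<in> events"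
    proof -
      have "(\<Union>k\<in>Jx. space M - r k -` {-1, 1} \<inter> space M) \<in> events"
        using r_meas by (intro sets.countable_UN' count) (auto intro!: sets.compl_sets measurable_sets)
      then have "space M - (\<Union>k\<in>Jx. space M - r k -` {-1, 1} \<inter> space M) \<in> events" by (rule sets.compl_sets)
      also have "space M - (\<Union>k\<in>Jx. space M - r k -` {-1, 1} \<inter> space M) = {w \<in> space M. \<forall>k\<in>Jx. r k w \<in> {-1, 1}}" by auto
      finally show ?thesis .
    qed
    have "G = {w \<in> space M. ?g w \<noteq> \<infinity>} \<inter> {w \<in> space M. \<forall>k\<in>Jx. r k w \<in> {-1, 1}}" by (auto simp: G_def)
    then show ?thesis using g1 g2 by auto
  qed
  have conv: "convergent (\<lambda>n. S (F n) w)" if w: "w \<in> G" for w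
  proof -
    have fin: "?g w \<noteq> \<infinity>" using w by (simp add: G_def)
    have sm: "summable (\<lambda>n. 2 ^ n * (norm (?d n w))\<^sup>2)" using fin by (intro summable_suminf_not_top) auto
    then have "Bseq (\<lambda>n. 2 ^ n * (norm (?d n w))\<^sup>2)" by (intro convergent_imp_Bseq summable_LIMSEQ_zero[THEN convergentI])
    then obtain B where B: "B > 0" "\<And>n. norm (2 ^ n * (norm (?d n w))\<^sup>2) \<le> B" unfolding Bseq_def by blast
    have "norm (?d n w) \<le> sqrt B * (sqrt (1/2)) ^ n" for n
    proof -
      have "2 ^ n * (norm (?d n w))\<^sup>2 \<le> B" using B(2)[of n] by simp
      then have "(norm (?d n w))\<^sup>2 \<le> B * (1/2) ^ n" by (simp add: field_simps power_one_over)
      then have "norm (?d n w) \<le> sqrt (B * (1/2) ^ n)" by (simp add: real_le_rsqrt)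
      then show ?thesis by (simp add: real_sqrt_mult real_sqrt_power)
    qed
    then have "summable (\<lambda>n. ?d n w)"
      by (intro summable_comparison_test[OF _ summable_mult[OF summable_geometric]] exI[of _ 0]) auto
    then show ?thesis using summable_iff_convergent[of "\<lambda>n. ?d n w"]
    proof -
      assume "summable (\<lambda>n. ?d n w)"
      then have "convergent (\<lambda>n. \<Sum>i<n. ?d i w)" by (simp add: summable_iff_convergent)
      then have "convergent (\<lambda>n. S (F n) w - S (F 0) w)" unfolding sum_lessThan_telescope[of "\<lambda>n. S (F n) w"] .
      then show ?thesis by (simp add: convergent_diff_const_right_iff)
    qed
  qed
  define f where "f w = (if w \<in> G then lim (\<lambda>n. S (F n) w) else 0)" for w
  have flim: "(\<lambda>n. S (F n) w) \<longlonglongrightarrow> f w" if "w \<in> G" for w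
    using conv[OF that] that by (simp add: f_def convergent_LIMSEQ_iff)
  have fsm: "strongly_measurable M f"
    unfolding strongly_measurable_def
  proof (intro exI conjI allI ballI)
    let ?r = "\<lambda>k w. if w \<in> G then r k w else 0"
    show "simple_function M (\<lambda>w. \<Sum>k\<in>F n. ?r k w *\<^sub>R x k)" for n
    proof -
      have sr: "simple_function M (?r k)" if "k \<in> Jx" for k
      proof (rule simple_function_borel_measurable)
        have "r k \<in> borel_measurable M" by (rule r_meas[OF that])
        then show "?r k \<in> borel_measurable M" using Gm by measurable
        have "?r k ` space M \<subseteq> {-1, 0, 1}" using that by (auto simp: G_def)
        then show "finite (?r k ` space M)" by (rule finite_subset) simp
      qed
      have "simple_function M (\<lambda>w. \<Sum>k\<in>A. ?r k w *\<^sub>R x k)" if "finite A" "A \<subseteq> Jx" for A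
        using that
      proof (induction A rule: finite_induct)
        case (insert k A)
          then have k: "simple_function M (?r k)" by (intro sr) simp
          have k': "simple_function M (\<lambda>w. ?r k w *\<^sub>R x k)"
            using simple_function_compose1[OF k, of "\<lambda>c. c *\<^sub>R x k"] by (simp only:)
          have "simple_function M (\<lambda>w. \<Sum>k\<in>A. ?r k w *\<^sub>R x k)" using insert by simp
          from simple_function_compose2[OF k' this, of "(+)"] show ?case using insert by simp
      qed simp
      then show ?thesis using F by blast
    qed
    show "(\<lambda>n. \<Sum>k\<in>F n. ?r k w *\<^sub>R x k) \<longlonglongrightarrow> f w" for w
    proof (cases "w \<in> G")
      case True
      then show ?thesis using flim[OF True] by (simp add: psum_def)
    next
      case False
      then show ?thesis by (simp add: f_def)
    qed
  qed
  have tail: "integrable M (\<lambda>w. (norm (S (F n) w - f w))\<^sup>2) \<and> expectation (\<lambda>w. (norm (S (F n) w - f w))\<^sup>2) \<le> (1/8) ^ n" for n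
  proof -
    have m: "(\<lambda>w. (norm (S (F n) w - f w))\<^sup>2) \<in> borel_measurable M"
      using strongly_measurable_norm[OF strongly_measurable_diff[OF psum_sm[OF F, of x n] fsm]] by measurable
    have "(\<integral>\<^sup>+w. ennreal ((norm (S (F n) w - f w))\<^sup>2) \<partial>M) = (\<integral>\<^sup>+w. liminf (\<lambda>m. ennreal ((norm (S (F n) w - S (F m) w))\<^sup>2)) \<partial>M)"
    proof (rule nn_integral_cong_AE)
      show "AE w in M. ennreal ((norm (S (F n) w - f w))\<^sup>2) = liminf (\<lambda>m. ennreal ((norm (S (F n) w - S (F m) w))\<^sup>2))"
        using GAE
      proof eventually_elim
        case (elim w)
        have "(\<lambda>m. ennreal ((norm (S (F n) w - S (F m) w))\<^sup>2)) \<longlonglongrightarrow> ennreal ((norm (S (F n) w - f w))\<^sup>2)"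
          by (intro tendsto_ennrealI tendsto_intros flim elim)
        then show ?case by (rule lim_imp_Liminf[OF sequentially_bot, symmetric])
      qed
    qed
    also have "\<dots> \<le> liminf (\<lambda>m. \<integral>\<^sup>+w. ennreal ((norm (S (F n) w - S (F m) w))\<^sup>2) \<partial>M)"
    proof (rule nn_integral_liminf)
      fix m
      have "(\<lambda>w. (norm (S (F n) w - S (F m) w))\<^sup>2) \<in> borel_measurable M"
        using strongly_measurable_norm[OF strongly_measurable_diff[OF psum_sm[OF F, of x n] psum_sm[OF F, of x m]]] by measurable
      then show "(\<lambda>w. ennreal ((norm (S (F n) w - S (F m) w))\<^sup>2)) \<in> borel_measurable M" by measurable
    qed
    also have "\<dots> \<le> ennreal ((1/8) ^ n)"
    proof (rule Liminf_le)
      show "\<forall>\<^sub>F m in sequentially. (\<integral>\<^sup>+w. ennreal ((norm (S (F n) w - S (F m) w))\<^sup>2) \<partial>M) \<le> ennreal ((1/8) ^ n)"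
        unfolding eventually_sequentially
      proof (intro exI[of _ n] allI impI)
        fix m assume nm: "n \<le> m"
        have "S (F n) w - S (F m) w = - S (F m - F n) w" for w using S_Un[OF F(1) F(1) Fm[OF nm], of w] by (simp add: algebra_simps)
        then have "(\<integral>\<^sup>+w. ennreal ((norm (S (F n) w - S (F m) w))\<^sup>2) \<partial>M) = (\<integral>\<^sup>+w. ennreal ((norm (S (F m - F n) w))\<^sup>2) \<partial>M)" by simp
        also have "\<dots> = ennreal (E2 (F m - F n))" using F by (intro nn_integral_eq_integral psum_expectation(1)) auto
        also have "\<dots> \<le> ennreal ((1/8) ^ n)" by (rule ennreal_leI[OF less_imp_le[OF Ft]]) (use F in auto)
        finally show "(\<integral>\<^sup>+w. ennreal ((norm (S (F n) w - S (F m) w))\<^sup>2) \<partial>M) \<le> ennreal ((1/8) ^ n)" .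
      qed
    qed simp
    finally have le: "(\<integral>\<^sup>+w. ennreal ((norm (S (F n) w - f w))\<^sup>2) \<partial>M) \<le> ennreal ((1/8) ^ n)" .
    have i: "integrable M (\<lambda>w. (norm (S (F n) w - f w))\<^sup>2)"
      using m le by (intro integrableI_nonneg) (auto intro: le_less_trans)
    moreover have "ennreal (expectation (\<lambda>w. (norm (S (F n) w - f w))\<^sup>2)) \<le> ennreal ((1/8) ^ n)"
      using le nn_integral_eq_integral[OF i] by simp
    ultimately show ?thesis by (simp add: ennreal_le_iff)
  qed
  have fL2: "integrable M (\<lambda>w. (norm (f w))\<^sup>2)"
  proof (rule Bochner_Integration.integrable_bound)
    show "integrable M (\<lambda>w. 2 * (norm (S (F 0) w))\<^sup>2 + 2 * (norm (S (F 0) w - f w))\<^sup>2)"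
      using psum_expectation(1)[OF F, of x 0] tail[of 0] by (intro Bochner_Integration.integrable_add integrable_mult_right) auto
    show "(\<lambda>w. (norm (f w))\<^sup>2) \<in> borel_measurable M" using strongly_measurable_norm[OF fsm] by measurable
    show "AE w in M. norm ((norm (f w))\<^sup>2) \<le> norm (2 * (norm (S (F 0) w))\<^sup>2 + 2 * (norm (S (F 0) w - f w))\<^sup>2)"
    proof (rule AE_I2)
      fix w
      show "norm ((norm (f w))\<^sup>2) \<le> norm (2 * (norm (S (F 0) w))\<^sup>2 + 2 * (norm (S (F 0) w - f w))\<^sup>2)"
        using sq_add[of "S (F 0) w" "- (S (F 0) w - f w)"] by (simp add: norm_minus_commute[of "f w"])
    qed
  qed
  have close: "L2_norm M (\<lambda>w. S A w - f w) \<le> sqrt (4 * (1/8) ^ n)" if A: "finite A" "A \<subseteq> Jx" "F n \<subseteq> A" for A n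
  proof -
    have E: "E2 (A - F n) \<le> (1/8) ^ n" by (rule less_imp_le[OF Ft]) (use A in auto)
    have i: "integrable M (\<lambda>w. (norm (S (A - F n) w))\<^sup>2)" using A by (intro psum_expectation(1)) auto
    have "expectation (\<lambda>w. (norm (S A w - f w))\<^sup>2) \<le> expectation (\<lambda>w. 2 * (norm (S (A - F n) w))\<^sup>2 + 2 * (norm (S (F n) w - f w))\<^sup>2)"
    proof (rule integral_mono')
      show "integrable M (\<lambda>w. 2 * (norm (S (A - F n) w))\<^sup>2 + 2 * (norm (S (F n) w - f w))\<^sup>2)"
        using i tail[of n] by (intro Bochner_Integration.integrable_add integrable_mult_right) auto
      fix w
      have eq: "S A w - f w = S (A - F n) w + (S (F n) w - f w)" using S_Un[OF F(1) A(1) A(3), of w] by (simp add: algebra_simps)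
      show "(norm (S A w - f w))\<^sup>2 \<le> 2 * (norm (S (A - F n) w))\<^sup>2 + 2 * (norm (S (F n) w - f w))\<^sup>2"
        unfolding eq by (rule sq_add)
    qed auto
    also have "\<dots> = 2 * E2 (A - F n) + 2 * expectation (\<lambda>w. (norm (S (F n) w - f w))\<^sup>2)" using i tail[of n] by simp
    also have "\<dots> \<le> 4 * (1/8) ^ n" using E tail[of n] by linarith
    finally show ?thesis unfolding L2_norm_def by (rule real_sqrt_le_mono)
  qed
  have lim0: "(\<lambda>n. sqrt (4 * (1/8) ^ n)) \<longlonglongrightarrow> 0"
  proof -
    have "(\<lambda>n. sqrt (4 * (1/8::real) ^ n)) \<longlonglongrightarrow> sqrt (4 * 0)"
      by (intro tendsto_intros LIMSEQ_realpow_zero) auto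
    then show ?thesis by simp
  qed
  have "f \<in> Rad M r Jx"
    unfolding Rad_def L2_space_def
  proof (intro CollectI conjI allI impI fsm fL2)
    fix e :: real assume "e > 0"
    then have "\<forall>\<^sub>F n in sequentially. sqrt (4 * (1/8) ^ n) < e" using order_tendstoD(2)[OF lim0] by blast
    then obtain n where n: "sqrt (4 * (1/8) ^ n) < e" using eventually_happens'[OF sequentially_bot] by blast
    have "L2_norm M (\<lambda>w. f w - (\<Sum>i\<in>F n. r i w *\<^sub>R x i)) = L2_norm M (\<lambda>w. S (F n) w - f w)"
      unfolding L2_norm_def psum_def by (simp add: norm_minus_commute)
    also have "\<dots> < e" using close[OF F order_refl] n by (rule le_less_trans)
    finally show "\<exists>A x. finite A \<and> A \<subseteq> Jx \<and> L2_norm M (\<lambda>w. f w - (\<Sum>i\<in>A. r i w *\<^sub>R x i)) < e" using F by blast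
  qed
  moreover have "((\<lambda>A. L2_norm M (\<lambda>w. (\<Sum>i\<in>A. r i w *\<^sub>R x i) - f w)) \<longlongrightarrow> 0) (finite_subsets_at_top Jx)"
  proof (rule tendstoI)
    fix e :: real assume "e > 0"
    then have "\<forall>\<^sub>F n in sequentially. sqrt (4 * (1/8) ^ n) < e" using order_tendstoD(2)[OF lim0] by blast
    then obtain n where n: "sqrt (4 * (1/8) ^ n) < e" using eventually_happens'[OF sequentially_bot] by blast
    show "\<forall>\<^sub>F A in finite_subsets_at_top Jx. dist (L2_norm M (\<lambda>w. (\<Sum>i\<in>A. r i w *\<^sub>R x i) - f w)) 0 < e"
      unfolding eventually_finite_subsets_at_top
    proof (intro exI[of _ "F n"] conjI allI impI F)
      fix A assume A: "finite A \<and> F n \<subseteq> A \<and> A \<subseteq> Jx"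
      then have "L2_norm M (\<lambda>w. S A w - f w) < e" using close[of A n] n by auto
      moreover have "0 \<le> L2_norm M (\<lambda>w. S A w - f w)" by (simp add: L2_norm_def)
      ultimately show "dist (L2_norm M (\<lambda>w. (\<Sum>i\<in>A. r i w *\<^sub>R x i) - f w)) 0 < e" by (simp add: psum_def dist_real_def)
    qed
  qed
  ultimately show ?thesis unfolding Rad_has_sum_def by blast
qed

text \<open>The sum is not unique as a function, so the bound is proved for every sum, from its definition.\<close>

lemma sum_norm_bound:
  assumes f: "Rad_has_sum M r Jx x f" shows "L2_norm M f \<le> sqrt (2 * M0)"
proof -
  have fsm: "strongly_measurable M f" and fL2: "integrable M (\<lambda>w. (norm (f w))\<^sup>2)"
    using f by (auto simp: Rad_has_sum_def Rad_def L2_space_def)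
  have lim: "((\<lambda>A. L2_norm M (\<lambda>w. S A w - f w)) \<longlongrightarrow> 0) (finite_subsets_at_top Jx)"
    using f by (simp add: Rad_has_sum_def psum_def)
  have "(L2_norm M f)\<^sup>2 \<le> 2 * M0 + 2 * e\<^sup>2" if e: "e > 0" for e
  proof -
    have "\<forall>\<^sub>F A in finite_subsets_at_top Jx. L2_norm M (\<lambda>w. S A w - f w) < e" using order_tendstoD(2)[OF lim e] .
    then obtain F where "finite F" "F \<subseteq> Jx" "\<forall>A. finite A \<and> F \<subseteq> A \<and> A \<subseteq> Jx \<longrightarrow> L2_norm M (\<lambda>w. S A w - f w) < e"
      unfolding eventually_finite_subsets_at_top by blast
    then have F: "finite F" "F \<subseteq> Jx" "L2_norm M (\<lambda>w. S F w - f w) < e" by auto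
    have iS: "integrable M (\<lambda>w. (norm (S F w))\<^sup>2)" by (rule psum_expectation(1)[OF F(1,2)])
    have i: "integrable M (\<lambda>w. (norm (S F w - f w))\<^sup>2)"
    proof (rule Bochner_Integration.integrable_bound)
      show "integrable M (\<lambda>w. 2 * (norm (S F w))\<^sup>2 + 2 * (norm (f w))\<^sup>2)"
        using iS fL2 by (intro Bochner_Integration.integrable_add integrable_mult_right) auto
      show "(\<lambda>w. (norm (S F w - f w))\<^sup>2) \<in> borel_measurable M"
        using strongly_measurable_norm[OF strongly_measurable_diff[OF psum_sm[OF F(1,2), of x] fsm]] by measurable
      show "AE w in M. norm ((norm (S F w - f w))\<^sup>2) \<le> norm (2 * (norm (S F w))\<^sup>2 + 2 * (norm (f w))\<^sup>2)"
      proof (rule AE_I2)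
        fix w show "norm ((norm (S F w - f w))\<^sup>2) \<le> norm (2 * (norm (S F w))\<^sup>2 + 2 * (norm (f w))\<^sup>2)"
          using sq_add[of "S F w" "- f w"] by simp
      qed
    qed
    have e2: "expectation (\<lambda>w. (norm (S F w - f w))\<^sup>2) \<le> e\<^sup>2"
    proof -
      have n: "0 \<le> expectation (\<lambda>w. (norm (S F w - f w))\<^sup>2)" by simp
      have "(L2_norm M (\<lambda>w. S F w - f w))\<^sup>2 \<le> e\<^sup>2" using F(3) by (intro power_mono) (auto simp: L2_norm_def)
      then show ?thesis using n by (simp add: L2_norm_def)
    qed
    have "expectation (\<lambda>w. (norm (f w))\<^sup>2) \<le> expectation (\<lambda>w. 2 * (norm (S F w))\<^sup>2 + 2 * (norm (S F w - f w))\<^sup>2)"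
    proof (rule integral_mono)
      show "integrable M (\<lambda>w. 2 * (norm (S F w))\<^sup>2 + 2 * (norm (S F w - f w))\<^sup>2)"
        using iS i by (intro Bochner_Integration.integrable_add integrable_mult_right) auto
      show "(norm (f w))\<^sup>2 \<le> 2 * (norm (S F w))\<^sup>2 + 2 * (norm (S F w - f w))\<^sup>2" for w
        using sq_add[of "S F w" "- (S F w - f w)"] by (simp add: norm_minus_commute[of "f w"])
    qed (rule fL2)
    also have "\<dots> = 2 * E2 F + 2 * expectation (\<lambda>w. (norm (S F w - f w))\<^sup>2)" using iS i by simp
    also have "\<dots> \<le> 2 * M0 + 2 * e\<^sup>2" using E2_bound[OF F(1,2)] e2 by linarith
    finally show ?thesis by (simp add: L2_norm_def)
  qed
  note b = this
  have "((\<lambda>e. 2 * M0 + 2 * e\<^sup>2) \<longlongrightarrow> 2 * M0 + 2 * 0\<^sup>2) (at_right 0)" by (intro tendsto_intros)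
  then have "(L2_norm M f)\<^sup>2 \<le> 2 * M0 + 2 * 0\<^sup>2"
    by (rule tendsto_lowerbound) (auto simp: eventually_at_right_field intro!: exI[of _ 1] b)
  then show ?thesis by (intro real_le_rsqrt) simp
qed

lemma Rad_sum_norm_le: "Rad_sum_norm M r Jx x \<le> ennreal (sqrt (2 * M0))"
  unfolding Rad_sum_norm_def using Rad_series_summable sum_norm_bound[OF someI_ex[OF Rad_series_summable]] by (simp add: ennreal_leI)

end

section \<open>The square function estimate\<close>

theorem theorem3p1:
  fixes T :: "'d::finite \<Rightarrow> ('a::{complex_normed_vector, banach} \<Rightarrow>\<^sub>L 'a)"
    and \<gamma> \<alpha> :: "'d \<Rightarrow> real"
    and M :: "'w measure"
    and r :: "('d \<Rightarrow> nat) \<Rightarrow> 'w \<Rightarrow> real"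
  assumes "finite_cotype TYPE('a)"
    and "rademacher_family M pos_indices r"
    and "commuting_ritt T"
    and "\<And>i. 0 < \<gamma> i \<and> \<gamma> i < pi / 2"
    and "has_joint_Hinf_calculus \<gamma> T"
    and "\<And>i. 0 < \<alpha> i"
  shows "\<exists>K>0. \<forall>x. square_fun_norm M r T \<alpha> x \<le> ennreal (K * norm x)"
proof -
  from assms(5) obtain a b Kc where ab: "\<forall>i. ritt_of_type (T i) (a i) \<and> a i < b i \<and> b i < \<gamma> i"
    and Kc: "Kc > 0" "\<forall>F\<in>H01_inf \<gamma>. norm (H01_calc b T F) \<le> Kc * (SUP z\<in>stolz_prod \<gamma>. cmod (H01_fun F z))"
    unfolding has_joint_Hinf_calculus_def by (elim exE conjE) (rule that)
  have angle: "ritt_angle (b i) (T i) (a i)" for i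
  proof unfold_locales
    show "0 < b i" "b i < pi / 2" "ritt_of_type (T i) (a i)" "a i < b i"
      using ab[rule_format, of i] assms(4)[of i] by (auto simp: ritt_of_type_def)
  qed
  have comm: "T i o\<^sub>L T j = T j o\<^sub>L T i" for i j using assms(3) by (simp add: commuting_ritt_def)
  interpret joint_calc T a b \<alpha> \<gamma> Kc
    by (intro joint_calc.intro ritt_tuple.intro joint_calc_axioms.intro angle comm assms(4,6) Kc Kc(2)[rule_format])
  from assms(1) obtain q where q: "q \<ge> 2" "has_cotype TYPE('a) q" unfolding finite_cotype_def by auto
  from q(2) obtain C where C: "C > 0"
    and cot: "\<forall>n. \<forall>x::nat \<Rightarrow> 'a. (\<Sum>i<n. norm (x i) powr q) powr (1 / q) \<le>
        C * sqrt ((\<Sum>\<epsilon>\<in>sign_cube {..<n}. (norm (\<Sum>i<n. \<epsilon> i *\<^sub>R x i))\<^sup>2) / 2 ^ n)"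
    unfolding has_cotype_def sign_cube_def[symmetric] by (elim exE conjE) (rule that)
  from square_sum_sign_average_bound[OF q(2,1)] obtain B where B: "B \<ge> 0"
    and bd: "\<forall>x A \<theta>. finite A \<longrightarrow> A \<subseteq> pos_indices \<longrightarrow> (\<forall>k\<in>A. \<bar>\<theta> k\<bar> \<le> 1) \<longrightarrow>
      sign_avg A (\<lambda>\<epsilon>. (norm (\<Sum>k\<in>A. (\<epsilon> k * \<theta> k) *\<^sub>R square_term T \<alpha> x k))\<^sup>2) \<le> B * (norm x)\<^sup>2"
    by (elim exE conjE) (rule that)
  have le: "square_fun_norm M r T \<alpha> x \<le> ennreal ((sqrt (2 * B) + 1) * norm x)" for x
  proof -
    interpret rb: rad_bounded M pos_indices r "square_term T \<alpha> x" q C "B * (norm x)\<^sup>2"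
    proof (unfold_locales)
      show "rademacher_family M pos_indices r" "q \<ge> 2" "C > 0" "B * (norm x)\<^sup>2 \<ge> 0" using assms(2) q C B by auto
      have "countable (PiE (UNIV :: 'd set) (\<lambda>_. UNIV :: nat set))" by (rule countable_PiE) auto
      then show "countable (pos_indices :: ('d \<Rightarrow> nat) set)" by (rule countable_subset[rotated]) auto
    qed (use cot bd in blast)+
    have "square_fun_norm M r T \<alpha> x \<le> ennreal (sqrt (2 * (B * (norm x)\<^sup>2)))"
      unfolding square_fun_norm_def by (rule rb.Rad_sum_norm_le)
    also have "sqrt (2 * (B * (norm x)\<^sup>2)) = sqrt (2 * B) * norm x" by (simp add: real_sqrt_mult)
    also have "ennreal (sqrt (2 * B) * norm x) \<le> ennreal ((sqrt (2 * B) + 1) * norm x)"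
      by (intro ennreal_leI mult_right_mono) auto
    finally show ?thesis .
  qed
  have "sqrt (2 * B) + 1 > 0" using B by (intro add_nonneg_pos) auto
  with le show ?thesis by (intro exI[of _ "sqrt (2 * B) + 1"]) auto
qed

end
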